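(* For every $\Psi\in\mathrm{MAVal}_k(\mathbb{R}^n)$ there exists a unique homogeneous, symmetric polynomial $Q[\Psi]$ on $(\mathbb{C}^n)^k$ of degree $(2,\dots,2)$ such that for all $\phi\in C_c(\mathbb{R}^n)$ \begin{align*} \mathcal{F}(\mathrm{GW}(\Psi[\phi]))[z_1,\dots,z_k]=\frac{(-1)^k}{k!}Q[\Psi](z_1,\dots,z_k)\mathcal{F}(\phi)\left[\sum_{j=1}^{k}z_j\right]. \end{align*} In particular, $Q[\Psi]=0$ if and only if $\Psi=0$.
   Context: $\mathrm{MAVal}_k(\mathbb{R}^n)$ is the space of continuous valuations $\Psi:\mathrm{Conv}(\mathbb{R}^n,\mathbb{R})\to\mathcal{M}(\mathbb{R}^n)$ (finite-valued convex functions, complex Radon measures) that are dually epi-translation invariant, locally determined, translation equivariant and $k$-homogeneous. $\Psi[\phi](f)=\int\phi\,d\Psi(f)$ is a complex-valued continuous dually epi-translation invariant $k$-homogeneous valuation; $\mathrm{GW}(\mu)$ denotes its Goodey-Weil distribution, the unique symmetric compactly supported distribution on $(\mathbb{R}^n)^k$ with $\mathrm{GW}(\mu)[f_1\otimes\dots\otimes f_k]=\bar\mu(f_1,\dots,f_k)$ (polarization) for smooth convex $f_i$; $\mathcal{F}$ is the Fourier-Laplace transform, $\mathcal{F}(\mathrm{GW}(\mu))[z_1,\dots,z_k]=\mathrm{GW}(\mu)[e^{i\langle z_1,\cdot\rangle}\otimes\dots\otimes e^{i\langle z_k,\cdot\rangle}]$. Homogeneous of degree $(2,\dots,2)$ means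 $2$-homogeneous in each argument. *)

theory Defs
  imports "HOL-Analysis.Analysis"
begin

fun iter_dd :: "'a list \<Rightarrow> ('a::real_normed_vector \<Rightarrow> 'b::real_normed_vector) \<Rightarrow> 'a \<Rightarrow> 'b" where
  "iter_dd [] g = g"
| "iter_dd (v # vs) g = (\<lambda>x. frechet_derivative (iter_dd vs g) (at x) v)"

definition smooth_fun :: "('a::real_normed_vector \<Rightarrow> 'b::real_normed_vector) \<Rightarrow> bool" where
  "smooth_fun g \<longleftrightarrow> (\<forall>vs x. iter_dd vs g differentiable (at x))"

definition Cc :: "(real^'n \<Rightarrow> real) \<Rightarrow> bool" where
  "Cc \<phi> \<longleftrightarrow> continuous_on UNIV \<phi> \<and> bounded {x. \<phi> x \<noteq> 0}"

text \<open>A complex Radon measure mu is represented by the functional phi |-> integral of phi d mu on C_c.\<close>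
definition radon_functional :: "((real^'n \<Rightarrow> real) \<Rightarrow> complex) \<Rightarrow> bool" where
  "radon_functional L \<longleftrightarrow>
     (\<forall>a b \<phi> \<psi>. Cc \<phi> \<longrightarrow> Cc \<psi> \<longrightarrow>
        L (\<lambda>x. a * \<phi> x + b * \<psi> x) = of_real a * L \<phi> + of_real b * L \<psi>) \<and>
     (\<forall>K. compact K \<longrightarrow> (\<exists>C. \<forall>\<phi> B. Cc \<phi> \<longrightarrow> {x. \<phi> x \<noteq> 0} \<subseteq> K \<longrightarrow>
        (\<forall>x. \<bar>\<phi> x\<bar> \<le> B) \<longrightarrow> norm (L \<phi>) \<le> C * B))"

text \<open>Psi f phi stands for the integral of phi against the measure Psi(f).\<close>
definition MAVal :: "nat \<Rightarrow> ((real^'n \<Rightarrow> real) \<Rightarrow> (real^'n \<Rightarrow> real) \<Rightarrow> complex) \<Rightarrow> bool" where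
  "MAVal k \<Psi> \<longleftrightarrow>
    \<comment> \<open>values are complex Radon measures\<close>
    (\<forall>f. convex_on UNIV f \<longrightarrow> radon_functional (\<Psi> f)) \<and>
    \<comment> \<open>valuation\<close>
    (\<forall>f g \<phi>. convex_on UNIV f \<longrightarrow> convex_on UNIV g \<longrightarrow>
        convex_on UNIV (\<lambda>x. min (f x) (g x)) \<longrightarrow> Cc \<phi> \<longrightarrow>
        \<Psi> (\<lambda>x. max (f x) (g x)) \<phi> + \<Psi> (\<lambda>x. min (f x) (g x)) \<phi> = \<Psi> f \<phi> + \<Psi> g \<phi>) \<and>
    \<comment> \<open>continuity: epi-convergence (= locally uniform convergence) to weak convergence\<close>
    (\<forall>fs f \<phi>. (\<forall>i. convex_on UNIV (fs i)) \<longrightarrow> convex_on UNIV f \<longrightarrow>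
        (\<forall>K. compact K \<longrightarrow> uniform_limit K fs f sequentially) \<longrightarrow> Cc \<phi> \<longrightarrow>
        (\<lambda>i. \<Psi> (fs i) \<phi>) \<longlonglongrightarrow> \<Psi> f \<phi>) \<and>
    \<comment> \<open>dually epi-translation invariant\<close>
    (\<forall>f y c \<phi>. convex_on UNIV f \<longrightarrow> Cc \<phi> \<longrightarrow>
        \<Psi> (\<lambda>x. f x + y \<bullet> x + c) \<phi> = \<Psi> f \<phi>) \<and>
    \<comment> \<open>locally determined\<close>
    (\<forall>f g U \<phi>. convex_on UNIV f \<longrightarrow> convex_on UNIV g \<longrightarrow> open U \<longrightarrow>
        (\<forall>x\<in>U. f x = g x) \<longrightarrow> Cc \<phi> \<longrightarrow> closure {x. \<phi> x \<noteq> 0} \<subseteq> U \<longrightarrow>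
        \<Psi> f \<phi> = \<Psi> g \<phi>) \<and>
    \<comment> \<open>translation equivariant: Psi(f(. - x)) = Psi(f)(. - x)\<close>
    (\<forall>f x \<phi>. convex_on UNIV f \<longrightarrow> Cc \<phi> \<longrightarrow>
        \<Psi> (\<lambda>y. f (y - x)) \<phi> = \<Psi> f (\<lambda>y. \<phi> (y + x))) \<and>
    \<comment> \<open>k-homogeneous\<close>
    (\<forall>f t \<phi>. convex_on UNIV f \<longrightarrow> t > 0 \<longrightarrow> Cc \<phi> \<longrightarrow>
        \<Psi> (\<lambda>x. t * f x) \<phi> = of_real t ^ k * \<Psi> f \<phi>)"

text \<open>Compactly supported distributions on (R^n)^k: continuous linear functionals on C^infinity.\<close>
definition comp_distr :: "((real^'n^'k \<Rightarrow> complex) \<Rightarrow> complex) \<Rightarrow> bool" where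
  "comp_distr T \<longleftrightarrow>
     (\<forall>a g h. smooth_fun g \<longrightarrow> smooth_fun h \<longrightarrow>
        T (\<lambda>x. a * g x + h x) = a * T g + T h) \<and>
     (\<exists>K C m. compact K \<and> (\<forall>g B. smooth_fun g \<longrightarrow>
        (\<forall>vs x. length vs \<le> m \<longrightarrow> (\<forall>v\<in>set vs. norm v \<le> 1) \<longrightarrow> x \<in> K \<longrightarrow>
            norm (iter_dd vs g x) \<le> B) \<longrightarrow> norm (T g) \<le> C * B))"

definition sym_distr :: "((real^'n^'k \<Rightarrow> complex) \<Rightarrow> complex) \<Rightarrow> bool" where
  "sym_distr T \<longleftrightarrow> (\<forall>\<sigma> g. \<sigma> permutes (UNIV :: 'k set) \<longrightarrow> smooth_fun g \<longrightarrow>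
      T (\<lambda>X. g (\<chi> j. X $ \<sigma> j)) = T g)"

definition polarization :: "((real^'n \<Rightarrow> real) \<Rightarrow> complex) \<Rightarrow> ('k::finite \<Rightarrow> real^'n \<Rightarrow> real) \<Rightarrow> complex" where
  "polarization \<mu> fs = (1 / fact CARD('k)) *
     (\<Sum>S\<in>Pow (UNIV :: 'k set). (-1) ^ (CARD('k) - card S) * \<mu> (\<lambda>x. \<Sum>j\<in>S. fs j x))"

definition tensor :: "('k::finite \<Rightarrow> real^'n \<Rightarrow> real) \<Rightarrow> real^'n^'k \<Rightarrow> complex" where
  "tensor fs = (\<lambda>X. \<Prod>j\<in>UNIV. complex_of_real (fs j (X $ j)))"

definition is_GW :: "((real^'n \<Rightarrow> real) \<Rightarrow> complex) \<Rightarrow> ((real^'n^'k \<Rightarrow> complex) \<Rightarrow> complex) \<Rightarrow> bool" where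
  "is_GW \<mu> T \<longleftrightarrow> comp_distr T \<and> sym_distr T \<and> (\<forall>g. \<not> smooth_fun g \<longrightarrow> T g = 0) \<and>
     (\<forall>fs. (\<forall>j. smooth_fun (fs j) \<and> convex_on UNIV (fs j)) \<longrightarrow>
        T (tensor fs) = polarization \<mu> fs)"

definition GW :: "((real^'n \<Rightarrow> real) \<Rightarrow> complex) \<Rightarrow> (real^'n^'k \<Rightarrow> complex) \<Rightarrow> complex" where
  "GW \<mu> = (THE T. is_GW \<mu> T)"

definition FL :: "((real^'n^'k \<Rightarrow> complex) \<Rightarrow> complex) \<Rightarrow> complex^'n^'k \<Rightarrow> complex" where
  "FL T z = T (\<lambda>X. exp (\<i> * (\<Sum>j\<in>UNIV. \<Sum>l\<in>UNIV. z $ j $ l * complex_of_real (X $ j $ l))))"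

definition FT :: "(real^'n \<Rightarrow> real) \<Rightarrow> complex^'n \<Rightarrow> complex" where
  "FT \<phi> w = (\<integral>x. exp (\<i> * (\<Sum>l\<in>UNIV. w $ l * complex_of_real (x $ l))) * complex_of_real (\<phi> x) \<partial>lborel)"

definition poly_deg2_each :: "(complex^'n^'k \<Rightarrow> complex) \<Rightarrow> bool" where
  "poly_deg2_each Q \<longleftrightarrow> (\<exists>c :: ('k \<Rightarrow> 'n) \<Rightarrow> ('k \<Rightarrow> 'n) \<Rightarrow> complex.
     \<forall>z. Q z = (\<Sum>a\<in>UNIV. \<Sum>b\<in>UNIV. c a b * (\<Prod>j\<in>UNIV. z $ j $ a j * z $ j $ b j)))"

definition sym_poly :: "(complex^'n^'k \<Rightarrow> complex) \<Rightarrow> bool" where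
  "sym_poly Q \<longleftrightarrow> (\<forall>\<sigma> z. \<sigma> permutes (UNIV :: 'k set) \<longrightarrow> Q (\<chi> j. z $ \<sigma> j) = Q z)"

definition Q_of :: "((real^'n \<Rightarrow> real) \<Rightarrow> (real^'n \<Rightarrow> real) \<Rightarrow> complex) \<Rightarrow> (complex^'n^'k \<Rightarrow> complex) \<Rightarrow> bool" where
  "Q_of \<Psi> Q \<longleftrightarrow> poly_deg2_each Q \<and> sym_poly Q \<and>
     (\<forall>\<phi> z. Cc \<phi> \<longrightarrow>
        FL (GW (\<lambda>f. \<Psi> f \<phi>)) z =
          ((-1) ^ CARD('k) / fact CARD('k)) * Q z * FT \<phi> (\<Sum>j\<in>UNIV. z $ j))"

end

theory Submission
  imports Defs
begin

text \<open>If a convex function is a maximum of finitely many affine functions, it is affine near every point outside finitely many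
hyperplanes. For dimension + 1 such functions in general position, near every point one of them is affine, so locality
and dual epi-translation invariance make the corresponding iterated difference of \<open>\<Psi>\<close> vanish. By continuity this
holds for all convex functions; homogeneity then reduces the order to \<open>k + 1\<close>, so the polarization is
multilinear. On quadratic functions it is translation invariant, hence a multilinear form in the Hessians times
Lebesgue measure. Gluing translated copies of a function along a fine grid by taking maxima bounds the
polarization on balls of radius \<open>d\<close> by a multiple of \<open>d\<close> to the power \<open>n\<close> times the second derivatives; hence only second
order Taylor polynomials matter, and on smooth functions the polarization has density \<open>B(D\<^sup>2 f\<^sub>1, ..., D\<^sup>2 f\<^sub>k)\<close>. This
exhibits the Goodey-Weil distribution as an explicit differential operator on the diagonal, whose Fourier-Laplace transform
is computed by inspection. That no other distribution has the same values on tensor products of smooth convex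
functions follows because polynomials are dense in the smooth functions and are differences of convex ones.\<close>

section \<open>Smooth functions\<close>

text \<open>Only convex functions may be inserted into \<open>\<Psi>\<close>, and this shapes most
  of the argument. Taylor remainders and negative multiples are in general not convex, so
  differences are handled as equations between sums of convex functions, and a function controlled
  only on a ball is first extended to a convex function of quadratic growth. Measures are accessible
  only through test functions; pointwise statements are made by testing with \<open>moll d\<close>,
  whose height of order \<open>d\<close> to the power \<open>-n\<close> is cancelled exactly by the
  volume factor of the small-ball bound. \<open>GW\<close> is a \<open>THE\<close>, so a candidate
  alone is not enough: uniqueness among all compactly supported distributions is required. In the
  transform every slot contributes two factors \<open>\<i>\<close>, which explains the sign; the
  factorial of the theorem is compensated by a factor \<open>fact CARD('k)\<close>, because
  polarization is already normalised. Symmetry of the polynomial comes from symmetry of the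
  distribution. That \<open>Q = 0\<close> forces \<open>\<Psi> = 0\<close> rests on squares of
  linear forms: on these the polarization is, up to a constant, a value of the polynomial.\<close>

text \<open>Smoothness quantifies over all lists of directions; an invariant class replaces that
  induction, so that each closure property below only has to name a class stable under directional
  derivatives.\<close>

lemma smooth_funI:
  assumes "g \<in> S" "\<And>f x. f \<in> S \<Longrightarrow> f differentiable (at x)"
    "\<And>f v. f \<in> S \<Longrightarrow> (\<lambda>x. frechet_derivative f (at x) v) \<in> S"
  shows "smooth_fun g"
proof -
  have "iter_dd vs g \<in> S" for vs
    by (induction vs) (use assms in auto)
  then show ?thesis using assms(2) by (simp add: smooth_fun_def)
qed

lemma smooth_fun_differentiable: "smooth_fun g \<Longrightarrow> g differentiable (at x)"
  unfolding smooth_fun_def by (metis iter_dd.simps(1))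

lemma iter_dd_append: "iter_dd (us @ vs) g = iter_dd us (iter_dd vs g)"
  by (induction us) auto

lemma smooth_fun_iter_dd: "smooth_fun g \<Longrightarrow> smooth_fun (iter_dd vs g)"
  unfolding smooth_fun_def by (metis iter_dd_append)

lemma smooth_fun_deriv: "smooth_fun g \<Longrightarrow> smooth_fun (\<lambda>x. frechet_derivative g (at x) v)"
  using smooth_fun_iter_dd[of g "[v]"] by simp

lemma smooth_fun_has_derivative:
  "smooth_fun g \<Longrightarrow> (g has_derivative frechet_derivative g (at x)) (at x)"
  using smooth_fun_differentiable frechet_derivative_works by blast

lemma smooth_fun_continuous: "smooth_fun g \<Longrightarrow> continuous_on S g"
  by (meson continuous_at_imp_continuous_on differentiable_imp_continuous_within smooth_fun_differentiable)

lemma frechet_derivativeI: "(f has_derivative f') (at x) \<Longrightarrow> frechet_derivative f (at x) = f'"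
  by (metis frechet_derivative_at)

text \<open>The Leibniz rule turns one term \<open>B f g\<close> into two, so the invariant class
  consists of finite sums of such terms. They are encoded as lists of pairs, which makes a
  derivative an append of two mapped lists.\<close>

lemma smooth_fun_bilinear:
  fixes f :: "'d::real_normed_vector \<Rightarrow> _"
  assumes B: "bounded_bilinear B" and f: "smooth_fun f" and g: "smooth_fun g"
  shows "smooth_fun (\<lambda>x. B (f x) (g x))"
proof -
  define S :: "('d::real_normed_vector \<Rightarrow> _) set" where "S = {h. \<exists>fs. (\<forall>p\<in>set fs. smooth_fun (fst p) \<and> smooth_fun (snd p)) \<and>
      h = (\<lambda>x. \<Sum>p\<leftarrow>fs. B (fst p x) (snd p x))}"
  have der: "((\<lambda>x. \<Sum>p\<leftarrow>fs. B (fst p x) (snd p x)) has_derivative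
      (\<lambda>v. \<Sum>p\<leftarrow>fs. B (fst p x) (frechet_derivative (snd p) (at x) v) + B (frechet_derivative (fst p) (at x) v) (snd p x))) (at x)"
    if "\<forall>p\<in>set fs. smooth_fun (fst p) \<and> smooth_fun (snd p)" for fs x
    using that
  proof (induction fs)
    case (Cons p fs)
    have "((\<lambda>x. B (fst p x) (snd p x)) has_derivative
      (\<lambda>v. B (fst p x) (frechet_derivative (snd p) (at x) v) + B (frechet_derivative (fst p) (at x) v) (snd p x))) (at x)"
      using Cons.prems by (intro bounded_bilinear.FDERIV[OF B] smooth_fun_has_derivative) auto
    then show ?case using Cons by (auto intro!: has_derivative_add)
  qed auto
  show ?thesis
  proof (rule smooth_funI[of _ S])
    show "(\<lambda>x. B (f x) (g x)) \<in> S"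
      unfolding S_def using f g by (auto intro!: exI[of _ "[(f,g)]"])
  next
    fix h x assume "h \<in> S"
    then show "h differentiable (at x)"
      unfolding S_def using der differentiable_def by blast
  next
    fix h v assume "h \<in> S"
    then obtain fs where fs: "\<forall>p\<in>set fs. smooth_fun (fst p) \<and> smooth_fun (snd p)"
       "h = (\<lambda>x. \<Sum>p\<leftarrow>fs. B (fst p x) (snd p x))" unfolding S_def by blast
    let ?gs = "map (\<lambda>p. (fst p, \<lambda>x. frechet_derivative (snd p) (at x) v)) fs @
               map (\<lambda>p. (\<lambda>x. frechet_derivative (fst p) (at x) v, snd p)) fs"
    have "(\<lambda>x. frechet_derivative h (at x) v) = (\<lambda>x. \<Sum>p\<leftarrow>?gs. B (fst p x) (snd p x))"
      unfolding fs(2) frechet_derivativeI[OF der[OF fs(1)]]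
      by (auto simp: sum_list_addf comp_def)
    moreover have "\<forall>p\<in>set ?gs. smooth_fun (fst p) \<and> smooth_fun (snd p)"
      using fs(1) by (fastforce intro: smooth_fun_deriv)
    ultimately show "(\<lambda>x. frechet_derivative h (at x) v) \<in> S"
      unfolding S_def by blast
  qed
qed

lemma smooth_fun_const [simp]: "smooth_fun (\<lambda>x. c)"
  by (rule smooth_funI[of _ "range (\<lambda>c x. c)"]) auto

lemma smooth_fun_bounded_linear:
  assumes L: "bounded_linear L" shows "smooth_fun L"
proof -
  have d: "frechet_derivative L (at x) = L" for x
    by (rule frechet_derivativeI[OF bounded_linear_imp_has_derivative[OF L]])
  have "iter_dd vs L = L \<or> (\<exists>c. iter_dd vs L = (\<lambda>x. c))" for vs
    by (induction vs) (auto simp: d)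
  then show ?thesis
    unfolding smooth_fun_def by (metis L bounded_linear_imp_differentiable differentiable_const)
qed

lemma smooth_fun_mult:
  fixes f g :: "'a::real_normed_vector \<Rightarrow> 'b::real_normed_algebra"
  shows "smooth_fun f \<Longrightarrow> smooth_fun g \<Longrightarrow> smooth_fun (\<lambda>x. f x * g x)"
  by (rule smooth_fun_bilinear[OF bounded_bilinear_mult])

text \<open>An instance of the bilinear case: scale \<open>L a\<close> by a real number and let the
  second function be constantly 1.\<close>

lemma smooth_fun_bounded_linear_left:
  assumes L: "bounded_linear L" and f: "smooth_fun f"
  shows "smooth_fun (\<lambda>x. L (f x))"
proof -
  have "bounded_bilinear (\<lambda>a (r::real). r *\<^sub>R L a)"
    using bounded_bilinear.comp[OF bounded_bilinear.flip[OF bounded_bilinear_scaleR] L bounded_linear_ident] .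
  from smooth_fun_bilinear[OF this f smooth_fun_const[of 1]] show ?thesis by simp
qed

lemma smooth_fun_add:
  assumes f: "smooth_fun f" and g: "smooth_fun g"
  shows "smooth_fun (\<lambda>x. f x + g x)"
proof (rule smooth_funI[of _ "{h. \<exists>f g. smooth_fun f \<and> smooth_fun g \<and> h = (\<lambda>x. f x + g x)}"])
  fix h v
  assume "h \<in> {h. \<exists>f g. smooth_fun f \<and> smooth_fun g \<and> h = (\<lambda>x. f x + g x)}"
  then obtain f g where *: "smooth_fun f" "smooth_fun g" "h = (\<lambda>x. f x + g x)" by blast
  have "frechet_derivative h (at x) = (\<lambda>v. frechet_derivative f (at x) v + frechet_derivative g (at x) v)" for x
    unfolding *(3) by (intro frechet_derivativeI has_derivative_add smooth_fun_has_derivative *)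
  then have "(\<lambda>x. frechet_derivative h (at x) v) =
      (\<lambda>x. frechet_derivative f (at x) v + frechet_derivative g (at x) v)" by simp
  moreover note smooth_fun_deriv[OF *(1), of v] smooth_fun_deriv[OF *(2), of v]
  ultimately show "(\<lambda>x. frechet_derivative h (at x) v) \<in> {h. \<exists>f g. smooth_fun f \<and> smooth_fun g \<and> h = (\<lambda>x. f x + g x)}"
    by blast
next
  show "(\<lambda>x. f x + g x) \<in> {h. \<exists>f g. smooth_fun f \<and> smooth_fun g \<and> h = (\<lambda>x. f x + g x)}"
    using f g by blast
next
  fix h x
  assume "h \<in> {h. \<exists>f g. smooth_fun f \<and> smooth_fun g \<and> h = (\<lambda>x. f x + g x)}"
  then show "h differentiable (at x)"
    by (elim CollectE exE conjE) (simp add: smooth_fun_differentiable differentiable_add)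
qed

lemma iter_dd_add:
  assumes f: "smooth_fun f" and g: "smooth_fun g"
  shows "iter_dd vs (\<lambda>x. f x + g x) = (\<lambda>x. iter_dd vs f x + iter_dd vs g x)"
proof (induction vs)
  case (Cons v vs)
  have "frechet_derivative (\<lambda>x. iter_dd vs f x + iter_dd vs g x) (at x)
      = (\<lambda>v. frechet_derivative (iter_dd vs f) (at x) v + frechet_derivative (iter_dd vs g) (at x) v)" for x
    by (intro frechet_derivativeI has_derivative_add smooth_fun_has_derivative smooth_fun_iter_dd assms)
  then show ?case by (simp add: Cons)
qed simp

lemma iter_dd_bounded_linear_left:
  assumes L: "bounded_linear L" and g: "smooth_fun g"
  shows "iter_dd vs (\<lambda>x. L (g x)) = (\<lambda>x. L (iter_dd vs g x))"
proof (induction vs)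
  case (Cons v vs)
  have "frechet_derivative (\<lambda>x. L (iter_dd vs g x)) (at x)
      = (\<lambda>v. L (frechet_derivative (iter_dd vs g) (at x) v))" for x
    by (intro frechet_derivativeI bounded_linear.has_derivative[OF L] smooth_fun_has_derivative smooth_fun_iter_dd g)
  then show ?case by (simp add: Cons)
qed simp

lemma iter_dd_bounded_linear_right:
  assumes L: "bounded_linear L" and g: "smooth_fun g"
  shows "iter_dd vs (\<lambda>x. g (L x)) = (\<lambda>x. iter_dd (map L vs) g (L x))"
proof (induction vs)
  case (Cons v vs)
  have "frechet_derivative (\<lambda>x. iter_dd (map L vs) g (L x)) (at x)
      = (\<lambda>v. frechet_derivative (iter_dd (map L vs) g) (at (L x)) (L v))" for x
    by (intro frechet_derivativeI has_derivative_compose[where f=L and g="iter_dd (map L vs) g"]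
          smooth_fun_has_derivative smooth_fun_iter_dd g bounded_linear_imp_has_derivative L)
  then show ?case by (simp add: Cons)
qed simp

lemma smooth_fun_bounded_linear_right:
  assumes L: "bounded_linear L" and g: "smooth_fun g"
  shows "smooth_fun (\<lambda>x. g (L x))"
  unfolding smooth_fun_def iter_dd_bounded_linear_right[OF assms]
proof (intro allI)
  fix vs x
  show "(\<lambda>x. iter_dd (map L vs) g (L x)) differentiable (at x)"
    by (rule differentiableI[OF has_derivative_compose[OF bounded_linear_imp_has_derivative[OF L]
      smooth_fun_has_derivative[OF smooth_fun_iter_dd[OF g]]]])
qed

lemma smooth_fun_scaleR: "smooth_fun f \<Longrightarrow> smooth_fun (\<lambda>x. c *\<^sub>R f x)"
  by (rule smooth_fun_bounded_linear_left[OF bounded_linear_scaleR_right])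

lemma smooth_fun_minus: "smooth_fun f \<Longrightarrow> smooth_fun (\<lambda>x. - f x)"
  by (rule smooth_fun_bounded_linear_left[OF bounded_linear_minus[OF bounded_linear_ident]])

lemma smooth_fun_diff: "smooth_fun f \<Longrightarrow> smooth_fun g \<Longrightarrow> smooth_fun (\<lambda>x. f x - g x)"
  using smooth_fun_add[of f "\<lambda>x. - g x"] smooth_fun_minus[of g] by simp

lemma iter_dd_diff:
  assumes f: "smooth_fun f" and g: "smooth_fun g"
  shows "iter_dd vs (\<lambda>x. f x - g x) = (\<lambda>x. iter_dd vs f x - iter_dd vs g x)"
  using iter_dd_add[OF f smooth_fun_minus[OF g], of vs]
    iter_dd_bounded_linear_left[OF bounded_linear_minus[OF bounded_linear_ident] g, of vs] by simp

lemma smooth_fun_sum: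
  "(\<And>i. i \<in> I \<Longrightarrow> smooth_fun (f i)) \<Longrightarrow> smooth_fun (\<lambda>x. \<Sum>i\<in>I. f i x)"
  by (induction I rule: infinite_finite_induct) (simp_all add: smooth_fun_add)

lemma smooth_fun_prod:
  fixes f :: "'i \<Rightarrow> 'a::real_normed_vector \<Rightarrow> 'b::real_normed_field"
  shows "(\<And>i. i \<in> I \<Longrightarrow> smooth_fun (f i)) \<Longrightarrow> smooth_fun (\<lambda>x. \<Prod>i\<in>I. f i x)"
  by (induction I rule: infinite_finite_induct) (simp_all add: smooth_fun_mult)

lemma smooth_fun_of_real:
  "smooth_fun f \<Longrightarrow> smooth_fun (\<lambda>x. of_real (f x) :: 'b::real_normed_algebra_1)"
  by (rule smooth_fun_bounded_linear_left[OF bounded_linear_of_real])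

lemma smooth_fun_real_polynomial: "real_polynomial_function p \<Longrightarrow> smooth_fun p"
  by (induction rule: real_polynomial_function.induct)
    (simp_all add: smooth_fun_bounded_linear smooth_fun_add smooth_fun_mult)

lemma smooth_fun_tensor:
  assumes "\<And>j. smooth_fun (fs j)"
  shows "smooth_fun (tensor fs :: real^'n^'k \<Rightarrow> complex)"
  unfolding tensor_def
  by (rule smooth_fun_prod, rule smooth_fun_of_real,
      rule smooth_fun_bounded_linear_right[OF bounded_linear_vec_nth assms])

text \<open>An exponential is an eigenfunction of every directional derivative; the eigenvalues
  \<open>L v\<close> are what later turns the differential operator into a polynomial.\<close>

lemma smooth_fun_exp_linear:
  fixes L :: "'a::real_normed_vector \<Rightarrow> 'b::{real_normed_field,banach}"
  assumes L: "bounded_linear L"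
  shows "smooth_fun (\<lambda>x. exp (L x))" 
    and iter_dd_exp_linear: "iter_dd vs (\<lambda>x. exp (L x)) = (\<lambda>x. (\<Prod>v\<leftarrow>vs. L v) * exp (L x))"
proof -
  have hd: "((\<lambda>x. c * exp (L x)) has_derivative (\<lambda>v. (L v * c) * exp (L x))) (at x)" for x c
  proof -
    have "((\<lambda>x. exp (L x)) has_derivative (\<lambda>v. exp (L x) * L v)) (at x)"
      using has_derivative_compose[OF bounded_linear_imp_has_derivative[OF L]
          DERIV_exp[of "L x", unfolded has_field_derivative_def]] by simp
    from has_derivative_mult_right[OF this, of c] show ?thesis by (simp add: algebra_simps)
  qed
  then have D: "frechet_derivative (\<lambda>x. c * exp (L x)) (at x) = (\<lambda>v. (L v * c) * exp (L x))" for x c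
    by (rule frechet_derivativeI)
  have d: "(\<lambda>x. c * exp (L x)) differentiable (at x)" for c x
    using hd differentiable_def by blast
  show "smooth_fun (\<lambda>x. exp (L x))"
  proof (rule smooth_funI[of _ "range (\<lambda>c x. c * exp (L x))"])
    show "(\<lambda>x. exp (L x)) \<in> range (\<lambda>c x. c * exp (L x))"
      by (rule image_eqI[of _ _ 1]) auto
  next
    fix h v assume "h \<in> range (\<lambda>c x. c * exp (L x))"
    then obtain c where "h = (\<lambda>x. c * exp (L x))" by blast
    then have "(\<lambda>x. frechet_derivative h (at x) v) = (\<lambda>x. (L v * c) * exp (L x))" using D by simp
    then show "(\<lambda>x. frechet_derivative h (at x) v) \<in> range (\<lambda>c x. c * exp (L x))"
      by (rule image_eqI) simp
  qed (use d in blast)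
  show "iter_dd vs (\<lambda>x. exp (L x)) = (\<lambda>x. (\<Prod>v\<leftarrow>vs. L v) * exp (L x))"
    by (induction vs) (auto simp: D)
qed

lemma has_derivative_translate:
  assumes "smooth_fun g"
  shows "((\<lambda>y. g (y + c)) has_derivative frechet_derivative g (at (y + c))) (at y)"
proof -
  have "((\<lambda>y. y + c) has_derivative (\<lambda>x. x)) (at y)"
    by (auto intro!: derivative_eq_intros)
  from has_derivative_compose[OF this smooth_fun_has_derivative[OF assms]] show ?thesis .
qed

lemma iter_dd_translate:
  assumes g: "smooth_fun g"
  shows "iter_dd vs (\<lambda>y. g (y + c)) = (\<lambda>y. iter_dd vs g (y + c))"
  by (induction vs)
    (simp_all add: frechet_derivativeI[OF has_derivative_translate[OF smooth_fun_iter_dd[OF g]]])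

lemma smooth_fun_translate:
  assumes g: "smooth_fun g"
  shows "smooth_fun (\<lambda>y. g (y + c))"
  unfolding smooth_fun_def iter_dd_translate[OF g]
  using has_derivative_translate[OF smooth_fun_iter_dd[OF g]] differentiableI by blast

lemma smooth_fun_line_deriv:
  fixes g :: "'a::real_normed_vector \<Rightarrow> real"
  assumes "smooth_fun g"
  shows "((\<lambda>s. g (x + s *\<^sub>R v)) has_real_derivative iter_dd [v] g (x + s *\<^sub>R v)) (at s)"
proof -
  have "((\<lambda>s. x + s *\<^sub>R v) has_derivative (\<lambda>h. h *\<^sub>R v)) (at s)"
    by (auto intro!: derivative_eq_intros)
  from has_derivative_compose[OF this smooth_fun_has_derivative[OF assms]]
  have "((\<lambda>s. g (x + s *\<^sub>R v)) has_derivative (\<lambda>h. frechet_derivative g (at (x + s *\<^sub>R v)) (h *\<^sub>R v))) (at s)" .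
  moreover have "frechet_derivative g (at (x + s *\<^sub>R v)) (h *\<^sub>R v) = iter_dd [v] g (x + s *\<^sub>R v) * h" for h
    using linear_frechet_derivative[OF smooth_fun_differentiable[OF assms]]
    by (simp add: linear_cmul)
  ultimately show ?thesis by (simp add: has_field_derivative_def)
qed

lemma smooth_fun_mvt:
  fixes g :: "'a::real_normed_vector \<Rightarrow> real"
  assumes "smooth_fun g" "h > 0"
  obtains s where "0 < s" "s < h" "g (x + h *\<^sub>R v) - g x = h * iter_dd [v] g (x + s *\<^sub>R v)"
proof -
  have "\<exists>z>0. z < h \<and> g (x + h *\<^sub>R v) - g (x + 0 *\<^sub>R v) = (h - 0) * iter_dd [v] g (x + z *\<^sub>R v)"
    using smooth_fun_line_deriv[OF assms(1)] by (intro MVT2 assms(2))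
  then show ?thesis using that by auto
qed

lemma iter_dd_linear:
  assumes "smooth_fun g" shows "linear (\<lambda>v. iter_dd (v # vs) g x)"
  using linear_frechet_derivative[OF smooth_fun_differentiable[OF smooth_fun_iter_dd[OF assms]]] by simp

text \<open>Schwarz's theorem. The second difference over a parallelogram is symmetric in the two
  directions, and two applications of the mean value theorem express it by either mixed derivative
  at some point of the parallelogram; continuity excludes a gap between the two.\<close>

lemma iter_dd_swap2:
  fixes g :: "'a::real_normed_vector \<Rightarrow> real"
  assumes g: "smooth_fun g"
  shows "iter_dd [w, v] g x = iter_dd [v, w] g x"
proof (rule ccontr)
  assume ne: "iter_dd [w, v] g x \<noteq> iter_dd [v, w] g x"
  have key: "\<exists>a b. 0 \<le> a \<and> a \<le> h \<and> 0 \<le> b \<and> b \<le> h \<and>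
      g (x + h *\<^sub>R v + h *\<^sub>R w) - g (x + h *\<^sub>R v) - g (x + h *\<^sub>R w) + g x =
      h * h * iter_dd [w, v] g (x + a *\<^sub>R v + b *\<^sub>R w)" if h: "h > 0" for h v w
  proof -
    let ?k = "\<lambda>y. g (y + h *\<^sub>R w) - g y"
    have k: "smooth_fun ?k" by (intro smooth_fun_diff smooth_fun_translate g)
    obtain a where a: "0 < a" "a < h" "?k (x + h *\<^sub>R v) - ?k x = h * iter_dd [v] ?k (x + a *\<^sub>R v)"
      by (rule smooth_fun_mvt[OF k h, where x = x and v = v])
    have "iter_dd [v] ?k y = iter_dd [v] g (y + h *\<^sub>R w) - iter_dd [v] g y" for y
      unfolding iter_dd_diff[OF smooth_fun_translate[OF g] g] iter_dd_translate[OF g] ..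
    moreover obtain b where b: "0 < b" "b < h"
      "iter_dd [v] g ((x + a *\<^sub>R v) + h *\<^sub>R w) - iter_dd [v] g (x + a *\<^sub>R v) = h * iter_dd [w] (iter_dd [v] g) ((x + a *\<^sub>R v) + b *\<^sub>R w)"
      by (rule smooth_fun_mvt[OF smooth_fun_iter_dd[OF g, of "[v]"] h, where x = "x + a *\<^sub>R v" and v = w])
    ultimately have "?k (x + h *\<^sub>R v) - ?k x = h * (h * iter_dd [w, v] g (x + a *\<^sub>R v + b *\<^sub>R w))"
      using a(3) by simp
    then show ?thesis using a(1,2) b(1,2)
      by (intro exI[of _ a] exI[of _ b]) (simp add: algebra_simps)
  qed
  define e where "e = \<bar>iter_dd [w, v] g x - iter_dd [v, w] g x\<bar> / 2"
  have e: "e > 0" using ne by (simp add: e_def)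
  have "continuous (at x) (iter_dd [w, v] g)" "continuous (at x) (iter_dd [v, w] g)"
    using smooth_fun_continuous[OF smooth_fun_iter_dd[OF g], of UNIV] continuous_on_eq_continuous_at by blast+
  then obtain d1 d2 where d0: "d1 > 0" "d2 > 0"
     "\<And>y. dist y x < d1 \<Longrightarrow> \<bar>iter_dd [w, v] g y - iter_dd [w, v] g x\<bar> < e"
     "\<And>y. dist y x < d2 \<Longrightarrow> \<bar>iter_dd [v, w] g y - iter_dd [v, w] g x\<bar> < e"
    using e unfolding continuous_at_eps_delta dist_real_def by metis
  note d = d0
  \<comment> \<open>Small enough that the parallelogram spanned by \<open>h *\<^sub>R v\<close> and
    \<open>h *\<^sub>R w\<close> stays within both radii; the \<open>+ 1\<close> covers the case
    that both directions are zero.\<close>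
  define h where "h = min d1 d2 / (2 * (norm v + norm w + 1))"
  have h: "h > 0" unfolding h_def using d by (simp add: add_nonneg_pos)
  have near: "dist (x + a *\<^sub>R v + b *\<^sub>R w) x < min d1 d2" if "0 \<le> a" "a \<le> h" "0 \<le> b" "b \<le> h" for a b
  proof -
    have "dist (x + a *\<^sub>R v + b *\<^sub>R w) x \<le> a * norm v + b * norm w"
      using that norm_triangle_ineq[of "a *\<^sub>R v" "b *\<^sub>R w"] by (simp add: dist_norm add.assoc)
    also have "\<dots> \<le> h * norm v + h * norm w"
      using that by (intro add_mono mult_right_mono) auto
    also have "\<dots> < h * (2 * (norm v + norm w + 1))"
      using h by (simp add: algebra_simps add_nonneg_pos)
    also have "\<dots> = min d1 d2" unfolding h_def by (simp add: add_nonneg_eq_0_iff)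
    finally show ?thesis .
  qed
  from key[OF h, of v w] obtain a b where ab: "0 \<le> a" "a \<le> h" "0 \<le> b" "b \<le> h"
    "g (x + h *\<^sub>R v + h *\<^sub>R w) - g (x + h *\<^sub>R v) - g (x + h *\<^sub>R w) + g x = h * h * iter_dd [w, v] g (x + a *\<^sub>R v + b *\<^sub>R w)" by blast
  from key[OF h, of w v] obtain c c' where cc: "0 \<le> c" "c \<le> h" "0 \<le> c'" "c' \<le> h"
    "g (x + h *\<^sub>R w + h *\<^sub>R v) - g (x + h *\<^sub>R w) - g (x + h *\<^sub>R v) + g x = h * h * iter_dd [v, w] g (x + c *\<^sub>R w + c' *\<^sub>R v)" by blast
  have "h * h * iter_dd [w, v] g (x + a *\<^sub>R v + b *\<^sub>R w) = h * h * iter_dd [v, w] g (x + c' *\<^sub>R v + c *\<^sub>R w)"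
    using ab(5) cc(5) by (simp add: algebra_simps)
  then have "iter_dd [w, v] g (x + a *\<^sub>R v + b *\<^sub>R w) = iter_dd [v, w] g (x + c' *\<^sub>R v + c *\<^sub>R w)"
    using h by simp
  moreover have "\<bar>iter_dd [w, v] g (x + a *\<^sub>R v + b *\<^sub>R w) - iter_dd [w, v] g x\<bar> < e"
    "\<bar>iter_dd [v, w] g (x + c' *\<^sub>R v + c *\<^sub>R w) - iter_dd [v, w] g x\<bar> < e"
    using near[of a b] near[of c' c] ab cc d(3,4) by auto
  moreover have "\<And>A B p q :: real. A = B \<Longrightarrow> \<bar>A - p\<bar> < \<bar>p - q\<bar> / 2 \<Longrightarrow> \<bar>B - q\<bar> < \<bar>p - q\<bar> / 2 \<Longrightarrow> False"
    by (auto simp: abs_if split: if_splits)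
  ultimately show False unfolding e_def by blast
qed

lemma iter_dd_rotate:
  fixes g :: "'a::real_normed_vector \<Rightarrow> real"
  assumes g: "smooth_fun g"
  shows "iter_dd (vs @ [v]) g = iter_dd (v # vs) g"
proof (induction vs)
  case (Cons u us)
  have "iter_dd ((u # us) @ [v]) g = iter_dd [u, v] (iter_dd us g)"
    using Cons by simp
  also have "\<dots> = iter_dd [v, u] (iter_dd us g)"
    by (rule ext) (rule iter_dd_swap2[OF smooth_fun_iter_dd[OF g]])
  finally show ?case by simp
qed simp

lemma iter_dd_mset:
  fixes g :: "'a::real_normed_vector \<Rightarrow> real"
  assumes g: "smooth_fun g" 
  shows "mset us = mset vs \<Longrightarrow> iter_dd us g = iter_dd vs g"
proof (induction us arbitrary: vs)
  case (Cons u us)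
  from Cons.prems have "u \<in> set vs" by (metis list.set_intros(1) set_mset_mset)
  then obtain xs ys where vs: "vs = xs @ u # ys" by (meson split_list)
  have "iter_dd vs g = iter_dd xs (iter_dd (ys @ [u]) g)"
    unfolding vs iter_dd_append[of xs] iter_dd_rotate[OF g] ..
  also have "\<dots> = iter_dd ((xs @ ys) @ [u]) g" by (simp only: iter_dd_append append_assoc)
  also have "\<dots> = iter_dd (u # (xs @ ys)) g" by (rule iter_dd_rotate[OF g])
  also have "\<dots> = iter_dd (u # us) g" using Cons.IH[of "xs @ ys"] Cons.prems vs by simp
  finally show ?case by simp
qed simp

text \<open>Polynomials written in powers of the single coordinate \<open>x \<bullet> b\<close> with
  coefficients constant along \<open>b\<close>, the form in which an antiderivative along
  \<open>b\<close> can be written down term by term.\<close>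

inductive_set poly_in_dir :: "'a::euclidean_space \<Rightarrow> ('a \<Rightarrow> real) set" for b where
  monom: "real_polynomial_function r \<Longrightarrow> (\<And>x t. r (x + t *\<^sub>R b) = r x) \<Longrightarrow>
      (\<lambda>x. (x \<bullet> b) ^ i * r x) \<in> poly_in_dir b"
| add: "p \<in> poly_in_dir b \<Longrightarrow> q \<in> poly_in_dir b \<Longrightarrow> (\<lambda>x. p x + q x) \<in> poly_in_dir b"

lemma poly_in_dir_mult:
  assumes "p \<in> poly_in_dir b" "q \<in> poly_in_dir b"
  shows "(\<lambda>x. p x * q x) \<in> poly_in_dir b"
  using assms
proof (induction p rule: poly_in_dir.induct)
  case (monom r i)
  note r = monom
  from \<open>q \<in> poly_in_dir b\<close> show ?case
  proof (induction q rule: poly_in_dir.induct)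
    case (monom s j)
    have "(\<lambda>x. (x \<bullet> b) ^ (i + j) * (r x * s x)) \<in> poly_in_dir b"
      using r(1,2) monom by (intro poly_in_dir.monom real_polynomial_function.intros(4)) auto
    then show ?case by (simp add: power_add mult_ac)
  next
    case (add p q)
    then show ?case using poly_in_dir.add[OF add.IH] by (simp add: algebra_simps)
  qed
next
  case (add p1 p2)
  then show ?case using poly_in_dir.add[OF add.IH] by (simp add: algebra_simps)
qed

lemma real_polynomial_poly_in_dir:
  assumes "real_polynomial_function p" and b: "b \<in> Basis"
  shows "p \<in> poly_in_dir b"
  using assms(1)
proof (induction p rule: real_polynomial_function.induct)
  case (linear f)
  have bl: "bounded_linear (\<lambda>x. x - (x \<bullet> b) *\<^sub>R b)"
    by (intro bounded_linear_sub bounded_linear_ident bounded_linear_scaleR_const bounded_linear_inner_left)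
  have "(\<lambda>x. (x \<bullet> b) ^ 1 * f b) \<in> poly_in_dir b"
    by (rule poly_in_dir.monom) auto
  moreover have "(\<lambda>x. (x \<bullet> b) ^ 0 * f (x - (x \<bullet> b) *\<^sub>R b)) \<in> poly_in_dir b"
    using bounded_linear_compose[OF linear bl] b
    by (intro poly_in_dir.monom real_polynomial_function.intros(1)) (auto simp: algebra_simps)
  ultimately have "(\<lambda>x. (x \<bullet> b) ^ 1 * f b + (x \<bullet> b) ^ 0 * f (x - (x \<bullet> b) *\<^sub>R b)) \<in> poly_in_dir b"
    by (rule poly_in_dir.add)
  moreover have "(x \<bullet> b) ^ 1 * f b + (x \<bullet> b) ^ 0 * f (x - (x \<bullet> b) *\<^sub>R b) = f x" for x
    using linear_diff[OF bounded_linear.linear[OF linear]] linear_scale[OF bounded_linear.linear[OF linear]] by simp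
  ultimately show ?case by simp
next
  case (const c)
  show ?case using poly_in_dir.monom[of "\<lambda>x. c" b 0] by auto
qed (auto intro: poly_in_dir.add poly_in_dir_mult)

lemma iter_dd_single: "(g has_derivative g') (at x) \<Longrightarrow> iter_dd [v] g x = g' v"
  by (simp add: frechet_derivativeI)

text \<open>Vanishing on the hyperplane \<open>x \<bullet> b = 0\<close> fixes the constant of
  integration, so that the values there can be prescribed by adding another polynomial that is
  constant along \<open>b\<close>.\<close>

lemma real_polynomial_antiderivative:
  fixes p :: "'a::euclidean_space \<Rightarrow> real"
  assumes p: "real_polynomial_function p" and b: "b \<in> Basis"
  obtains P where "real_polynomial_function P" "iter_dd [b] P = p" "\<And>x. x \<bullet> b = 0 \<Longrightarrow> P x = 0"
proof -
  have "\<exists>P. real_polynomial_function P \<and> iter_dd [b] P = p \<and> (\<forall>x. x \<bullet> b = 0 \<longrightarrow> P x = 0)"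
    using real_polynomial_poly_in_dir[OF assms]
  proof (induction p rule: poly_in_dir.induct)
    case (monom r i)
    let ?P = "\<lambda>x. (x \<bullet> b) ^ Suc i * (1 / real (Suc i) * r x)"
    have P: "real_polynomial_function ?P"
      by (intro real_polynomial_function.intros(4) real_polynomial_function_power real_polynomial_function.intros(1)
          monom(1) real_polynomial_function.intros(2) bounded_linear_inner_left)
    have "iter_dd [b] ?P x = (x \<bullet> b) ^ i * r x" for x
    proof -
      have "((\<lambda>s. ?P (x + s *\<^sub>R b)) has_real_derivative iter_dd [b] ?P (x + 0 *\<^sub>R b)) (at 0)"
        by (rule smooth_fun_line_deriv[OF smooth_fun_real_polynomial[OF P]])
      moreover have "(\<lambda>s. ?P (x + s *\<^sub>R b)) = (\<lambda>s. (x \<bullet> b + s) ^ Suc i * (1 / real (Suc i) * r x))"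
        using b monom(2) by (simp add: inner_add_left)
      moreover have "((\<lambda>s. (x \<bullet> b + s) ^ Suc i * (1 / real (Suc i) * r x)) has_real_derivative (x \<bullet> b) ^ i * r x) (at 0)"
        by (rule derivative_eq_intros refl | simp)+
      ultimately show ?thesis
        using DERIV_unique by (metis (no_types, lifting) add.right_neutral scale_zero_left)
    qed
    with P show ?case by (intro exI[of _ ?P]) auto
  next
    case (add p q)
    then obtain P Q where PQ: "real_polynomial_function P \<and> iter_dd [b] P = p \<and> (\<forall>x. x \<bullet> b = 0 \<longrightarrow> P x = 0)"
      "real_polynomial_function Q \<and> iter_dd [b] Q = q \<and> (\<forall>x. x \<bullet> b = 0 \<longrightarrow> Q x = 0)" by blast
    then have "iter_dd [b] (\<lambda>x. P x + Q x) = (\<lambda>x. p x + q x)"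
      using iter_dd_add[of P Q "[b]"] smooth_fun_real_polynomial by metis
    with PQ show ?case by (intro exI[of _ "\<lambda>x. P x + Q x"]) auto
  qed
  then show ?thesis using that by blast
qed

section \<open>Polynomial approximation in all derivatives\<close>

lemma smooth_fun_mvt_segment:
  fixes g :: "'a::real_normed_vector \<Rightarrow> real"
  assumes "smooth_fun g"
  obtains s where "0 < s" "s < 1" "g y - g x = iter_dd [y - x] g (x + s *\<^sub>R (y - x))"
  by (rule smooth_fun_mvt[OF assms, of 1 x "y - x"]) auto

text \<open>Derivatives are approximated by integrating: a polynomial close to the derivative of
  \<open>g\<close> along \<open>i\<close> is integrated along \<open>i\<close>, and a polynomial
  close to \<open>g\<close> on the hyperplane supplies the constant of integration. The outer
  induction adds a direction, the inner one raises the order in it. The order is bounded per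
  direction because the inner induction changes it in one direction only.\<close>

lemma polynomial_approx_dirs:
  fixes g :: "'a::euclidean_space \<Rightarrow> real"
  assumes "finite I" "I \<subseteq> Basis" "smooth_fun g" "e > 0" and R: "R > 0"
  shows "\<exists>p. real_polynomial_function p \<and>
    (\<forall>us x. set us \<subseteq> I \<longrightarrow> (\<forall>b. count_list us b \<le> m) \<longrightarrow> x \<in> cbox (-R *\<^sub>R One) (R *\<^sub>R One) \<longrightarrow>
       \<bar>iter_dd us (\<lambda>x. g x - p x) x\<bar> \<le> e)"
  using assms(1-4)
proof (induction I arbitrary: g e rule: finite_induct)
  case empty
  obtain p where "real_polynomial_function p"
      "\<And>x. x \<in> cbox (-R *\<^sub>R One) (R *\<^sub>R One) \<Longrightarrow> \<bar>g x - p x\<bar> < e"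
    using Stone_Weierstrass_real_polynomial_function[OF compact_cbox smooth_fun_continuous[OF empty(2)] empty(3)] by metis
  then show ?case by (intro exI[of _ p]) (auto intro: less_imp_le)
next
  case (insert i I)
  let ?C = "cbox (-R *\<^sub>R One) (R *\<^sub>R One) :: 'a set"
  define \<pi> where "\<pi> = (\<lambda>x::'a. x - (x \<bullet> i) *\<^sub>R i)"
  have i: "i \<in> Basis" and I: "I \<subseteq> Basis" using insert by auto
  have \<pi>: "bounded_linear \<pi>" unfolding \<pi>_def
    by (intro bounded_linear_sub bounded_linear_ident bounded_linear_scaleR_const bounded_linear_inner_left)
  have \<pi>\<pi>: "\<pi> (\<pi> x) = \<pi> x" for x using i by (simp add: \<pi>_def inner_diff_left)
  have \<pi>C: "\<pi> x \<in> ?C" if "x \<in> ?C" for x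
    using that i R by (auto simp: \<pi>_def mem_box inner_diff_left inner_Basis)
  have map\<pi>: "map \<pi> us = us" if "set us \<subseteq> I" for us
  proof -
    have "\<pi> u = u" if "u \<in> set us" for u
    proof -
      have "u \<in> I" using that \<open>set us \<subseteq> I\<close> by blast
      then have "u \<bullet> i = 0" using I i insert(2) by (metis inner_not_same_Basis subsetD)
      then show ?thesis by (simp add: \<pi>_def)
    qed
    then show ?thesis by (simp add: map_idI)
  qed
  have claim: "\<exists>P. real_polynomial_function P \<and>
    (\<forall>us q' x. set us \<subseteq> I \<longrightarrow> (\<forall>b. count_list us b \<le> m) \<longrightarrow> q' \<le> q \<longrightarrow> x \<in> ?C \<longrightarrow>
       \<bar>iter_dd us (iter_dd (replicate q' i) (\<lambda>x. g x - P x)) x\<bar> \<le> e)"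
    if "smooth_fun g" "e > 0" for q g e
    using that
  proof (induction q arbitrary: g e)
    case 0
    then show ?case using insert.IH[OF I 0] by auto
  next
    case (Suc q)
    \<comment> \<open>An error \<open>e'\<close> on the hyperplane and at most \<open>R * e'\<close>
      from integrating over a distance of at most \<open>R\<close> add up to
      \<open>e\<close>.\<close>
    define e' where "e' = e / (1 + R)"
    have e'0: "e' > 0" using Suc.prems(2) R by (simp add: e'_def)
    have e'1: "e' + R * e' = e" 
    proof -
      have "e' + R * e' = (1 + R) * e'" by (simp add: algebra_simps)
      then show ?thesis using R by (simp add: e'_def)
    qed
    have e': "e' > 0" "e' \<le> e" "e' + R * e' \<le> e"
      using e'0 e'1 mult_pos_pos[OF R e'0] by linarith+
    define Dg where "Dg = iter_dd [i] g"
    have Dg: "smooth_fun Dg" unfolding Dg_def by (rule smooth_fun_iter_dd[OF Suc.prems(1)])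
    have g: "smooth_fun g" by fact
    obtain p where p: "real_polynomial_function p"
      "\<And>us q' x. set us \<subseteq> I \<Longrightarrow> (\<And>b. count_list us b \<le> m) \<Longrightarrow> q' \<le> q \<Longrightarrow> x \<in> ?C \<Longrightarrow>
         \<bar>iter_dd us (iter_dd (replicate q' i) (\<lambda>x. Dg x - p x)) x\<bar> \<le> e'"
      using Suc.IH[OF Dg e'(1)] by blast
    obtain r where r: "real_polynomial_function r"
      "\<And>us x. set us \<subseteq> I \<Longrightarrow> (\<And>b. count_list us b \<le> m) \<Longrightarrow> x \<in> ?C \<Longrightarrow>
         \<bar>iter_dd us (\<lambda>x. g (\<pi> x) - r x) x\<bar> \<le> e'"
      using insert.IH[OF I smooth_fun_bounded_linear_right[OF \<pi> g] e'(1)] by blast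
    obtain J where J: "real_polynomial_function J" "iter_dd [i] J = p" "\<And>x. x \<bullet> i = 0 \<Longrightarrow> J x = 0"
      using real_polynomial_antiderivative[OF p(1) i] by blast
    define P where "P = (\<lambda>x. J x + r (\<pi> x))"
    have r\<pi>: "real_polynomial_function (\<lambda>x. r (\<pi> x))"
      using real_polynomial_function_compose[of \<pi> r] r(1) \<pi>
      by (simp add: comp_def polynomial_function_bounded_linear)
    have P: "real_polynomial_function P"
      unfolding P_def by (intro real_polynomial_function.intros(3) J r\<pi>)
    define d where "d = (\<lambda>x. g x - P x)"
    have d: "smooth_fun d" unfolding d_def by (intro smooth_fun_diff g smooth_fun_real_polynomial P)
    have Dd: "iter_dd [i] d = (\<lambda>x. Dg x - p x)"
    proof -
      have "iter_dd [i] (\<lambda>x. r (\<pi> x)) = (\<lambda>x. 0)"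
        unfolding iter_dd_bounded_linear_right[OF \<pi> smooth_fun_real_polynomial[OF r(1)]]
      proof -
        have "\<pi> i = 0" using i by (simp add: \<pi>_def)
        then show "(\<lambda>x. iter_dd (map \<pi> [i]) r (\<pi> x)) = (\<lambda>x. 0)"
          using linear_0[OF iter_dd_linear[OF smooth_fun_real_polynomial[OF r(1)], of "[]"]] by simp
      qed
      then have "iter_dd [i] P = p"
        unfolding P_def iter_dd_add[OF smooth_fun_real_polynomial[OF J(1)] smooth_fun_real_polynomial[OF r\<pi>]] J(2)
        by simp
      then show ?thesis
        unfolding d_def iter_dd_diff[OF g smooth_fun_real_polynomial[OF P]] Dg_def by simp
    qed
    show ?case
    proof (intro exI[of _ P] conjI P allI impI)
      fix us q' x
      assume us: "set us \<subseteq> I" "\<forall>b. count_list us b \<le> m" and q': "q' \<le> Suc q" and x: "x \<in> ?C"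
      show "\<bar>iter_dd us (iter_dd (replicate q' i) (\<lambda>x. g x - P x)) x\<bar> \<le> e"
      proof (cases q')
        case (Suc q'')
        have "iter_dd (replicate q' i) d = iter_dd (replicate q'' i) (iter_dd [i] d)"
          unfolding Suc iter_dd_append[symmetric] by (simp add: replicate_append_same)
        then show ?thesis
          using p(2)[of us q'' x] us q' x e'(2) unfolding Dd d_def[symmetric] Suc by auto
      next
        case 0
        \<comment> \<open>Without a derivative along \<open>i\<close>, the point \<open>x\<close> is
          compared with its projection to the hyperplane by the mean value theorem; the directions
          in \<open>us\<close> commute with the derivative along \<open>i\<close>.\<close>
        define F where "F = iter_dd us d"
        have F: "smooth_fun F" unfolding F_def by (rule smooth_fun_iter_dd[OF d])
        obtain s where s: "0 < s" "s < 1" "F x - F (\<pi> x) = iter_dd [x - \<pi> x] F (\<pi> x + s *\<^sub>R (x - \<pi> x))"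
          by (rule smooth_fun_mvt_segment[OF F])
        define y where "y = \<pi> x + s *\<^sub>R (x - \<pi> x)"
        have y: "y \<in> ?C"
        proof -
          have "y = (1 - s) *\<^sub>R \<pi> x + s *\<^sub>R x" by (simp add: y_def algebra_simps)
          then show ?thesis
            using convexD[OF convex_box(1)[of "-R *\<^sub>R One" "R *\<^sub>R One"] \<pi>C[OF x] x, of "1 - s" s] s by simp
        qed
        have "F x - F (\<pi> x) = (x \<bullet> i) * iter_dd [i] F y"
          unfolding s(3) y_def[symmetric]
          using linear_cmul[OF iter_dd_linear[OF F, of "[]" y], of "x \<bullet> i" i] by (simp add: \<pi>_def)
        moreover have "iter_dd [i] F = iter_dd us (\<lambda>x. Dg x - p x)"
        proof -
          have "iter_dd [i] F = iter_dd (us @ [i]) d"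
            unfolding F_def iter_dd_append[symmetric] by (subst iter_dd_rotate[OF d]) simp
          then show ?thesis by (simp only: iter_dd_append Dd)
        qed
        moreover have "\<bar>iter_dd us (\<lambda>x. Dg x - p x) y\<bar> \<le> e'"
          using p(2)[of us 0 y] us y by simp
        moreover have "\<bar>x \<bullet> i\<bar> \<le> R" using x i by (force simp: mem_box)
        ultimately have 1: "\<bar>F x - F (\<pi> x)\<bar> \<le> R * e'"
          using mult_mono[of "\<bar>x \<bullet> i\<bar>" R "\<bar>iter_dd us (\<lambda>x. Dg x - p x) y\<bar>" e'] R
          by (simp only: abs_mult)
        have "F (\<pi> x) = iter_dd us (\<lambda>x. d (\<pi> x)) x"
          unfolding iter_dd_bounded_linear_right[OF \<pi> d] map\<pi>[OF us(1)] F_def ..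
        also have "(\<lambda>x. d (\<pi> x)) = (\<lambda>x. g (\<pi> (\<pi> x)) - r (\<pi> x))"
          using i by (auto simp: d_def P_def \<pi>\<pi> J(3) \<pi>_def inner_diff_left)
        also have "iter_dd us \<dots> x = iter_dd us (\<lambda>x. g (\<pi> x) - r x) (\<pi> x)"
          using iter_dd_bounded_linear_right[OF \<pi> smooth_fun_diff[OF smooth_fun_bounded_linear_right[OF \<pi> g] smooth_fun_real_polynomial[OF r(1)]], of us]
          by (simp add: map\<pi>[OF us(1)])
        finally have 2: "\<bar>F (\<pi> x)\<bar> \<le> e'"
          using r(2)[of us "\<pi> x"] us \<pi>C[OF x] by simp
        show ?thesis using 1 2 e'(3) unfolding 0 F_def d_def by simp
      qed
    qed
  qed
  obtain P where P: "real_polynomial_function P" "\<And>us q' x. set us \<subseteq> I \<Longrightarrow> (\<And>b. count_list us b \<le> m) \<Longrightarrow> q' \<le> m \<Longrightarrow> x \<in> ?C \<Longrightarrow>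
       \<bar>iter_dd us (iter_dd (replicate q' i) (\<lambda>x. g x - P x)) x\<bar> \<le> e"
    using claim[OF insert.prems(2,3), of m] by blast
  have d: "smooth_fun (\<lambda>x. g x - P x)" by (intro smooth_fun_diff insert.prems smooth_fun_real_polynomial P)
  show ?case
  proof (intro exI[of _ P] conjI P(1) allI impI)
    fix us x assume us: "set us \<subseteq> insert i I" "\<forall>b. count_list us b \<le> m" and x: "x \<in> ?C"
    let ?vs = "filter (\<lambda>u. u \<noteq> i) us"
    \<comment> \<open>Directional derivatives commute, so all occurrences of \<open>i\<close> can be
      moved to the innermost places.\<close>
    have "mset us = mset (?vs @ replicate (count_list us i) i)"
      by (induction us) auto
    from iter_dd_mset[OF d this]
    have "iter_dd us (\<lambda>x. g x - P x) = iter_dd ?vs (iter_dd (replicate (count_list us i) i) (\<lambda>x. g x - P x))"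
      by (simp only: iter_dd_append)
    moreover have "count_list ?vs b \<le> m" for b
    proof -
      have "count_list ?vs b \<le> count_list us b" by (induction us) auto
      then show ?thesis using us(2) le_trans by blast
    qed
    moreover have "set ?vs \<subseteq> I" using us(1) by auto
    ultimately show "\<bar>iter_dd us (\<lambda>x. g x - P x) x\<bar> \<le> e"
      using P(2)[of ?vs "count_list us i" x] us(2) x by simp
  qed
qed

lemma polynomial_approx:
  fixes g :: "'a::euclidean_space \<Rightarrow> real"
  assumes "smooth_fun g" "e > 0" and K: "bounded (K :: 'a set)"
  obtains p where "real_polynomial_function p"
    "\<And>us x. set us \<subseteq> Basis \<Longrightarrow> length us \<le> m \<Longrightarrow> x \<in> K \<Longrightarrow> \<bar>iter_dd us (\<lambda>x. g x - p x) x\<bar> \<le> e"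
proof -
  obtain R where R: "R > 0" "K \<subseteq> cbox (-R *\<^sub>R One) (R *\<^sub>R One)"
  proof -
    obtain R where R: "R > 0" "\<And>x. x \<in> K \<Longrightarrow> norm x \<le> R"
      using K bounded_pos by blast
    have "x \<in> cbox (-R *\<^sub>R One) (R *\<^sub>R One)" if "x \<in> K" for x
    proof -
      have "\<bar>x \<bullet> b\<bar> \<le> R" if "b \<in> Basis" for b
        using R(2)[OF \<open>x \<in> K\<close>] Basis_le_norm[OF that, of x] by linarith
      then show ?thesis by (fastforce simp: mem_box abs_le_iff)
    qed
    then show thesis using that R(1) by blast
  qed
  obtain p where p: "real_polynomial_function p"
    "\<forall>us x. set us \<subseteq> Basis \<longrightarrow> (\<forall>b. count_list us b \<le> m) \<longrightarrow> x \<in> cbox (-R *\<^sub>R One) (R *\<^sub>R One) \<longrightarrow>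
       \<bar>iter_dd us (\<lambda>x. g x - p x) x\<bar> \<le> e"
    using polynomial_approx_dirs[OF finite_Basis subset_refl assms(1,2) R(1), of m] by blast
  show thesis
  proof (rule that[OF p(1)])
    fix us :: "'a list" and x assume "set us \<subseteq> Basis" "length us \<le> m" "x \<in> K"
    moreover have "\<forall>b. count_list us b \<le> m" using \<open>length us \<le> m\<close> by (meson count_le_length le_trans)
    ultimately show "\<bar>iter_dd us (\<lambda>x. g x - p x) x\<bar> \<le> e" using p(2) R(2) by blast
  qed
qed

lemma iter_dd_sum:
  assumes "finite I" "\<And>i. i \<in> I \<Longrightarrow> smooth_fun (f i)"
  shows "iter_dd vs (\<lambda>x. \<Sum>i\<in>I. f i x) = (\<lambda>x. \<Sum>i\<in>I. iter_dd vs (f i) x)"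
  using assms
proof (induction I rule: finite_induct)
  case empty
  have "iter_dd vs (\<lambda>x. 0) = (\<lambda>x. 0)" by (induction vs) auto
  then show ?case by simp
next
  case (insert i I)
  then show ?case
    using iter_dd_add[of "f i" "\<lambda>x. \<Sum>i\<in>I. f i x" vs] by (simp add: smooth_fun_sum)
qed

text \<open>A direction of norm at most 1 has coordinates at most 1, so expanding it in the basis
  costs a factor \<open>DIM('a)\<close>. The list \<open>vs\<close> holds the directions already
  expanded.\<close>

lemma iter_dd_bound_from_Basis:
  fixes g :: "'a::euclidean_space \<Rightarrow> 'b::real_normed_vector"
  assumes g: "smooth_fun g"
    and B: "\<And>us. set us \<subseteq> Basis \<Longrightarrow> length us \<le> m \<Longrightarrow> norm (iter_dd us g x) \<le> B"
  shows "set vs \<subseteq> Basis \<Longrightarrow> length ws + length vs \<le> m \<Longrightarrow> (\<And>w. w \<in> set ws \<Longrightarrow> norm w \<le> 1) \<Longrightarrow>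
    norm (iter_dd (ws @ vs) g x) \<le> real DIM('a) ^ length ws * B"
proof (induction ws arbitrary: vs rule: rev_induct)
  case Nil then show ?case using B by simp
next
  case (snoc w ws)
  have h: "smooth_fun (iter_dd vs g)" by (rule smooth_fun_iter_dd[OF g])
  have "iter_dd (w # vs) g = (\<lambda>y. \<Sum>b\<in>Basis. (w \<bullet> b) *\<^sub>R iter_dd (b # vs) g y)"
  proof
    fix y
    interpret l: linear "\<lambda>w. iter_dd (w # vs) g y" by (rule iter_dd_linear[OF g])
    show "iter_dd (w # vs) g y = (\<Sum>b\<in>Basis. (w \<bullet> b) *\<^sub>R iter_dd (b # vs) g y)"
      by (subst euclidean_representation[of w, symmetric]) (simp only: l.sum l.scale)
  qed
  then have "iter_dd ((ws @ [w]) @ vs) g = iter_dd ws (\<lambda>y. \<Sum>b\<in>Basis. (w \<bullet> b) *\<^sub>R iter_dd (b # vs) g y)"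
    by (simp only: append_assoc append_Cons append_Nil iter_dd_append)
  also have "\<dots> = (\<lambda>y. \<Sum>b\<in>Basis. (w \<bullet> b) *\<^sub>R iter_dd (ws @ b # vs) g y)"
    unfolding iter_dd_append
    by (subst iter_dd_sum[OF finite_Basis smooth_fun_scaleR[OF smooth_fun_iter_dd[OF g]]])
      (rule ext, rule sum.cong[OF refl], subst iter_dd_bounded_linear_left[OF bounded_linear_scaleR_right smooth_fun_iter_dd[OF g]], rule refl)
  finally have "norm (iter_dd ((ws @ [w]) @ vs) g x) \<le> (\<Sum>b\<in>Basis. norm ((w \<bullet> b) *\<^sub>R iter_dd (ws @ b # vs) g x))"
    by (simp only: norm_sum)
  also have "\<dots> \<le> (\<Sum>b\<in>(Basis::'a set). real DIM('a) ^ length ws * B)"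
  proof (rule sum_mono)
    fix b :: 'a assume b: "b \<in> Basis"
    have "\<bar>w \<bullet> b\<bar> \<le> 1" using snoc.prems(3)[of w] Basis_le_norm[OF b, of w] by simp
    moreover have "norm (iter_dd (ws @ b # vs) g x) \<le> real DIM('a) ^ length ws * B"
      using snoc.prems b by (intro snoc.IH) auto
    ultimately show "norm ((w \<bullet> b) *\<^sub>R iter_dd (ws @ b # vs) g x) \<le> real DIM('a) ^ length ws * B"
      using mult_mono[of "\<bar>w \<bullet> b\<bar>" 1 "norm (iter_dd (ws @ b # vs) g x)"] by simp
  qed
  also have "\<dots> = real DIM('a) ^ length (ws @ [w]) * B" by simp
  finally show ?case .
qed

section \<open>Uniqueness of the Goodey-Weil distribution\<close>

text \<open>Nonnegativity of both parts makes their squares convex, which is what closes the class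
  under products.\<close>

definition smooth_dc :: "('a::real_normed_vector \<Rightarrow> real) \<Rightarrow> bool" where
  "smooth_dc f \<longleftrightarrow> (\<exists>u w. smooth_fun u \<and> smooth_fun w \<and> convex_on UNIV u \<and> convex_on UNIV w \<and>
     (\<forall>x. 0 \<le> u x) \<and> (\<forall>x. 0 \<le> w x) \<and> f = (\<lambda>x. u x - w x))"

lemma convex_on_nonneg_square:
  assumes u: "convex_on UNIV u" and nn: "\<And>x. 0 \<le> u x"
  shows "convex_on UNIV (\<lambda>x. (u x)\<^sup>2)"
proof (rule convex_onI)
  fix t :: real and x y assume t: "0 < t" "t < 1"
  have "u ((1 - t) *\<^sub>R x + t *\<^sub>R y) \<le> (1 - t) * u x + t * u y"
    using convex_onD[OF u, of t x y] t by simp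
  then have "(u ((1 - t) *\<^sub>R x + t *\<^sub>R y))\<^sup>2 \<le> ((1 - t) * u x + t * u y)\<^sup>2"
    using nn by (intro power_mono) auto
  also have "\<dots> \<le> (1 - t) * (u x)\<^sup>2 + t * (u y)\<^sup>2"
    using convex_onD[OF convex_power2, of t "u x" "u y"] t by simp
  finally show "(u ((1 - t) *\<^sub>R x + t *\<^sub>R y))\<^sup>2 \<le> (1 - t) * (u x)\<^sup>2 + t * (u y)\<^sup>2" .
qed simp

lemma convex_on_affine_square:
  assumes "bounded_linear f"
  shows "convex_on UNIV (\<lambda>x. (f x + c)\<^sup>2 :: real)"
proof (rule convex_onI)
  interpret bounded_linear f by fact
  fix t :: real and x y assume t: "0 < t" "t < 1"
  have "f ((1 - t) *\<^sub>R x + t *\<^sub>R y) + c = (1 - t) * (f x + c) + t * (f y + c)"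
    by (simp only: add scale) (simp add: algebra_simps)
  then show "(f ((1 - t) *\<^sub>R x + t *\<^sub>R y) + c)\<^sup>2 \<le> (1 - t) * (f x + c)\<^sup>2 + t * (f y + c)\<^sup>2"
    using convex_onD[OF convex_power2, of t "f x + c" "f y + c"] t by simp
qed simp

lemma convex_on_scale: "convex_on S f \<Longrightarrow> 0 \<le> c \<Longrightarrow> convex_on S (\<lambda>x. c * f x :: real)"
  by (rule convex_on_cmul)

lemma convex_on_constant: "convex_on UNIV (\<lambda>x. c :: real)"
  by (rule convex_onI) (auto simp: algebra_simps)

text \<open>A linear function need not be nonnegative, so \<open>f\<close> is written as
  \<open>(f + 1)\<^sup>2 / 2 - (f\<^sup>2 + 1) / 2\<close>.\<close>

lemma smooth_dc_linear:
  assumes f: "bounded_linear f" shows "smooth_dc f"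
proof -
  have s: "smooth_fun (\<lambda>x. 1/2 * (f x + c)\<^sup>2)" for c
    unfolding power2_eq_square
    by (intro smooth_fun_mult smooth_fun_const smooth_fun_add smooth_fun_bounded_linear[OF f])
  have c: "convex_on UNIV (\<lambda>x. 1/2 * (f x + c)\<^sup>2)" for c
    by (rule convex_on_scale[OF convex_on_affine_square[OF f]]) simp
  have s2: "smooth_fun (\<lambda>x. 1/2 * (f x + 0)\<^sup>2 + 1/2)"
    by (rule smooth_fun_add[OF s smooth_fun_const])
  have c2: "convex_on UNIV (\<lambda>x. 1/2 * (f x + 0)\<^sup>2 + 1/2)"
    by (rule convex_on_add[OF c convex_on_constant])
  have "f = (\<lambda>x. 1/2 * (f x + 1)\<^sup>2 - (1/2 * (f x + 0)\<^sup>2 + 1/2))"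
    by (auto simp: power2_eq_square field_simps)
  then show ?thesis unfolding smooth_dc_def using s c s2 c2
    by (intro exI[of _ "\<lambda>x. 1/2 * (f x + 1)\<^sup>2"] exI[of _ "\<lambda>x. 1/2 * (f x + 0)\<^sup>2 + 1/2"]) auto
qed

lemma smooth_dc_const: "smooth_dc (\<lambda>x. c)"
  unfolding smooth_dc_def
  by (rule exI[of _ "\<lambda>x. \<bar>c\<bar>"], rule exI[of _ "\<lambda>x. \<bar>c\<bar> - c"])
    (auto intro: convex_on_constant)

lemma smooth_dc_mult:
  assumes "smooth_dc p" "smooth_dc q" shows "smooth_dc (\<lambda>x. p x * q x)"
proof -
  obtain a b where ab: "smooth_fun a" "smooth_fun b" "convex_on UNIV a" "convex_on UNIV b"
     "\<And>x. 0 \<le> a x" "\<And>x. 0 \<le> b x" "p = (\<lambda>x. a x - b x)" using assms(1) unfolding smooth_dc_def by blast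
  obtain c d where cd: "smooth_fun c" "smooth_fun d" "convex_on UNIV c" "convex_on UNIV d"
     "\<And>x. 0 \<le> c x" "\<And>x. 0 \<le> d x" "q = (\<lambda>x. c x - d x)" using assms(2) unfolding smooth_dc_def by blast
  \<comment> \<open>Every product in \<open>(a - b) * (c - d)\<close> is replaced by means of
    \<open>2 * p * q = (p + q)\<^sup>2 - p\<^sup>2 - q\<^sup>2\<close>, and the squares are sorted
    by sign.\<close>
  let ?u = "\<lambda>x. 1/2 * ((a x + c x)\<^sup>2 + (b x + d x)\<^sup>2 + (a x)\<^sup>2 + (d x)\<^sup>2 + (b x)\<^sup>2 + (c x)\<^sup>2)"
  let ?w = "\<lambda>x. 1/2 * ((a x + d x)\<^sup>2 + (b x + c x)\<^sup>2 + (a x)\<^sup>2 + (c x)\<^sup>2 + (b x)\<^sup>2 + (d x)\<^sup>2)"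
  have "(\<lambda>x. p x * q x) = (\<lambda>x. ?u x - ?w x)"
    unfolding ab(7) cd(7) by (simp add: power2_eq_square algebra_simps)
  moreover have "convex_on UNIV ?u" "convex_on UNIV ?w"
    by (intro convex_on_scale convex_on_add convex_on_nonneg_square ab cd add_nonneg_nonneg; simp)+
  moreover have "smooth_fun ?u" "smooth_fun ?w" unfolding power2_eq_square
    by (intro smooth_fun_mult smooth_fun_const smooth_fun_add ab cd)+
  ultimately show ?thesis unfolding smooth_dc_def
    by (intro exI[of _ ?u] exI[of _ ?w]) auto
qed

text \<open>With differences of convex functions as factors, the span is closed under multiplication
  and therefore contains all polynomials.\<close>

inductive_set tensor_span :: "(real^'n^'k \<Rightarrow> complex) set" where
  tensor: "(\<And>j. smooth_dc (fs j)) \<Longrightarrow> (\<lambda>X. c * tensor fs X) \<in> tensor_span"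
| add: "p \<in> tensor_span \<Longrightarrow> q \<in> tensor_span \<Longrightarrow> (\<lambda>X. p X + q X) \<in> tensor_span"

lemma tensor_span_mult:
  assumes "p \<in> tensor_span" "q \<in> tensor_span"
  shows "(\<lambda>x. p x * q x) \<in> tensor_span"
  using assms
proof (induction p rule: tensor_span.induct)
  case (tensor fs c)
  note r = tensor
  from \<open>q \<in> tensor_span\<close> show ?case
  proof (induction q rule: tensor_span.induct)
    case (tensor gs d)
    have "(\<lambda>X. (c * d) * tensor (\<lambda>j x. fs j x * gs j x) X) \<in> tensor_span"
      using r tensor by (intro tensor_span.tensor smooth_dc_mult)
    then show ?case by (simp add: tensor_def prod.distrib mult_ac)
  next
    case (add p q)
    then show ?case using tensor_span.add[OF add.IH] by (simp add: algebra_simps)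
  qed
next
  case (add p1 p2)
  then show ?case using tensor_span.add[OF add.IH] by (simp add: algebra_simps)
qed

lemma tensor_span_sum:
  assumes "finite I" "\<And>i. i \<in> I \<Longrightarrow> f i \<in> tensor_span"
  shows "(\<lambda>X. \<Sum>i\<in>I. f i X) \<in> tensor_span"
  using assms
proof (induction I rule: finite_induct)
  case empty
  show ?case using tensor_span.tensor[of "\<lambda>_ _. 0" 0, OF smooth_dc_const] by simp
qed (auto intro: tensor_span.add)

lemma real_polynomial_tensor_span:
  fixes p :: "real^'n^'k \<Rightarrow> real"
  assumes "real_polynomial_function p"
  shows "(\<lambda>X. complex_of_real (p X)) \<in> tensor_span"
  using assms
proof (induction p rule: real_polynomial_function.induct)
  case (linear f)
  have slot: "(\<lambda>X::real^'n^'k. complex_of_real (X $ j $ l)) \<in> tensor_span" for j l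
  proof -
    have "(\<lambda>X. 1 * tensor (\<lambda>i. if i = j then (\<lambda>x. x $ l) else (\<lambda>x. 1)) X) \<in> (tensor_span :: (real^'n^'k \<Rightarrow> complex) set)"
      by (rule tensor_span.tensor) (auto intro: smooth_dc_const smooth_dc_linear bounded_linear_vec_nth)
    moreover have "tensor (\<lambda>i. if i = j then (\<lambda>x. x $ l) else (\<lambda>x. 1)) X = complex_of_real (X $ j $ l)" for X :: "real^'n^'k"
    proof -
      have "tensor (\<lambda>i. if i = j then (\<lambda>x. x $ l) else (\<lambda>x. 1)) X = (\<Prod>i\<in>UNIV. if i = j then complex_of_real (X $ j $ l) else 1)"
        unfolding tensor_def by (rule prod.cong) auto
      then show ?thesis by simp
    qed
    ultimately show ?thesis by simp
  qed
  have const: "(\<lambda>X. c) \<in> (tensor_span :: (real^'n^'k \<Rightarrow> complex) set)" for c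
    using tensor_span.tensor[of "\<lambda>_ _. 1" c, OF smooth_dc_const] by (simp add: tensor_def)
  interpret f: bounded_linear f by fact
  have fX: "f X = (\<Sum>j\<in>UNIV. \<Sum>l\<in>UNIV. f (axis j (axis l 1)) * X $ j $ l)" for X
  proof -
    have "X = (\<Sum>j\<in>UNIV. \<Sum>l\<in>UNIV. X $ j $ l *\<^sub>R axis j (axis l 1))"
    proof -
      have "(\<Sum>x\<in>UNIV. \<Sum>y\<in>UNIV. if i = x then if l = y then X $ x $ y else 0 else 0)
          = (\<Sum>x\<in>UNIV. if i = x then X $ x $ l else 0)" for i l
        by (rule sum.cong) auto
      then show ?thesis
        by (simp add: vec_eq_iff axis_def if_distrib[of "\<lambda>x. _ * x"] if_distrib[of "\<lambda>x. x $ _"] cong: if_cong)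
    qed
    then have "f X = f (\<Sum>j\<in>UNIV. \<Sum>l\<in>UNIV. X $ j $ l *\<^sub>R axis j (axis l 1))" by simp
    also have "\<dots> = (\<Sum>j\<in>UNIV. \<Sum>l\<in>UNIV. f (axis j (axis l 1)) * X $ j $ l)"
      by (simp add: f.sum f.scale mult.commute)
    finally show ?thesis .
  qed
  have "(\<lambda>X. complex_of_real (f X)) = (\<lambda>X. \<Sum>j\<in>UNIV. \<Sum>l\<in>UNIV. complex_of_real (f (axis j (axis l 1))) * complex_of_real (X $ j $ l))"
    by (rule ext, subst fX) (simp only: of_real_sum of_real_mult)
  also have "\<dots> \<in> tensor_span"
    by (rule tensor_span_sum[OF finite], rule tensor_span_sum[OF finite],
        rule tensor_span_mult[OF const slot])
  finally show ?case .
next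
  case (const c)
  show ?case using tensor_span.tensor[of "\<lambda>_ _. 1" "complex_of_real c", OF smooth_dc_const] by (simp add: tensor_def)
qed (auto intro: tensor_span.add tensor_span_mult)

lemma smooth_dc_smooth: "smooth_dc f \<Longrightarrow> smooth_fun f"
  unfolding smooth_dc_def by (auto intro: smooth_fun_diff)

lemma tensor_span_smooth: "p \<in> tensor_span \<Longrightarrow> smooth_fun p"
  by (induction rule: tensor_span.induct)
    (simp_all add: smooth_fun_add smooth_fun_mult smooth_fun_tensor smooth_dc_smooth)

section \<open>Distributions determined by tensor products\<close>

lemma comp_distr_linear:
  assumes "comp_distr T" "smooth_fun g" "smooth_fun h"
  shows "T (\<lambda>x. a * g x + h x) = a * T g + T h"
  using assms unfolding comp_distr_def by blast

lemma comp_distr_scale: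
  assumes "comp_distr T" "smooth_fun g" shows "T (\<lambda>x. a * g x) = a * T g"
proof -
  have "T (\<lambda>x. 1 * 0 + 0) = 1 * T (\<lambda>x. 0) + T (\<lambda>x. 0)"
    by (rule comp_distr_linear[OF assms(1)]) auto
  then have "T (\<lambda>x. 0) = 0" by simp
  then show ?thesis using comp_distr_linear[OF assms smooth_fun_const[of 0], of a] by simp
qed

lemma comp_distr_add:
  assumes "comp_distr T" "smooth_fun g" "smooth_fun h" shows "T (\<lambda>x. g x + h x) = T g + T h"
  using comp_distr_linear[OF assms, of 1] by simp

lemma comp_distr_diff:
  assumes "comp_distr T" "smooth_fun g" "smooth_fun h" shows "T (\<lambda>x. g x - h x) = T g - T h"
  using comp_distr_linear[OF assms(1,3,2), of "-1"] by simp

lemma tensor_update_diff: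
  "tensor (fs(j := (\<lambda>x. u x - w x))) X = tensor (fs(j := u)) X - tensor (fs(j := w)) X"
  unfolding tensor_def by (simp add: prod.remove[of _ j] left_diff_distrib)

text \<open>A tensor product is linear in each slot, so the slots are changed one at a time from
  convex functions to differences of such; \<open>S\<close> collects the slots already
  changed.\<close>

lemma comp_distr_eq_tensor_span:
  fixes T1 T2 :: "(real^'n^'k \<Rightarrow> complex) \<Rightarrow> complex"
  assumes T: "comp_distr T1" "comp_distr T2"
    and eq: "\<And>fs. (\<And>j. smooth_fun (fs j) \<and> convex_on UNIV (fs j)) \<Longrightarrow> T1 (tensor fs) = T2 (tensor fs)"
  shows "p \<in> tensor_span \<Longrightarrow> T1 p = T2 p"
proof (induction p rule: tensor_span.induct)
  case (tensor fs c)
  have "\<forall>fs. (\<forall>j\<in>S. smooth_dc (fs j)) \<longrightarrow> (\<forall>j. j \<notin> S \<longrightarrow> smooth_fun (fs j) \<and> convex_on UNIV (fs j)) \<longrightarrow>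
    T1 (tensor fs) = T2 (tensor fs)" for S :: "'k set"
    using finite[of S]
  proof (induction S rule: finite_induct)
    case empty
    then show ?case using eq by auto
  next
    case (insert j S)
    show ?case
    proof (intro allI impI)
      fix fs :: "'k \<Rightarrow> real^'n \<Rightarrow> real"
      assume fs: "\<forall>j\<in>insert j S. smooth_dc (fs j)" "\<forall>i. i \<notin> insert j S \<longrightarrow> smooth_fun (fs i) \<and> convex_on UNIV (fs i)"
      obtain u w where uw: "smooth_fun u" "smooth_fun w" "convex_on UNIV u" "convex_on UNIV w" "fs j = (\<lambda>x. u x - w x)"
        using fs(1) unfolding smooth_dc_def by auto
      have e: "tensor fs = (\<lambda>X. tensor (fs(j := u)) X - tensor (fs(j := w)) X)"
        using tensor_update_diff[of fs j u w] uw(5) by (simp add: fun_upd_idem fun_eq_iff)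
      have sm: "smooth_fun (fs i)" for i
        using fs smooth_dc_smooth by blast
      have s: "smooth_fun (tensor (fs(j := u)) :: real^'n^'k \<Rightarrow> complex)"
              "smooth_fun (tensor (fs(j := w)) :: real^'n^'k \<Rightarrow> complex)"
        using uw sm by (auto intro!: smooth_fun_tensor)
      have "T1 (tensor (fs(j := v))) = T2 (tensor (fs(j := v)))" if "v = u \<or> v = w" for v
      proof (rule insert.IH[rule_format])
        show "smooth_dc ((fs(j := v)) i)" if "i \<in> S" for i
          using that insert.hyps fs(1) by (cases "i = j") auto
        show "smooth_fun ((fs(j := v)) i) \<and> convex_on UNIV ((fs(j := v)) i)" if "i \<notin> S" for i
          using that \<open>v = u \<or> v = w\<close> uw fs(2) by (cases "i = j") auto
      qed
      then show "T1 (tensor fs) = T2 (tensor fs)"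
        unfolding e comp_distr_diff[OF T(1) s] comp_distr_diff[OF T(2) s] by simp
    qed
  qed
  from this[of UNIV] tensor have "T1 (tensor fs) = T2 (tensor fs)" by simp
  then show ?case
    using comp_distr_scale[OF T(1) smooth_fun_tensor, of fs] comp_distr_scale[OF T(2) smooth_fun_tensor, of fs]
      tensor smooth_dc_smooth by metis
next
  case (add p q)
  then show ?case using comp_distr_add[OF T(1)] comp_distr_add[OF T(2)] tensor_span_smooth by metis
qed

lemma comp_distr_bound:
  fixes T :: "(real^'n^'k \<Rightarrow> complex) \<Rightarrow> complex"
  assumes "comp_distr T"
  obtains K C m where "compact K" "0 \<le> C"
    "\<And>g B. smooth_fun g \<Longrightarrow> 0 \<le> B \<Longrightarrow> (\<And>vs x. length vs \<le> m \<Longrightarrow> (\<And>v. v \<in> set vs \<Longrightarrow> norm v \<le> 1) \<Longrightarrow> x \<in> K \<Longrightarrow>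
            norm (iter_dd vs g x) \<le> B) \<Longrightarrow> norm (T g) \<le> C * B"
proof -
  obtain K C m where *: "compact K" "\<And>g B. smooth_fun g \<Longrightarrow> 
        (\<forall>vs x. length vs \<le> m \<longrightarrow> (\<forall>v\<in>set vs. norm v \<le> 1) \<longrightarrow> x \<in> K \<longrightarrow>
            norm (iter_dd vs g x) \<le> B) \<Longrightarrow> norm (T g) \<le> C * B"
    using assms unfolding comp_distr_def by blast
  show thesis
  proof (rule that[of K "max C 0" m])
    fix g :: "real^'n^'k \<Rightarrow> complex" and B assume g: "smooth_fun g" "(0::real) \<le> B" "\<And>vs x. length vs \<le> m \<Longrightarrow> (\<And>v. v \<in> set vs \<Longrightarrow> norm v \<le> 1) \<Longrightarrow> x \<in> K \<Longrightarrow>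
            norm (iter_dd vs g x) \<le> B"
    have "norm (T g) \<le> C * B" using *(2)[OF g(1)] g(3) by blast
    also have "\<dots> \<le> max C 0 * B" using g(2) by (intro mult_right_mono) auto
    finally show "norm (T g) \<le> max C 0 * B" .
  qed (use * in auto)
qed

text \<open>A compactly supported distribution sees finitely many orders of derivatives on a compact
  set. There polynomials approximate every smooth function, and on polynomials the two distributions
  agree. Real and imaginary parts are treated separately because the approximation is one of real
  functions.\<close>

lemma comp_distr_eqI:
  fixes T1 T2 :: "(real^'n^'k \<Rightarrow> complex) \<Rightarrow> complex"
  assumes T: "comp_distr T1" "comp_distr T2"
    and eq: "\<And>fs. (\<And>j. smooth_fun (fs j) \<and> convex_on UNIV (fs j)) \<Longrightarrow> T1 (tensor fs) = T2 (tensor fs)"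
    and g: "smooth_fun g"
  shows "T1 g = T2 g"
proof -
  obtain K1 C1 m1 where 1: "compact K1" "0 \<le> C1"
    "\<And>g B. smooth_fun g \<Longrightarrow> 0 \<le> B \<Longrightarrow> (\<And>vs x. length vs \<le> m1 \<Longrightarrow> (\<And>v. v \<in> set vs \<Longrightarrow> norm v \<le> 1) \<Longrightarrow> x \<in> K1 \<Longrightarrow>
            norm (iter_dd vs g x) \<le> B) \<Longrightarrow> norm (T1 g) \<le> C1 * B"
    by (rule comp_distr_bound[OF T(1)]) blast
  obtain K2 C2 m2 where 2: "compact K2" "0 \<le> C2"
    "\<And>g B. smooth_fun g \<Longrightarrow> 0 \<le> B \<Longrightarrow> (\<And>vs x. length vs \<le> m2 \<Longrightarrow> (\<And>v. v \<in> set vs \<Longrightarrow> norm v \<le> 1) \<Longrightarrow> x \<in> K2 \<Longrightarrow>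
            norm (iter_dd vs g x) \<le> B) \<Longrightarrow> norm (T2 g) \<le> C2 * B"
    by (rule comp_distr_bound[OF T(2)]) blast
  define m where "m = max m1 m2"
  \<comment> \<open>The price for passing from basis directions, in which the approximation is
    stated, to the directions of norm at most 1 in \<open>comp_distr\<close>.\<close>
  define N where "N = real DIM(real^'n^'k) ^ m"
  have N: "N \<ge> 1" unfolding N_def by (rule one_le_power) (use DIM_positive[where 'a="real^'n^'k"] in linarith)
  have realcase: "T1 (\<lambda>X. complex_of_real (h X)) = T2 (\<lambda>X. complex_of_real (h X))" if h: "smooth_fun h" for h :: "real^'n^'k \<Rightarrow> real"
  proof -
    have "norm (T1 (\<lambda>X. complex_of_real (h X)) - T2 (\<lambda>X. complex_of_real (h X))) \<le> (C1 + C2) * N * e" if e: "e > 0" for e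
    proof -
      have "bounded (K1 \<union> K2)" using 1(1) 2(1) compact_imp_bounded by blast
      then obtain p where p: "real_polynomial_function p"
        "\<And>us x. set us \<subseteq> Basis \<Longrightarrow> length us \<le> m \<Longrightarrow> x \<in> K1 \<union> K2 \<Longrightarrow> \<bar>iter_dd us (\<lambda>x. h x - p x) x\<bar> \<le> e"
        by (rule polynomial_approx[OF h e, where m = m]) blast
      define d where "d = (\<lambda>x. h x - p x)"
      have sp: "smooth_fun p" by (rule smooth_fun_real_polynomial[OF p(1)])
      have d: "smooth_fun d" unfolding d_def by (intro smooth_fun_diff h sp)
      have sd: "smooth_fun (\<lambda>X. complex_of_real (d X))" by (rule smooth_fun_of_real[OF d])
      have bd: "norm (iter_dd vs (\<lambda>X. complex_of_real (d X)) x) \<le> N * e"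
        if vs: "length vs \<le> m" "\<And>v. v \<in> set vs \<Longrightarrow> norm v \<le> 1" and x: "x \<in> K1 \<union> K2" for vs x
      proof -
        have "norm (iter_dd (vs @ []) d x) \<le> real DIM(real^'n^'k) ^ length vs * e"
          using p(2) x vs unfolding d_def[symmetric] by (intro iter_dd_bound_from_Basis[OF d, where m=m]) auto
        also have "\<dots> \<le> N * e" unfolding N_def
          using e vs(1) DIM_positive[where 'a="real^'n^'k"] by (intro mult_right_mono power_increasing) linarith+
        finally show ?thesis by (simp add: iter_dd_bounded_linear_left[OF bounded_linear_of_real d])
      qed
      have T12p: "T1 (\<lambda>X. complex_of_real (p X)) = T2 (\<lambda>X. complex_of_real (p X))"
        by (rule comp_distr_eq_tensor_span[OF T eq real_polynomial_tensor_span[OF p(1)]])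
      have Td: "T (\<lambda>X. complex_of_real (d X)) = T (\<lambda>X. complex_of_real (h X)) - T (\<lambda>X. complex_of_real (p X))"
        if "comp_distr T" for T :: "(real^'n^'k \<Rightarrow> complex) \<Rightarrow> complex"
        using comp_distr_diff[OF that smooth_fun_of_real[OF h] smooth_fun_of_real[OF sp]] by (simp add: d_def)
      have "T1 (\<lambda>X. complex_of_real (h X)) - T2 (\<lambda>X. complex_of_real (h X)) = T1 (\<lambda>X. complex_of_real (d X)) - T2 (\<lambda>X. complex_of_real (d X))"
        using Td[OF T(1)] Td[OF T(2)] T12p by simp
      moreover have "norm (T1 (\<lambda>X. complex_of_real (d X))) \<le> C1 * (N * e)"
        using N e bd by (intro 1(3)[OF sd]) (auto simp: m_def)
      moreover have "norm (T2 (\<lambda>X. complex_of_real (d X))) \<le> C2 * (N * e)"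
        using N e bd by (intro 2(3)[OF sd]) (auto simp: m_def)
      ultimately have "norm (T1 (\<lambda>X. complex_of_real (h X)) - T2 (\<lambda>X. complex_of_real (h X))) \<le> C1 * (N * e) + C2 * (N * e)"
        using norm_triangle_ineq4[of "T1 (\<lambda>X. complex_of_real (d X))" "T2 (\<lambda>X. complex_of_real (d X))"]
        by simp
      then show ?thesis by (simp add: algebra_simps)
    qed
    note le = this
    have "norm (T1 (\<lambda>X. complex_of_real (h X)) - T2 (\<lambda>X. complex_of_real (h X))) \<le> 0 + e" if e: "e > 0" for e
    proof -
      have c: "(C1 + C2) * N + 1 > 0" using N 1(2) 2(2) by (intro add_nonneg_pos mult_nonneg_nonneg) auto
      have "(C1 + C2) * N * (e / ((C1 + C2) * N + 1)) \<le> e"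
        using c e by (simp add: divide_le_eq algebra_simps)
      then show ?thesis using le[of "e / ((C1 + C2) * N + 1)"] c e by simp
    qed
    then have "norm (T1 (\<lambda>X. complex_of_real (h X)) - T2 (\<lambda>X. complex_of_real (h X))) \<le> 0"
      by (rule field_le_epsilon)
    then show ?thesis by simp
  qed
  have re: "smooth_fun (\<lambda>X. Re (g X))" and im: "smooth_fun (\<lambda>X. Im (g X))"
    by (rule smooth_fun_bounded_linear_left[OF bounded_linear_Re g] smooth_fun_bounded_linear_left[OF bounded_linear_Im g])+
  have "g = (\<lambda>X. \<i> * complex_of_real (Im (g X)) + complex_of_real (Re (g X)))"
    by (auto simp: complex_eq_iff)
  then have Tg: "T g = \<i> * T (\<lambda>X. complex_of_real (Im (g X))) + T (\<lambda>X. complex_of_real (Re (g X)))"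
    if "comp_distr T" for T :: "(real^'n^'k \<Rightarrow> complex) \<Rightarrow> complex"
    using comp_distr_linear[OF that smooth_fun_of_real[OF im] smooth_fun_of_real[OF re], of \<i>] by simp
  show ?thesis using Tg[OF T(1)] Tg[OF T(2)] realcase[OF re] realcase[OF im] by simp
qed

text \<open>Agreement outside the smooth functions comes from the default value 0 in
  \<open>is_GW\<close>; without it the \<open>THE\<close> in \<open>GW\<close> would not pick out a
  function.\<close>

lemma is_GW_unique:
  assumes "is_GW \<mu> T1" "is_GW \<mu> T2" shows "T1 = T2"
proof
  fix g
  show "T1 g = T2 g"
    using assms comp_distr_eqI[of T1 T2 g] unfolding is_GW_def by (cases "smooth_fun g") auto
qed

lemma GW_eq: "is_GW \<mu> T \<Longrightarrow> GW \<mu> = T"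
  unfolding GW_def using is_GW_unique by blast

section \<open>Radon functionals\<close>

instance bcontfun :: (metric_space, banach) banach ..

text \<open>A gliding hump argument without Baire category. If the operator norms exceed
  \<open>4 ^ n\<close> along a sequence, a series with terms of norm \<open>(1/3) ^ n\<close> is
  built whose \<open>n\<close>-th term makes the value under the \<open>n\<close>-th operator large,
  while the later terms are too small to undo this.\<close>

theorem banach_steinhaus:
  fixes T :: "'i \<Rightarrow> 'a::banach \<Rightarrow> 'b::real_normed_vector"
  assumes T: "\<And>i. bounded_linear (T i)"
    and bd: "\<And>x. \<exists>c. \<forall>i. norm (T i x) \<le> c"
  obtains M where "\<And>i x. norm (T i x) \<le> M * norm x"
proof -
  have "\<exists>M. \<forall>i. onorm (T i) \<le> M"
  proof (rule ccontr)
    assume "\<nexists>M. \<forall>i. onorm (T i) \<le> M"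
    then have "\<exists>i. onorm (T i) > 4 ^ n" for n :: nat by (meson not_le)
    then obtain s where s: "\<And>n. onorm (T (s n)) > 4 ^ n" by metis
    \<comment> \<open>The factor \<open>3/4\<close> has to exceed \<open>1/2\<close>, because the
      terms after the \<open>n\<close>-th have total norm at most \<open>(1/3) ^ n / 2\<close>; a
      quarter is left over.\<close>
    have "\<exists>v. norm v = (1/3) ^ n \<and> norm (T (s n) v) \<ge> 3/4 * (1/3) ^ n * onorm (T (s n))" for n
    proof -
      let ?N = "onorm (T (s n))"
      have N: "?N > 0" using s[of n] zero_less_power[of "4::real" n] by linarith
      have "\<not> (\<forall>u. norm (T (s n) u) \<le> 3/4 * ?N * norm u)"
        using onorm_bound[of "3/4 * ?N" "T (s n)"] N by force
      then obtain u where u: "norm (T (s n) u) > 3/4 * ?N * norm u" by (meson not_le)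
      then have u0: "norm u > 0" using linear_0[OF bounded_linear.linear[OF T[of "s n"]]] by fastforce
      define v where "v = ((1/3) ^ n / norm u) *\<^sub>R u"
      have "norm (T (s n) v) = (1/3) ^ n / norm u * norm (T (s n) u)"
        unfolding v_def using linear_cmul[OF bounded_linear.linear[OF T[of "s n"]]] by simp
      also have "\<dots> \<ge> (1/3) ^ n / norm u * (3/4 * ?N * norm u)"
        using u by (intro mult_left_mono) auto
      finally have "norm (T (s n) v) \<ge> 3/4 * (1/3) ^ n * ?N" using u0 by simp
      moreover have "norm v = (1/3) ^ n" unfolding v_def using u0 by simp
      ultimately show ?thesis by blast
    qed
    then obtain v where v: "\<And>n. norm (v n) = (1/3) ^ n" "\<And>n. norm (T (s n) (v n)) \<ge> 3/4 * (1/3) ^ n * onorm (T (s n))"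
      by metis
    \<comment> \<open>The operator maps the difference of \<open>x + v n\<close> and
      \<open>x - v n\<close> to twice the image of \<open>v n\<close>, so at least one of the two
      signs does not decrease the norm below that of the image of \<open>v n\<close>.\<close>
    define w where "w = (\<lambda>n x. if norm (T (s n) (x + v n)) \<ge> norm (T (s n) (v n)) then v n else - v n)"
    have w: "norm (w n x) = (1/3) ^ n" "norm (T (s n) (x + w n x)) \<ge> norm (T (s n) (v n))" for n x
    proof -
      interpret l: bounded_linear "T (s n)" by (rule T)
      show "norm (w n x) = (1/3) ^ n" by (simp add: w_def v)
      have "2 * norm (T (s n) (v n)) = norm (T (s n) (x + v n) - T (s n) (x - v n))"
        by (simp add: l.add l.diff scaleR_2[symmetric])
      also have "\<dots> \<le> norm (T (s n) (x + v n)) + norm (T (s n) (x - v n))" by (rule norm_triangle_ineq4)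
      finally show "norm (T (s n) (x + w n x)) \<ge> norm (T (s n) (v n))" by (auto simp: w_def)
    qed
    define X where "X = rec_nat 0 (\<lambda>n x. x + w n x)"
    have X: "X 0 = 0" "\<And>n. X (Suc n) = X n + w n (X n)" by (simp_all add: X_def)
    define d where "d = (\<lambda>n. w n (X n))"
    have d: "norm (d n) = (1/3) ^ n" for n by (simp add: d_def w)
    have Xs: "X n = (\<Sum>k<n. d k)" for n by (induction n) (auto simp: X d_def)
    have sn: "summable (\<lambda>n. norm (d n))" unfolding d by (rule summable_geometric) simp
    then have sd: "summable d" by (rule summable_norm_cancel)
    define x where "x = suminf d"
    have tail: "norm (x - X (Suc n)) \<le> (1/3) ^ n / 2" for n
    proof -
      have "x - X (Suc n) = (\<Sum>k. d (k + Suc n))"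
        unfolding x_def Xs using suminf_minus_initial_segment[OF sd, of "Suc n"] by simp
      moreover have "norm (\<Sum>k. d (k + Suc n)) \<le> (\<Sum>k. norm (d (k + Suc n)))"
        by (rule summable_norm) (use summable_ignore_initial_segment[OF sn, of "Suc n"] in simp)
      moreover have "(\<Sum>k. norm (d (k + Suc n))) = (\<Sum>k. (1/3) ^ Suc n * (1/3) ^ k)"
        by (simp add: d power_add mult_ac)
      moreover have "\<dots> = (1/3) ^ Suc n * (\<Sum>k. (1/3) ^ k)"
        by (rule suminf_mult) (rule summable_geometric, simp)
      moreover have "(\<Sum>k. (1/3::real) ^ k) = 3/2" by (subst suminf_geometric) auto
      ultimately show ?thesis by simp
    qed
    have low: "norm (T (s n) x) \<ge> (4/3) ^ n / 4" for n
    proof -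
      interpret l: bounded_linear "T (s n)" by (rule T)
      let ?N = "onorm (T (s n))"
      have "norm (T (s n) (X (Suc n))) \<ge> 3/4 * (1/3) ^ n * ?N"
        using v(2)[of n] w(2)[of n "X n"] by (simp add: X)
      moreover have "norm (T (s n) (x - X (Suc n))) \<le> ?N * ((1/3) ^ n / 2)"
        using onorm[OF T[of "s n"], of "x - X (Suc n)"] tail[of n] s[of n] onorm_pos_le[OF T[of "s n"]]
        by (meson mult_left_mono order_trans)
      moreover have "norm (T (s n) (X (Suc n))) \<le> norm (T (s n) x) + norm (T (s n) (x - X (Suc n)))"
        using norm_triangle_ineq4[of "T (s n) x" "T (s n) (x - X (Suc n))"] by (simp add: l.diff)
      ultimately have "norm (T (s n) x) \<ge> (1/3) ^ n * ?N / 4" by (simp add: algebra_simps)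
      moreover have "(1/3) ^ n * ?N \<ge> (1/3) ^ n * 4 ^ n" using s[of n] by (intro mult_left_mono) auto
      moreover have "(1/3) ^ n * 4 ^ n = (4/3 :: real) ^ n" by (simp add: power_mult_distrib[symmetric])
      ultimately show ?thesis by linarith
    qed
    obtain c where c: "\<And>i. norm (T i x) \<le> c" using bd by blast
    obtain n where "(4/3 :: real) ^ n > 4 * c" using real_arch_pow[of "4/3" "4 * c"] by auto
    then show False using low[of n] c[of "s n"] by linarith
  qed
  then obtain M where M: "\<And>i. onorm (T i) \<le> M" by blast
  show thesis
  proof (rule that)
    fix i x
    have "norm (T i x) \<le> onorm (T i) * norm x" by (rule onorm[OF T])
    also have "\<dots> \<le> M * norm x" using M by (intro mult_right_mono) auto
    finally show "norm (T i x) \<le> M * norm x" .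
  qed
qed

section \<open>Compactly supported continuous functions and functionals on them\<close>

lemma Cc_support:
  assumes "Cc \<phi>" obtains R where "R > 0" "{x. \<phi> x \<noteq> 0} \<subseteq> cball 0 R"
  using assms unfolding Cc_def bounded_pos by (auto simp: subset_iff)

lemma Cc_vanish: "{x. \<phi> x \<noteq> 0} \<subseteq> S \<Longrightarrow> x \<notin> S \<Longrightarrow> \<phi> x = 0" by blast

lemma CcI: "continuous_on UNIV \<phi> \<Longrightarrow> {x. \<phi> x \<noteq> 0} \<subseteq> cball 0 R \<Longrightarrow> Cc \<phi>"
  unfolding Cc_def using bounded_cball bounded_subset by blast

lemma Cc_continuous: "Cc \<phi> \<Longrightarrow> continuous_on S \<phi>"
  unfolding Cc_def using continuous_on_subset by blast

lemma Cc_bounded: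
  assumes "Cc \<phi>" obtains B where "B > 0" "\<And>x. \<bar>\<phi> x\<bar> \<le> B"
proof -
  obtain R where R: "R > 0" "{x. \<phi> x \<noteq> 0} \<subseteq> cball 0 R" by (rule Cc_support[OF assms])
  have "compact (\<phi> ` cball 0 R)"
    by (rule compact_continuous_image[OF Cc_continuous[OF assms] compact_cball])
  then obtain B where B: "B > 0" "\<And>x. x \<in> cball 0 R \<Longrightarrow> \<bar>\<phi> x\<bar> \<le> B"
    using compact_imp_bounded bounded_pos by (metis imageI real_norm_def)
  have "\<bar>\<phi> x\<bar> \<le> B" for x
    using B Cc_vanish[OF R(2), of x] by (cases "x \<in> cball 0 R") auto
  then show thesis using that B(1) by blast
qed

lemma Cc_zero [simp]: "Cc (\<lambda>x. 0)" by (simp add: Cc_def)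

lemma Cc_add: assumes "Cc \<phi>" "Cc \<psi>" shows "Cc (\<lambda>x. \<phi> x + \<psi> x)"
proof -
  have "{x. \<phi> x + \<psi> x \<noteq> 0} \<subseteq> {x. \<phi> x \<noteq> 0} \<union> {x. \<psi> x \<noteq> 0}" by auto
  then show ?thesis using assms unfolding Cc_def
    by (auto intro: continuous_intros bounded_subset bounded_Un[THEN iffD2])
qed

lemma Cc_cmult: assumes "Cc \<phi>" shows "Cc (\<lambda>x. a * \<phi> x)"
proof -
  have "{x. a * \<phi> x \<noteq> 0} \<subseteq> {x. \<phi> x \<noteq> 0}" by auto
  then show ?thesis using assms unfolding Cc_def
    by (auto intro: continuous_intros bounded_subset)
qed

lemma Cc_mult: assumes "Cc \<phi>" "continuous_on UNIV \<psi>" shows "Cc (\<lambda>x. \<phi> x * \<psi> x)"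
proof -
  have "{x. \<phi> x * \<psi> x \<noteq> 0} \<subseteq> {x. \<phi> x \<noteq> 0}" by auto
  then show ?thesis using assms unfolding Cc_def
    by (auto intro: continuous_intros bounded_subset)
qed

lemma Cc_diff: "Cc \<phi> \<Longrightarrow> Cc \<psi> \<Longrightarrow> Cc (\<lambda>x. \<phi> x - \<psi> x)"
  using Cc_add[of \<phi> "\<lambda>x. -1 * \<psi> x"] Cc_cmult[of \<psi> "-1"] by simp

lemma Cc_translate: assumes "Cc \<phi>" shows "Cc (\<lambda>x. \<phi> (x + y))"
proof -
  obtain R where R: "R > 0" "{x. \<phi> x \<noteq> 0} \<subseteq> cball 0 R" by (rule Cc_support[OF assms])
  have "continuous_on UNIV (\<lambda>x. \<phi> (x + y))"
    by (rule continuous_on_compose2[OF Cc_continuous[OF assms, of UNIV]]) (auto intro: continuous_intros)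
  moreover have "{x. \<phi> (x + y) \<noteq> 0} \<subseteq> cball 0 (R + norm y)"
  proof
    fix x assume "x \<in> {x. \<phi> (x + y) \<noteq> 0}"
    then have "norm (x + y) \<le> R" using R(2) by auto
    then show "x \<in> cball 0 (R + norm y)" using norm_triangle_ineq4[of "x + y" y] by simp
  qed
  ultimately show ?thesis by (rule CcI)
qed

lemma Cc_sum: "(\<And>i. i \<in> I \<Longrightarrow> Cc (f i)) \<Longrightarrow> Cc (\<lambda>x. \<Sum>i\<in>I. f i x)"
  by (induction I rule: infinite_finite_induct) (simp_all add: Cc_add)

lemma radon_linear:
  "radon_functional L \<Longrightarrow> Cc \<phi> \<Longrightarrow> Cc \<psi> \<Longrightarrow> L (\<lambda>x. a * \<phi> x + b * \<psi> x) = of_real a * L \<phi> + of_real b * L \<psi>"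
  unfolding radon_functional_def by blast

lemma radon_add: "radon_functional L \<Longrightarrow> Cc \<phi> \<Longrightarrow> Cc \<psi> \<Longrightarrow> L (\<lambda>x. \<phi> x + \<psi> x) = L \<phi> + L \<psi>"
  using radon_linear[of L \<phi> \<psi> 1 1] by simp

lemma radon_diff: "radon_functional L \<Longrightarrow> Cc \<phi> \<Longrightarrow> Cc \<psi> \<Longrightarrow> L (\<lambda>x. \<phi> x - \<psi> x) = L \<phi> - L \<psi>"
  using radon_linear[of L \<phi> \<psi> 1 "-1"] by simp

lemma radon_cmult: "radon_functional L \<Longrightarrow> Cc \<phi> \<Longrightarrow> L (\<lambda>x. a * \<phi> x) = of_real a * L \<phi>"
  using radon_linear[of L \<phi> \<phi> a 0] by simp

lemma radon_zero: "radon_functional L \<Longrightarrow> L (\<lambda>x. 0) = 0"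
  using radon_cmult[of L "\<lambda>x. 0" 0] by simp

lemma radon_sum:
  assumes L: "radon_functional L"
  shows "finite I \<Longrightarrow> (\<And>i. i \<in> I \<Longrightarrow> Cc (f i)) \<Longrightarrow> L (\<lambda>x. \<Sum>i\<in>I. f i x) = (\<Sum>i\<in>I. L (f i))"
proof (induction I rule: finite_induct)
  case (insert i I)
  have "L (\<lambda>x. f i x + (\<Sum>i\<in>I. f i x)) = L (f i) + L (\<lambda>x. \<Sum>i\<in>I. f i x)"
    using insert by (intro radon_add[OF L] Cc_sum) auto
  then show ?case using insert by simp
qed (simp add: radon_zero[OF L])

lemma radon_bound:
  fixes L :: "(real^'n \<Rightarrow> real) \<Rightarrow> complex"
  assumes "radon_functional L"
  obtains C where "C \<ge> 0" "\<And>\<phi> B. Cc \<phi> \<Longrightarrow> {x. \<phi> x \<noteq> 0} \<subseteq> cball 0 R \<Longrightarrow> (\<And>x. \<bar>\<phi> x\<bar> \<le> B) \<Longrightarrow> norm (L \<phi>) \<le> C * B"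
proof -
  obtain C where C: "\<And>\<phi> B. Cc \<phi> \<Longrightarrow> {x. \<phi> x \<noteq> 0} \<subseteq> cball 0 R \<Longrightarrow> (\<forall>x. \<bar>\<phi> x\<bar> \<le> B) \<Longrightarrow> norm (L \<phi>) \<le> C * B"
    using assms[unfolded radon_functional_def, THEN conjunct2, rule_format, OF compact_cball[of 0 R]] by blast
  show thesis
  proof (rule that[of "max C 0"])
    fix \<phi> :: "real^'n \<Rightarrow> real" and B assume *: "Cc \<phi>" "{x. \<phi> x \<noteq> 0} \<subseteq> cball 0 R" "\<And>x. \<bar>\<phi> x\<bar> \<le> B"
    have "B \<ge> 0" using *(3)[of 0] by linarith
    have "norm (L \<phi>) \<le> C * B" using C * by blast
    also have "\<dots> \<le> max C 0 * B" using \<open>B \<ge> 0\<close> by (intro mult_right_mono) auto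
    finally show "norm (L \<phi>) \<le> max C 0 * B" .
  qed simp
qed

section \<open>Radon functionals as bounded operators\<close>

definition cutoff :: "real \<Rightarrow> real^'n \<Rightarrow> real" where
  "cutoff R x = max 0 (min 1 (R + 1 - norm x))"

lemma cutoff_Cc [simp]: "Cc (cutoff R)"
proof (rule CcI[of _ "R + 1"])
  show "continuous_on UNIV (cutoff R)" unfolding cutoff_def by (intro continuous_intros)
qed (auto simp: cutoff_def max_def min_def split: if_splits)

lemma cutoff_bounds: "0 \<le> cutoff R x" "cutoff R x \<le> 1" by (auto simp: cutoff_def)
lemma cutoff_eq_1: "norm x \<le> R \<Longrightarrow> cutoff R x = 1" by (auto simp: cutoff_def)
lemma cutoff_support: "{x. cutoff R x \<noteq> 0} \<subseteq> cball 0 (R + 1)"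
  by (auto simp: cutoff_def max_def min_def split: if_splits)

text \<open>Bounded continuous functions form a Banach space, on which the uniform boundedness principle and
  vector-valued integration are available.\<close>
definition cut_functional :: "real \<Rightarrow> ((real^'n \<Rightarrow> real) \<Rightarrow> complex) \<Rightarrow> ((real^'n) \<Rightarrow>\<^sub>C real) \<Rightarrow> complex" where
  "cut_functional R L u = L (\<lambda>x. cutoff R x * apply_bcontfun u x)"

lemma cut_functional_bounded_linear:
  fixes L :: "(real^'n \<Rightarrow> real) \<Rightarrow> complex"
  assumes L: "radon_functional L"
  shows "bounded_linear (cut_functional R L)"
proof -
  obtain C where C: "C \<ge> 0" "\<And>\<phi> B. Cc \<phi> \<Longrightarrow> {x. \<phi> x \<noteq> 0} \<subseteq> cball 0 (R + 1) \<Longrightarrow> (\<And>x. \<bar>\<phi> x\<bar> \<le> B) \<Longrightarrow> norm (L \<phi>) \<le> C * B"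
    by (rule radon_bound[OF L]) blast
  have cc: "Cc (\<lambda>x. cutoff R x * apply_bcontfun u x)" for u
    by (rule Cc_mult) auto
  show ?thesis
  proof (rule bounded_linear_intro[where K = C])
    fix u v :: "(real^'n) \<Rightarrow>\<^sub>C real" and r :: real
    have "(\<lambda>x. cutoff R x * apply_bcontfun (u + v) x) = (\<lambda>x. cutoff R x * apply_bcontfun u x + cutoff R x * apply_bcontfun v x)"
      by (simp add: distrib_left)
    then show "cut_functional R L (u + v) = cut_functional R L u + cut_functional R L v"
      unfolding cut_functional_def using radon_add[OF L cc cc] by simp
    have "(\<lambda>x. cutoff R x * apply_bcontfun (r *\<^sub>R u) x) = (\<lambda>x. r * (cutoff R x * apply_bcontfun u x))"
      by (simp add: mult_ac)
    then show "cut_functional R L (r *\<^sub>R u) = r *\<^sub>R cut_functional R L u"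
      unfolding cut_functional_def using radon_cmult[OF L cc] by (simp add: scaleR_conv_of_real)
    have "norm (cut_functional R L u) \<le> C * norm u"
      unfolding cut_functional_def
    proof (rule C(2)[OF cc])
      show "{x. cutoff R x * apply_bcontfun u x \<noteq> 0} \<subseteq> cball 0 (R + 1)"
        using cutoff_support[of R] by auto
      fix x
      have "\<bar>cutoff R x * apply_bcontfun u x\<bar> \<le> 1 * norm u"
        unfolding abs_mult using cutoff_bounds[of R x] norm_bounded[of u x] by (intro mult_mono) auto
      then show "\<bar>cutoff R x * apply_bcontfun u x\<bar> \<le> norm u" by simp
    qed
    then show "norm (cut_functional R L u) \<le> norm u * C" by (simp add: mult.commute)
  qed
qed

lemma cut_functional_eq:
  assumes "{x. apply_bcontfun u x \<noteq> 0} \<subseteq> cball 0 R"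
  shows "cut_functional R L u = L (apply_bcontfun u)"
proof -
  have "(\<lambda>x. cutoff R x * apply_bcontfun u x) = apply_bcontfun u"
    using assms cutoff_eq_1[of _ R] by (auto simp: fun_eq_iff subset_iff)
  then show ?thesis by (simp add: cut_functional_def)
qed

lemma Cc_bcontfun:
  assumes "Cc \<phi>" shows "apply_bcontfun (Bcontfun \<phi>) = \<phi>"
proof (rule Bcontfun_inverse)
  obtain B where "\<And>x. \<bar>\<phi> x\<bar> \<le> B" by (rule Cc_bounded[OF assms]) blast
  then show "\<phi> \<in> bcontfun"
    unfolding bcontfun_def using Cc_continuous[OF assms] by (auto simp: bounded_iff)
qed

text \<open>A Radon functional need not be bounded on all of \<open>Cc\<close>. After multiplication
  by a cutoff it acts as a bounded operator on bounded continuous functions, where the uniform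
  boundedness principle applies.\<close>

lemma radon_uniform_boundedness:
  fixes Ls :: "'i \<Rightarrow> (real^'n \<Rightarrow> real) \<Rightarrow> complex"
  assumes L: "\<And>i. radon_functional (Ls i)"
    and bd: "\<And>\<psi>. Cc \<psi> \<Longrightarrow> \<exists>c. \<forall>i. norm (Ls i \<psi>) \<le> c"
  obtains M where "\<And>i \<psi> B. Cc \<psi> \<Longrightarrow> {x. \<psi> x \<noteq> 0} \<subseteq> cball 0 R \<Longrightarrow> (\<And>x. \<bar>\<psi> x\<bar> \<le> B) \<Longrightarrow> norm (Ls i \<psi>) \<le> M * B"
proof -
  have "\<exists>c. \<forall>i. norm (cut_functional R (Ls i) u) \<le> c" for u
    unfolding cut_functional_def by (rule bd, rule Cc_mult) auto
  then obtain M0 where M0: "\<And>i u. norm (cut_functional R (Ls i) u) \<le> M0 * norm u"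
    using banach_steinhaus[of "\<lambda>i. cut_functional R (Ls i)"] cut_functional_bounded_linear[OF L] by metis
  define M where "M = max M0 0"
  have M: "norm (cut_functional R (Ls i) u) \<le> M * norm u" for i u
    using M0[of i u] mult_right_mono[of M0 M "norm u"] by (simp add: M_def)
  show thesis
  proof (rule that)
    fix i and \<psi> :: "real^'n \<Rightarrow> real" and B assume \<psi>: "Cc \<psi>" "{x. \<psi> x \<noteq> 0} \<subseteq> cball 0 R" "\<And>x. \<bar>\<psi> x\<bar> \<le> B"
    have "norm (Bcontfun \<psi>) \<le> B"
      by (rule norm_bound) (simp add: Cc_bcontfun \<psi>)
    then have "M * norm (Bcontfun \<psi>) \<le> M * B" by (intro mult_left_mono) (auto simp: M_def)
    moreover have "cut_functional R (Ls i) (Bcontfun \<psi>) = Ls i \<psi>"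
      using cut_functional_eq[of "Bcontfun \<psi>" R "Ls i"] \<psi> by (simp add: Cc_bcontfun)
    ultimately show "norm (Ls i \<psi>) \<le> M * B" using M[of i "Bcontfun \<psi>"] by simp
  qed
qed

lemma Cc_uniformly_continuous:
  fixes \<psi> :: "real^'n \<Rightarrow> real"
  assumes \<psi>: "Cc \<psi>" and e: "e > 0"
  obtains d where "d > 0" "\<And>x x'. dist x x' < d \<Longrightarrow> dist (\<psi> x) (\<psi> x') < e"
proof -
  obtain R where R: "R > 0" "{x. \<psi> x \<noteq> 0} \<subseteq> cball 0 R" by (rule Cc_support[OF \<psi>])
  have "uniformly_continuous_on (cball 0 (R + 1)) \<psi>"
    by (rule compact_uniformly_continuous[OF Cc_continuous[OF \<psi>] compact_cball])
  then obtain d where d: "d > 0" "\<And>x x'. x \<in> cball 0 (R + 1) \<Longrightarrow> x' \<in> cball 0 (R + 1) \<Longrightarrow> dist x' x < d \<Longrightarrow> dist (\<psi> x') (\<psi> x) < e"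
    using e unfolding uniformly_continuous_on_def by blast
  show thesis
  proof (rule that[of "min d 1"])
    fix x x' :: "real^'n" assume xx: "dist x x' < min d 1"
    show "dist (\<psi> x) (\<psi> x') < e"
    proof (cases "x \<in> cball 0 (R + 1) \<and> x' \<in> cball 0 (R + 1)")
      case True then show ?thesis using d(2)[of x' x] xx by simp
    next
      case False
      then have "x \<notin> cball 0 R \<and> x' \<notin> cball 0 R"
        using xx norm_triangle_ineq2[of x x'] norm_triangle_ineq2[of x' x] by (auto simp: dist_norm norm_minus_commute)
      then have "\<psi> x = 0" "\<psi> x' = 0" using R(2) by blast+
      then show ?thesis using e by simp
    qed
  qed (use d in auto)
qed

section \<open>Lebesgue integrals and convolution\<close>

lemma lborel_integral_cbox:
  fixes f :: "'a::euclidean_space \<Rightarrow> 'b::euclidean_space"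
  assumes c: "continuous_on (cbox a b) f" and z: "\<And>x. x \<notin> cbox a b \<Longrightarrow> f x = 0"
  shows "integrable lborel f" "integral (cbox a b) f = (LINT x|lborel. f x)"
proof -
  have eq: "(\<lambda>x. indicator (cbox a b) x *\<^sub>R f x) = f"
    using z by (auto simp: fun_eq_iff indicator_def)
  have "integrable lborel (\<lambda>x. indicator (cbox a b) x *\<^sub>R f x)"
    by (rule borel_integrable_compact[OF compact_cbox c])
  then show "integrable lborel f" unfolding eq .
  then have "set_integrable lborel (cbox a b) f" unfolding set_integrable_def eq .
  from set_borel_integral_eq_integral(2)[OF this]
  show "integral (cbox a b) f = (LINT x|lborel. f x)"
    unfolding set_lebesgue_integral_def eq by simp
qed

lemma Cc_integrable: assumes "Cc \<phi>" shows "integrable lborel \<phi>"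
proof -
  obtain a where a: "{x. \<phi> x \<noteq> 0} \<subseteq> cbox (- a) a"
    using bounded_subset_cbox_symmetric assms unfolding Cc_def by metis
  then show ?thesis using lborel_integral_cbox(1)[OF Cc_continuous[OF assms], of "-a" a] by blast
qed

lemma continuous_Cc_integrable:
  fixes g :: "real^'n \<Rightarrow> complex"
  assumes "Cc \<phi>" and g: "continuous_on UNIV g"
  shows "integrable lborel (\<lambda>x. complex_of_real (\<phi> x) * g x)"
proof -
  obtain a where a: "{x. \<phi> x \<noteq> 0} \<subseteq> cbox (- a) a"
    using bounded_subset_cbox_symmetric assms unfolding Cc_def by metis
  have "continuous_on (cbox (-a) a) (\<lambda>x. complex_of_real (\<phi> x) * g x)"
    using g by (intro continuous_intros Cc_continuous assms(1)) (auto intro: continuous_on_subset)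
  then show ?thesis by (rule lborel_integral_cbox(1)) (use a in auto)
qed

lemma apply_bcontfun_bounded_linear:
  "bounded_linear (\<lambda>u :: ('a::topological_space) \<Rightarrow>\<^sub>C ('b::real_normed_vector). apply_bcontfun u x)"
  by (rule bounded_linear_intro[where K = 1]) (auto simp: norm_bounded)

text \<open>The convolution is the integral of the translates of \<open>\<psi>\<close> as elements
  of the Banach space of bounded continuous functions. Bounded linear maps commute with that
  integral: evaluation at \<open>x\<close> identifies it pointwise, and
  \<open>cut_functional R L\<close> gives the exchange with \<open>L\<close>.\<close>

lemma radon_convolution:
  fixes L :: "(real^'n \<Rightarrow> real) \<Rightarrow> complex"
  assumes L: "radon_functional L" and \<phi>: "Cc \<phi>" and \<psi>: "Cc \<psi>"
  shows "L (\<lambda>x. LINT y|lborel. \<phi> y * \<psi> (x - y)) = (LINT y|lborel. complex_of_real (\<phi> y) * L (\<lambda>x. \<psi> (x - y)))" (is ?A)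
    and "integrable lborel (\<lambda>y. complex_of_real (\<phi> y) * L (\<lambda>x. \<psi> (x - y)))" (is ?B)
    and "Cc (\<lambda>x. LINT y|lborel. \<phi> y * \<psi> (x - y))" (is ?Conv)
proof -
  obtain R1 where R1: "R1 > 0" "{x. \<phi> x \<noteq> 0} \<subseteq> cball 0 R1" by (rule Cc_support[OF \<phi>])
  obtain R2 where R2: "R2 > 0" "{x. \<psi> x \<noteq> 0} \<subseteq> cball 0 R2" by (rule Cc_support[OF \<psi>])
  define R where "R = R1 + R2"
  obtain a :: "real^'n" where a: "cball 0 R1 \<subseteq> cbox (- a) a"
    using bounded_subset_cbox_symmetric[OF bounded_cball] by metis
  let ?C = "cbox (- a) a"
  have tr: "Cc (\<lambda>x. \<psi> (x - y))" for y using Cc_translate[OF \<psi>, of "- y"] by simp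
  define bc where "bc = (\<lambda>y. Bcontfun (\<lambda>x. \<psi> (x - y)))"
  have bc: "apply_bcontfun (bc y) x = \<psi> (x - y)" for x y
    unfolding bc_def Cc_bcontfun[OF tr] ..
  define F where "F = (\<lambda>y. \<phi> y *\<^sub>R bc y)"
  have cbc: "continuous_on ?C bc"
    unfolding continuous_on_iff
  proof (intro ballI allI impI)
    fix x :: "real^'n" and e :: real assume "e > 0"
    then obtain d where d: "d > 0" "\<And>x x'. dist x x' < d \<Longrightarrow> dist (\<psi> x) (\<psi> x') < e / 2"
      using Cc_uniformly_continuous[OF \<psi>, of "e/2"] by (metis half_gt_zero)
    show "\<exists>d>0. \<forall>x'\<in>?C. dist x' x < d \<longrightarrow> dist (bc x') (bc x) < e"
    proof (intro exI[of _ d] conjI ballI impI d)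
      fix x' assume "dist x' x < d"
      then have "dist (\<psi> (z - x')) (\<psi> (z - x)) \<le> e / 2" for z
        using d(2)[of "z - x'" "z - x"] by (simp add: dist_norm norm_minus_commute less_imp_le)
      then have "dist (bc x') (bc x) \<le> e / 2" by (intro dist_bound) (simp add: bc)
      then show "dist (bc x') (bc x) < e" using \<open>e > 0\<close> by simp
    qed
  qed
  have cF: "continuous_on ?C F" unfolding F_def
    by (intro continuous_on_scaleR cbc Cc_continuous[OF \<phi>])
  then have iF: "F integrable_on ?C" by (rule integrable_continuous)
  define u where "u = integral ?C F"
  have u: "apply_bcontfun u x = (LINT y|lborel. \<phi> y * \<psi> (x - y))" for x
  proof -
    have "apply_bcontfun u x = integral ?C ((\<lambda>w. apply_bcontfun w x) \<circ> F)"
      unfolding u_def by (rule integral_linear[OF iF apply_bcontfun_bounded_linear, symmetric])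
    also have "(\<lambda>w. apply_bcontfun w x) \<circ> F = (\<lambda>y. \<phi> y * \<psi> (x - y))"
      by (auto simp: F_def bc comp_def)
    also have "integral ?C \<dots> = (LINT y|lborel. \<phi> y * \<psi> (x - y))"
    proof (rule lborel_integral_cbox(2))
      have "continuous_on UNIV (\<lambda>y. \<psi> (x - y))"
        by (rule continuous_on_compose2[OF Cc_continuous[OF \<psi>, of UNIV]]) (auto intro: continuous_intros)
      then show "continuous_on ?C (\<lambda>y. \<phi> y * \<psi> (x - y))"
        by (intro continuous_on_mult Cc_continuous[OF \<phi>]) (auto intro: continuous_on_subset)
      show "\<phi> y * \<psi> (x - y) = 0" if "y \<notin> ?C" for y using that a R1(2) by auto
    qed
    finally show ?thesis .
  qed
  have supp: "{x. apply_bcontfun u x \<noteq> 0} \<subseteq> cball 0 R"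
  proof
    fix x assume "x \<in> {x. apply_bcontfun u x \<noteq> 0}"
    then have "(\<lambda>y. \<phi> y * \<psi> (x - y)) \<noteq> (\<lambda>y. 0)" by (auto simp: u)
    then obtain y where "\<phi> y \<noteq> 0" "\<psi> (x - y) \<noteq> 0" by (force simp: fun_eq_iff)
    then have "norm y \<le> R1" "norm (x - y) \<le> R2" using R1(2) R2(2) by auto
    then show "x \<in> cball 0 R" unfolding R_def using norm_triangle_ineq[of y "x - y"] by simp
  qed
  have ue: "apply_bcontfun u = (\<lambda>x. LINT y|lborel. \<phi> y * \<psi> (x - y))" using u by auto
  show ?Conv unfolding ue[symmetric] by (rule CcI[OF _ supp]) simp
  have bl: "bounded_linear (cut_functional R L)" by (rule cut_functional_bounded_linear[OF L])
  have LF: "cut_functional R L \<circ> F = (\<lambda>y. complex_of_real (\<phi> y) * L (\<lambda>x. \<psi> (x - y)))"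
  proof
    fix y
    interpret l: bounded_linear "cut_functional R L" by (rule bl)
    have "(cut_functional R L \<circ> F) y = complex_of_real (\<phi> y) * cut_functional R L (bc y)"
      by (simp add: F_def l.scaleR scaleR_conv_of_real)
    also have "\<dots> = complex_of_real (\<phi> y) * L (\<lambda>x. \<psi> (x - y))"
    proof (cases "\<phi> y = 0")
      case False
      then have y: "norm y \<le> R1" using R1(2) by auto
      have "{x. apply_bcontfun (bc y) x \<noteq> 0} \<subseteq> cball 0 R"
      proof
        fix x assume "x \<in> {x. apply_bcontfun (bc y) x \<noteq> 0}"
        then have "norm (x - y) \<le> R2" using R2(2) by (auto simp: bc)
        then show "x \<in> cball 0 R" unfolding R_def using y norm_triangle_ineq[of y "x - y"] by simp
      qed
      moreover have "apply_bcontfun (bc y) = (\<lambda>x. \<psi> (x - y))" using bc by auto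
      ultimately show ?thesis using cut_functional_eq[of "bc y" R L] by simp
    qed simp
    finally show "(cut_functional R L \<circ> F) y = complex_of_real (\<phi> y) * L (\<lambda>x. \<psi> (x - y))" .
  qed
  have cc: "continuous_on ?C (\<lambda>y. complex_of_real (\<phi> y) * L (\<lambda>x. \<psi> (x - y)))"
    unfolding LF[symmetric] comp_def using cF bounded_linear.continuous_on[OF bl] by blast
  have zz: "complex_of_real (\<phi> y) * L (\<lambda>x. \<psi> (x - y)) = 0" if "y \<notin> ?C" for y
    using that a R1(2) by auto
  show ?B by (rule lborel_integral_cbox(1)[OF cc zz])
  have "L (apply_bcontfun u) = cut_functional R L u" using cut_functional_eq[OF supp] by simp
  also have "\<dots> = integral ?C (cut_functional R L \<circ> F)"
    unfolding u_def by (rule integral_linear[OF iF bl, symmetric])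
  also have "\<dots> = (LINT y|lborel. complex_of_real (\<phi> y) * L (\<lambda>x. \<psi> (x - y)))"
    unfolding LF by (rule lborel_integral_cbox(2)[OF cc zz])
  finally show ?A unfolding ue .
qed

lemma lborel_integral_translate:
  fixes f :: "'a::euclidean_space \<Rightarrow> 'b::{banach,second_countable_topology}"
  assumes "f \<in> borel_measurable borel"
  shows "(LINT x|lborel. f (c + x)) = (LINT x|lborel. f x)"
proof -
  have "(LINT x|lborel. f x) = (LINT x|distr lborel borel ((+) c). f x)" by (simp add: lborel_distr_plus)
  also have "\<dots> = (LINT x|lborel. f (c + x))" by (rule integral_distr) (use assms in auto)
  finally show ?thesis by simp
qed

lemma lborel_integral_scale:
  fixes f :: "'a::euclidean_space \<Rightarrow> real"
  assumes "f \<in> borel_measurable borel" "d > 0"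
  shows "(LINT x|lborel. f x) = d ^ DIM('a) * (LINT x|lborel. f (d *\<^sub>R x))"
proof -
  have "(LINT x|lborel. f x) = (LINT x|density (distr lborel borel (\<lambda>x. 0 + d *\<^sub>R x)) (\<lambda>_. ennreal (\<bar>d\<bar> ^ DIM('a))). f x)"
    using lborel_affine[of d "0::'a"] assms(2) by simp
  also have "\<dots> = (LINT x|distr lborel borel (\<lambda>x. 0 + d *\<^sub>R x). \<bar>d\<bar> ^ DIM('a) *\<^sub>R f x)"
    by (rule integral_density) (use assms in auto)
  also have "\<dots> = (LINT x|lborel. \<bar>d\<bar> ^ DIM('a) *\<^sub>R f (0 + d *\<^sub>R x))"
    by (rule integral_distr) (use assms in auto)
  finally show ?thesis using assms(2) by simp
qed

lemma Cc_integral_pos: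
  assumes \<phi>: "Cc \<phi>" and nn: "\<And>x. 0 \<le> \<phi> x" and pos: "\<phi> x0 > 0"
  shows "(LINT x|lborel. \<phi> x) > 0"
proof (rule ccontr)
  assume "\<not> ?thesis"
  moreover have "(LINT x|lborel. \<phi> x) \<ge> 0" by (rule integral_nonneg_AE) (simp add: nn)
  ultimately have "(LINT x|lborel. \<phi> x) = 0" by linarith
  then have "AE x in lborel. \<phi> x = 0"
    using integral_nonneg_eq_0_iff_AE[OF Cc_integrable[OF \<phi>]] nn by simp
  then obtain N where N: "N \<in> null_sets lborel" "{x. \<phi> x \<noteq> 0} \<subseteq> N"
    by (auto elim!: AE_E simp: null_sets_def)
  have op: "open {x. 0 < \<phi> x}"
    by (rule open_Collect_less) (use Cc_continuous[OF \<phi>] in auto)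
  have "negligible N" using N(1) negligible_iff_null_sets null_sets_completionI by blast
  then have "negligible {x. 0 < \<phi> x}" by (rule negligible_subset) (use N(2) in auto)
  then show False using open_not_negligible[OF op] pos by blast
qed

section \<open>Mollification by rescaled tents\<close>

definition tent :: "real^'n \<Rightarrow> real" where "tent x = max 0 (1 - norm x)"

definition moll :: "real \<Rightarrow> real^'n \<Rightarrow> real" where
  "moll d x = tent ((1 / d) *\<^sub>R x) / (d ^ CARD('n) * (LINT x|lborel. tent (x :: real^'n)))"

lemma tent_Cc: "Cc tent"
proof (rule CcI[of _ 1])
  show "continuous_on UNIV tent" unfolding tent_def by (intro continuous_intros)
qed (auto simp: tent_def max_def split: if_splits)

lemma tent_integral_pos: "(LINT x|lborel. tent (x :: real^'n)) > 0"
  by (rule Cc_integral_pos[OF tent_Cc, of 0]) (auto simp: tent_def)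

lemma moll_continuous: "continuous_on UNIV (moll d)"
  unfolding moll_def tent_def divide_inverse by (intro continuous_intros)

lemma moll_support: "d > 0 \<Longrightarrow> {x. moll d x \<noteq> 0} \<subseteq> cball 0 d"
  by (auto simp: moll_def tent_def max_def field_simps split: if_splits)

lemma moll_Cc: "d > 0 \<Longrightarrow> Cc (moll d)"
  by (rule CcI[OF moll_continuous moll_support])

lemma moll_nonneg: "d > 0 \<Longrightarrow> 0 \<le> moll d (x :: real^'n)"
  unfolding moll_def using tent_integral_pos[where 'n='n] by (auto simp: tent_def intro!: divide_nonneg_nonneg mult_nonneg_nonneg)

text \<open>The height of the mollifier, to be cancelled later by the volume factor of the bound on
  small balls.\<close>

lemma moll_le: 
  assumes "d > 0" shows "moll d (x :: real^'n) \<le> (1 / (LINT x|lborel. tent (x :: real^'n))) / d ^ CARD('n)"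
proof -
  have "tent ((1 / d) *\<^sub>R x) \<le> 1" by (simp add: tent_def)
  then have "tent ((1 / d) *\<^sub>R x) / (d ^ CARD('n) * (LINT x|lborel. tent (x :: real^'n))) \<le> 1 / (d ^ CARD('n) * (LINT x|lborel. tent (x :: real^'n)))"
    using tent_integral_pos[where 'n='n] assms by (intro divide_right_mono) auto
  then show ?thesis by (simp add: moll_def mult.commute)
qed

lemma moll_minus: "moll d (- x) = moll d x" by (simp add: moll_def tent_def)

lemma moll_integral:
  assumes "d > 0" shows "(LINT x|lborel. moll d (x :: real^'n)) = 1"
proof -
  have m: "moll d \<in> borel_measurable borel"
    using moll_continuous borel_measurable_continuous_onI by blast
  have "(LINT x|lborel. moll d (x :: real^'n)) = d ^ DIM(real^'n) * (LINT x|lborel. moll d (d *\<^sub>R (x :: real^'n)))"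
    by (rule lborel_integral_scale[OF m assms])
  also have "(\<lambda>x::real^'n. moll d (d *\<^sub>R x)) = (\<lambda>x. tent x / (d ^ CARD('n) * (LINT x|lborel. tent (x :: real^'n))))"
    using assms by (simp add: moll_def)
  finally show ?thesis using tent_integral_pos[where 'n='n] assms by simp
qed

lemma moll_integral_translate:
  assumes "d > 0" shows "(LINT y|lborel. moll d (x - y :: real^'n)) = 1"
proof -
  have m: "moll d \<in> borel_measurable borel"
    using moll_continuous borel_measurable_continuous_onI by blast
  have "(\<lambda>y. moll d (x - y)) = (\<lambda>y. moll d (- x + y))"
    using moll_minus[of d "x - _"] by (simp add: fun_eq_iff)
  then show ?thesis using lborel_integral_translate[OF m, of "-x"] moll_integral[OF assms] by simp
qed

text \<open>Reduces the value at \<open>\<phi>\<close> to values at bumps of arbitrarily small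
  support, where locality can be exploited. The convolutions converge uniformly to
  \<open>\<phi>\<close> with supports in one fixed ball.\<close>

lemma radon_mollify:
  fixes L :: "(real^'n \<Rightarrow> real) \<Rightarrow> complex"
  assumes L: "radon_functional L" and \<phi>: "Cc \<phi>" and e: "e > 0"
  obtains d0 where "d0 > 0"
    "\<And>d. 0 < d \<Longrightarrow> d < d0 \<Longrightarrow> norm ((LINT y|lborel. complex_of_real (\<phi> y) * L (\<lambda>x. moll d (x - y))) - L \<phi>) \<le> e"
proof -
  obtain R where R: "R > 0" "{x. \<phi> x \<noteq> 0} \<subseteq> cball 0 R" by (rule Cc_support[OF \<phi>])
  obtain C where C: "C \<ge> 0" "\<And>\<phi> B. Cc \<phi> \<Longrightarrow> {x. \<phi> x \<noteq> 0} \<subseteq> cball 0 (R + 1) \<Longrightarrow> (\<And>x. \<bar>\<phi> x\<bar> \<le> B) \<Longrightarrow> norm (L \<phi>) \<le> C * B"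
    by (rule radon_bound[OF L]) blast
  define e' where "e' = e / (C + 1)"
  have e': "e' > 0" using e C(1) by (simp add: e'_def)
  obtain d where d: "d > 0" "\<And>x x'. dist x x' < d \<Longrightarrow> dist (\<phi> x) (\<phi> x') < e'"
    by (rule Cc_uniformly_continuous[OF \<phi> e']) blast
  show thesis
  proof (rule that[of "min d 1"])
    fix \<delta> assume \<delta>: "0 < \<delta>" "\<delta> < min d 1"
    let ?c = "\<lambda>x. LINT y|lborel. \<phi> y * moll \<delta> (x - y)"
    note conv = radon_convolution[OF L \<phi> moll_Cc[OF \<delta>(1)]]
    have mc: "Cc (\<lambda>y. moll \<delta> (x - y))" for x :: "real^'n"
    proof -
      have "(\<lambda>y. moll \<delta> (x - y)) = (\<lambda>y. moll \<delta> (y + - x))"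
        using moll_minus[of \<delta>] by (metis add_uminus_conv_diff minus_diff_eq)
      then show ?thesis using Cc_translate[OF moll_Cc[OF \<delta>(1)], of "-x"] by simp
    qed
    have near: "\<bar>?c x - \<phi> x\<bar> \<le> e'" for x
    proof -
      have "?c x - \<phi> x = (LINT y|lborel. \<phi> y * moll \<delta> (x - y)) - (LINT y|lborel. \<phi> x * moll \<delta> (x - y))"
        using moll_integral_translate[OF \<delta>(1), of x] by simp
      also have "\<dots> = (LINT y|lborel. \<phi> y * moll \<delta> (x - y) - \<phi> x * moll \<delta> (x - y))"
        using Cc_integrable[OF Cc_mult[OF mc Cc_continuous[OF \<phi>]], of x] Cc_integrable[OF Cc_cmult[OF mc], of "\<phi> x" x]
        by (subst Bochner_Integration.integral_diff) (auto simp: mult.commute)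
      also have "\<bar>\<dots>\<bar> \<le> (LINT y|lborel. \<bar>\<phi> y * moll \<delta> (x - y) - \<phi> x * moll \<delta> (x - y)\<bar>)"
        by (rule integral_abs_bound)
      also have "\<dots> \<le> (LINT y|lborel. e' * moll \<delta> (x - y))"
      proof (rule integral_mono)
        have "Cc (\<lambda>y. moll \<delta> (x - y) * (\<phi> y - \<phi> x))"
          by (rule Cc_mult[OF mc]) (intro continuous_intros Cc_continuous[OF \<phi>])
        then have "integrable lborel (\<lambda>y. moll \<delta> (x - y) * (\<phi> y - \<phi> x))" by (rule Cc_integrable)
        then show "integrable lborel (\<lambda>y. \<bar>\<phi> y * moll \<delta> (x - y) - \<phi> x * moll \<delta> (x - y)\<bar>)"
          by (intro integrable_abs) (simp add: algebra_simps)
        show "integrable lborel (\<lambda>y. e' * moll \<delta> (x - y))" by (rule Cc_integrable[OF Cc_cmult[OF mc]])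
        fix y
        show "\<bar>\<phi> y * moll \<delta> (x - y) - \<phi> x * moll \<delta> (x - y)\<bar> \<le> e' * moll \<delta> (x - y)"
        proof (cases "moll \<delta> (x - y) = 0")
          case False
          then have "norm (x - y) \<le> \<delta>" using moll_support[OF \<delta>(1)] by auto
          then have "dist y x < d" using \<delta> by (simp add: dist_norm norm_minus_commute)
          from d(2)[OF this] have "\<bar>\<phi> y - \<phi> x\<bar> \<le> e'" by (simp add: dist_real_def)
          then have "\<bar>\<phi> y - \<phi> x\<bar> * moll \<delta> (x - y) \<le> e' * moll \<delta> (x - y)"
            using moll_nonneg[OF \<delta>(1)] by (intro mult_right_mono)
          then show ?thesis using moll_nonneg[OF \<delta>(1), of "x - y"] by (simp add: left_diff_distrib[symmetric] abs_mult)
        qed simp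
      qed
      also have "\<dots> = e'" using moll_integral_translate[OF \<delta>(1), of x] by simp
      finally show ?thesis .
    qed
    have supp: "{x. ?c x - \<phi> x \<noteq> 0} \<subseteq> cball 0 (R + 1)"
    proof (rule subsetI, rule ccontr)
      fix x assume x: "x \<in> {x. ?c x - \<phi> x \<noteq> 0}" "x \<notin> cball 0 (R + 1)"
      have "\<phi> x = 0" using x(2) R by auto
      moreover have "\<phi> y * moll \<delta> (x - y) = 0" for y
      proof (rule ccontr)
        assume "\<phi> y * moll \<delta> (x - y) \<noteq> 0"
        then have "norm y \<le> R" "norm (x - y) \<le> \<delta>" using R(2) moll_support[OF \<delta>(1)] by auto
        then show False using x(2) \<delta> norm_triangle_ineq[of y "x - y"] by simp
      qed
      ultimately have "(\<lambda>y. \<phi> y * moll \<delta> (x - y)) = (\<lambda>y. 0)" "\<phi> x = 0" by blast+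
      then show False using x(1) by simp
    qed
    have "L ?c - L \<phi> = L (\<lambda>x. ?c x - \<phi> x)"
      by (rule radon_diff[OF L conv(3) \<phi>, symmetric])
    also have "norm \<dots> \<le> C * e'"
      by (rule C(2)[OF Cc_diff[OF conv(3) \<phi>] supp near])
    also have "\<dots> \<le> e" using e C(1) by (simp add: e'_def field_simps)
    finally show "norm ((LINT y|lborel. complex_of_real (\<phi> y) * L (\<lambda>x. moll \<delta> (x - y))) - L \<phi>) \<le> e"
      unfolding conv(1) .
  qed (use d in auto)
qed

section \<open>Max-affine functions in general position\<close>

text \<open>The point \<open>(x, f x)\<close> is separated from the strict epigraph; the hyperplane
  cannot be vertical because \<open>f\<close> is finite everywhere.\<close>

lemma convex_on_subgradient:
  fixes f :: "'a::euclidean_space \<Rightarrow> real"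
  assumes f: "convex_on UNIV f"
  obtains g where "\<And>y. f y \<ge> f x + g \<bullet> (y - x)"
proof -
  let ?T = "{p. f (fst p) < snd p}"
  have "convex ?T"
  proof (rule convexI)
    fix p q :: "'a \<times> real" and u v :: real
    assume *: "p \<in> ?T" "q \<in> ?T" "0 \<le> u" "0 \<le> v" "u + v = 1"
    have "f (u *\<^sub>R fst p + v *\<^sub>R fst q) \<le> u * f (fst p) + v * f (fst q)"
      using f * unfolding convex_on_def by blast
    also have "\<dots> < u * snd p + v * snd q"
    proof (cases "u = 0")
      case True then show ?thesis using * by simp
    next
      case False
      then have "u * f (fst p) < u * snd p" using * by simp
      moreover have "v * f (fst q) \<le> v * snd q" using * by (intro mult_left_mono) auto
      ultimately show ?thesis by linarith
    qed
    finally show "u *\<^sub>R p + v *\<^sub>R q \<in> ?T" by simp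
  qed
  moreover have "?T \<noteq> {}" by (auto intro!: exI[of _ 0] exI[of _ "f 0 + 1"])
  moreover have "{(x, f x)} \<inter> ?T = {}" by auto
  ultimately obtain a b where ab: "a \<noteq> 0" "a \<bullet> (x, f x) \<le> b" "\<And>p. p \<in> ?T \<Longrightarrow> a \<bullet> p \<ge> b"
    using separating_hyperplane_sets[of "{(x, f x)}" ?T] by auto
  obtain \<alpha> \<beta> where a: "a = (\<alpha>, \<beta>)" by (cases a)
  have key: "\<alpha> \<bullet> x + \<beta> * f x \<le> \<alpha> \<bullet> y + \<beta> * t" if "f y < t" for y t
    using ab(2) ab(3)[of "(y, t)"] that by (simp add: a)
  have "\<beta> \<ge> 0" using key[of x "f x + 1"] by (simp add: algebra_simps)
  \<comment> \<open>A vertical hyperplane is refuted by moving from \<open>x\<close> against its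
    normal \<open>\<alpha>\<close>.\<close>
  moreover have "\<beta> \<noteq> 0"
  proof
    assume "\<beta> = 0"
    then have "\<alpha> \<bullet> \<alpha> \<le> 0" using key[of "x - \<alpha>" "f (x - \<alpha>) + 1"] by (simp add: inner_diff_right)
    then have "\<alpha> = 0" using inner_ge_zero[of \<alpha>] inner_eq_zero_iff[of \<alpha>] by linarith
    then show False using ab(1) a \<open>\<beta> = 0\<close> by (simp add: zero_prod_def)
  qed
  ultimately have \<beta>: "\<beta> > 0" by simp
  show thesis
  proof (rule that[of "- ((1 / \<beta>) *\<^sub>R \<alpha>)"])
    fix y
    have "f x + (- ((1 / \<beta>) *\<^sub>R \<alpha>)) \<bullet> (y - x) \<le> t" if "f y < t" for t
    proof -
      have "\<beta> * (f x + (- ((1 / \<beta>) *\<^sub>R \<alpha>)) \<bullet> (y - x)) \<le> \<beta> * t"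
        using key[OF that] \<beta> by (simp add: algebra_simps inner_diff_right)
      then show ?thesis using \<beta> by simp
    qed
    then show "f x + (- ((1 / \<beta>) *\<^sub>R \<alpha>)) \<bullet> (y - x) \<le> f y" by (rule dense_ge)
  qed
qed

lemma convex_on_continuous_UNIV:
  fixes f :: "'a::euclidean_space \<Rightarrow> real"
  shows "convex_on UNIV f \<Longrightarrow> continuous_on S f"
  using convex_on_continuous[OF open_UNIV] continuous_on_subset by blast

lemma convex_on_inner: "convex_on UNIV (\<lambda>x. a \<bullet> x + c :: real)"
  by (rule convex_onI) (auto simp: inner_add_right algebra_simps)

definition maxaff :: "('a::euclidean_space \<times> real) set \<Rightarrow> 'a \<Rightarrow> real" where
  "maxaff A x = Max ((\<lambda>p. fst p \<bullet> x + snd p) ` A)"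

lemma maxaff_ge: "finite A \<Longrightarrow> p \<in> A \<Longrightarrow> fst p \<bullet> x + snd p \<le> maxaff A x"
  unfolding maxaff_def by (rule Max_ge) auto

lemma maxaff_le: "finite A \<Longrightarrow> A \<noteq> {} \<Longrightarrow> (\<And>p. p \<in> A \<Longrightarrow> fst p \<bullet> x + snd p \<le> t) \<Longrightarrow> maxaff A x \<le> t"
  unfolding maxaff_def by (rule Max.boundedI) auto

lemma maxaff_attained:
  assumes "finite A" "A \<noteq> {}" obtains p where "p \<in> A" "maxaff A x = fst p \<bullet> x + snd p"
proof -
  have "maxaff A x \<in> (\<lambda>p. fst p \<bullet> x + snd p) ` A"
    unfolding maxaff_def using assms by (intro Max_in) auto
  then show thesis using that by blast
qed

lemma maxaff_convex: assumes "finite A" "A \<noteq> {}" shows "convex_on UNIV (maxaff A)"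
proof (rule convex_onI)
  fix t :: real and x y assume t: "0 < t" "t < 1"
  show "maxaff A ((1 - t) *\<^sub>R x + t *\<^sub>R y) \<le> (1 - t) * maxaff A x + t * maxaff A y"
  proof (rule maxaff_le[OF assms])
    fix p assume p: "p \<in> A"
    have "fst p \<bullet> ((1 - t) *\<^sub>R x + t *\<^sub>R y) + snd p = (1 - t) * (fst p \<bullet> x + snd p) + t * (fst p \<bullet> y + snd p)"
      by (simp add: inner_add_right algebra_simps)
    also have "\<dots> \<le> (1 - t) * maxaff A x + t * maxaff A y"
      using t maxaff_ge[OF assms(1) p] by (intro add_mono mult_left_mono) auto
    finally show "fst p \<bullet> ((1 - t) *\<^sub>R x + t *\<^sub>R y) + snd p \<le> (1 - t) * maxaff A x + t * maxaff A y" .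
  qed
qed simp

lemma convex_on_translate:
  fixes f :: "'a::real_vector \<Rightarrow> real"
  assumes "convex_on UNIV f" shows "convex_on UNIV (\<lambda>x. f (x - v))"
proof (rule convex_onI)
  fix t :: real and x y assume t: "0 < t" "t < 1"
  have "(1 - t) *\<^sub>R x + t *\<^sub>R y - v = (1 - t) *\<^sub>R (x - v) + t *\<^sub>R (y - v)" by (simp add: algebra_simps)
  then show "f ((1 - t) *\<^sub>R x + t *\<^sub>R y - v) \<le> (1 - t) * f (x - v) + t * f (y - v)"
    using convex_onD[OF assms, of t "x - v" "y - v"] t by simp
qed simp

text \<open>The supporting planes lie below \<open>f\<close>, and each is close to \<open>f\<close>
  near its base point; by compactness finitely many of them suffice on the ball.\<close>

lemma maxaff_approx:
  fixes f :: "'a::euclidean_space \<Rightarrow> real"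
  assumes f: "convex_on UNIV f" and e: "e > 0" and R: "R > 0"
  obtains A where "finite A" "A \<noteq> {}" "\<And>x. maxaff A x \<le> f x" "\<And>x. x \<in> cball 0 R \<Longrightarrow> f x - e \<le> maxaff A x"
proof -
  have "\<forall>x. \<exists>g. \<forall>y. f y \<ge> f x + g \<bullet> (y - x)"
    using convex_on_subgradient[OF f] by blast
  then obtain g where g: "\<And>x y. f y \<ge> f x + g x \<bullet> (y - x)" by metis
  define p where "p = (\<lambda>y. (g y, f y - g y \<bullet> y))"
  have p: "fst (p y) \<bullet> x + snd (p y) = f y + g y \<bullet> (x - y)" for x y
    by (simp add: p_def inner_diff_right)
  define U where "U = (\<lambda>y. {x. f x - e < fst (p y) \<bullet> x + snd (p y)})"
  have "open (U y)" for y unfolding U_def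
    by (rule open_Collect_less) (auto intro!: continuous_intros convex_on_continuous_UNIV[OF f])
  moreover have "cball 0 R \<subseteq> (\<Union>y\<in>cball 0 R. U y)"
    using e by (auto simp: U_def p)
  ultimately obtain D where D: "D \<subseteq> cball 0 R" "finite D" "cball 0 R \<subseteq> (\<Union>y\<in>D. U y)"
    by (rule compactE_image[OF compact_cball]) auto
  have "0 \<in> (\<Union>y\<in>D. U y)" using D(3) R by (metis centre_in_cball less_imp_le subsetD)
  then have ne: "p ` D \<noteq> {}" by auto
  show thesis
  proof (rule that[of "p ` D"])
    show "maxaff (p ` D) x \<le> f x" for x
      using D(2) ne g by (intro maxaff_le) (auto simp: p)
    show "f x - e \<le> maxaff (p ` D) x" if x: "x \<in> cball 0 R" for x
    proof -
      obtain y where "y \<in> D" "x \<in> U y" using D(3) x by blast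
      then show ?thesis using maxaff_ge[of "p ` D" "p y" x] D(2) unfolding U_def by force
    qed
  qed (use D ne in auto)
qed

text \<open>The hyperplanes outside of which \<^const>\<open>maxaff\<close> is locally affine, as pairs (normal, offset).\<close>
definition creases :: "('a::euclidean_space \<times> real) set \<Rightarrow> ('a \<times> real) set" where
  "creases A = (\<lambda>(p, q). (fst p - fst q, snd q - snd p)) ` {(p, q). p \<in> A \<and> q \<in> A \<and> fst p \<noteq> fst q}"

lemma creases_finite: "finite A \<Longrightarrow> finite (creases A)"
  unfolding creases_def by (rule finite_imageI, rule finite_subset[of _ "A \<times> A"]) auto

lemma creases_nonzero: "h \<in> creases A \<Longrightarrow> fst h \<noteq> 0"
  by (auto simp: creases_def)

text \<open>Off the creases the maximiser at \<open>x\<close> is strict, since a tie between equal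
  slopes would force equal offsets. Finitely many strict inequalities persist in a
  neighbourhood.\<close>

lemma maxaff_locally_affine:
  assumes A: "finite A" "A \<noteq> {}" and x: "\<And>h. h \<in> creases A \<Longrightarrow> fst h \<bullet> x \<noteq> snd h"
  obtains U a c where "open U" "x \<in> U" "\<And>y. y \<in> U \<Longrightarrow> maxaff A y = a \<bullet> y + c"
proof -
  obtain p where p: "p \<in> A" "maxaff A x = fst p \<bullet> x + snd p" by (rule maxaff_attained[OF A])
  define U where "U = (\<Inter>q\<in>A - {p}. {y. fst q \<bullet> y + snd q < fst p \<bullet> y + snd p})"
  have "open U" unfolding U_def using A
    by (intro open_INT ballI open_Collect_less) (auto intro!: continuous_intros)
  moreover have "x \<in> U"
    unfolding U_def
  proof (intro INT_I CollectI)
    fix q assume q: "q \<in> A - {p}"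
    have le: "fst q \<bullet> x + snd q \<le> fst p \<bullet> x + snd p" using maxaff_ge[OF A(1), of q x] p q by simp
    moreover have "fst q \<bullet> x + snd q \<noteq> fst p \<bullet> x + snd p"
    proof
      assume eq: "fst q \<bullet> x + snd q = fst p \<bullet> x + snd p"
      show False
      proof (cases "fst p = fst q")
        case True then show ?thesis using eq q by (simp add: prod_eq_iff)
      next
        case False
        then have "(fst p - fst q, snd q - snd p) \<in> creases A"
          unfolding creases_def using p q by (intro image_eqI[of _ _ "(p, q)"]) auto
        from x[OF this] show ?thesis using eq by (simp add: inner_diff_left)
      qed
    qed
    ultimately show "fst q \<bullet> x + snd q < fst p \<bullet> x + snd p" by simp
  qed
  moreover have "maxaff A y = fst p \<bullet> y + snd p" if "y \<in> U" for y
  proof (rule antisym)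
    show "maxaff A y \<le> fst p \<bullet> y + snd p"
    proof (rule maxaff_le[OF A])
      fix q assume "q \<in> A"
      then show "fst q \<bullet> y + snd q \<le> fst p \<bullet> y + snd p"
        using that unfolding U_def by (cases "q = p") (auto intro: less_imp_le)
    qed
  qed (use maxaff_ge[OF A(1) p(1)] in auto)
  ultimately show thesis using that by blast
qed

text \<open>The translation of the next family is chosen outside finitely many hyperplanes of bad
  values, so that none of its hyperplanes contains one of the affine sets found so far. Every
  nonempty intersection then loses one dimension.\<close>

lemma general_position_aux:
  fixes H :: "nat \<Rightarrow> ('a::euclidean_space \<times> real) set"
  assumes fin: "\<And>j. finite (H j)" and nz: "\<And>j h. h \<in> H j \<Longrightarrow> fst h \<noteq> 0" and e: "e > 0"
  shows "\<exists>v. (\<forall>j. norm (v j) < e) \<and> (\<exists>\<A>. finite \<A> \<and> (\<forall>S\<in>\<A>. affine S \<and> aff_dim S \<le> int DIM('a) - int m) \<and>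
     {x. \<forall>j<m. \<exists>h\<in>H j. fst h \<bullet> (x - v j) = snd h} \<subseteq> \<Union>\<A>)"
proof (induction m)
  case 0
  show ?case using e by (intro exI[of _ "\<lambda>_. 0"] conjI exI[of _ "{UNIV}"]) auto
next
  case (Suc m)
  then obtain v \<A> where v: "\<And>j. norm (v j) < e" and \<A>: "finite \<A>" "\<And>S. S \<in> \<A> \<Longrightarrow> affine S"
     "\<And>S. S \<in> \<A> \<Longrightarrow> aff_dim S \<le> int DIM('a) - int m"
     "{x. \<forall>j<m. \<exists>h\<in>H j. fst h \<bullet> (x - v j) = snd h} \<subseteq> \<Union>\<A>" by blast
  define p where "p = (\<lambda>S::'a set. SOME x. x \<in> S)"
  have p: "p S \<in> S" if "S \<noteq> {}" for S using that unfolding p_def by (simp add: some_in_eq)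
  \<comment> \<open>A translated hyperplane that contains \<open>S\<close> contains the base point
    \<open>p S\<close>; excluding the latter is one linear condition on the translation.\<close>
  define bad where "bad = (\<Union>S\<in>\<A>. \<Union>h\<in>H m. {w. fst h \<bullet> w = fst h \<bullet> p S - snd h})"
  have "negligible bad" unfolding bad_def
    using \<A>(1) fin nz by (auto intro!: negligible_Union negligible_hyperplane)
  then have "ball 0 e \<subseteq> bad \<Longrightarrow> negligible (ball (0::'a) e)" by (rule negligible_subset)
  moreover have "ball (0::'a) e \<noteq> {}" using e by simp
  ultimately have "\<not> ball 0 e \<subseteq> bad"
    using open_not_negligible[OF open_ball] by blast
  then obtain w where w: "norm w < e" "w \<notin> bad" unfolding subset_iff mem_ball_0 by blast
  define \<B> where "\<B> = {T \<in> (\<lambda>(S, h). S \<inter> {x. fst h \<bullet> x = snd h + fst h \<bullet> w}) ` (\<A> \<times> H m). T \<noteq> {}}"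
  show ?case
  proof (intro exI[of _ "v(m := w)"] conjI exI[of _ \<B>])
    show "\<forall>j. norm ((v(m := w)) j) < e" using v w by auto
    show "finite \<B>" unfolding \<B>_def using \<A>(1) fin by auto
    show "\<forall>T\<in>\<B>. affine T \<and> aff_dim T \<le> int DIM('a) - int (Suc m)"
    proof
      fix T assume "T \<in> \<B>"
      then obtain S h where T: "S \<in> \<A>" "h \<in> H m" "T = S \<inter> {x. fst h \<bullet> x = snd h + fst h \<bullet> w}" "T \<noteq> {}"
        unfolding \<B>_def by auto
      have "p S \<notin> {x. fst h \<bullet> x = snd h + fst h \<bullet> w}"
      proof
        assume "p S \<in> {x. fst h \<bullet> x = snd h + fst h \<bullet> w}"
        then have "fst h \<bullet> w = fst h \<bullet> p S - snd h" by simp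
        then show False using w(2) T(1,2) unfolding bad_def by blast
      qed
      then have "\<not> S \<subseteq> {x. fst h \<bullet> x = snd h + fst h \<bullet> w}" using p[of S] T(3,4) by blast
      then have "aff_dim T = aff_dim S - 1"
        using aff_dim_affine_Int_hyperplane[OF \<A>(2)[OF T(1)], of "fst h" "snd h + fst h \<bullet> w"] T(3,4) by auto
      moreover have "affine T" unfolding T(3) by (intro affine_Int \<A>(2) T(1) affine_hyperplane)
      ultimately show "affine T \<and> aff_dim T \<le> int DIM('a) - int (Suc m)" using \<A>(3)[OF T(1)] by simp
    qed
    show "{x. \<forall>j<Suc m. \<exists>h\<in>H j. fst h \<bullet> (x - (v(m := w)) j) = snd h} \<subseteq> \<Union>\<B>"
    proof
      fix x assume x: "x \<in> {x. \<forall>j<Suc m. \<exists>h\<in>H j. fst h \<bullet> (x - (v(m := w)) j) = snd h}"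
      then have "\<forall>j<m. \<exists>h\<in>H j. fst h \<bullet> (x - v j) = snd h"
        by (auto dest: less_SucI split: if_splits)
      then obtain S where S: "S \<in> \<A>" "x \<in> S" using \<A>(4) by blast
      from x obtain h where h: "h \<in> H m" "fst h \<bullet> (x - w) = snd h" by auto
      let ?T = "S \<inter> {x. fst h \<bullet> x = snd h + fst h \<bullet> w}"
      have "x \<in> ?T" using S h by (simp add: inner_diff_right)
      moreover have "?T \<in> (\<lambda>(S, h). S \<inter> {x. fst h \<bullet> x = snd h + fst h \<bullet> w}) ` (\<A> \<times> H m)"
        by (rule image_eqI[of _ _ "(S, h)"]) (use S h in auto)
      moreover from \<open>x \<in> ?T\<close> have "?T \<noteq> {}" by (metis empty_iff)
      ultimately have "?T \<in> \<B>" unfolding \<B>_def mem_Collect_eq by (intro conjI)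
      then show "x \<in> \<Union>\<B>" using \<open>x \<in> ?T\<close> by (rule UnionI)
    qed
  qed
qed

lemma general_position:
  fixes H :: "nat \<Rightarrow> ('a::euclidean_space \<times> real) set"
  assumes "\<And>j. finite (H j)" "\<And>j h. h \<in> H j \<Longrightarrow> fst h \<noteq> 0" "e > 0"
  obtains v where "\<And>j. norm (v j) < e"
    "\<And>x. \<exists>j<Suc DIM('a). \<forall>h\<in>H j. fst h \<bullet> (x - v j) \<noteq> snd h"
proof -
  have "\<exists>v. (\<forall>j. norm (v j) < e) \<and> (\<exists>\<A>. finite \<A> \<and>
     (\<forall>S\<in>\<A>. affine S \<and> aff_dim S \<le> int DIM('a) - int (Suc DIM('a))) \<and>
     {x. \<forall>j<Suc DIM('a). \<exists>h\<in>H j. fst h \<bullet> (x - v j) = snd h} \<subseteq> \<Union>\<A>)"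
    by (rule general_position_aux[OF assms(1) _ assms(3)]) (rule assms(2))
  then obtain v \<A> where v: "\<forall>j. norm (v j) < e" and \<A>:
     "\<forall>S\<in>\<A>. affine S \<and> aff_dim S \<le> int DIM('a) - int (Suc DIM('a))"
     "{x. \<forall>j<Suc DIM('a). \<exists>h\<in>H j. fst h \<bullet> (x - v j) = snd h} \<subseteq> \<Union>\<A>"
    by (elim exE conjE) (rule that)
  \<comment> \<open>With dimension + 1 families the bound on the affine dimension is
    \<open>-1\<close>, which only the empty set attains.\<close>
  have "S = {}" if "S \<in> \<A>" for S
    using \<A>(1) that aff_dim_geq[of S] aff_dim_empty[of S] by fastforce
  then have "\<Union>\<A> = {}" by (rule Union_empty_conv[THEN iffD2, rule_format])
  have *: "\<not> (\<forall>j<Suc DIM('a). \<exists>h\<in>H j. fst h \<bullet> (x - v j) = snd h)" for x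
  proof
    assume "\<forall>j<Suc DIM('a). \<exists>h\<in>H j. fst h \<bullet> (x - v j) = snd h"
    then have "x \<in> {x. \<forall>j<Suc DIM('a). \<exists>h\<in>H j. fst h \<bullet> (x - v j) = snd h}" by (rule CollectI)
    then have "x \<in> \<Union>\<A>" by (rule subsetD[OF \<A>(2)])
    then show False unfolding \<open>\<Union>\<A> = {}\<close> by (rule emptyE)
  qed
  show thesis
  proof (rule that[of v])
    show "\<exists>j<Suc DIM('a). \<forall>h\<in>H j. fst h \<bullet> (x - v j) \<noteq> snd h" for x using *[of x] by simp
    show "norm (v j) < e" for j using v by simp
  qed
qed

lemma maxaff_lipschitz:
  assumes "finite A" "A \<noteq> {}"
  shows "\<bar>maxaff A (x - v) - maxaff A x\<bar> \<le> (\<Sum>p\<in>A. norm (fst p)) * norm v"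
proof -
  have *: "maxaff A y \<le> maxaff A z + (\<Sum>p\<in>A. norm (fst p)) * norm (y - z)" for y z
  proof (rule maxaff_le[OF assms])
    fix p assume p: "p \<in> A"
    have "fst p \<bullet> y + snd p = fst p \<bullet> z + snd p + fst p \<bullet> (y - z)" by (simp add: inner_diff_right)
    also have "\<dots> \<le> maxaff A z + norm (fst p) * norm (y - z)"
      using maxaff_ge[OF assms(1) p, of z] norm_cauchy_schwarz[of "fst p" "y - z"] by linarith
    also have "\<dots> \<le> maxaff A z + (\<Sum>p\<in>A. norm (fst p)) * norm (y - z)"
      using member_le_sum[OF p, of "\<lambda>p. norm (fst p)"] assms(1) by (intro add_left_mono mult_right_mono) auto
    finally show "fst p \<bullet> y + snd p \<le> maxaff A z + (\<Sum>p\<in>A. norm (fst p)) * norm (y - z)" .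
  qed
  show ?thesis using *[of "x - v" x] *[of x "x - v"] by simp
qed

section \<open>Iterated differences\<close>

lemma radon_functional_linear_comb:
  fixes L1 :: "(real^'n \<Rightarrow> real) \<Rightarrow> complex"
  assumes L: "radon_functional L1" "radon_functional L2"
  shows "radon_functional (\<lambda>\<phi>. c * L1 \<phi> + d * L2 \<phi>)"
  unfolding radon_functional_def
proof (intro conjI allI impI)
  fix a b :: real and \<phi> \<psi> :: "real^'n \<Rightarrow> real" assume "Cc \<phi>" "Cc \<psi>"
  then show "c * L1 (\<lambda>x. a * \<phi> x + b * \<psi> x) + d * L2 (\<lambda>x. a * \<phi> x + b * \<psi> x) =
     complex_of_real a * (c * L1 \<phi> + d * L2 \<phi>) + complex_of_real b * (c * L1 \<psi> + d * L2 \<psi>)"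
    using radon_linear[OF L(1)] radon_linear[OF L(2)] by (simp add: algebra_simps)
next
  fix K :: "(real^'n) set" assume "compact K"
  note bd = L[unfolded radon_functional_def, THEN conjunct2, rule_format, OF this]
  obtain C1 where C1: "\<And>\<phi> B. Cc \<phi> \<Longrightarrow> {x. \<phi> x \<noteq> 0} \<subseteq> K \<Longrightarrow> (\<forall>x. \<bar>\<phi> x\<bar> \<le> B) \<Longrightarrow> norm (L1 \<phi>) \<le> C1 * B"
    using bd(1) by blast
  obtain C2 where C2: "\<And>\<phi> B. Cc \<phi> \<Longrightarrow> {x. \<phi> x \<noteq> 0} \<subseteq> K \<Longrightarrow> (\<forall>x. \<bar>\<phi> x\<bar> \<le> B) \<Longrightarrow> norm (L2 \<phi>) \<le> C2 * B"
    using bd(2) by blast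
  show "\<exists>C. \<forall>\<phi> B. Cc \<phi> \<longrightarrow> {x. \<phi> x \<noteq> 0} \<subseteq> K \<longrightarrow> (\<forall>x. \<bar>\<phi> x\<bar> \<le> B) \<longrightarrow> norm (c * L1 \<phi> + d * L2 \<phi>) \<le> C * B"
  proof (intro exI[of _ "norm c * C1 + norm d * C2"] allI impI)
    fix \<phi> B assume *: "Cc \<phi>" "{x. \<phi> x \<noteq> 0} \<subseteq> K" "\<forall>x. \<bar>\<phi> x\<bar> \<le> B"
    have "norm (c * L1 \<phi> + d * L2 \<phi>) \<le> norm c * norm (L1 \<phi>) + norm d * norm (L2 \<phi>)"
      using norm_triangle_ineq[of "c * L1 \<phi>" "d * L2 \<phi>"] by (simp add: norm_mult)
    also have "\<dots> \<le> norm c * (C1 * B) + norm d * (C2 * B)"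
      using C1[OF *] C2[OF *] by (intro add_mono mult_left_mono) auto
    finally show "norm (c * L1 \<phi> + d * L2 \<phi>) \<le> (norm c * C1 + norm d * C2) * B" by (simp add: algebra_simps)
  qed
qed

lemma radon_functional_diff:
  "radon_functional L1 \<Longrightarrow> radon_functional L2 \<Longrightarrow> radon_functional (\<lambda>\<phi>. L1 \<phi> - L2 \<phi>)"
  using radon_functional_linear_comb[of L1 L2 1 "-1"] by simp

lemma radon_functional_cmult:
  "radon_functional L1 \<Longrightarrow> radon_functional (\<lambda>\<phi>. c * L1 \<phi>)"
  using radon_functional_linear_comb[of L1 L1 c 0] by simp

text \<open>Mollification takes the place of a partition of unity: once \<open>d\<close> is below
  the Lebesgue number of the cover, each translated mollifier that matters is supported in a single
  set of the cover.\<close>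

lemma radon_local_zero:
  assumes L: "radon_functional L"
    and loc: "\<And>x. \<exists>U. open U \<and> x \<in> U \<and> (\<forall>\<phi>. Cc \<phi> \<longrightarrow> closure {x. \<phi> x \<noteq> 0} \<subseteq> U \<longrightarrow> L \<phi> = 0)"
    and \<phi>: "Cc \<phi>"
  shows "L \<phi> = 0"
proof -
  obtain R where R: "R > 0" "{x. \<phi> x \<noteq> 0} \<subseteq> cball 0 R" by (rule Cc_support[OF \<phi>])
  let ?G = "{U. open U \<and> (\<forall>\<phi>. Cc \<phi> \<longrightarrow> closure {x. \<phi> x \<noteq> 0} \<subseteq> U \<longrightarrow> L \<phi> = 0)}"
  have "cball 0 R \<subseteq> \<Union>?G" using loc by blast
  then obtain \<epsilon> where \<epsilon>: "\<epsilon> > 0" "\<And>x. x \<in> cball 0 R \<Longrightarrow> \<exists>U\<in>?G. ball x \<epsilon> \<subseteq> U"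
    by (rule Heine_Borel_lemma[OF compact_cball]) auto
  have "norm (L \<phi>) \<le> 0 + e" if e: "e > 0" for e
  proof -
    obtain d0 where d0: "d0 > 0" "\<And>d. 0 < d \<Longrightarrow> d < d0 \<Longrightarrow> norm ((LINT y|lborel. complex_of_real (\<phi> y) * L (\<lambda>x. moll d (x - y))) - L \<phi>) \<le> e"
      by (rule radon_mollify[OF L \<phi> e]) blast
    define d where "d = min d0 \<epsilon> / 2"
    have d: "0 < d" "d < d0" "d < \<epsilon>" using d0(1) \<epsilon>(1) by (auto simp: d_def)
    have "complex_of_real (\<phi> y) * L (\<lambda>x. moll d (x - y)) = 0" for y
    proof (cases "\<phi> y = 0")
      case False
      then have "y \<in> cball 0 R" using R(2) by blast
      then obtain U where U: "open U" "\<And>\<phi>. Cc \<phi> \<Longrightarrow> closure {x. \<phi> x \<noteq> 0} \<subseteq> U \<Longrightarrow> L \<phi> = 0" "ball y \<epsilon> \<subseteq> U"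
        using \<epsilon>(2) by blast
      have "{x. moll d (x - y) \<noteq> 0} \<subseteq> cball y d"
        using moll_support[OF d(1)] by (auto simp: dist_norm norm_minus_commute)
      then have "closure {x. moll d (x - y) \<noteq> 0} \<subseteq> cball y d" by (rule closure_minimal) simp
      also have "\<dots> \<subseteq> U" using d(3) U(3) by auto
      finally show ?thesis using U(2)[of "\<lambda>x. moll d (x - y)"] Cc_translate[OF moll_Cc[OF d(1)], of "- y"] by simp
    qed simp
    then have "(\<lambda>y. complex_of_real (\<phi> y) * L (\<lambda>x. moll d (x - y))) = (\<lambda>y. 0)" by blast
    then show ?thesis using d0(2)[OF d(1,2)] by simp
  qed
  then have "norm (L \<phi>) \<le> 0" by (rule field_le_epsilon)
  then show ?thesis by simp
qed

text \<open>The last argument is the base point of the difference. It moves in the recursion and is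
  kept general for the inductions; polarization is the case of base point 0.\<close>

fun mdiff :: "('a \<Rightarrow> real) list \<Rightarrow> (('a \<Rightarrow> real) \<Rightarrow> complex) \<Rightarrow> ('a \<Rightarrow> real) \<Rightarrow> complex" where
  "mdiff [] \<mu> f = \<mu> f"
| "mdiff (g # gs) \<mu> f = mdiff gs \<mu> (\<lambda>x. f x + g x) - mdiff gs \<mu> f"

text \<open>Additivity in a slot fails only by a difference with one more slot, so vanishing of one
  order gives additivity at the order below.\<close>

lemma mdiff_add_slot:
  "mdiff (xs @ (\<lambda>x. g x + h x) # ys) \<mu> f =
   mdiff (xs @ g # ys) \<mu> f + mdiff (xs @ h # ys) \<mu> f + mdiff (xs @ g # h # ys) \<mu> f"
  by (induction xs arbitrary: f) (simp_all add: algebra_simps)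

lemma mdiff_subsets:
  assumes "distinct js"
  shows "mdiff (map fs js) \<mu> f = (\<Sum>S\<in>Pow (set js). (-1) ^ (length js - card S) * \<mu> (\<lambda>x. f x + (\<Sum>j\<in>S. fs j x)))"
  using assms
proof (induction js arbitrary: f)
  case (Cons j js)
  have fin: "finite S" if "S \<in> Pow (set js)" for S using that finite_subset by auto
  have card: "card S \<le> length js" if "S \<in> Pow (set js)" for S
    using that card_mono[of "set js" S] card_length[of js] by auto
  have inj: "inj_on (insert j) (Pow (set js))" using Cons.prems
    by (auto simp: inj_on_def)
  have "(\<Sum>S\<in>Pow (set (j # js)). (-1) ^ (length (j # js) - card S) * \<mu> (\<lambda>x. f x + (\<Sum>j\<in>S. fs j x)))
      = (\<Sum>S\<in>Pow (set js). (-1) ^ (Suc (length js) - card S) * \<mu> (\<lambda>x. f x + (\<Sum>j\<in>S. fs j x)))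
      + (\<Sum>S\<in>insert j ` Pow (set js). (-1) ^ (Suc (length js) - card S) * \<mu> (\<lambda>x. f x + (\<Sum>j\<in>S. fs j x)))"
    unfolding list.set Pow_insert using Cons.prems by (subst sum.union_disjoint) auto
  also have "(\<Sum>S\<in>insert j ` Pow (set js). (-1) ^ (Suc (length js) - card S) * \<mu> (\<lambda>x. f x + (\<Sum>j\<in>S. fs j x)))
      = (\<Sum>S\<in>Pow (set js). (-1) ^ (length js - card S) * \<mu> (\<lambda>x. (f x + fs j x) + (\<Sum>j\<in>S. fs j x)))"
    unfolding sum.reindex[OF inj] comp_def
  proof (rule sum.cong[OF refl])
    fix S assume S: "S \<in> Pow (set js)"
    then have "j \<notin> S" using Cons.prems by auto
    then show "(-1) ^ (Suc (length js) - card (insert j S)) * \<mu> (\<lambda>x. f x + (\<Sum>j\<in>insert j S. fs j x))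
       = (-1) ^ (length js - card S) * \<mu> (\<lambda>x. (f x + fs j x) + (\<Sum>j\<in>S. fs j x))"
      using fin[OF S] by (simp add: add.assoc)
  qed
  also have "(\<Sum>S\<in>Pow (set js). (-1) ^ (Suc (length js) - card S) * \<mu> (\<lambda>x. f x + (\<Sum>j\<in>S. fs j x)))
     = - (\<Sum>S\<in>Pow (set js). (-1) ^ (length js - card S) * \<mu> (\<lambda>x. f x + (\<Sum>j\<in>S. fs j x)))"
    unfolding sum_negf[symmetric] by (rule sum.cong[OF refl]) (use card in \<open>simp add: Suc_diff_le\<close>)
  finally show ?case using Cons by simp
qed simp

section \<open>Iterated differences of the valuation\<close>

locale ma_val =
  fixes k :: nat and \<Psi> :: "(real^'n \<Rightarrow> real) \<Rightarrow> (real^'n \<Rightarrow> real) \<Rightarrow> complex"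
  assumes MA: "MAVal k \<Psi>" and k_pos: "k > 0"
begin

lemma radon: "convex_on UNIV f \<Longrightarrow> radon_functional (\<Psi> f)"
  by (rule MA[unfolded MAVal_def, THEN conjunct1, rule_format])

lemma continuous:
  "(\<And>i. convex_on UNIV (fs i)) \<Longrightarrow> convex_on UNIV f \<Longrightarrow> (\<And>K. compact K \<Longrightarrow> uniform_limit K fs f sequentially) \<Longrightarrow>
   Cc \<phi> \<Longrightarrow> (\<lambda>i. \<Psi> (fs i) \<phi>) \<longlonglongrightarrow> \<Psi> f \<phi>"
  using MA[unfolded MAVal_def, THEN conjunct2, THEN conjunct2, THEN conjunct1, rule_format] .

lemma epi_invariant: "convex_on UNIV f \<Longrightarrow> Cc \<phi> \<Longrightarrow> \<Psi> (\<lambda>x. f x + (y \<bullet> x + c)) \<phi> = \<Psi> f \<phi>"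
  using MA[unfolded MAVal_def, THEN conjunct2, THEN conjunct2, THEN conjunct2, THEN conjunct1, rule_format, of f \<phi> y c] by (simp add: add.assoc)

lemma locality:
  "convex_on UNIV f \<Longrightarrow> convex_on UNIV g \<Longrightarrow> open U \<Longrightarrow> (\<And>x. x \<in> U \<Longrightarrow> f x = g x) \<Longrightarrow> Cc \<phi> \<Longrightarrow>
   closure {x. \<phi> x \<noteq> 0} \<subseteq> U \<Longrightarrow> \<Psi> f \<phi> = \<Psi> g \<phi>"
  using MA[unfolded MAVal_def, THEN conjunct2, THEN conjunct2, THEN conjunct2, THEN conjunct2, THEN conjunct1, rule_format] .

lemma translate: "convex_on UNIV f \<Longrightarrow> Cc \<phi> \<Longrightarrow> \<Psi> (\<lambda>y. f (y - x)) \<phi> = \<Psi> f (\<lambda>y. \<phi> (y + x))"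
  by (rule MA[unfolded MAVal_def, THEN conjunct2, THEN conjunct2, THEN conjunct2, THEN conjunct2, THEN conjunct2, THEN conjunct1, rule_format])

lemma homogeneous: "convex_on UNIV f \<Longrightarrow> t > 0 \<Longrightarrow> Cc \<phi> \<Longrightarrow> \<Psi> (\<lambda>x. t * f x) \<phi> = of_real t ^ k * \<Psi> f \<phi>"
  by (rule MA[unfolded MAVal_def, THEN conjunct2, THEN conjunct2, THEN conjunct2, THEN conjunct2, THEN conjunct2, THEN conjunct2, rule_format])

abbreviation D :: "(real^'n \<Rightarrow> real) list \<Rightarrow> (real^'n \<Rightarrow> real) \<Rightarrow> (real^'n \<Rightarrow> real) \<Rightarrow> complex" where
  "D gs f \<phi> \<equiv> mdiff gs (\<lambda>f. \<Psi> f \<phi>) f"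

lemma D_radon: 
  "(\<And>g. g \<in> set gs \<Longrightarrow> convex_on UNIV g) \<Longrightarrow> convex_on UNIV f \<Longrightarrow> radon_functional (D gs f)"
proof (induction gs arbitrary: f)
  case (Cons g gs)
  then show ?case
    using radon_functional_diff[OF Cons.IH Cons.IH, of "\<lambda>x. f x + g x" f] convex_on_add[of UNIV f g] by simp
qed (simp add: radon)

lemma D_local_cong:
  assumes "open U" "Cc \<phi>" "closure {x. \<phi> x \<noteq> 0} \<subseteq> U"
  shows "(\<And>g. g \<in> set gs \<Longrightarrow> convex_on UNIV g) \<Longrightarrow> convex_on UNIV f \<Longrightarrow> convex_on UNIV f' \<Longrightarrow>
    (\<And>x. x \<in> U \<Longrightarrow> f' x = f x + (y \<bullet> x + c)) \<Longrightarrow> D gs f' \<phi> = D gs f \<phi>"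
proof (induction gs arbitrary: f f')
  case Nil
  have "\<Psi> f' \<phi> = \<Psi> (\<lambda>x. f x + (y \<bullet> x + c)) \<phi>"
    using Nil assms by (intro locality[of _ _ U] convex_on_add convex_on_inner) auto
  then show ?case using epi_invariant[OF Nil(2) assms(2)] by simp
next
  case (Cons g gs)
  have "D gs (\<lambda>x. f' x + g x) \<phi> = D gs (\<lambda>x. f x + g x) \<phi>"
    using Cons.prems by (intro Cons.IH convex_on_add) auto
  moreover have "D gs f' \<phi> = D gs f \<phi>" using Cons.prems by (intro Cons.IH) auto
  ultimately show ?case by simp
qed

text \<open>Adding a function that is affine on \<open>U\<close> does not change the remaining
  difference when tested inside \<open>U\<close>, so the two terms of that slot cancel.\<close>

lemma D_affine_zero:
  assumes "open U" "Cc \<phi>" "closure {x. \<phi> x \<noteq> 0} \<subseteq> U"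
  shows "(\<And>g. g \<in> set gs \<Longrightarrow> convex_on UNIV g) \<Longrightarrow> convex_on UNIV f \<Longrightarrow> h \<in> set gs \<Longrightarrow>
    (\<And>x. x \<in> U \<Longrightarrow> h x = y \<bullet> x + c) \<Longrightarrow> D gs f \<phi> = 0"
proof (induction gs arbitrary: f)
  case (Cons g gs)
  show ?case
  proof (cases "h = g")
    case True
    have "D gs (\<lambda>x. f x + g x) \<phi> = D gs f \<phi>"
      using Cons.prems True by (intro D_local_cong[OF assms, where y=y and c=c] convex_on_add) auto
    then show ?thesis by simp
  next
    case False
    then have h: "h \<in> set gs" using Cons.prems by auto
    have "D gs (\<lambda>x. f x + g x) \<phi> = 0" "D gs f \<phi> = 0"
      using Cons.prems h by (intro Cons.IH convex_on_add; auto)+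
    then show ?thesis by simp
  qed
qed simp

lemma D_continuous:
  assumes \<phi>: "Cc \<phi>"
  shows "(\<And>j i. j \<in> set js \<Longrightarrow> convex_on UNIV (G j i)) \<Longrightarrow> (\<And>j. j \<in> set js \<Longrightarrow> convex_on UNIV (g j)) \<Longrightarrow>
    (\<And>i. convex_on UNIV (F i)) \<Longrightarrow> convex_on UNIV f \<Longrightarrow>
    (\<And>j K. j \<in> set js \<Longrightarrow> compact K \<Longrightarrow> uniform_limit K (G j) (g j) sequentially) \<Longrightarrow>
    (\<And>K. compact K \<Longrightarrow> uniform_limit K F f sequentially) \<Longrightarrow>
    (\<lambda>i. D (map (\<lambda>j. G j i) js) (F i) \<phi>) \<longlonglongrightarrow> D (map g js) f \<phi>"
proof (induction js arbitrary: F f)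
  case Nil then show ?case using continuous \<phi> by simp
next
  case (Cons j js)
  have 1: "(\<lambda>i. D (map (\<lambda>j. G j i) js) (\<lambda>x. F i x + G j i x) \<phi>) \<longlonglongrightarrow> D (map g js) (\<lambda>x. f x + g j x) \<phi>"
    using Cons.prems by (intro Cons.IH convex_on_add uniform_limit_add) auto
  have 2: "(\<lambda>i. D (map (\<lambda>j. G j i) js) (F i) \<phi>) \<longlonglongrightarrow> D (map g js) f \<phi>"
    using Cons.prems by (intro Cons.IH) auto
  from tendsto_diff[OF 1 2] show ?case by simp
qed

text \<open>Near every point one of dimension + 1 max-affine functions in general position is affine, so
  that locality kills the iterated difference.\<close>
lemma D_dim_zero:
  fixes g :: "nat \<Rightarrow> real^'n \<Rightarrow> real"
  assumes g: "\<And>j. convex_on UNIV (g j)" and f: "convex_on UNIV f" and \<phi>: "Cc \<phi>"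
  shows "D (map g [0..<Suc CARD('n)]) f \<phi> = 0"
proof -
  have "\<exists>A. \<forall>j. finite (A j) \<and> A j \<noteq> {} \<and> (\<forall>x. maxaff (A j) x \<le> g j x) \<and>
      (\<forall>x\<in>cball 0 (real (Suc i)). g j x - 1 / real (Suc i) \<le> maxaff (A j) x)" for i
  proof (rule choice, rule allI)
    fix j
    show "\<exists>A. finite A \<and> A \<noteq> {} \<and> (\<forall>x. maxaff A x \<le> g j x) \<and>
      (\<forall>x\<in>cball 0 (real (Suc i)). g j x - 1 / real (Suc i) \<le> maxaff A x)"
      by (rule maxaff_approx[OF g[of j], of "1 / real (Suc i)" "real (Suc i)"]) auto
  qed
  then obtain A where A: "\<And>i j. finite (A i j)" "\<And>i j. A i j \<noteq> {}" "\<And>i j x. maxaff (A i j) x \<le> g j x"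
      "\<And>i j x. x \<in> cball 0 (real (Suc i)) \<Longrightarrow> g j x - 1 / real (Suc i) \<le> maxaff (A i j) x" by metis
  \<comment> \<open>Dominates the Lipschitz constants of all the functions involved, so that
    translations of size \<open>1 / (real (Suc i) * l i)\<close> move them by at most
    \<open>1 / real (Suc i)\<close>; the summand 1 keeps it positive.\<close>
  define l where "l = (\<lambda>i. 1 + (\<Sum>j<Suc CARD('n). \<Sum>p\<in>A i j. norm (fst p)))"
  have l: "l i > 0" for i unfolding l_def by (intro add_pos_nonneg sum_nonneg) auto
  have "\<exists>v. (\<forall>j. norm (v j) < 1 / (real (Suc i) * l i)) \<and>
      (\<forall>x. \<exists>j<Suc CARD('n). \<forall>h\<in>creases (A i j). fst h \<bullet> (x - v j) \<noteq> snd h)" for i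
    using general_position[of "\<lambda>j. creases (A i j)" "1 / (real (Suc i) * l i)"] creases_finite[OF A(1)]
      creases_nonzero l[of i] by (metis DIM_cart DIM_real mult.right_neutral divide_pos_pos mult_pos_pos of_nat_0_less_iff zero_less_Suc zero_less_one)
  then obtain v where v: "\<And>i j. norm (v i j) < 1 / (real (Suc i) * l i)"
      "\<And>i x. \<exists>j<Suc CARD('n). \<forall>h\<in>creases (A i j). fst h \<bullet> (x - v i j) \<noteq> snd h" by metis
  define G where "G = (\<lambda>j i x. maxaff (A i j) (x - v i j))"
  have Gc: "convex_on UNIV (G j i)" for j i
    unfolding G_def by (intro convex_on_translate maxaff_convex A)
  have Gz: "D (map (\<lambda>j. G j i) [0..<Suc CARD('n)]) f \<phi> = 0" for i
  proof (rule radon_local_zero[OF D_radon _ \<phi>])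
    fix x
    obtain j where j: "j < Suc CARD('n)" "\<And>h. h \<in> creases (A i j) \<Longrightarrow> fst h \<bullet> (x - v i j) \<noteq> snd h"
      using v(2) by blast
    obtain U a c where U: "open U" "x - v i j \<in> U" "\<And>y. y \<in> U \<Longrightarrow> maxaff (A i j) y = a \<bullet> y + c"
      by (rule maxaff_locally_affine[OF A(1,2) j(2)]) blast+
    let ?U = "(+) (v i j) ` U"
    have "open ?U" using U(1) by (rule open_translation)
    moreover have "x \<in> ?U" using U(2) by (force intro: image_eqI[of _ _ "x - v i j"])
    moreover have "D (map (\<lambda>j. G j i) [0..<Suc CARD('n)]) f \<psi> = 0" if "Cc \<psi>" "closure {x. \<psi> x \<noteq> 0} \<subseteq> ?U" for \<psi>
    proof (rule D_affine_zero[OF \<open>open ?U\<close> that _ f, of _ "G j i" a "c - a \<bullet> v i j"])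
      have "j \<in> set [0..<Suc CARD('n)]" unfolding set_upt using j(1) by (intro atLeastLessThan_iff[THEN iffD2]) blast
      then show "G j i \<in> set (map (\<lambda>j. G j i) [0..<Suc CARD('n)])" unfolding set_map by (rule imageI)
      show "G j i y = a \<bullet> y + (c - a \<bullet> v i j)" if "y \<in> ?U" for y
        using that U(3) by (auto simp: G_def inner_add_right)
    qed (use Gc in auto)
    ultimately show "\<exists>U. open U \<and> x \<in> U \<and> (\<forall>\<phi>. Cc \<phi> \<longrightarrow> closure {x. \<phi> x \<noteq> 0} \<subseteq> U \<longrightarrow> D (map (\<lambda>j. G j i) [0..<Suc CARD('n)]) f \<phi> = 0)"
      by blast
  qed (use Gc f in auto)
  have "(\<lambda>i. D (map (\<lambda>j. G j i) [0..<Suc CARD('n)]) f \<phi>) \<longlonglongrightarrow> D (map g [0..<Suc CARD('n)]) f \<phi>"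
  proof (rule D_continuous[OF \<phi>])
    fix j and K :: "(real^'n) set" assume j: "j \<in> set [0..<Suc CARD('n)]" and K: "compact K"
    have d: "\<bar>G j i x - g j x\<bar> \<le> 2 / real (Suc i)" if x: "norm x \<le> real (Suc i)" for i x
    proof -
      have "\<bar>G j i x - maxaff (A i j) x\<bar> \<le> (\<Sum>p\<in>A i j. norm (fst p)) * norm (v i j)"
        unfolding G_def by (rule maxaff_lipschitz[OF A(1,2)])
      also have "\<dots> \<le> l i * norm (v i j)"
      proof (rule mult_right_mono)
        have "(\<Sum>p\<in>A i j. norm (fst p)) \<le> (\<Sum>j<Suc CARD('n). \<Sum>p\<in>A i j. norm (fst p))"
          using j by (intro member_le_sum[of j "{..<Suc CARD('n)}" "\<lambda>j. \<Sum>p\<in>A i j. norm (fst p)"] sum_nonneg) auto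
        then show "(\<Sum>p\<in>A i j. norm (fst p)) \<le> l i" by (simp add: l_def)
      qed simp
      also have "\<dots> \<le> l i * (1 / (real (Suc i) * l i))"
        using l[of i] v(1)[of i j] by (intro mult_left_mono) auto
      also have "\<dots> = 1 / real (Suc i)" using l[of i] by simp
      finally have "\<bar>G j i x - maxaff (A i j) x\<bar> \<le> 1 / real (Suc i)" .
      moreover have "\<bar>maxaff (A i j) x - g j x\<bar> \<le> 1 / real (Suc i)"
        using A(3)[of i j x] A(4)[of x i j] x by simp
      moreover have "2 / real (Suc i) = 1 / real (Suc i) + 1 / real (Suc i)" by simp
      ultimately show ?thesis by linarith
    qed
    show "uniform_limit K (G j) (g j) sequentially"
      unfolding uniform_limit_iff
    proof (intro allI impI)
      fix e :: real assume e: "e > 0"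
      obtain R where R: "\<And>x. x \<in> K \<Longrightarrow> norm x \<le> R" using compact_imp_bounded[OF K] unfolding bounded_iff by blast
      obtain N :: nat where N: "real N > max R (2 / e)" using reals_Archimedean2 by blast
      show "\<forall>\<^sub>F i in sequentially. \<forall>x\<in>K. dist (G j i x) (g j x) < e"
        unfolding eventually_sequentially
      proof (intro exI[of _ N] allI impI ballI)
        fix i x assume i: "N \<le> i" and x: "x \<in> K"
        have "norm x \<le> real (Suc i)" using R[OF x] N i by simp
        from d[OF this] have "\<bar>G j i x - g j x\<bar> \<le> 2 / real (Suc i)" .
        also have "2 / e < real (Suc i)" using N i by simp
        then have "2 / real (Suc i) < e" using e by (simp add: field_simps)
        finally show "dist (G j i x) (g j x) < e" by (simp add: dist_real_def)
      qed
    qed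
  qed (use Gc g f in \<open>auto intro: uniform_limit_const\<close>)
  then show ?thesis unfolding Gz by (simp add: LIMSEQ_const_iff)
qed

lemma D_zero_long:
  assumes "length gs = Suc CARD('n)" "\<And>g. g \<in> set gs \<Longrightarrow> convex_on UNIV g" "convex_on UNIV f" "Cc \<phi>"
  shows "D gs f \<phi> = 0"
proof -
  have c0: "convex_on UNIV (\<lambda>x::real^'n. 0::real)" using convex_on_inner[of 0 0] by simp
  define g where "g = (\<lambda>j. if j < length gs then gs ! j else (\<lambda>x. 0))"
  have "gs = map g [0..<Suc CARD('n)]"
    by (rule nth_equalityI) (auto simp: g_def assms(1) nth_append less_Suc_eq)
  moreover have "convex_on UNIV (g j)" for j
    using assms(2) c0 by (auto simp: g_def)
  ultimately show ?thesis using D_dim_zero[of g f \<phi>] assms by simp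
qed

end

section \<open>Polarization\<close>

lemma convex_on_zero: "convex_on UNIV (\<lambda>x::'a::euclidean_space. 0::real)"
  using convex_on_inner[of 0 0] by simp

lemma convex_on_sum_UNIV:
  "(\<And>i. i \<in> I \<Longrightarrow> convex_on UNIV (f i)) \<Longrightarrow> convex_on UNIV (\<lambda>x::'a::euclidean_space. \<Sum>i\<in>I. f i x :: real)"
  by (induction I rule: infinite_finite_induct) (simp_all add: convex_on_zero convex_on_add)

text \<open>Stated for nonnegative arguments because a negative multiple of a convex function need
  not be convex; accordingly the rational approximations of \<open>t\<close> are nonnegative
  too.\<close>

lemma additive_continuous_linear:
  fixes h :: "real \<Rightarrow> 'a::real_normed_vector"
  assumes add: "\<And>s t. 0 \<le> s \<Longrightarrow> 0 \<le> t \<Longrightarrow> h (s + t) = h s + h t"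
    and cont: "\<And>r t. (\<And>i. 0 \<le> r i) \<Longrightarrow> r \<longlonglongrightarrow> t \<Longrightarrow> (\<lambda>i. h (r i)) \<longlonglongrightarrow> h t"
    and t: "0 \<le> t"
  shows "h t = t *\<^sub>R h 1"
proof -
  have h0: "h 0 = 0" using add[of 0 0] by simp
  have mul: "h (real m * s) = real m *\<^sub>R h s" if "0 \<le> s" for m s
  proof (induction m)
    case (Suc m)
    then show ?case using add[of s "real m * s"] that by (simp add: algebra_simps)
  qed (simp add: h0)
  have rat: "h (real m / real (Suc q)) = (real m / real (Suc q)) *\<^sub>R h 1" for m q
  proof -
    have "real (Suc q) *\<^sub>R h (real m / real (Suc q)) = real m *\<^sub>R h 1"
      using mul[of "real m / real (Suc q)" "Suc q"] mul[of 1 m] by simp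
    then have "(1 / real (Suc q)) *\<^sub>R (real (Suc q) *\<^sub>R h (real m / real (Suc q))) = (1 / real (Suc q)) *\<^sub>R (real m *\<^sub>R h 1)" by simp
    then show ?thesis unfolding scaleR_scaleR by simp
  qed
  define r where "r = (\<lambda>i. real (nat \<lfloor>t * real (Suc i)\<rfloor>) / real (Suc i))"
  have "\<bar>r i - t\<bar> \<le> 1 / real (Suc i)" for i
  proof -
    have n: "real (nat \<lfloor>t * real (Suc i)\<rfloor>) = of_int \<lfloor>t * real (Suc i)\<rfloor>" using t by simp
    have "\<bar>of_int \<lfloor>t * real (Suc i)\<rfloor> - t * real (Suc i)\<bar> \<le> 1" by linarith
    then have "\<bar>of_int \<lfloor>t * real (Suc i)\<rfloor> - t * real (Suc i)\<bar> / real (Suc i) \<le> 1 / real (Suc i)"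
      by (intro divide_right_mono) auto
    moreover have "\<bar>of_int \<lfloor>t * real (Suc i)\<rfloor> - t * real (Suc i)\<bar> / real (Suc i)
       = \<bar>(of_int \<lfloor>t * real (Suc i)\<rfloor> - t * real (Suc i)) / real (Suc i)\<bar>" by (simp only: abs_divide abs_of_nat)
    moreover have "(of_int \<lfloor>t * real (Suc i)\<rfloor> - t * real (Suc i)) / real (Suc i) = r i - t"
      unfolding r_def n by (simp only: diff_divide_distrib) simp
    ultimately show ?thesis by (simp only:)
  qed
  then have "(\<lambda>i. r i - t) \<longlonglongrightarrow> 0"
    by (intro Lim_null_comparison[OF _ LIMSEQ_Suc[OF lim_inverse_n']]) (auto simp: real_norm_def inverse_eq_divide)
  then have rt: "r \<longlonglongrightarrow> t" by (simp add: LIM_zero_iff)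
  have "(\<lambda>i. h (r i)) \<longlonglongrightarrow> h t" by (rule cont[OF _ rt]) (simp add: r_def)
  moreover have "(\<lambda>i. h (r i)) = (\<lambda>i. r i *\<^sub>R h 1)" unfolding r_def rat ..
  moreover have "(\<lambda>i. r i *\<^sub>R h 1) \<longlonglongrightarrow> t *\<^sub>R h 1" by (intro tendsto_intros rt)
  ultimately show ?thesis using LIMSEQ_unique by auto
qed

context ma_val begin

definition vanishing :: "nat \<Rightarrow> (real^'n \<Rightarrow> real) \<Rightarrow> bool" where
  "vanishing N \<phi> \<longleftrightarrow> (\<forall>gs f. length gs = N \<longrightarrow> (\<forall>g\<in>set gs. convex_on UNIV g) \<longrightarrow> convex_on UNIV f \<longrightarrow> D gs f \<phi> = 0)"

lemma vanishingD:
  "vanishing N \<phi> \<Longrightarrow> length gs = N \<Longrightarrow> (\<And>g. g \<in> set gs \<Longrightarrow> convex_on UNIV g) \<Longrightarrow> convex_on UNIV f \<Longrightarrow> D gs f \<phi> = 0"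
  unfolding vanishing_def by blast

lemma vanishing_Suc: assumes "vanishing N \<phi>" shows "vanishing (Suc N) \<phi>"
  unfolding vanishing_def
proof (intro allI impI)
  fix gs :: "(real^'n \<Rightarrow> real) list" and f :: "real^'n \<Rightarrow> real" assume *: "length gs = Suc N" "\<forall>g\<in>set gs. convex_on UNIV g" "convex_on UNIV f"
  then obtain g gs' where gs: "gs = g # gs'" by (cases gs) auto
  have "D gs' (\<lambda>x. f x + g x) \<phi> = 0" "D gs' f \<phi> = 0"
    using * gs by (intro vanishingD[OF assms] convex_on_add; auto)+
  then show "D gs f \<phi> = 0" by (simp add: gs)
qed

lemma D_base:
  assumes "vanishing (Suc (length gs)) \<phi>" "\<And>g. g \<in> set gs \<Longrightarrow> convex_on UNIV g" "convex_on UNIV f"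
  shows "D gs f \<phi> = D gs (\<lambda>x. 0) \<phi>"
  using vanishingD[OF assms(1), of "f # gs" "\<lambda>x. 0"] assms convex_on_zero by auto

lemma D_double:
  assumes v: "vanishing (Suc N) \<phi>" and f: "convex_on UNIV f"
  shows "length xs + length ys = N \<Longrightarrow> (\<And>g. g \<in> set xs \<union> set ys \<Longrightarrow> convex_on UNIV g) \<Longrightarrow>
    D (map (\<lambda>g x. g x + g x) xs @ ys) f \<phi> = 2 ^ length xs * D (xs @ ys) f \<phi>"
proof (induction xs arbitrary: ys rule: rev_induct)
  case (snoc x xs)
  have "D (map (\<lambda>g x. g x + g x) (xs @ [x]) @ ys) f \<phi> = 2 ^ length xs * D (xs @ (\<lambda>y. x y + x y) # ys) f \<phi>"
  proof -
    have c: "convex_on UNIV (\<lambda>y. x y + x y)"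
      using snoc.prems(2)[of x] by (intro convex_on_add) auto
    have "D (map (\<lambda>g x. g x + g x) xs @ (\<lambda>y. x y + x y) # ys) f \<phi> = 2 ^ length xs * D (xs @ (\<lambda>y. x y + x y) # ys) f \<phi>"
      by (rule snoc.IH) (use snoc.prems c in auto)
    then show ?thesis by simp
  qed
  also have "D (xs @ (\<lambda>y. x y + x y) # ys) f \<phi> = D (xs @ x # ys) f \<phi> + D (xs @ x # ys) f \<phi>"
    unfolding mdiff_add_slot using vanishingD[OF v, of "xs @ x # x # ys" f] snoc.prems f by auto
  finally show ?case by simp
qed simp

lemma D_homogeneous2:
  assumes \<phi>: "Cc \<phi>"
  shows "(\<And>g. g \<in> set gs \<Longrightarrow> convex_on UNIV g) \<Longrightarrow> convex_on UNIV f \<Longrightarrow>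
    D (map (\<lambda>g x. g x + g x) gs) (\<lambda>x. f x + f x) \<phi> = 2 ^ k * D gs f \<phi>"
proof (induction gs arbitrary: f)
  case Nil
  then show ?case using homogeneous[of f 2 \<phi>] \<phi> by (simp add: mult_2[symmetric])
next
  case (Cons g gs)
  have "D (map (\<lambda>g x. g x + g x) gs) (\<lambda>x. (f x + g x) + (f x + g x)) \<phi> = 2 ^ k * D gs (\<lambda>x. f x + g x) \<phi>"
    using Cons.prems by (intro Cons.IH convex_on_add) auto
  moreover have "D (map (\<lambda>g x. g x + g x) gs) (\<lambda>x. f x + f x) \<phi> = 2 ^ k * D gs f \<phi>"
    using Cons.prems by (intro Cons.IH) auto
  ultimately show ?case by (simp add: algebra_simps)
qed

text \<open>Doubling all arguments multiplies the difference by \<open>2 ^ k\<close> by homogeneity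
  and by \<open>2 ^ N\<close> by additivity in the \<open>N\<close> slots. Changing the base point
  has no effect, since differences of order \<open>N + 1\<close> vanish. For \<open>N\<close> other
  than \<open>k\<close> the two factors differ.\<close>

lemma vanishing_pred:
  assumes v: "vanishing (Suc N) \<phi>" and N: "N \<noteq> k" and \<phi>: "Cc \<phi>"
  shows "vanishing N \<phi>"
  unfolding vanishing_def
proof (intro allI impI)
  fix gs :: "(real^'n \<Rightarrow> real) list" and f :: "real^'n \<Rightarrow> real" assume *: "length gs = N" "\<forall>g\<in>set gs. convex_on UNIV g" "convex_on UNIV f"
  have c2: "convex_on UNIV (\<lambda>x. f x + f x)" using * by (intro convex_on_add) auto
  have "2 ^ k * D gs f \<phi> = D (map (\<lambda>g x. g x + g x) gs @ []) (\<lambda>x. f x + f x) \<phi>"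
    using D_homogeneous2[OF \<phi>, of gs f] * by simp
  also have "\<dots> = 2 ^ N * D (gs @ []) (\<lambda>x. f x + f x) \<phi>"
    using D_double[OF v c2, of gs "[]"] * by simp
  also have "D (gs @ []) (\<lambda>x. f x + f x) \<phi> = D gs f \<phi>"
    using D_base[of gs \<phi> f] D_base[of gs \<phi> "\<lambda>x. f x + f x"] v * c2 by simp
  finally have "(2 ^ k - 2 ^ N) * D gs f \<phi> = 0" by (simp add: algebra_simps)
  moreover have "(2::complex) ^ k \<noteq> 2 ^ N"
  proof -
    have "(2::nat) ^ k \<noteq> 2 ^ N" using N by simp
    then show ?thesis by (metis of_nat_eq_iff of_nat_numeral of_nat_power)
  qed
  ultimately show "D gs f \<phi> = 0" by simp
qed

text \<open>From order dimension + 1, homogeneity leads down to order \<open>k + 1\<close>; when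
  \<open>k\<close> is at least the dimension, one goes up instead.\<close>

lemma vanishing_Suc_k: assumes \<phi>: "Cc \<phi>" shows "vanishing (Suc k) \<phi>"
proof -
  have n: "vanishing (Suc CARD('n)) \<phi>"
    unfolding vanishing_def using D_zero_long \<phi> by blast
  show ?thesis
  proof (cases "Suc CARD('n) \<le> Suc k")
    case True
    then show ?thesis
      by (induction rule: dec_induct) (use n vanishing_Suc in auto)
  next
    case False
    then have "Suc k \<le> Suc CARD('n)" by simp
    then show ?thesis
      by (induction rule: inc_induct) (use n vanishing_pred[OF _ _ \<phi>] in auto)
  qed
qed

text \<open>Below order \<open>k\<close> homogeneity forces vanishing all the way down to order 0,
  which is \<open>\<Psi>\<close> itself.\<close>

lemma vanishing_k_imp_zero:
  assumes v: "vanishing k \<phi>" and \<phi>: "Cc \<phi>" and f: "convex_on UNIV f"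
  shows "\<Psi> f \<phi> = 0"
proof -
  have "vanishing 0 \<phi>"
    using le0[of k] by (induction rule: inc_induct) (use v vanishing_pred[OF _ _ \<phi>] in auto)
  then show ?thesis using vanishingD[of 0 \<phi> "[]" f] f by simp
qed

end

text \<open>The list \<open>ks\<close> fixes an enumeration of the index type, because iterated
  differences and iterated derivatives are taken along lists.\<close>

locale ma_pol = ma_val k \<Psi> for k and \<Psi> :: "(real^'n \<Rightarrow> real) \<Rightarrow> (real^'n \<Rightarrow> real) \<Rightarrow> complex" +
  fixes ks :: "'k::finite list"
  assumes ks: "distinct ks" "set ks = UNIV" and k_card: "k = CARD('k)"
begin

abbreviation P :: "('k \<Rightarrow> real^'n \<Rightarrow> real) \<Rightarrow> (real^'n \<Rightarrow> real) \<Rightarrow> complex" where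
  "P fs \<phi> \<equiv> polarization (\<lambda>f. \<Psi> f \<phi>) fs"

lemma length_ks: "length ks = k"
  using distinct_card[OF ks(1)] ks(2) k_card by simp

lemma P_D: "P fs \<phi> = (1 / fact k) * D (map fs ks) (\<lambda>x. 0) \<phi>"
  unfolding polarization_def mdiff_subsets[OF ks(1)] ks(2) length_ks k_card[symmetric] by simp

lemma P_radon: assumes "\<And>j. convex_on UNIV (fs j)" shows "radon_functional (P fs)"
  unfolding P_D by (intro radon_functional_cmult D_radon) (use assms convex_on_zero in auto)

lemma P_add:
  assumes "\<And>i. convex_on UNIV (fs i)" "convex_on UNIV u" "convex_on UNIV w" "Cc \<phi>"
  shows "P (fs(j := (\<lambda>x. u x + w x))) \<phi> = P (fs(j := u)) \<phi> + P (fs(j := w)) \<phi>"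
proof -
  obtain xs ys where s: "ks = xs @ j # ys" using ks(2) by (metis UNIV_I split_list)
  then have j: "j \<notin> set xs" "j \<notin> set ys" using ks(1) by auto
  have m: "map (fs(j := v)) ks = map fs xs @ v # map fs ys" for v using j by (simp add: s)
  \<comment> \<open>The correction term of \<open>mdiff_add_slot\<close>, which has
    \<open>k + 1\<close> slots.\<close>
  have "D (map fs xs @ u # w # map fs ys) (\<lambda>x. 0) \<phi> = 0"
    using length_ks assms convex_on_zero by (intro vanishingD[OF vanishing_Suc_k]) (auto simp: s)
  then show ?thesis unfolding P_D m mdiff_add_slot by (simp add: algebra_simps)
qed

lemma P_scale:
  assumes fs: "\<And>i. convex_on UNIV (fs i)" and u: "convex_on UNIV u" and \<phi>: "Cc \<phi>" and t: "0 \<le> t"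
  shows "P (fs(j := (\<lambda>x. t * u x))) \<phi> = of_real t * P (fs(j := u)) \<phi>"
proof -
  define h where "h = (\<lambda>t. P (fs(j := (\<lambda>x. t * u x))) \<phi>)"
  have "h t = t *\<^sub>R h 1"
  proof (rule additive_continuous_linear[OF _ _ t])
    fix s t :: real assume "0 \<le> s" "0 \<le> t"
    then show "h (s + t) = h s + h t"
      unfolding h_def using P_add[of fs "\<lambda>x. s * u x" "\<lambda>x. t * u x" \<phi> j] fs u \<phi>
      by (simp add: convex_on_cmul distrib_right)
  next
    fix r t assume r: "\<And>i. 0 \<le> r i" "r \<longlonglongrightarrow> (t::real)"
    then have t: "0 \<le> t" using LIMSEQ_le_const by blast
    have c: "convex_on UNIV ((fs(j := (\<lambda>x. s * u x))) i)" if "0 \<le> s" for s i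
      using that fs u by (auto simp: convex_on_cmul)
    have "(\<lambda>i. D (map (\<lambda>l. (fs(j := (\<lambda>x. r i * u x))) l) ks) (\<lambda>x. 0) \<phi>) \<longlonglongrightarrow> D (map (fs(j := (\<lambda>x. t * u x))) ks) (\<lambda>x. 0) \<phi>"
    proof (rule D_continuous[OF \<phi>])
      fix l and K :: "(real^'n) set" assume K: "compact K"
      have "uniform_limit K (\<lambda>i x. r i * u x) (\<lambda>x. t * u x) sequentially"
      proof (rule uniform_lim_mult)
        show "uniform_limit K (\<lambda>i x. r i) (\<lambda>x. t) sequentially"
          unfolding uniform_limit_iff
        proof (intro allI impI)
          fix e :: real assume "e > 0"
          then show "\<forall>\<^sub>F i in sequentially. \<forall>x\<in>K. dist (r i) t < e"
            by (rule eventually_mono[OF tendstoD[OF r(2)]]) simp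
        qed
        have "compact (u ` K)" by (rule compact_continuous_image[OF convex_on_continuous_UNIV[OF u] K])
        then show "bounded (u ` K)" by (rule compact_imp_bounded)
      qed (auto simp: image_constant_conv intro: uniform_limit_const)
      then show "uniform_limit K (\<lambda>i. (fs(j := (\<lambda>x. r i * u x))) l) ((fs(j := (\<lambda>x. t * u x))) l) sequentially"
        by (cases "l = j") (auto intro: uniform_limit_const)
    qed (use c[OF r(1)] c[OF t] convex_on_zero in \<open>auto intro: uniform_limit_const\<close>)
    then show "(\<lambda>i. h (r i)) \<longlonglongrightarrow> h t"
      unfolding h_def P_D by (intro tendsto_mult_left)
  qed
  then show ?thesis by (simp add: h_def scaleR_conv_of_real)
qed

lemma P_local:
  assumes fs: "\<And>j. convex_on UNIV (fs j)" and gs: "\<And>j. convex_on UNIV (gs j)" and U: "open U"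
    and eq: "\<And>j x. x \<in> U \<Longrightarrow> gs j x = fs j x + (y j \<bullet> x + c j)"
    and \<phi>: "Cc \<phi>" "closure {x. \<phi> x \<noteq> 0} \<subseteq> U"
  shows "P gs \<phi> = P fs \<phi>"
proof -
  have "\<Psi> (\<lambda>x. \<Sum>j\<in>S. gs j x) \<phi> = \<Psi> (\<lambda>x. \<Sum>j\<in>S. fs j x) \<phi>" for S
  proof -
    have cf: "convex_on UNIV (\<lambda>x. \<Sum>j\<in>S. fs j x)" by (intro convex_on_sum_UNIV fs)
    have "\<Psi> (\<lambda>x. \<Sum>j\<in>S. gs j x) \<phi> = \<Psi> (\<lambda>x. (\<Sum>j\<in>S. fs j x) + ((\<Sum>j\<in>S. y j) \<bullet> x + (\<Sum>j\<in>S. c j))) \<phi>"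
    proof (rule locality[OF convex_on_sum_UNIV convex_on_add[OF cf convex_on_inner] U _ \<phi>])
      fix x assume "x \<in> U"
      then have "(\<Sum>j\<in>S. gs j x) = (\<Sum>j\<in>S. fs j x + (y j \<bullet> x + c j))" using eq by simp
      then show "(\<Sum>j\<in>S. gs j x) = (\<Sum>j\<in>S. fs j x) + ((\<Sum>j\<in>S. y j) \<bullet> x + (\<Sum>j\<in>S. c j))"
        by (simp add: sum.distrib inner_sum_left)
    qed (use gs in auto)
    then show ?thesis using epi_invariant[OF cf \<phi>(1)] by simp
  qed
  then show ?thesis unfolding polarization_def by simp
qed

lemma P_translate:
  assumes "\<And>j. convex_on UNIV (fs j)" "Cc \<phi>"
  shows "P (\<lambda>j x. fs j (x - v)) \<phi> = P fs (\<lambda>x. \<phi> (x + v))"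
  unfolding polarization_def
  using translate[OF convex_on_sum_UNIV[of _ fs] assms(2)] assms(1) by simp

end

section \<open>Bounds on small balls\<close>

lemma convex_on_Max:
  fixes f :: "'i \<Rightarrow> 'a::real_vector \<Rightarrow> real"
  assumes I: "finite I" "I \<noteq> {}" and f: "\<And>i. i \<in> I \<Longrightarrow> convex_on UNIV (f i)"
  shows "convex_on UNIV (\<lambda>x. Max ((\<lambda>i. f i x) ` I))"
proof (rule convex_onI)
  fix t :: real and x y :: 'a assume t: "0 < t" "t < 1"
  let ?M = "\<lambda>x. Max ((\<lambda>i. f i x) ` I)"
  show "?M ((1 - t) *\<^sub>R x + t *\<^sub>R y) \<le> (1 - t) * ?M x + t * ?M y"
  proof (rule Max.boundedI)
    fix a assume "a \<in> (\<lambda>i. f i ((1 - t) *\<^sub>R x + t *\<^sub>R y)) ` I"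
    then obtain i where i: "i \<in> I" "a = f i ((1 - t) *\<^sub>R x + t *\<^sub>R y)" by blast
    have "a \<le> (1 - t) * f i x + t * f i y"
      unfolding i(2) using convex_onD[OF f[OF i(1)], of t x y] t by simp
    also have "\<dots> \<le> (1 - t) * ?M x + t * ?M y"
      using t I i by (intro add_mono mult_left_mono Max_ge) auto
    finally show "a \<le> (1 - t) * ?M x + t * ?M y" .
  qed (use I in auto)
qed simp

lemma convex_on_norm_square: "convex_on UNIV (\<lambda>x::'a::real_inner. (norm x)\<^sup>2)"
proof (rule convex_onI)
  fix t :: real and x y :: 'a assume t: "0 < t" "t < 1"
  have "norm ((1 - t) *\<^sub>R x + t *\<^sub>R y) \<le> (1 - t) * norm x + t * norm y"
    using norm_triangle_ineq[of "(1 - t) *\<^sub>R x" "t *\<^sub>R y"] t by simp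
  then have "(norm ((1 - t) *\<^sub>R x + t *\<^sub>R y))\<^sup>2 \<le> ((1 - t) * norm x + t * norm y)\<^sup>2"
    by (intro power_mono) auto
  also have "\<dots> \<le> (1 - t) * (norm x)\<^sup>2 + t * (norm y)\<^sup>2"
    using convex_onD[OF convex_power2, of t "norm x" "norm y"] t by simp
  finally show "(norm ((1 - t) *\<^sub>R x + t *\<^sub>R y))\<^sup>2 \<le> (1 - t) * (norm x)\<^sup>2 + t * (norm y)\<^sup>2" .
qed simp

context ma_val begin

text \<open>Counterexamples with growing constants, divided by \<open>Suc i\<close>, still tend to 0
  locally uniformly. Continuity bounds their measures against each test function, and the uniform
  boundedness principle makes this bound uniform on the ball.\<close>

lemma uniform_bound:
  obtains M where "\<And>G \<psi> B. convex_on UNIV G \<Longrightarrow> (\<And>x. \<bar>G x\<bar> \<le> c * ((norm x)\<^sup>2 + 1)) \<Longrightarrow> Cc \<psi> \<Longrightarrow>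
     {x. \<psi> x \<noteq> 0} \<subseteq> cball 0 R \<Longrightarrow> (\<And>x. \<bar>\<psi> x\<bar> \<le> B) \<Longrightarrow> norm (\<Psi> G \<psi>) \<le> M * B"
proof (rule ccontr)
  note that' = that
  assume nothesis: "\<not> thesis"
  \<comment> \<open>Of the \<open>Suc k\<close> factors, \<open>k\<close> are consumed by
    homogeneity after division by \<open>Suc i\<close>; the remaining one diverges.\<close>
  have "\<exists>G \<psi> B. convex_on UNIV G \<and> (\<forall>x. \<bar>G x\<bar> \<le> c * ((norm x)\<^sup>2 + 1)) \<and> Cc \<psi> \<and>
     {x. \<psi> x \<noteq> 0} \<subseteq> cball 0 R \<and> (\<forall>x. \<bar>\<psi> x\<bar> \<le> B) \<and> norm (\<Psi> G \<psi>) > real (Suc i) ^ Suc k * B" for i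
  proof (rule ccontr)
    assume "\<not> ?thesis"
    then have "norm (\<Psi> G \<psi>) \<le> real (Suc i) ^ Suc k * B" if "convex_on UNIV G" "(\<And>x. \<bar>G x\<bar> \<le> c * ((norm x)\<^sup>2 + 1))" "Cc \<psi>"
       "{x. \<psi> x \<noteq> 0} \<subseteq> cball 0 R" "(\<And>x. \<bar>\<psi> x\<bar> \<le> B)" for G \<psi> B
      using that by (meson not_less)
    from that'[OF this] nothesis show False by blast
  qed
  then obtain G \<psi> B where G: "\<And>i. convex_on UNIV (G i)" "\<And>i x. \<bar>G i x\<bar> \<le> c * ((norm x)\<^sup>2 + 1)"
     and \<psi>: "\<And>i. Cc (\<psi> i)" "\<And>i. {x. \<psi> i x \<noteq> 0} \<subseteq> cball 0 R" "\<And>i x. \<bar>\<psi> i x\<bar> \<le> B i"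
     and big: "\<And>i. norm (\<Psi> (G i) (\<psi> i)) > real (Suc i) ^ Suc k * B i" by metis
  define F where "F = (\<lambda>i x. (1 / real (Suc i)) * G i x)"
  have F: "convex_on UNIV (F i)" for i unfolding F_def by (intro convex_on_cmul G) simp
  have lim: "uniform_limit K F (\<lambda>x. 0) sequentially" if K: "compact K" for K
    unfolding uniform_limit_iff
  proof (intro allI impI)
    fix e :: real assume e: "e > 0"
    obtain r where r: "\<And>x. x \<in> K \<Longrightarrow> norm x \<le> r" using compact_imp_bounded[OF K] unfolding bounded_iff by blast
    define b where "b = \<bar>c\<bar> * (r\<^sup>2 + 1)"
    obtain N :: nat where N: "real N > b / e" using reals_Archimedean2 by blast
    show "\<forall>\<^sub>F i in sequentially. \<forall>x\<in>K. dist (F i x) 0 < e"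
      unfolding eventually_sequentially
    proof (intro exI[of _ N] allI impI ballI)
      fix i x assume i: "N \<le> i" and x: "x \<in> K"
      have "\<bar>G i x\<bar> \<le> c * ((norm x)\<^sup>2 + 1)" by (rule G)
      also have "\<dots> \<le> \<bar>c\<bar> * ((norm x)\<^sup>2 + 1)" by (intro mult_right_mono) auto
      also have "\<dots> \<le> b" unfolding b_def using r[OF x] by (intro mult_left_mono add_mono power_mono) auto
      finally have "\<bar>G i x\<bar> \<le> b" .
      moreover have "b < e * real (Suc i)"
      proof -
        have "b < e * real N" using N e by (simp add: field_simps)
        also have "\<dots> \<le> e * real (Suc i)" using i e by (intro mult_left_mono) auto
        finally show ?thesis .
      qed
      ultimately have "\<bar>G i x\<bar> < e * real (Suc i)" by linarith
      then show "dist (F i x) 0 < e" by (simp add: F_def dist_real_def abs_mult field_simps)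
    qed
  qed
  have bd: "\<exists>c. \<forall>i. norm (\<Psi> (F i) \<phi>) \<le> c" if "Cc \<phi>" for \<phi>
  proof -
    have "(\<lambda>i. \<Psi> (F i) \<phi>) \<longlonglongrightarrow> \<Psi> (\<lambda>x. 0) \<phi>"
      using F convex_on_zero lim that by (intro continuous) auto
    then show ?thesis using convergent_imp_Bseq[OF convergentI] BseqE by metis
  qed
  have "\<exists>M. \<forall>i \<psi> B. Cc \<psi> \<longrightarrow> {x. \<psi> x \<noteq> 0} \<subseteq> cball 0 R \<longrightarrow> (\<forall>x. \<bar>\<psi> x\<bar> \<le> B) \<longrightarrow> norm (\<Psi> (F i) \<psi>) \<le> M * B"
  proof (rule radon_uniform_boundedness[of "\<lambda>i. \<Psi> (F i)" R])
    fix M assume *: "\<And>i \<psi> B. Cc \<psi> \<Longrightarrow> {x. \<psi> x \<noteq> 0} \<subseteq> cball 0 R \<Longrightarrow> (\<And>x. \<bar>\<psi> x\<bar> \<le> B) \<Longrightarrow> norm (\<Psi> (F i) \<psi>) \<le> M * B"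
    show ?thesis by (rule exI[of _ M], intro allI impI, rule *) simp_all
  qed (use radon[OF F] bd in auto)
  then obtain M where M: "\<forall>i \<psi> B. Cc \<psi> \<longrightarrow> {x. \<psi> x \<noteq> 0} \<subseteq> cball 0 R \<longrightarrow> (\<forall>x. \<bar>\<psi> x\<bar> \<le> B) \<longrightarrow> norm (\<Psi> (F i) \<psi>) \<le> M * B"
    by (elim exE)
  obtain i :: nat where i: "real i > M" using reals_Archimedean2 by blast
  have B: "B i \<ge> 0" using \<psi>(3)[of i 0] by linarith
  have "norm (\<Psi> (F i) (\<psi> i)) = (1 / real (Suc i)) ^ k * norm (\<Psi> (G i) (\<psi> i))"
  proof -
    have sc: "norm (\<Psi> (\<lambda>x. s * G i x) (\<psi> i)) = s ^ k * norm (\<Psi> (G i) (\<psi> i))" if "s > 0" for s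
      using homogeneous[OF G(1) that \<psi>(1), of i i] that by (simp add: norm_mult norm_power)
    show ?thesis unfolding F_def by (rule sc) simp
  qed
  also have "\<dots> > (1 / real (Suc i)) ^ k * (real (Suc i) ^ Suc k * B i)"
    by (intro mult_strict_left_mono big) simp
  finally have "norm (\<Psi> (F i) (\<psi> i)) > real (Suc i) * B i" by (simp add: power_divide)
  moreover have "norm (\<Psi> (F i) (\<psi> i)) \<le> M * B i" using M \<psi> by simp
  moreover have "M * B i \<le> real (Suc i) * B i" using i B by (intro mult_right_mono) auto
  ultimately show False by linarith
qed

end

section \<open>Gluing copies along a grid\<close>

definition grid :: "real \<Rightarrow> nat \<Rightarrow> (real^'n) set" where
  "grid s m = (\<lambda>h. \<chi> i. s * real (h i)) ` (PiE UNIV (\<lambda>_. {..m}))"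

lemma grid_card: assumes "s > 0" shows "card (grid s m :: (real^'n) set) = Suc m ^ CARD('n)"
proof -
  have "inj_on (\<lambda>h::'n \<Rightarrow> nat. \<chi> i. s * real (h i)) (PiE UNIV (\<lambda>_. {..m}))"
    using assms by (intro inj_onI) (auto simp: vec_eq_iff)
  then show ?thesis unfolding grid_def by (subst card_image) (simp_all add: card_PiE)
qed

lemma grid_finite: "finite (grid s m)" unfolding grid_def by (intro finite_imageI finite_PiE) auto

lemma grid_norm: assumes "p \<in> grid s m" "s > 0" shows "norm (p :: real^'n) \<le> real CARD('n) * (s * real m)"
proof -
  obtain h where h: "\<And>i. h i \<le> m" "p = (\<chi> i. s * real (h i))" using assms(1) unfolding grid_def by (auto simp: PiE_def Pi_def)
  have "norm p \<le> (\<Sum>i\<in>UNIV. \<bar>p $ i\<bar>)" by (rule norm_le_l1_cart)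
  also have "\<dots> \<le> (\<Sum>i\<in>(UNIV::'n set). s * real m)"
    using h assms(2) by (intro sum_mono) (simp add: abs_mult)
  finally show ?thesis by simp
qed

lemma grid_dist:
  assumes "p \<in> grid s m" "q \<in> grid s m" "p \<noteq> (q :: real^'n)" "s > 0" shows "s \<le> norm (p - q)"
proof -
  obtain h h' where h: "p = (\<chi> i. s * real (h i))" "q = (\<chi> i. s * real (h' i))"
    using assms(1,2) unfolding grid_def by auto
  obtain i where i: "h i \<noteq> h' i" using assms(3) h by (auto simp: vec_eq_iff)
  have "s * 1 \<le> s * \<bar>real (h i) - real (h' i)\<bar>" using i assms(4) by (intro mult_left_mono) auto
  also have "\<dots> = \<bar>(p - q) $ i\<bar>" using assms(4) by (simp add: h abs_mult right_diff_distrib[symmetric])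
  also have "\<dots> \<le> norm (p - q)" by (rule component_le_norm_cart)
  finally show ?thesis by simp
qed

context ma_val begin

text \<open>Copies of \<open>F\<close> around the points of a grid of spacing \<open>5 * d\<close> are glued, by taking maxima, into a convex
  function that stays within a fixed distance of a fixed quadratic function. The measure of the glued function
  on a unit cube is bounded, and it contains about \<open>d\<close> to the power \<open>- n\<close> copies of \<open>\<Psi> F\<close>.\<close>
lemma lattice_bound_pos:
  assumes C: "C > 0"
  obtains K where "K \<ge> 0" "\<And>d F \<phi> B. 0 < d \<Longrightarrow> d \<le> 1 \<Longrightarrow> convex_on UNIV F \<Longrightarrow> (\<And>x. 0 \<le> F x) \<Longrightarrow> (\<And>x. F x \<le> C * (norm x)\<^sup>2) \<Longrightarrow>
     Cc \<phi> \<Longrightarrow> {x. \<phi> x \<noteq> 0} \<subseteq> cball 0 d \<Longrightarrow> (\<And>x. \<bar>\<phi> x\<bar> \<le> B) \<Longrightarrow> norm (\<Psi> F \<phi>) \<le> K * d ^ CARD('n) * B"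
proof -
  \<comment> \<open>The glued function is at most \<open>2 * C * (norm x)\<^sup>2 + 8 * C\<close>.
    Grid points have norm at most \<open>CARD('n)\<close>, and the bumps around them reach at most 1
    further.\<close>
  obtain M where M: "\<And>G \<psi> B. convex_on UNIV G \<Longrightarrow> (\<And>x. \<bar>G x\<bar> \<le> (8 * C) * ((norm x)\<^sup>2 + 1)) \<Longrightarrow> Cc \<psi> \<Longrightarrow>
     {x. \<psi> x \<noteq> 0} \<subseteq> cball 0 (real CARD('n) + 1) \<Longrightarrow> (\<And>x. \<bar>\<psi> x\<bar> \<le> B) \<Longrightarrow> norm (\<Psi> G \<psi>) \<le> M * B"
    by (rule uniform_bound[of "8 * C" "real CARD('n) + 1"]) blast
  show thesis
  proof (rule that[of "max M 0 * 5 ^ CARD('n)"])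
    fix d :: real and F \<phi> :: "real^'n \<Rightarrow> real" and B :: real
    assume d: "0 < d" "d \<le> 1" and F: "convex_on UNIV F" "\<And>x. 0 \<le> F x" "\<And>x. F x \<le> C * (norm x)\<^sup>2"
      and \<phi>: "Cc \<phi>" "{x. \<phi> x \<noteq> 0} \<subseteq> cball 0 d" "\<And>x. \<bar>\<phi> x\<bar> \<le> B"
    have B: "B \<ge> 0" using \<phi>(3)[of 0] by linarith
    \<comment> \<open>The largest \<open>m\<close> for which the grid fits into the unit cube; the
      \<open>Suc m\<close> points on each axis outnumber \<open>1 / (5 * d)\<close> even when
      \<open>m = 0\<close>.\<close>
    define m where "m = nat \<lfloor>1 / (5 * d)\<rfloor>"
    define X where "X = (grid (5 * d) m :: (real^'n) set)"
    have X: "finite X" "card X = Suc m ^ CARD('n)" unfolding X_def using d by (simp_all add: grid_finite grid_card)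
    have Xd: "5 * d \<le> norm (p - q)" if "p \<in> X" "q \<in> X" "p \<noteq> q" for p q
      using that grid_dist d(1) unfolding X_def by (metis mult_pos_pos zero_less_numeral)
    have m1: "real m \<le> 1 / (5 * d)" "1 / (5 * d) < real (Suc m)" 
    proof -
      have "real m = of_int \<lfloor>1 / (5 * d)\<rfloor>" using d by (simp add: m_def)
      moreover have "real (Suc m) = real m + 1" by simp
      ultimately show "real m \<le> 1 / (5 * d)" "1 / (5 * d) < real (Suc m)"
        using of_int_floor_le[of "1 / (5 * d)"] real_of_int_floor_add_one_gt[of "1 / (5 * d)"] by linarith+
    qed
    have Xn: "norm p \<le> real CARD('n)" if "p \<in> X" for p
    proof -
      have "norm p \<le> real CARD('n) * (5 * d * real m)" using grid_norm[of p "5 * d" m] that d(1) by (simp add: X_def)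
      also have "\<dots> \<le> real CARD('n) * (5 * d * (1 / (5 * d)))" using m1(1) d(1) by (intro mult_left_mono) auto
      finally show ?thesis using d(1) by simp
    qed
    \<comment> \<open>The added affine function is the tangent of
      \<open>2 * C * (norm x)\<^sup>2\<close> at \<open>p\<close>, raised by
      \<open>8 * C * d\<^sup>2\<close>. Within distance \<open>2 * d\<close> of \<open>p\<close>
      this lies above the quadratic, while from distance \<open>3 * d\<close> on \<open>f p\<close>
      lies below it, because \<open>F\<close> makes up for at most half of the tangent's gap. Hence
      the spacing \<open>5 * d\<close>.\<close>
    define f where "f = (\<lambda>p x. F (x - p) + ((4 * C) *\<^sub>R p \<bullet> x + (8 * C * d\<^sup>2 - 2 * C * (norm p)\<^sup>2)))"
    have f_eq: "f p x = 2 * C * (norm x)\<^sup>2 + (F (x - p) - 2 * C * (norm (x - p))\<^sup>2 + 8 * C * d\<^sup>2)" for p x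
      unfolding f_def by (simp add: power2_norm_eq_inner inner_diff_left inner_diff_right inner_commute algebra_simps)
    define I where "I = insert None (Some ` X)"
    define G0 where "G0 = (\<lambda>i x. case i of None \<Rightarrow> 2 * C * (norm x)\<^sup>2 | Some p \<Rightarrow> f p x)"
    define G where "G = (\<lambda>x. Max ((\<lambda>i. G0 i x) ` I))"
    have I: "finite I" "I \<noteq> {}" unfolding I_def using X by auto
    have fc: "convex_on UNIV (f p)" for p unfolding f_def
      by (rule convex_on_add[OF convex_on_translate[OF F(1)] convex_on_inner])
    have Gc: "convex_on UNIV G" unfolding G_def
    proof (rule convex_on_Max[OF I])
      fix i show "convex_on UNIV (G0 i)"
        using fc C by (cases i) (auto simp: G0_def intro!: convex_on_cmul convex_on_norm_square)
    qed
    have f_le: "f p x \<le> 2 * C * (norm x)\<^sup>2 + 8 * C * d\<^sup>2" for p x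
    proof -
      have "F (x - p) \<le> 2 * C * (norm (x - p))\<^sup>2"
        using F(3)[of "x - p"] mult_nonneg_nonneg[OF less_imp_le[OF C] zero_le_power2[of "norm (x - p)"]] by linarith
      then show ?thesis unfolding f_eq by simp
    qed
    have Gl: "2 * C * (norm x)\<^sup>2 \<le> G x" for x
      unfolding G_def
    proof (rule Max_ge)
      show "2 * C * (norm x)\<^sup>2 \<in> (\<lambda>i. G0 i x) ` I"
        by (rule image_eqI[of _ _ None]) (simp_all add: I_def G0_def)
    qed (use I in simp)
    have Gu: "G x \<le> 2 * C * (norm x)\<^sup>2 + 8 * C * d\<^sup>2" for x
      unfolding G_def
    proof (rule Max.boundedI)
      fix a assume "a \<in> (\<lambda>i. G0 i x) ` I"
      then show "a \<le> 2 * C * (norm x)\<^sup>2 + 8 * C * d\<^sup>2"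
        using f_le C by (auto simp: I_def G0_def)
    qed (use I in auto)
    have Gb: "\<bar>G x\<bar> \<le> (8 * C) * ((norm x)\<^sup>2 + 1)" for x
    proof -
      have "d\<^sup>2 \<le> 1" using d by (simp add: power_le_one)
      then have "8 * C * d\<^sup>2 \<le> 8 * C * 1" using C by (intro mult_left_mono) auto
      moreover have "0 \<le> C * (norm x)\<^sup>2" using C by simp
      moreover have "(8 * C) * ((norm x)\<^sup>2 + 1) = 8 * (C * (norm x)\<^sup>2) + 8 * C" by (simp add: algebra_simps)
      ultimately show ?thesis using Gl[of x] Gu[of x] by linarith
    qed
    have Gf: "G x = f p x" if p: "p \<in> X" and x: "x \<in> ball p (2 * d)" for p x
      unfolding G_def
    proof (rule Max_eqI)
      have y: "norm (x - p) < 2 * d" using x by (simp add: dist_norm norm_minus_commute)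
      have "(norm (x - p))\<^sup>2 \<le> (2 * d)\<^sup>2" using y by (intro power_mono) auto
      then have "2 * C * (norm (x - p))\<^sup>2 \<le> 8 * C * d\<^sup>2" using C by (simp add: power2_eq_square)
      then have pQ: "2 * C * (norm x)\<^sup>2 \<le> f p x" unfolding f_eq using F(2)[of "x - p"] by linarith
      fix a assume "a \<in> (\<lambda>i. G0 i x) ` I"
      then consider "a = 2 * C * (norm x)\<^sup>2" | q where "q \<in> X" "a = f q x" by (auto simp: I_def G0_def)
      then show "a \<le> f p x"
      proof cases
        case (2 q)
        show ?thesis
        proof (cases "q = p")
          case False
          have "5 * d \<le> norm (p - q)" using Xd[OF p 2(1)] False by auto
          then have "3 * d \<le> norm (x - q)" using y norm_triangle_ineq[of "p - x" "x - q"] by (simp add: norm_minus_commute)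
          then have "(3 * d)\<^sup>2 \<le> (norm (x - q))\<^sup>2" using d by (intro power_mono) auto
          then have "C * (9 * d\<^sup>2) \<le> C * (norm (x - q))\<^sup>2" using C by (simp add: power_mult_distrib)
          moreover have "0 \<le> C * d\<^sup>2" using C by simp
          ultimately have "f q x \<le> 2 * C * (norm x)\<^sup>2"
            unfolding f_eq using F(3)[of "x - q"] by (simp add: algebra_simps)
          then show ?thesis using pQ 2 by simp
        qed (use 2 in simp)
      qed (use pQ in simp)
    next
      show "f p x \<in> (\<lambda>i. G0 i x) ` I" using p by (auto simp: I_def G0_def intro!: image_eqI[of _ _ "Some p"])
    qed (use I in auto)
    have tr: "Cc (\<lambda>x. \<phi> (x - p))" for p using Cc_translate[OF \<phi>(1), of "- p"] by simp
    have one: "\<Psi> G (\<lambda>x. \<phi> (x - p)) = \<Psi> F \<phi>" if p: "p \<in> X" for p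
    proof -
      have "{x. \<phi> (x - p) \<noteq> 0} \<subseteq> cball p d" using \<phi>(2) by (auto simp: dist_norm norm_minus_commute)
      then have "closure {x. \<phi> (x - p) \<noteq> 0} \<subseteq> cball p d" by (rule closure_minimal) simp
      also have "\<dots> \<subseteq> ball p (2 * d)" using d by auto
      finally have "\<Psi> G (\<lambda>x. \<phi> (x - p)) = \<Psi> (f p) (\<lambda>x. \<phi> (x - p))"
        using Gf[OF p] by (intro locality[OF Gc fc open_ball _ tr]) auto
      also have "\<dots> = \<Psi> (\<lambda>x. F (x - p)) (\<lambda>x. \<phi> (x - p))"
        unfolding f_def by (rule epi_invariant[OF convex_on_translate[OF F(1)] tr])
      also have "\<dots> = \<Psi> F \<phi>" using translate[OF F(1) tr, of p p] by simp
      finally show ?thesis .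
    qed
    let ?\<psi> = "\<lambda>x. \<Sum>p\<in>X. \<phi> (x - p)"
    have "\<Psi> G ?\<psi> = (\<Sum>p\<in>X. \<Psi> G (\<lambda>x. \<phi> (x - p)))" by (rule radon_sum[OF radon[OF Gc] X(1) tr])
    also have "\<dots> = of_nat (card X) * \<Psi> F \<phi>" using one by simp
    finally have sumX: "\<Psi> G ?\<psi> = of_nat (card X) * \<Psi> F \<phi>" .
    have "norm (\<Psi> G ?\<psi>) \<le> M * B"
    proof (rule M[OF Gc Gb])
      show "Cc ?\<psi>" by (rule Cc_sum[OF tr])
      show "{x. ?\<psi> x \<noteq> 0} \<subseteq> cball 0 (real CARD('n) + 1)"
      proof
        fix x assume "x \<in> {x. ?\<psi> x \<noteq> 0}"
        then have "(\<Sum>p\<in>X. \<phi> (x - p)) \<noteq> 0" by simp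
        then obtain p where p: "p \<in> X" "\<phi> (x - p) \<noteq> 0" by (rule sum.not_neutral_contains_not_neutral)
        then have "norm (x - p) \<le> d" using \<phi>(2) by auto
        then show "x \<in> cball 0 (real CARD('n) + 1)" using Xn[OF p(1)] d(2) norm_triangle_ineq[of p "x - p"] by simp
      qed
      fix x
      show "\<bar>?\<psi> x\<bar> \<le> B"
      proof (cases "\<exists>p\<in>X. \<phi> (x - p) \<noteq> 0")
        case True
        then obtain p where p: "p \<in> X" "\<phi> (x - p) \<noteq> 0" by blast
        have "\<phi> (x - q) = 0" if "q \<in> X" "q \<noteq> p" for q
        proof (rule ccontr)
          assume "\<phi> (x - q) \<noteq> 0"
          then have "norm (x - q) \<le> d" "norm (x - p) \<le> d" using \<phi>(2) p by auto
          then have "norm (p - q) \<le> 2 * d" using norm_triangle_ineq[of "p - x" "x - q"] by (simp add: norm_minus_commute)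
          then show False using Xd[OF p(1) that(1)] that(2) d(1) by auto
        qed
        then have "(\<Sum>q\<in>X. \<phi> (x - q)) = \<phi> (x - p)"
          using sum.remove[OF X(1) p(1), of "\<lambda>q. \<phi> (x - q)"] by simp
        then show ?thesis using \<phi>(3) by simp
      next
        case False then show ?thesis using B by simp
      qed
    qed
    also have "M * B \<le> max M 0 * B" using B by (intro mult_right_mono) auto
    finally have le: "real (card X) * norm (\<Psi> F \<phi>) \<le> max M 0 * B" unfolding sumX by (simp add: norm_mult)
    have "(1 / (5 * d)) ^ CARD('n) \<le> real (card X)"
      unfolding X(2) of_nat_power using m1(2) d(1) by (intro power_mono) auto
    then have "(1 / (5 * d)) ^ CARD('n) * norm (\<Psi> F \<phi>) \<le> max M 0 * B"
      using le mult_right_mono[of "(1 / (5 * d)) ^ CARD('n)" "real (card X)" "norm (\<Psi> F \<phi>)"] by simp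
    then have "(5 * d) ^ CARD('n) * ((1 / (5 * d)) ^ CARD('n) * norm (\<Psi> F \<phi>)) \<le> (5 * d) ^ CARD('n) * (max M 0 * B)"
      using d(1) by (intro mult_left_mono) auto
    moreover have "(5 * d) ^ CARD('n) * (1 / (5 * d)) ^ CARD('n) = 1"
      unfolding power_mult_distrib[symmetric] using d(1) by simp
    then have "(5 * d) ^ CARD('n) * ((1 / (5 * d)) ^ CARD('n) * norm (\<Psi> F \<phi>)) = norm (\<Psi> F \<phi>)"
      by (simp only: mult.assoc[symmetric] mult_1)
    ultimately have "norm (\<Psi> F \<phi>) \<le> (5 * d) ^ CARD('n) * (max M 0 * B)" by (simp only:)
    also have "\<dots> = max M 0 * 5 ^ CARD('n) * d ^ CARD('n) * B"
      by (simp only: power_mult_distrib mult_ac)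
    finally show "norm (\<Psi> F \<phi>) \<le> max M 0 * 5 ^ CARD('n) * d ^ CARD('n) * B" .
  qed simp
qed

end

section \<open>Quadratic functions\<close>

text \<open>Uniqueness of Lebesgue measure up to a factor. By invariance the mollified value of
  \<open>\<phi>\<close> is \<open>L (moll d)\<close> times the integral of \<open>\<phi>\<close>;
  taking \<open>moll 1\<close> for \<open>\<phi>\<close> shows that the factors tend to
  \<open>L (moll 1)\<close>.\<close>

lemma radon_translation_invariant:
  fixes L :: "(real^'n \<Rightarrow> real) \<Rightarrow> complex"
  assumes L: "radon_functional L" and inv: "\<And>\<phi> y. Cc \<phi> \<Longrightarrow> L (\<lambda>x. \<phi> (x - y)) = L \<phi>" and \<phi>: "Cc \<phi>"
  shows "L \<phi> = L (moll 1) * of_real (LINT x|lborel. \<phi> x)"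
proof -
  define c where "c = (\<lambda>d. L (moll d))"
  define I where "I = complex_of_real (LINT x|lborel. \<phi> x)"
  have conv: "\<exists>d0>0. \<forall>d. 0 < d \<longrightarrow> d < d0 \<longrightarrow> norm (c d * of_real (LINT x|lborel. \<psi> x) - L \<psi>) \<le> e"
    if \<psi>: "Cc \<psi>" and e: "e > 0" for \<psi> e
  proof -
    obtain d0 where d0: "d0 > 0" "\<And>d. 0 < d \<Longrightarrow> d < d0 \<Longrightarrow> norm ((LINT y|lborel. complex_of_real (\<psi> y) * L (\<lambda>x. moll d (x - y))) - L \<psi>) \<le> e"
      by (rule radon_mollify[OF L \<psi> e]) blast
    have "(LINT y|lborel. complex_of_real (\<psi> y) * L (\<lambda>x. moll d (x - y))) = c d * of_real (LINT x|lborel. \<psi> x)" if "0 < d" for d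
      unfolding inv[OF moll_Cc[OF that]] c_def by (simp add: mult.commute)
    then show ?thesis using d0 by (intro exI[of _ d0]) simp
  qed
  have "norm (L \<phi> - c 1 * I) \<le> 0 + e" if e: "e > 0" for e
  proof -
    define e' where "e' = e / (1 + norm I)"
    have e': "e' > 0" using e by (simp add: e'_def add_pos_nonneg)
    obtain d1 where d1: "d1 > 0" "\<And>d. 0 < d \<Longrightarrow> d < d1 \<Longrightarrow> norm (c d * I - L \<phi>) \<le> e'"
      using conv[OF \<phi> e'] unfolding I_def by blast
    obtain d2 where d2: "d2 > 0" "\<And>d. 0 < d \<Longrightarrow> d < d2 \<Longrightarrow> norm (c d * 1 - c 1) \<le> e'"
      using conv[OF moll_Cc[of 1] e'] moll_integral[of 1, where 'n='n] unfolding c_def by auto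
    define d where "d = min d1 d2 / 2"
    have d: "0 < d" "d < d1" "d < d2" using d1 d2 by (auto simp: d_def)
    have "L \<phi> - c 1 * I = (c d - c 1) * I - (c d * I - L \<phi>)" by (simp add: algebra_simps)
    also have "norm \<dots> \<le> norm (c d - c 1) * norm I + norm (c d * I - L \<phi>)"
      using norm_triangle_ineq4[of "(c d - c 1) * I" "c d * I - L \<phi>"] by (simp add: norm_mult)
    also have "\<dots> \<le> e' * norm I + e'"
      using d1(2)[OF d(1,2)] d2(2)[OF d(1,3)] by (intro add_mono mult_right_mono) auto
    also have "\<dots> = (1 + norm I) * e'" by (simp add: algebra_simps)
    also have "\<dots> = e" unfolding e'_def using add_pos_nonneg[of 1 "norm I"] by simp
    finally show ?thesis by simp
  qed
  then have "norm (L \<phi> - c 1 * I) \<le> 0" by (rule field_le_epsilon)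
  then show ?thesis by (simp add: c_def I_def)
qed

text \<open>The factor \<open>1/2\<close> makes a symmetric \<open>A\<close> the Hessian.\<close>

definition quad :: "('n \<Rightarrow> 'n \<Rightarrow> real) \<Rightarrow> real^'n \<Rightarrow> real" where
  "quad A x = (\<Sum>a\<in>UNIV. \<Sum>b\<in>UNIV. 1/2 * A a b * (x $ a * x $ b))"

text \<open>Convex building blocks of quadratic forms: \<open>x $ a * x $ b\<close> is the ridge
  with sign \<open>True\<close> minus the ridge with sign \<open>False\<close>.\<close>

definition ridge :: "'n \<times> 'n \<times> bool \<Rightarrow> real^'n \<Rightarrow> real" where
  "ridge i x = (case i of (a, b, s) \<Rightarrow> ((if s then x $ a + x $ b else x $ a - x $ b))\<^sup>2 / 4)"

definition ridge_coeff :: "('n \<Rightarrow> 'n \<Rightarrow> real) \<Rightarrow> 'n \<times> 'n \<times> bool \<Rightarrow> real" where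
  "ridge_coeff A i = (case i of (a, b, s) \<Rightarrow> 1/2 * A a b * (if s then 1 else -1))"

lemma quad_ridge: "quad A x = (\<Sum>i\<in>UNIV. ridge_coeff A i * ridge i x)"
proof -
  have "(\<Sum>i\<in>UNIV. ridge_coeff A i * ridge i x) = (\<Sum>a\<in>UNIV. \<Sum>b\<in>UNIV. \<Sum>s\<in>UNIV. ridge_coeff A (a, b, s) * ridge (a, b, s) x)"
    unfolding UNIV_Times_UNIV[symmetric] sum.cartesian_product' by simp
  also have "\<dots> = quad A x" unfolding quad_def
  proof (intro sum.cong refl)
    fix a b
    show "(\<Sum>s\<in>UNIV. ridge_coeff A (a, b, s) * ridge (a, b, s) x) = 1/2 * A a b * (x $ a * x $ b)"
      by (simp add: UNIV_bool ridge_coeff_def ridge_def power2_eq_square field_simps)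
  qed
  finally show ?thesis by simp
qed

lemma ridge_convex: "convex_on UNIV (ridge (i :: 'n::finite \<times> 'n \<times> bool))"
proof -
  obtain a b s where i: "i = (a, b, s)" by (cases i)
  define l where "l = (\<lambda>x::real^'n. if s then x $ a + x $ b else x $ a - x $ b)"
  have "convex_on UNIV (\<lambda>x. (1/4) * (l x)\<^sup>2)"
  proof (rule convex_on_cmul)
    show "convex_on UNIV (\<lambda>x. (l x)\<^sup>2)"
    proof (rule convex_onI)
      fix t :: real and x y assume t: "0 < t" "t < 1"
      have "l ((1 - t) *\<^sub>R x + t *\<^sub>R y) = (1 - t) * l x + t * l y"
        unfolding l_def by (cases s) (simp_all add: algebra_simps)
      then show "(l ((1 - t) *\<^sub>R x + t *\<^sub>R y))\<^sup>2 \<le> (1 - t) * (l x)\<^sup>2 + t * (l y)\<^sup>2"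
        using convex_onD[OF convex_power2, of t "l x" "l y"] t by simp
    qed simp
  qed simp
  moreover have "ridge i = (\<lambda>x. (1/4) * (l x)\<^sup>2)" by (auto simp: ridge_def i l_def)
  ultimately show ?thesis by simp
qed

text \<open>Translation changes a quadratic function by an affine one, to which
  \<open>\<Psi>\<close> is blind; this is the source of translation invariant measures.\<close>

lemma quad_shift:
  "\<exists>y c. \<forall>x. quad A (x - v) = quad A x + (y \<bullet> x + c)"
proof (intro exI allI)
  fix x
  show "quad A (x - v) = quad A x + ((\<chi> a. - (\<Sum>b\<in>UNIV. 1/2 * (A a b + A b a) * v $ b)) \<bullet> x + quad A v)"
  proof -
    have "(\<chi> a. - (\<Sum>b\<in>UNIV. 1/2 * (A a b + A b a) * v $ b)) \<bullet> x = - (\<Sum>a\<in>UNIV. \<Sum>b\<in>UNIV. 1/2 * (A a b + A b a) * (v $ b * x $ a))"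
      by (simp add: inner_vec_def sum_distrib_right sum_distrib_left mult_ac sum_negf)
    also have "(\<Sum>a\<in>UNIV. \<Sum>b\<in>UNIV. 1/2 * (A a b + A b a) * (v $ b * x $ a))
        = (\<Sum>a\<in>UNIV. \<Sum>b\<in>UNIV. 1/2 * A a b * (v $ b * x $ a)) + (\<Sum>a\<in>UNIV. \<Sum>b\<in>UNIV. 1/2 * A b a * (v $ b * x $ a))"
      by (simp add: sum.distrib[symmetric] algebra_simps)
    also have "(\<Sum>a\<in>UNIV. \<Sum>b\<in>UNIV. 1/2 * A b a * (v $ b * x $ a)) = (\<Sum>a\<in>UNIV. \<Sum>b\<in>UNIV. 1/2 * A a b * (v $ a * x $ b))"
      by (rule sum.swap)
    finally have "(\<chi> a. - (\<Sum>b\<in>UNIV. 1/2 * (A a b + A b a) * v $ b)) \<bullet> x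
       = - (\<Sum>a\<in>UNIV. \<Sum>b\<in>UNIV. 1/2 * A a b * (v $ b * x $ a)) - (\<Sum>a\<in>UNIV. \<Sum>b\<in>UNIV. 1/2 * A a b * (v $ a * x $ b))" by simp
    moreover have "quad A (x - v) = quad A x + quad A v - (\<Sum>a\<in>UNIV. \<Sum>b\<in>UNIV. 1/2 * A a b * (v $ b * x $ a)) - (\<Sum>a\<in>UNIV. \<Sum>b\<in>UNIV. 1/2 * A a b * (v $ a * x $ b))"
      unfolding quad_def by (simp add: sum.distrib[symmetric] sum_subtractf[symmetric] algebra_simps)
    ultimately show ?thesis by simp
  qed
qed

lemma sum_fun_triple:
  fixes G :: "('k::finite \<Rightarrow> 'a::finite \<times> 'b::finite \<times> 'c::finite) \<Rightarrow> complex"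
  shows "(\<Sum>h\<in>UNIV. G h) = (\<Sum>a\<in>UNIV. \<Sum>b\<in>UNIV. \<Sum>s\<in>UNIV. G (\<lambda>j. (a j, b j, s j)))"
proof -
  have "(\<Sum>a\<in>UNIV. \<Sum>b\<in>UNIV. \<Sum>s\<in>UNIV. G (\<lambda>j. (a j, b j, s j)))
      = (\<Sum>z\<in>UNIV. G (\<lambda>j. (fst z j, fst (snd z) j, snd (snd z) j)))"
    unfolding UNIV_Times_UNIV[symmetric] sum.cartesian_product' by simp
  also have "\<dots> = (\<Sum>h\<in>UNIV. G h)"
    by (rule sum.reindex_bij_witness[of _ "\<lambda>h. (\<lambda>j. fst (h j), \<lambda>j. fst (snd (h j)), \<lambda>j. snd (snd (h j)))" "\<lambda>z j. (fst z j, fst (snd z) j, snd (snd z) j)"]) auto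
  finally show ?thesis by simp
qed

section \<open>Small-ball bounds and multilinear expansion of the polarization\<close>

context ma_pol begin

lemma P_bound:
  assumes C: "C > 0"
  obtains K where "K \<ge> 0" "\<And>d fs \<phi> B. 0 < d \<Longrightarrow> d \<le> 1 \<Longrightarrow> (\<And>j. convex_on UNIV (fs j)) \<Longrightarrow> (\<And>j x. 0 \<le> fs j x) \<Longrightarrow>
     (\<And>j x. fs j x \<le> C * (norm x)\<^sup>2) \<Longrightarrow> Cc \<phi> \<Longrightarrow> {x. \<phi> x \<noteq> 0} \<subseteq> cball 0 d \<Longrightarrow> (\<And>x. \<bar>\<phi> x\<bar> \<le> B) \<Longrightarrow>
     norm (P fs \<phi>) \<le> K * d ^ CARD('n) * B"
proof -
  have kC: "real k * C > 0" using k_pos C by simp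
  obtain K0 where K0: "K0 \<ge> 0" "\<And>d F \<phi> B. 0 < d \<Longrightarrow> d \<le> 1 \<Longrightarrow> convex_on UNIV F \<Longrightarrow> (\<And>x. 0 \<le> F x) \<Longrightarrow> (\<And>x. F x \<le> real k * C * (norm x)\<^sup>2) \<Longrightarrow>
     Cc \<phi> \<Longrightarrow> {x. \<phi> x \<noteq> 0} \<subseteq> cball 0 d \<Longrightarrow> (\<And>x. \<bar>\<phi> x\<bar> \<le> B) \<Longrightarrow> norm (\<Psi> F \<phi>) \<le> K0 * d ^ CARD('n) * B"
    by (rule lattice_bound_pos[OF kC]) blast
  show thesis
  proof (rule that[of "1 / fact k * (2 ^ k * K0)"])
    fix d B :: real and fs :: "'k \<Rightarrow> real^'n \<Rightarrow> real" and \<phi> :: "real^'n \<Rightarrow> real"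
    assume d: "0 < d" "d \<le> 1" and fs: "\<And>j. convex_on UNIV (fs j)" "\<And>j x. 0 \<le> fs j x" "\<And>j x. fs j x \<le> C * (norm x)\<^sup>2"
      and \<phi>: "Cc \<phi>" "{x. \<phi> x \<noteq> 0} \<subseteq> cball 0 d" "\<And>x. \<bar>\<phi> x\<bar> \<le> B"
    have S: "norm (\<Psi> (\<lambda>x. \<Sum>j\<in>S. fs j x) \<phi>) \<le> K0 * d ^ CARD('n) * B" for S
    proof (rule K0(2)[OF d convex_on_sum_UNIV[OF fs(1)] sum_nonneg[OF fs(2)] _ \<phi>])
      fix x
      have "(\<Sum>j\<in>S. fs j x) \<le> (\<Sum>j\<in>UNIV. fs j x)" by (rule sum_mono2) (auto simp: fs)
      also have "\<dots> \<le> (\<Sum>j\<in>(UNIV::'k set). C * (norm x)\<^sup>2)" by (rule sum_mono) (rule fs)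
      also have "\<dots> = real k * C * (norm x)\<^sup>2" by (simp add: k_card)
      finally show "(\<Sum>j\<in>S. fs j x) \<le> real k * C * (norm x)\<^sup>2" .
    qed
    have "norm (P fs \<phi>) = 1 / fact k * norm (\<Sum>S\<in>Pow (UNIV :: 'k set). (-1) ^ (CARD('k) - card S) * \<Psi> (\<lambda>x. \<Sum>j\<in>S. fs j x) \<phi>)"
      unfolding polarization_def k_card by (simp add: norm_mult norm_divide)
    also have "\<dots> \<le> 1 / fact k * (\<Sum>S\<in>Pow (UNIV :: 'k set). K0 * d ^ CARD('n) * B)"
    proof (intro mult_left_mono sum_norm_le)
      fix S :: "'k set"
      show "norm ((-1) ^ (CARD('k) - card S) * \<Psi> (\<lambda>x. \<Sum>j\<in>S. fs j x) \<phi>) \<le> K0 * d ^ CARD('n) * B"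
        using S[of S] by (simp add: norm_mult norm_power)
    qed simp
    also have "\<dots> = 1 / fact k * (2 ^ k * K0) * d ^ CARD('n) * B"
      by (simp add: card_Pow k_card)
    finally show "norm (P fs \<phi>) \<le> 1 / fact k * (2 ^ k * K0) * d ^ CARD('n) * B" .
  qed (use K0 in simp)
qed

lemma P_nonneg_sum:
  assumes fs: "\<And>i. convex_on UNIV (fs i)" and v: "\<And>i. convex_on UNIV (v i)" and \<phi>: "Cc \<phi>" 
  shows "finite I \<Longrightarrow> (\<And>i. i \<in> I \<Longrightarrow> 0 \<le> c i) \<Longrightarrow>
    P (fs(j := (\<lambda>x. \<Sum>i\<in>I. c i * v i x))) \<phi> = (\<Sum>i\<in>I. of_real (c i) * P (fs(j := v i)) \<phi>)"
proof (induction I rule: finite_induct)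
  case empty
  show ?case using P_scale[where fs = fs and t = 0 and j = j, OF fs convex_on_zero \<phi>] by (simp add: fun_upd_def)
next
  case (insert i I)
  have "P (fs(j := (\<lambda>x. c i * v i x + (\<Sum>i\<in>I. c i * v i x)))) \<phi>
     = P (fs(j := (\<lambda>x. c i * v i x))) \<phi> + P (fs(j := (\<lambda>x. \<Sum>i\<in>I. c i * v i x))) \<phi>"
    using insert v by (intro P_add fs \<phi> convex_on_sum_UNIV convex_on_cmul) auto
  also have "P (fs(j := (\<lambda>x. c i * v i x))) \<phi> = of_real (c i) * P (fs(j := v i)) \<phi>"
    using insert.prems by (intro P_scale fs v \<phi>) auto
  finally show ?case using insert by (simp add: fun_upd_def)
qed

text \<open>\<open>P\<close> is additive on convex functions only, so the terms with negative
  coefficients are added to \<open>u\<close>; both sides of the resulting equation are sums of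
  convex functions.\<close>

lemma P_linear_sum:
  assumes fs: "\<And>i. convex_on UNIV (fs i)" and v: "\<And>i. convex_on UNIV (v i)" and \<phi>: "Cc \<phi>"
    and I: "finite I" and u: "convex_on UNIV u" "\<And>x. u x = (\<Sum>i\<in>I. c i * v i x)"
  shows "P (fs(j := u)) \<phi> = (\<Sum>i\<in>I. of_real (c i) * P (fs(j := v i)) \<phi>)"
proof -
  let ?p = "\<lambda>i. max (c i) 0" and ?m = "\<lambda>i. max (- c i) 0"
  have c: "c i = ?p i - ?m i" for i by simp
  have m: "convex_on UNIV (\<lambda>x. \<Sum>i\<in>I. ?m i * v i x)"
    by (intro convex_on_sum_UNIV convex_on_cmul v) simp
  have "u x + (\<Sum>i\<in>I. ?m i * v i x) = (\<Sum>i\<in>I. ?p i * v i x)" for x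
  proof -
    have "(\<Sum>i\<in>I. c i * v i x) = (\<Sum>i\<in>I. ?p i * v i x - ?m i * v i x)"
      by (rule sum.cong[OF refl], subst c) (rule left_diff_distrib)
    then show ?thesis unfolding u(2) by (simp add: sum_subtractf)
  qed
  then have "P (fs(j := (\<lambda>x. u x + (\<Sum>i\<in>I. ?m i * v i x)))) \<phi> = P (fs(j := (\<lambda>x. \<Sum>i\<in>I. ?p i * v i x))) \<phi>" by presburger
  then have "P (fs(j := u)) \<phi> + (\<Sum>i\<in>I. of_real (?m i) * P (fs(j := v i)) \<phi>) = (\<Sum>i\<in>I. of_real (?p i) * P (fs(j := v i)) \<phi>)"
    using P_add[where fs = fs and j = j, OF fs u(1) m \<phi>] P_nonneg_sum[where fs = fs and v = v and c = ?m and j = j, OF fs v \<phi> I]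
      P_nonneg_sum[where fs = fs and v = v and c = ?p and j = j, OF fs v \<phi> I] by simp
  then have "P (fs(j := u)) \<phi> = (\<Sum>i\<in>I. of_real (?p i) * P (fs(j := v i)) \<phi> - of_real (?m i) * P (fs(j := v i)) \<phi>)"
    by (simp only: sum_subtractf eq_diff_eq)
  also have "\<dots> = (\<Sum>i\<in>I. of_real (c i) * P (fs(j := v i)) \<phi>)"
  proof (rule sum.cong[OF refl])
    fix i
    have "complex_of_real (c i) = of_real (?p i) - of_real (?m i)" by (simp add: max_def)
    then show "of_real (?p i) * P (fs(j := v i)) \<phi> - of_real (?m i) * P (fs(j := v i)) \<phi> = of_real (c i) * P (fs(j := v i)) \<phi>"
      by (simp only: left_diff_distrib)
  qed
  finally show ?thesis .
qed

text \<open>Multilinear expansion one slot at a time; \<open>S\<close> contains the slots still to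
  be expanded, the others keep their function.\<close>

lemma P_expand:
  fixes I :: "'i set"
  assumes v: "\<And>i. convex_on UNIV (v i)" and \<phi>: "Cc \<phi>" and I: "finite I" 
  shows "finite S \<Longrightarrow> (\<And>j. convex_on UNIV (fs j)) \<Longrightarrow> (\<And>j x. j \<in> S \<Longrightarrow> fs j x = (\<Sum>i\<in>I. c j i * v i x)) \<Longrightarrow>
    P fs \<phi> = (\<Sum>h\<in>PiE S (\<lambda>_. I). (\<Prod>j\<in>S. of_real (c j (h j))) * P (\<lambda>j. if j \<in> S then v (h j) else fs j) \<phi>)"
proof (induction S arbitrary: fs rule: finite_induct)
  case empty
  then show ?case by simp
next
  case (insert j S)
  let ?W = "\<lambda>i h. P (\<lambda>l. if l \<in> S then v (h l) else (fs(j := v i)) l) \<phi>"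
  have "P fs \<phi> = P (fs(j := fs j)) \<phi>" by simp
  also have "\<dots> = (\<Sum>i\<in>I. of_real (c j i) * P (fs(j := v i)) \<phi>)"
    using insert.prems by (intro P_linear_sum v \<phi> I) auto
  also have "\<dots> = (\<Sum>i\<in>I. \<Sum>h\<in>PiE S (\<lambda>_. I). of_real (c j i) * ((\<Prod>l\<in>S. of_real (c l (h l))) * ?W i h))"
  proof (rule sum.cong[OF refl])
    fix i assume "i \<in> I"
    have "P (fs(j := v i)) \<phi> = (\<Sum>h\<in>PiE S (\<lambda>_. I). (\<Prod>l\<in>S. of_real (c l (h l))) * ?W i h)"
      using insert.prems insert.hyps v by (intro insert.IH) auto
    then show "of_real (c j i) * P (fs(j := v i)) \<phi> = (\<Sum>h\<in>PiE S (\<lambda>_. I). of_real (c j i) * ((\<Prod>l\<in>S. of_real (c l (h l))) * ?W i h))"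
      by (simp add: sum_distrib_left)
  qed
  also have "\<dots> = (\<Sum>(i, h)\<in>I \<times> PiE S (\<lambda>_. I). of_real (c j i) * ((\<Prod>l\<in>S. of_real (c l (h l))) * ?W i h))"
    by (rule sum.cartesian_product)
  also have "\<dots> = (\<Sum>h\<in>PiE (insert j S) (\<lambda>_. I). (\<Prod>l\<in>insert j S. of_real (c l (h l))) * P (\<lambda>l. if l \<in> insert j S then v (h l) else fs l) \<phi>)"
  proof (rule sym, unfold PiE_insert_eq, subst sum.reindex)
    show "inj_on (\<lambda>(y, g). g(j := y)) (I \<times> PiE S (\<lambda>_. I))"
      using insert.hyps(2) by (rule inj_combinator[of j S "\<lambda>_. I"])
    show "sum ((\<lambda>h. (\<Prod>l\<in>insert j S. of_real (c l (h l))) * P (\<lambda>l. if l \<in> insert j S then v (h l) else fs l) \<phi>) \<circ> (\<lambda>(y, g). g(j := y))) (I \<times> PiE S (\<lambda>_. I))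
       = (\<Sum>(i, h)\<in>I \<times> PiE S (\<lambda>_. I). of_real (c j i) * ((\<Prod>l\<in>S. of_real (c l (h l))) * ?W i h))"
    proof (rule sum.cong[OF refl])
      fix z assume "z \<in> I \<times> PiE S (\<lambda>_. I)"
      obtain i h where z: "z = (i, h)" by (cases z)
      have 1: "(\<Prod>l\<in>insert j S. complex_of_real (c l ((h(j := i)) l))) = of_real (c j i) * (\<Prod>l\<in>S. of_real (c l (h l)))"
        using insert.hyps by (auto intro!: prod.cong)
      have 2: "(\<lambda>l. if l \<in> insert j S then v ((h(j := i)) l) else fs l) = (\<lambda>l. if l \<in> S then v (h l) else (fs(j := v i)) l)"
        using insert.hyps by auto
      show "((\<lambda>h. (\<Prod>l\<in>insert j S. of_real (c l (h l))) * P (\<lambda>l. if l \<in> insert j S then v (h l) else fs l) \<phi>) \<circ> (\<lambda>(y, g). g(j := y))) z =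
        (case z of (i, h) \<Rightarrow> of_real (c j i) * ((\<Prod>l\<in>S. of_real (c l (h l))) * ?W i h))"
        unfolding z comp_def split 1 2 by (simp only: mult.assoc)
    qed
  qed
  finally show ?case .
qed

lemma P_quad_const:
  assumes A: "\<And>j. convex_on UNIV (fs j)" and sh: "\<And>j v. \<exists>y c. \<forall>x. fs j (x - v) = fs j x + (y \<bullet> x + c)" and \<phi>: "Cc \<phi>"
  shows "P fs \<phi> = P fs (moll 1) * of_real (LINT x|lborel. \<phi> x)"
proof (rule radon_translation_invariant[OF P_radon[OF A] _ \<phi>])
  fix \<psi> :: "real^'n \<Rightarrow> real" and y assume \<psi>: "Cc \<psi>"
  obtain z c where zc: "\<And>j x. fs j (x - (- y)) = fs j x + (z j \<bullet> x + c j)" using sh[of _ "- y"] by metis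
  have "P fs (\<lambda>x. \<psi> (x - y)) = P (\<lambda>j x. fs j (x - (- y))) \<psi>"
    using P_translate[where fs = fs and v = "- y", OF A \<psi>] by simp
  also have "\<dots> = P fs \<psi>"
    by (rule P_local[OF A convex_on_translate[OF A] open_UNIV zc \<psi>]) simp
  finally show "P fs (\<lambda>x. \<psi> (x - y)) = P fs \<psi>" .
qed

text \<open>The coefficients of the multilinear form in the Hessians. The signs and halves come from
  \<open>ridge_coeff\<close>, and since \<open>moll 1\<close> has mass 1, testing with it reads off
  the multiple of Lebesgue measure.\<close>

definition coef :: "('k \<Rightarrow> 'n) \<Rightarrow> ('k \<Rightarrow> 'n) \<Rightarrow> complex" where
  "coef a b = (\<Sum>s\<in>UNIV. (\<Prod>j\<in>UNIV. of_real (1/2 * (if s j then 1 else -1))) * P (\<lambda>j. ridge (a j, b j, s j)) (moll 1))"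

lemma P_quad:
  assumes A: "\<And>j. convex_on UNIV (quad (A j))" and \<phi>: "Cc \<phi>"
  shows "P (\<lambda>j. quad (A j)) \<phi> =
    (\<Sum>a\<in>UNIV. \<Sum>b\<in>UNIV. coef a b * (\<Prod>j\<in>UNIV. of_real (A j (a j) (b j)))) * of_real (LINT x|lborel. \<phi> x)"
proof -
  have m: "Cc (moll 1 :: real^'n \<Rightarrow> real)" by (rule moll_Cc) simp
  have "P (\<lambda>j. quad (A j)) (moll 1) = (\<Sum>h\<in>PiE UNIV (\<lambda>_. UNIV). (\<Prod>j\<in>UNIV. of_real (ridge_coeff (A j) (h j))) *
      P (\<lambda>j. if j \<in> UNIV then ridge (h j) else quad (A j)) (moll 1))"
    by (rule P_expand[OF ridge_convex m finite finite A]) (rule quad_ridge)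
  also have "\<dots> = (\<Sum>h\<in>UNIV. (\<Prod>j\<in>UNIV. of_real (ridge_coeff (A j) (h j))) * P (\<lambda>j. ridge (h j)) (moll 1))"
    by (simp add: PiE_UNIV_domain)
  also have "\<dots> = (\<Sum>a\<in>UNIV. \<Sum>b\<in>UNIV. \<Sum>s\<in>UNIV. (\<Prod>j\<in>UNIV. of_real (ridge_coeff (A j) (a j, b j, s j))) * P (\<lambda>j. ridge (a j, b j, s j)) (moll 1))"
    by (rule sum_fun_triple)
  also have "\<dots> = (\<Sum>a\<in>UNIV. \<Sum>b\<in>UNIV. coef a b * (\<Prod>j\<in>UNIV. of_real (A j (a j) (b j))))"
  proof (intro sum.cong refl)
    fix a b
    have "(\<Prod>j\<in>UNIV. complex_of_real (ridge_coeff (A j) (a j, b j, s j))) =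
       (\<Prod>j\<in>UNIV. of_real (1/2 * (if s j then 1 else -1))) * (\<Prod>j\<in>UNIV. of_real (A j (a j) (b j)))" for s :: "'k \<Rightarrow> bool"
      unfolding prod.distrib[symmetric] by (rule prod.cong[OF refl]) (simp add: ridge_coeff_def)
    then show "(\<Sum>s\<in>UNIV. (\<Prod>j\<in>UNIV. complex_of_real (ridge_coeff (A j) (a j, b j, s j))) * P (\<lambda>j. ridge (a j, b j, s j)) (moll 1)) = coef a b * (\<Prod>j\<in>UNIV. of_real (A j (a j) (b j)))"
      unfolding coef_def sum_distrib_right by (intro sum.cong refl) (simp only: mult_ac)
  qed
  finally show ?thesis using P_quad_const[of "\<lambda>j. quad (A j)" \<phi>, OF A quad_shift \<phi>] by simp
qed

end

section \<open>Second order Taylor expansion\<close>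

text \<open>By locality only the values on the ball matter, but the small-ball bound asks for a
  globally convex function of quadratic growth. The bound on the slopes \<open>G\<close> keeps the
  supremum of the tangents finite and of the right growth outside the ball.\<close>

lemma tangent_extension:
  fixes h :: "'a::euclidean_space \<Rightarrow> real" and G :: "'a \<Rightarrow> 'a"
  assumes r: "r > 0" and c: "c \<ge> 0"
    and tan: "\<And>x y. x \<in> cball 0 r \<Longrightarrow> y \<in> cball 0 r \<Longrightarrow> h y + G y \<bullet> (x - y) \<le> h x"
    and h: "\<And>y. y \<in> cball 0 r \<Longrightarrow> 0 \<le> h y" "\<And>y. y \<in> cball 0 r \<Longrightarrow> h y \<le> c * (norm y)\<^sup>2"
    and G: "\<And>y. y \<in> cball 0 r \<Longrightarrow> norm (G y) \<le> c * norm y"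
  obtains H where "convex_on UNIV H" "\<And>x. x \<in> cball 0 r \<Longrightarrow> H x = h x" "\<And>x. 0 \<le> H x" "\<And>x. H x \<le> 4 * c * (norm x)\<^sup>2"
proof -
  define t where "t = (\<lambda>x y. h y + G y \<bullet> (x - y))"
  define H where "H = (\<lambda>x. SUP y\<in>cball 0 r. t x y)"
  have 0: "0 \<in> cball (0::'a) r" using r by simp
  have tb: "t x y \<le> c * r\<^sup>2 + c * r * (norm x + r)" if y: "y \<in> cball 0 r" for x y
  proof -
    have ny: "norm y \<le> r" using y by simp
    have "h y \<le> c * r\<^sup>2"
      using h(2)[OF y] mult_left_mono[OF power_mono[OF ny norm_ge_zero, of 2] c] by linarith
    moreover have "G y \<bullet> (x - y) \<le> norm (G y) * norm (x - y)" by (rule norm_cauchy_schwarz)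
    moreover have "norm (G y) * norm (x - y) \<le> (c * r) * (norm x + r)"
    proof (rule mult_mono)
      show "norm (G y) \<le> c * r" using G[OF y] mult_left_mono[OF ny c] by linarith
      show "norm (x - y) \<le> norm x + r" using norm_triangle_ineq4[of x y] ny by linarith
    qed (use c r in auto)
    ultimately show ?thesis unfolding t_def by linarith
  qed
  have bdd: "bdd_above (t x ` cball 0 r)" for x using tb by (intro bdd_aboveI2) blast
  have up: "t x y \<le> H x" if "y \<in> cball 0 r" for x y
    unfolding H_def by (rule cSUP_upper[OF that bdd])
  have least: "H x \<le> b" if "\<And>y. y \<in> cball 0 r \<Longrightarrow> t x y \<le> b" for x b
    unfolding H_def by (rule cSUP_least) (use 0 that in auto)
  have Heq: "H x = h x" if x: "x \<in> cball 0 r" for x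
  proof (rule antisym)
    show "H x \<le> h x" by (rule least) (unfold t_def, rule tan[OF x])
    show "h x \<le> H x" using up[OF x, of x] by (simp add: t_def)
  qed
  show thesis
  proof (rule that[of H, OF _ Heq])
    show "convex_on UNIV H"
    proof (rule convex_onI)
      fix s :: real and x y :: 'a assume s: "0 < s" "s < 1"
      show "H ((1 - s) *\<^sub>R x + s *\<^sub>R y) \<le> (1 - s) * H x + s * H y"
      proof (rule least)
        fix z :: 'a assume z: "z \<in> cball 0 r"
        have "t ((1 - s) *\<^sub>R x + s *\<^sub>R y) z = (1 - s) * t x z + s * t y z"
          unfolding t_def by (simp add: inner_diff_right inner_add_right algebra_simps)
        also have "\<dots> \<le> (1 - s) * H x + s * H y"
          using s up[OF z] by (intro add_mono mult_left_mono) auto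
        finally show "t ((1 - s) *\<^sub>R x + s *\<^sub>R y) z \<le> (1 - s) * H x + s * H y" .
      qed
    qed simp
    fix x
    have "G 0 = 0" using G[OF 0] by simp
    then have "0 \<le> t x 0" using h(1)[OF 0] by (simp add: t_def)
    then show "0 \<le> H x" using up[OF 0, of x] by linarith
    have p: "0 \<le> c * (norm x)\<^sup>2" using c by simp
    show "H x \<le> 4 * c * (norm x)\<^sup>2"
    proof (cases "norm x \<le> r")
      case True
      then show ?thesis using Heq[of x] h(2)[of x] p by simp
    next
      case False
      \<comment> \<open>Outside the ball \<open>r\<close> is below \<open>norm x\<close>, so the
        bound for a single tangent is at most three times
        \<open>c * (norm x)\<^sup>2\<close>.\<close>
      have "H x \<le> c * r\<^sup>2 + c * r * (norm x + r)" by (rule least) (rule tb)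
      also have "\<dots> \<le> c * (norm x)\<^sup>2 + c * norm x * (norm x + norm x)"
        using False r c by (intro add_mono mult_left_mono mult_mono power_mono) auto
      also have "\<dots> = 3 * (c * (norm x)\<^sup>2)" by (simp add: power2_eq_square algebra_simps)
      finally show ?thesis using p by linarith
    qed
  qed
qed

section \<open>Gradient and Hessian\<close>

definition grad :: "(real^'n \<Rightarrow> real) \<Rightarrow> real^'n \<Rightarrow> real^'n" where
  "grad f x = (\<chi> b. iter_dd [axis b 1] f x)"

definition hess :: "(real^'n \<Rightarrow> real) \<Rightarrow> real^'n \<Rightarrow> 'n \<Rightarrow> 'n \<Rightarrow> real" where
  "hess f x a b = iter_dd [axis a 1, axis b 1] f x"

lemma vec_axis_sum: "(v :: real^'n) = (\<Sum>b\<in>UNIV. v $ b *\<^sub>R axis b 1)"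
  using basis_expansion[of v] by (simp add: scalar_mult_eq_scaleR)

lemma iter_dd_grad:
  assumes "smooth_fun f" shows "iter_dd [v] f x = grad f x \<bullet> (v :: real^'n)"
proof -
  interpret l: linear "\<lambda>v. iter_dd [v] f x" by (rule iter_dd_linear[OF assms])
  have "iter_dd [v] f x = (\<Sum>b\<in>UNIV. v $ b *\<^sub>R iter_dd [axis b 1] f x)"
    by (subst vec_axis_sum[of v]) (simp only: l.sum l.scale)
  then show ?thesis by (simp add: grad_def inner_vec_def mult.commute)
qed

lemma hess_symmetric: "smooth_fun f \<Longrightarrow> hess f x a b = hess f x b a"
  unfolding hess_def by (rule iter_dd_swap2)

lemma hess_continuous: "smooth_fun f \<Longrightarrow> continuous_on S (\<lambda>x. hess f x a b)"
  unfolding hess_def by (rule smooth_fun_continuous[OF smooth_fun_iter_dd])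

lemma smooth_mvt_grad:
  fixes f :: "real^'n \<Rightarrow> real"
  assumes "smooth_fun f"
  obtains s where "0 < s" "s < 1" "f y - f x = grad f (x + s *\<^sub>R (y - x)) \<bullet> (y - x)"
  using smooth_fun_mvt_segment[OF assms, of y x] iter_dd_grad[OF assms] by metis

text \<open>The gradient is the subgradient: after subtracting a supporting plane, the restriction
  of \<open>f\<close> to any line through \<open>y\<close> has a minimum at
  \<open>y\<close>.\<close>

lemma convex_tangent:
  fixes f :: "real^'n \<Rightarrow> real"
  assumes f: "convex_on UNIV f" and s: "smooth_fun f"
  shows "f y + grad f y \<bullet> (x - y) \<le> f x"
proof -
  obtain v where v: "\<And>z. f z \<ge> f y + v \<bullet> (z - y)" using convex_on_subgradient[OF f] by blast
  define d where "d = x - y"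
  have "((\<lambda>t. f (y + t *\<^sub>R d)) has_real_derivative iter_dd [d] f (y + 0 *\<^sub>R d)) (at 0)"
    by (rule smooth_fun_line_deriv[OF s])
  then have "((\<lambda>t. f (y + t *\<^sub>R d) - t * (v \<bullet> d)) has_real_derivative iter_dd [d] f (y + 0 *\<^sub>R d) - v \<bullet> d) (at 0)"
    by (intro DERIV_diff DERIV_cmult_Id) (auto intro!: derivative_eq_intros)
  then have "iter_dd [d] f (y + 0 *\<^sub>R d) - v \<bullet> d = 0"
  proof (rule DERIV_local_min[where d = 1])
    show "\<forall>t. \<bar>0 - t\<bar> < 1 \<longrightarrow> f (y + 0 *\<^sub>R d) - 0 * (v \<bullet> d) \<le> f (y + t *\<^sub>R d) - t * (v \<bullet> d)"
    proof (intro allI impI)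
      fix t show "f (y + 0 *\<^sub>R d) - 0 * (v \<bullet> d) \<le> f (y + t *\<^sub>R d) - t * (v \<bullet> d)"
        using v[of "y + t *\<^sub>R d"] by simp
    qed
  qed simp
  then have "grad f y \<bullet> d = v \<bullet> d" using iter_dd_grad[OF s, of d y] by simp
  then show ?thesis using v[of x] by (simp add: d_def)
qed

text \<open>The mean value theorem for each partial derivative, then for \<open>e\<close> itself.
  Estimating by coordinates twice produces the square of \<open>CARD('n)\<close>.\<close>

lemma small_hessian:
  fixes e :: "real^'n \<Rightarrow> real"
  assumes s: "smooth_fun e" and \<epsilon>: "\<epsilon> \<ge> 0"
    and he: "\<And>x a b. x \<in> cball 0 r \<Longrightarrow> \<bar>hess e x a b\<bar> \<le> \<epsilon>"
    and x: "x \<in> cball 0 r" and y: "y \<in> cball 0 r"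
  shows "norm (grad e x - grad e y) \<le> (real CARD('n))\<^sup>2 * \<epsilon> * norm (x - y)"
    and "\<bar>e x - e y - grad e y \<bullet> (x - y)\<bar> \<le> (real CARD('n))\<^sup>2 * \<epsilon> * (norm (x - y))\<^sup>2"
proof -
  have seg: "y + t *\<^sub>R (x - y) \<in> cball 0 r" if "0 < t" "t < 1" "x \<in> cball 0 r" for t x
  proof -
    have "y + t *\<^sub>R (x - y) = (1 - t) *\<^sub>R y + t *\<^sub>R x" by (simp add: algebra_simps)
    then show ?thesis using convexD[OF convex_cball y that(3), of "1 - t" t] that by simp
  qed
  have g: "norm (grad e x - grad e y) \<le> (real CARD('n))\<^sup>2 * \<epsilon> * norm (x - y)" if x: "x \<in> cball 0 r" for x
  proof -
    have comp: "\<bar>(grad e x - grad e y) $ b\<bar> \<le> real CARD('n) * (\<epsilon> * norm (x - y))" for b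
    proof -
      define F where "F = iter_dd [axis b 1] e"
      have F: "smooth_fun F" unfolding F_def by (rule smooth_fun_iter_dd[OF s])
      obtain t where t: "0 < t" "t < 1" "F x - F y = grad F (y + t *\<^sub>R (x - y)) \<bullet> (x - y)"
        by (rule smooth_mvt_grad[OF F])
      define z where "z = y + t *\<^sub>R (x - y)"
      have z: "z \<in> cball 0 r" unfolding z_def by (rule seg[OF t(1,2) x])
      have gF: "grad F z $ a = hess e z a b" for a
        by (simp add: grad_def hess_def F_def)
      have "(grad e x - grad e y) $ b = F x - F y" by (simp add: grad_def F_def)
      also have "\<dots> = (\<Sum>a\<in>UNIV. hess e z a b * (x - y) $ a)"
        unfolding t(3) z_def[symmetric] by (simp add: inner_vec_def gF)
      also have "\<bar>\<dots>\<bar> \<le> (\<Sum>a\<in>UNIV. \<bar>hess e z a b * (x - y) $ a\<bar>)" by (rule sum_abs)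
      also have "\<dots> \<le> (\<Sum>a\<in>(UNIV::'n set). \<epsilon> * norm (x - y))"
        unfolding abs_mult by (intro sum_mono mult_mono he[OF z] component_le_norm_cart \<epsilon>) auto
      finally show ?thesis by simp
    qed
    have "norm (grad e x - grad e y) \<le> (\<Sum>b\<in>UNIV. \<bar>(grad e x - grad e y) $ b\<bar>)" by (rule norm_le_l1_cart)
    also have "\<dots> \<le> (\<Sum>b\<in>(UNIV::'n set). real CARD('n) * (\<epsilon> * norm (x - y)))" by (rule sum_mono) (rule comp)
    finally show ?thesis by (simp add: power2_eq_square mult_ac)
  qed
  show "norm (grad e x - grad e y) \<le> (real CARD('n))\<^sup>2 * \<epsilon> * norm (x - y)" by (rule g[OF x])
  obtain t where t: "0 < t" "t < 1" "e x - e y = grad e (y + t *\<^sub>R (x - y)) \<bullet> (x - y)"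
    by (rule smooth_mvt_grad[OF s])
  define z where "z = y + t *\<^sub>R (x - y)"
  have "e x - e y - grad e y \<bullet> (x - y) = (grad e z - grad e y) \<bullet> (x - y)"
    unfolding t(3) z_def by (simp add: inner_diff_left)
  also have "\<bar>\<dots>\<bar> \<le> norm (grad e z - grad e y) * norm (x - y)" by (rule Cauchy_Schwarz_ineq2)
  also have "\<dots> \<le> ((real CARD('n))\<^sup>2 * \<epsilon> * norm (z - y)) * norm (x - y)"
    unfolding z_def by (intro mult_right_mono g seg t x) auto
  also have "\<dots> \<le> ((real CARD('n))\<^sup>2 * \<epsilon> * norm (x - y)) * norm (x - y)"
  proof (intro mult_right_mono mult_left_mono)
    have "norm (z - y) = t * norm (x - y)" unfolding z_def using t by simp
    then show "norm (z - y) \<le> norm (x - y)" using t mult_left_le_one_le[of "norm (x - y)" t] by simp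
  qed (use \<epsilon> in auto)
  finally show "\<bar>e x - e y - grad e y \<bullet> (x - y)\<bar> \<le> (real CARD('n))\<^sup>2 * \<epsilon> * (norm (x - y))\<^sup>2"
    by (simp add: power2_eq_square mult_ac)
qed

section \<open>Derivatives of quadratic functions\<close>

lemma quad_has_derivative:
  "(quad A has_derivative (\<lambda>v. \<Sum>a\<in>UNIV. \<Sum>b\<in>UNIV. 1/2 * A a b * (x $ a * v $ b + v $ a * x $ b))) (at x)"
  unfolding quad_def
  by (intro has_derivative_sum has_derivative_mult_right has_derivative_mult
      bounded_linear.has_derivative[OF bounded_linear_vec_nth] has_derivative_ident)

lemma quad_polynomial: "real_polynomial_function (quad A)"
  unfolding quad_def
  by (intro real_polynomial_function_sum real_polynomial_function.intros(4) real_polynomial_function.intros(2)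
      real_polynomial_function.intros(1) bounded_linear_vec_nth finite)

lemma quad_smooth: "smooth_fun (quad A)"
  by (rule smooth_fun_real_polynomial[OF quad_polynomial])

lemma quad_deriv: "iter_dd [axis c 1] (quad A) x = (\<Sum>a\<in>UNIV. 1/2 * (A a c + A c a) * x $ a)"
proof -
  have "iter_dd [axis c 1] (quad A) x = (\<Sum>a\<in>UNIV. \<Sum>b\<in>UNIV. 1/2 * A a b * (x $ a * axis c 1 $ b + axis c 1 $ a * x $ b))"
    by (rule iter_dd_single[OF quad_has_derivative])
  also have "\<dots> = (\<Sum>a\<in>UNIV. \<Sum>b\<in>UNIV. if b = c then 1/2 * A a c * x $ a else 0) + (\<Sum>a\<in>UNIV. \<Sum>b\<in>UNIV. if a = c then 1/2 * A c b * x $ b else 0)"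
    unfolding sum.distrib[symmetric] by (intro sum.cong refl) (simp add: axis_def)
  also have "(\<Sum>a\<in>UNIV. \<Sum>b\<in>UNIV. if b = c then 1/2 * A a c * x $ a else 0) = (\<Sum>a\<in>UNIV. 1/2 * A a c * x $ a)"
    by simp
  also have "(\<Sum>a\<in>UNIV. \<Sum>b\<in>UNIV. if a = c then 1/2 * A c b * x $ b else 0) = (\<Sum>b\<in>UNIV. 1/2 * A c b * x $ b)"
    by (subst sum.swap) simp
  finally show ?thesis by (simp add: sum.distrib[symmetric] algebra_simps)
qed

lemma quad_hess: "hess (quad A) x d c = 1/2 * (A d c + A c d)"
proof -
  have "((\<lambda>x. \<Sum>a\<in>UNIV. 1/2 * (A a c + A c a) * x $ a) has_derivative (\<lambda>v. \<Sum>a\<in>UNIV. 1/2 * (A a c + A c a) * v $ a)) (at x)"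
    by (intro has_derivative_sum has_derivative_mult_right bounded_linear.has_derivative[OF bounded_linear_vec_nth] has_derivative_ident)
  moreover have "iter_dd [axis c 1] (quad A) = (\<lambda>x. \<Sum>a\<in>UNIV. 1/2 * (A a c + A c a) * x $ a)"
    using quad_deriv by blast
  moreover have "hess (quad A) x d c = iter_dd [axis d 1] (iter_dd [axis c 1] (quad A)) x"
    unfolding hess_def iter_dd_append[symmetric] by simp
  ultimately have "hess (quad A) x d c = (\<Sum>a\<in>UNIV. 1/2 * (A a c + A c a) * axis d 1 $ a)"
    using iter_dd_single by metis
  also have "\<dots> = (\<Sum>a\<in>UNIV. if a = d then 1/2 * (A d c + A c d) else 0)"
    by (rule sum.cong[OF refl]) (simp add: axis_def)
  finally show ?thesis by simp
qed

lemma quad_grad_zero: "grad (quad A) 0 = 0"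
  by (simp only: grad_def vec_eq_iff vec_lambda_beta quad_deriv) simp

lemma quad_zero: "quad A 0 = 0" by (simp add: quad_def)

lemma quad_bound:
  assumes "\<And>a b. \<bar>A a b\<bar> \<le> C" 
  shows "\<bar>quad A (x :: real^'n)\<bar> \<le> (real CARD('n))\<^sup>2 * C * (norm x)\<^sup>2"
proof -
  have C: "C \<ge> 0" using assms[of undefined undefined] by linarith
  have "\<bar>quad A x\<bar> \<le> (\<Sum>a\<in>UNIV. \<Sum>b\<in>UNIV. \<bar>1/2 * A a b * (x $ a * x $ b)\<bar>)"
    unfolding quad_def by (rule order_trans[OF sum_abs sum_mono[OF sum_abs]])
  also have "\<dots> \<le> (\<Sum>a\<in>(UNIV::'n set). \<Sum>b\<in>(UNIV::'n set). C * (norm x * norm x))"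
  proof (intro sum_mono)
    fix a b
    have "\<bar>1/2 * A a b\<bar> \<le> C" using assms[of a b] C by (simp add: abs_mult)
    moreover have "\<bar>x $ a * x $ b\<bar> \<le> norm x * norm x"
      unfolding abs_mult by (intro mult_mono component_le_norm_cart) auto
    ultimately show "\<bar>1/2 * A a b * (x $ a * x $ b)\<bar> \<le> C * (norm x * norm x)"
      unfolding abs_mult[of "1/2 * A a b"] using C by (intro mult_mono) auto
  qed
  finally show ?thesis by (simp add: power2_eq_square mult_ac)
qed

text \<open>The first-order Taylor remainder at \<open>y\<close>, moved to the origin;
  \<open>\<Psi>\<close> does not see the subtracted affine function.\<close>

definition recentre :: "(real^'n \<Rightarrow> real) \<Rightarrow> real^'n \<Rightarrow> real^'n \<Rightarrow> real" where
  "recentre f y x = f (x + y) - (grad f y \<bullet> x + f y)"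

lemma affine_smooth: "smooth_fun (\<lambda>x. v \<bullet> x + c :: real)"
  by (intro smooth_fun_add smooth_fun_const smooth_fun_bounded_linear bounded_linear_inner_right)

lemma iter_dd_affine: "iter_dd [u] (\<lambda>x. v \<bullet> x + c :: real) x = v \<bullet> u"
  by (rule iter_dd_single) (auto intro!: derivative_eq_intros)

lemma recentre_smooth: "smooth_fun f \<Longrightarrow> smooth_fun (recentre f y)"
  unfolding recentre_def by (intro smooth_fun_diff smooth_fun_translate affine_smooth)

lemma recentre_grad: 
  assumes "smooth_fun f" shows "grad (recentre f y) x = grad f (x + y) - grad f y"
proof -
  have "iter_dd [axis b 1] (recentre f y) x = iter_dd [axis b 1] f (x + y) - grad f y \<bullet> axis b 1" for b
    unfolding recentre_def iter_dd_diff[OF smooth_fun_translate[OF assms] affine_smooth] iter_dd_translate[OF assms] iter_dd_affine ..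
  then show ?thesis by (simp add: grad_def vec_eq_iff inner_axis del: iter_dd.simps)
qed

lemma recentre_hess:
  assumes "smooth_fun f" shows "hess (recentre f y) x a b = hess f (x + y) a b"
proof -
  have "iter_dd [axis a 1, axis b 1] (\<lambda>x. v \<bullet> x + c :: real) x = 0" for v c
  proof -
    have "iter_dd [axis b 1] (\<lambda>x. v \<bullet> x + c :: real) = (\<lambda>x. v \<bullet> axis b 1)"
      using iter_dd_affine by blast
    then show ?thesis by simp
  qed
  then show ?thesis
    unfolding hess_def recentre_def iter_dd_diff[OF smooth_fun_translate[OF assms] affine_smooth] iter_dd_translate[OF assms] by simp
qed

lemma recentre_zero: "recentre f y 0 = 0" by (simp add: recentre_def)

lemma recentre_convex: "convex_on UNIV f \<Longrightarrow> convex_on UNIV (recentre f y)"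
  using convex_on_add[OF convex_on_translate[of f "- y"] convex_on_inner[of "- grad f y" "- f y"]]
  by (simp add: recentre_def[abs_def] algebra_simps)

lemma recentre_quad_close:
  fixes f :: "real^'n \<Rightarrow> real"
  assumes f: "smooth_fun f" and \<epsilon>: "\<epsilon> \<ge> 0"
    and he: "\<And>x a b. x \<in> cball y r \<Longrightarrow> \<bar>hess f x a b - hess f y a b\<bar> \<le> \<epsilon>"
  defines "e \<equiv> (\<lambda>x. recentre f y x - quad (hess f y) x)"
  shows "smooth_fun e" "e 0 = 0" "grad e 0 = 0" "\<And>(x :: real^'n) a b. x \<in> cball 0 r \<Longrightarrow> \<bar>hess e x a b\<bar> \<le> \<epsilon>"
proof -
  show "smooth_fun e" unfolding e_def by (intro smooth_fun_diff recentre_smooth f quad_smooth)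
  show "e 0 = 0" by (simp add: e_def recentre_zero quad_zero)
  have "grad e 0 = grad (recentre f y) 0 - grad (quad (hess f y)) 0"
    unfolding grad_def e_def iter_dd_diff[OF recentre_smooth[OF f] quad_smooth] by (simp add: vec_eq_iff)
  then show "grad e 0 = 0" by (simp add: recentre_grad[OF f] quad_grad_zero)
  fix x :: "real^'n" and a b assume x: "x \<in> cball 0 r"
  have "hess e x a b = hess (recentre f y) x a b - hess (quad (hess f y)) x a b"
    unfolding hess_def e_def iter_dd_diff[OF recentre_smooth[OF f] quad_smooth] ..
  also have "\<dots> = hess f (x + y) a b - hess f y a b"
    unfolding recentre_hess[OF f] quad_hess using hess_symmetric[OF f, of y a b] by simp
  finally show "\<bar>hess e x a b\<bar> \<le> \<epsilon>" using he[of "x + y" a b] x by (simp add: dist_norm)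
qed

lemma hess_modulus:
  fixes fs :: "'k::finite \<Rightarrow> real^'n \<Rightarrow> real"
  assumes fs: "\<And>j. smooth_fun (fs j)" and \<epsilon>: "\<epsilon> > 0"
  obtains r where "0 < r" "r \<le> 1"
    "\<And>j x y a b. y \<in> cball 0 R \<Longrightarrow> x \<in> cball y r \<Longrightarrow> \<bar>hess (fs j) x a b - hess (fs j) y a b\<bar> \<le> \<epsilon>"
proof -
  have "\<exists>d>0. \<forall>x y. y \<in> cball 0 R \<longrightarrow> x \<in> cball y d \<longrightarrow> \<bar>hess (fs j) x a b - hess (fs j) y a b\<bar> \<le> \<epsilon>" for j a b
  proof -
    have "uniformly_continuous_on (cball 0 (R + 1)) (\<lambda>x. hess (fs j) x a b)"
      by (rule compact_uniformly_continuous[OF hess_continuous[OF fs] compact_cball])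
    then obtain d where d: "d > 0" "\<And>x y. y \<in> cball 0 (R + 1) \<Longrightarrow> x \<in> cball 0 (R + 1) \<Longrightarrow> dist x y < d \<Longrightarrow> dist (hess (fs j) x a b) (hess (fs j) y a b) < \<epsilon>"
      using \<epsilon> unfolding uniformly_continuous_on_def by meson
    show ?thesis
    proof (intro exI[of _ "min d 1 / 2"] conjI allI impI)
      fix x y :: "real^'n" assume y: "y \<in> cball 0 R" and x: "x \<in> cball y (min d 1 / 2)"
      have xy: "dist x y \<le> min d 1 / 2" using x by (simp add: dist_commute)
      have "dist x y < d" "dist x y \<le> 1" using xy d(1) by linarith+
      moreover have "norm x \<le> R + 1"
        using y \<open>dist x y \<le> 1\<close> norm_triangle_ineq[of "x - y" y] by (simp add: dist_norm)
      ultimately show "\<bar>hess (fs j) x a b - hess (fs j) y a b\<bar> \<le> \<epsilon>"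
        using d(2)[of y x] y by (simp add: dist_real_def)
    qed (use d in simp)
  qed
  then obtain d where d: "\<And>j a b. d j a b > 0"
    "\<And>j a b x y. y \<in> cball 0 R \<Longrightarrow> x \<in> cball y (d j a b) \<Longrightarrow> \<bar>hess (fs j) x a b - hess (fs j) y a b\<bar> \<le> \<epsilon>" by metis
  define r where "r = Min (insert 1 (range (\<lambda>(j, a, b). d j a b)))"
  have r: "r \<le> 1" "0 < r" unfolding r_def using d(1) by (auto simp: Min_gr_iff)
  have "r \<le> d j a b" for j a b unfolding r_def by (rule Min_le) (auto intro: image_eqI[of _ _ "(j, a, b)"])
  then show thesis using that[OF r(2,1)] d(2) by (meson mem_cball order_trans)
qed

lemma hess_bounded:
  fixes fs :: "'k::finite \<Rightarrow> real^'n \<Rightarrow> real"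
  assumes fs: "\<And>j. smooth_fun (fs j)"
  obtains C where "C > 0" "\<And>j x a b. x \<in> cball 0 R \<Longrightarrow> \<bar>hess (fs j) x a b\<bar> \<le> C"
proof -
  have "\<exists>c. \<forall>x\<in>cball 0 R. \<bar>hess (fs j) x a b\<bar> \<le> c" for j a b
  proof -
    have "compact ((\<lambda>x. hess (fs j) x a b) ` cball 0 R)"
      by (rule compact_continuous_image[OF hess_continuous[OF fs] compact_cball])
    then have "bounded ((\<lambda>x. hess (fs j) x a b) ` cball 0 R)" by (rule compact_imp_bounded)
    then show ?thesis unfolding bounded_iff by auto
  qed
  then obtain c where c: "\<And>j a b x. x \<in> cball 0 R \<Longrightarrow> \<bar>hess (fs j) x a b\<bar> \<le> c j a b" by metis
  define C where "C = Max (insert 1 (range (\<lambda>(j, a, b). c j a b)))"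
  have "C \<ge> 1" unfolding C_def by (rule Max_ge) auto
  moreover have "c j a b \<le> C" for j a b unfolding C_def by (rule Max_ge) (auto intro: image_eqI[of _ _ "(j, a, b)"])
  ultimately show thesis using that[of C] c by (meson order_trans less_le_trans zero_less_one)
qed

text \<open>The Hessian form is the limit of the rescaled functions
  \<open>recentre f y (s *\<^sub>R x) / s\<^sup>2\<close> as \<open>s\<close> tends to 0, each of
  which is convex. The limit is replaced by an explicit error of at most \<open>e\<close>.\<close>

lemma quad_hess_convex:
  fixes f :: "real^'n \<Rightarrow> real"
  assumes f: "smooth_fun f" "convex_on UNIV f"
  shows "convex_on UNIV (quad (hess f y))"
proof (rule convex_onI)
  fix t :: real and u v :: "real^'n" assume t: "0 < t" "t < 1"
  let ?q = "quad (hess f y)" and ?g = "recentre f y" and ?N = "(real CARD('n))\<^sup>2"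
  let ?w = "(1 - t) *\<^sub>R u + t *\<^sub>R v"
  define B where "B = ?N * ((norm u)\<^sup>2 + (norm v)\<^sup>2 + (norm ?w)\<^sup>2)"
  have qs: "?q (s *\<^sub>R x) = s\<^sup>2 * ?q x" for s x
    unfolding quad_def sum_distrib_left by (intro sum.cong refl) (simp add: power2_eq_square mult_ac)
  have "?q ?w \<le> ((1 - t) * ?q u + t * ?q v) + e" if e: "e > 0" for e
  proof -
    define \<epsilon> where "\<epsilon> = e / (B + 1)"
    have B: "B \<ge> 0" unfolding B_def by simp
    have \<epsilon>: "\<epsilon> > 0" "\<epsilon> * B \<le> e" unfolding \<epsilon>_def using e B by (auto simp: divide_simps)
    obtain r where r: "0 < r" "r \<le> 1"
       "\<And>(x :: real^'n) a b. x \<in> cball y r \<Longrightarrow> \<bar>hess f x a b - hess f y a b\<bar> \<le> \<epsilon>"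
    proof (rule hess_modulus[of "\<lambda>_::unit. f" \<epsilon> "norm y"])
      fix r assume *: "0 < r" "r \<le> 1" "\<And>j x y' a b. y' \<in> cball 0 (norm y) \<Longrightarrow> x \<in> cball y' r \<Longrightarrow> \<bar>hess f x a b - hess f y' a b\<bar> \<le> \<epsilon>"
      show thesis by (rule that[OF *(1,2)]) (rule *(3), simp_all)
    qed (use f \<epsilon> in auto)
    define e where "e = (\<lambda>x. ?g x - ?q x)"
    have close: "smooth_fun e" "e 0 = 0" "grad e 0 = 0"
      unfolding e_def by (rule recentre_quad_close[OF f(1) less_imp_le[OF \<epsilon>(1)]], rule r(3), assumption)+
    have close4: "\<bar>hess e x a b\<bar> \<le> \<epsilon>" if "x \<in> cball 0 r" for x a b
      unfolding e_def by (rule recentre_quad_close(4)[OF f(1) less_imp_le[OF \<epsilon>(1)] _ that]) (rule r(3))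
    have gq: "\<bar>?g x - ?q x\<bar> \<le> ?N * \<epsilon> * (norm x)\<^sup>2" if x: "norm x \<le> r" for x
    proof -
      have "\<bar>e x - e 0 - grad e 0 \<bullet> (x - 0)\<bar> \<le> ?N * \<epsilon> * (norm (x - 0))\<^sup>2"
        by (rule small_hessian(2)[where r = r, OF close(1) less_imp_le[OF \<epsilon>(1)]]) (use close4 x r in auto)
      then show ?thesis using close(2,3) by (simp add: e_def)
    qed
    define m where "m = norm u + norm v + norm ?w + 1"
    have m: "m > 0" unfolding m_def by (simp add: add_nonneg_pos)
    \<comment> \<open>Scales the three points of the convexity inequality into the ball on which the
      Hessian varies little.\<close>
    define s where "s = r / m"
    have s: "s > 0" unfolding s_def using r m by simp
    have sx: "norm (s *\<^sub>R x) \<le> r" if "norm x \<le> m" for x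
    proof -
      have "s * norm x \<le> s * m" using that s by (intro mult_left_mono) auto
      moreover have "s * m = r" using m by (simp add: s_def)
      moreover have "norm (s *\<^sub>R x) = s * norm x" using s by simp
      ultimately show ?thesis by linarith
    qed
    have bound: "\<bar>?g (s *\<^sub>R x) - s\<^sup>2 * ?q x\<bar> \<le> s\<^sup>2 * (?N * \<epsilon> * (norm x)\<^sup>2)" if "norm x \<le> m" for x
      using gq[OF sx[OF that]] s unfolding qs by (simp add: power_mult_distrib mult_ac)
    have bu: "norm u \<le> m" and bv: "norm v \<le> m" and bw: "norm ?w \<le> m" unfolding m_def by (simp_all add: add_nonneg_nonneg)
    have "s *\<^sub>R ?w = (1 - t) *\<^sub>R (s *\<^sub>R u) + t *\<^sub>R (s *\<^sub>R v)" by (simp add: algebra_simps)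
    then have cg: "?g (s *\<^sub>R ?w) \<le> (1 - t) * ?g (s *\<^sub>R u) + t * ?g (s *\<^sub>R v)"
      using convex_onD[OF recentre_convex[OF f(2), of y], of t "s *\<^sub>R u" "s *\<^sub>R v"] t by simp
    have "s\<^sup>2 * ?q ?w \<le> ?g (s *\<^sub>R ?w) + s\<^sup>2 * (?N * \<epsilon> * (norm ?w)\<^sup>2)" using bound[OF bw] by linarith
    also have "\<dots> \<le> (1 - t) * (s\<^sup>2 * ?q u + s\<^sup>2 * (?N * \<epsilon> * (norm u)\<^sup>2)) + t * (s\<^sup>2 * ?q v + s\<^sup>2 * (?N * \<epsilon> * (norm v)\<^sup>2)) + s\<^sup>2 * (?N * \<epsilon> * (norm ?w)\<^sup>2)"
    proof -
      have "(1 - t) * ?g (s *\<^sub>R u) \<le> (1 - t) * (s\<^sup>2 * ?q u + s\<^sup>2 * (?N * \<epsilon> * (norm u)\<^sup>2))"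
        using bound[OF bu] t by (intro mult_left_mono) linarith+
      moreover have "t * ?g (s *\<^sub>R v) \<le> t * (s\<^sup>2 * ?q v + s\<^sup>2 * (?N * \<epsilon> * (norm v)\<^sup>2))"
        using bound[OF bv] t by (intro mult_left_mono) linarith+
      ultimately show ?thesis using cg by linarith
    qed
    also have "\<dots> = s\<^sup>2 * ((1 - t) * ?q u + t * ?q v + (?N * \<epsilon>) * ((1 - t) * (norm u)\<^sup>2 + t * (norm v)\<^sup>2 + (norm ?w)\<^sup>2))"
      by (simp add: algebra_simps)
    finally have "?q ?w \<le> (1 - t) * ?q u + t * ?q v + (?N * \<epsilon>) * ((1 - t) * (norm u)\<^sup>2 + t * (norm v)\<^sup>2 + (norm ?w)\<^sup>2)"
      using s by simp
    also have "\<dots> \<le> (1 - t) * ?q u + t * ?q v + (?N * \<epsilon>) * ((norm u)\<^sup>2 + (norm v)\<^sup>2 + (norm ?w)\<^sup>2)"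
    proof -
      have "(1 - t) * (norm u)\<^sup>2 \<le> (norm u)\<^sup>2" "t * (norm v)\<^sup>2 \<le> (norm v)\<^sup>2" using t by (auto intro!: mult_left_le_one_le)
      then show ?thesis using \<epsilon>(1) by (intro add_left_mono mult_left_mono) auto
    qed
    also have "\<dots> = (1 - t) * ?q u + t * ?q v + \<epsilon> * B" by (simp add: B_def mult_ac)
    finally show ?thesis using \<epsilon>(2) by linarith
  qed
  then show "?q ?w \<le> (1 - t) * ?q u + t * ?q v" by (rule field_le_epsilon)
qed simp

lemma quad_nonneg: assumes "convex_on UNIV (quad A)" shows "0 \<le> quad A x"
proof -
  have "quad A (- x) = quad A x" by (simp add: quad_def)
  moreover have "quad A ((1 - 1/2) *\<^sub>R x + (1/2) *\<^sub>R (- x)) \<le> (1 - 1/2) * quad A x + 1/2 * quad A (- x)"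
    by (rule convex_onD[OF assms]) auto
  ultimately show ?thesis by (simp add: quad_zero)
qed

lemma norm_square_shift:
  fixes x y :: "'a::real_inner"
  shows "(norm x)\<^sup>2 = (norm y)\<^sup>2 + 2 * (y \<bullet> (x - y)) + (norm (x - y))\<^sup>2"
  by (simp add: power2_norm_eq_inner inner_diff_left inner_diff_right inner_commute algebra_simps)

text \<open>A small multiple of the squared norm makes the Taylor remainder lie above its tangents on the ball, so that the
  supremum of these tangents extends it to a convex function.\<close>
lemma taylor_decomposition:
  fixes f :: "real^'n \<Rightarrow> real"
  assumes f: "smooth_fun f" "convex_on UNIV f" and r: "r > 0" and \<epsilon>: "\<epsilon> > 0" and C: "C \<ge> 0"
    and he: "\<And>x a b. x \<in> cball y r \<Longrightarrow> \<bar>hess f x a b - hess f y a b\<bar> \<le> \<epsilon>"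
    and hC: "\<And>x a b. x \<in> cball y r \<Longrightarrow> \<bar>hess f x a b\<bar> \<le> C"
  obtains g H where "convex_on UNIV g" "convex_on UNIV H" 
    "\<And>x. x \<in> cball 0 r \<Longrightarrow> g x = recentre f y x"
    "\<And>x. x \<in> cball 0 r \<Longrightarrow> g x + \<epsilon> * ((real CARD('n))\<^sup>2 * (norm x)\<^sup>2) = quad (hess f y) x + \<epsilon> * H x"
    "\<And>x. 0 \<le> g x" "\<And>x. g x \<le> 4 * (real CARD('n))\<^sup>2 * C * (norm x)\<^sup>2"
    "\<And>x. 0 \<le> H x" "\<And>x. H x \<le> 12 * (real CARD('n))\<^sup>2 * (norm x)\<^sup>2"
proof -
  let ?N = "(real CARD('n))\<^sup>2" and ?g = "recentre f y"
  have 0: "0 \<in> cball (0::real^'n) r" using r by simp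
  have gs: "smooth_fun ?g" by (rule recentre_smooth[OF f(1)])
  have gh: "\<bar>hess ?g x a b\<bar> \<le> C" if "x \<in> cball 0 r" for x a b
    unfolding recentre_hess[OF f(1)] using hC[of "x + y"] that by (simp add: dist_norm)
  have g0: "grad ?g 0 = 0" using recentre_grad[OF f(1), of y 0] by simp
  have sg: "norm (grad ?g x - grad ?g z) \<le> ?N * C * norm (x - z)"
      "\<bar>?g x - ?g z - grad ?g z \<bullet> (x - z)\<bar> \<le> ?N * C * (norm (x - z))\<^sup>2" if "x \<in> cball 0 r" "z \<in> cball 0 r" for x z :: "real^'n"
    by (rule small_hessian[OF gs C _ that], rule gh, assumption)+
  obtain g where g: "convex_on UNIV g" "\<And>x. x \<in> cball 0 r \<Longrightarrow> g x = ?g x" "\<And>x. 0 \<le> g x" "\<And>x. g x \<le> 4 * (?N * C) * (norm x)\<^sup>2"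
  proof (rule tangent_extension[of r "?N * C" ?g "grad ?g"])
    show "?g z + grad ?g z \<bullet> (x - z) \<le> ?g x" for x z
      by (rule convex_tangent[OF recentre_convex[OF f(2)] gs])
    show "0 \<le> ?g x" for x
      using convex_tangent[OF recentre_convex[OF f(2)] gs, of 0 x] g0 recentre_zero[of f y] by simp
    show "?g x \<le> ?N * C * (norm x)\<^sup>2" if "x \<in> cball 0 r" for x
      using sg(2)[OF that 0] g0 recentre_zero[of f y] by simp
    show "norm (grad ?g x) \<le> ?N * C * norm x" if "x \<in> cball 0 r" for x
      using sg(1)[OF that 0] g0 by simp
  qed (use r C that in auto)
  define e where "e = (\<lambda>x. ?g x - quad (hess f y) x)"
  have ce: "smooth_fun e" "e 0 = 0" "grad e 0 = 0"
    unfolding e_def by (rule recentre_quad_close[OF f(1) less_imp_le[OF \<epsilon>]], rule he, assumption)+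
  have ce4: "\<bar>hess e x a b\<bar> \<le> \<epsilon>" if "x \<in> cball 0 r" for x a b
    unfolding e_def by (rule recentre_quad_close(4)[OF f(1) less_imp_le[OF \<epsilon>] _ that]) (rule he)
  have se: "norm (grad e x - grad e z) \<le> ?N * \<epsilon> * norm (x - z)"
      "\<bar>e x - e z - grad e z \<bullet> (x - z)\<bar> \<le> ?N * \<epsilon> * (norm (x - z))\<^sup>2" if "x \<in> cball 0 r" "z \<in> cball 0 r" for x z :: "real^'n"
    by (rule small_hessian[OF ce(1) less_imp_le[OF \<epsilon>] _ that], rule ce4, assumption)+
  \<comment> \<open>By \<open>se\<close> the remainder \<open>e\<close> falls below its tangents by
    at most \<open>?N * \<epsilon> * (norm (x - z))\<^sup>2\<close>, and the added multiple of the
    squared norm exceeds its own tangents by exactly that amount.\<close>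
  define h where "h = (\<lambda>x. e x + ?N * \<epsilon> * (norm x)\<^sup>2)"
  define G where "G = (\<lambda>x. grad e x + (2 * (?N * \<epsilon>)) *\<^sub>R x)"
  have N\<epsilon>: "0 \<le> ?N * \<epsilon>" using \<epsilon> by simp
  \<comment> \<open>The constant 3 is dictated by the gradient: one part from \<open>e\<close> and
    two from the squared norm.\<close>
  obtain H0 where H0: "convex_on UNIV H0" "\<And>x. x \<in> cball 0 r \<Longrightarrow> H0 x = h x" "\<And>x. 0 \<le> H0 x" "\<And>x. H0 x \<le> 4 * (3 * (?N * \<epsilon>)) * (norm x)\<^sup>2"
  proof (rule tangent_extension[of r "3 * (?N * \<epsilon>)" h G])
    fix x :: "real^'n" assume x: "x \<in> cball 0 r"
    have p: "0 \<le> ?N * \<epsilon> * (norm x)\<^sup>2" using \<epsilon> by simp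
    have ex: "\<bar>e x\<bar> \<le> ?N * \<epsilon> * (norm x)\<^sup>2" using se(2)[OF x 0] ce(2,3) by simp
    show "0 \<le> h x" using ex by (simp add: h_def)
    show "h x \<le> 3 * (?N * \<epsilon>) * (norm x)\<^sup>2" using ex p unfolding h_def by linarith
    have "norm (G x) \<le> norm (grad e x) + norm ((2 * (?N * \<epsilon>)) *\<^sub>R x)" unfolding G_def by (rule norm_triangle_ineq)
    also have "norm (grad e x) \<le> ?N * \<epsilon> * norm x" using se(1)[OF x 0] ce(3) by simp
    also have "norm ((2 * (?N * \<epsilon>)) *\<^sub>R x) = 2 * (?N * \<epsilon>) * norm x" using \<epsilon> by simp
    finally show "norm (G x) \<le> 3 * (?N * \<epsilon>) * norm x" by (simp add: algebra_simps)
  next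
    fix x z :: "real^'n" assume x: "x \<in> cball 0 r" and z: "z \<in> cball 0 r"
    have "- (?N * \<epsilon> * (norm (x - z))\<^sup>2) \<le> e x - e z - grad e z \<bullet> (x - z)"
      using se(2)[OF x z] by linarith
    moreover have "?N * \<epsilon> * (norm x)\<^sup>2 = ?N * \<epsilon> * (norm z)\<^sup>2 + 2 * (?N * \<epsilon>) * (z \<bullet> (x - z)) + ?N * \<epsilon> * (norm (x - z))\<^sup>2"
      unfolding norm_square_shift[of x z] by (simp add: algebra_simps)
    ultimately show "h z + G z \<bullet> (x - z) \<le> h x"
      unfolding h_def G_def inner_add_left inner_scaleR_left by linarith
  qed (use r N\<epsilon> that in auto)
  show thesis
  \<comment> \<open>Dividing by \<open>\<epsilon>\<close> makes the growth constant
    \<open>12 = 4 * 3\<close> of the correction independent of \<open>\<epsilon>\<close>.\<close>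
  proof (rule that[of g "\<lambda>x. (1 / \<epsilon>) * H0 x"])
    show "convex_on UNIV (\<lambda>x. (1 / \<epsilon>) * H0 x)" by (rule convex_on_cmul[OF _ H0(1)]) (use \<epsilon> in simp)
    show "g x + \<epsilon> * (?N * (norm x)\<^sup>2) = quad (hess f y) x + \<epsilon> * ((1 / \<epsilon>) * H0 x)" if "x \<in> cball 0 r" for x
      using g(2)[OF that] H0(2)[OF that] \<epsilon> by (simp add: h_def e_def mult_ac)
    show "0 \<le> (1 / \<epsilon>) * H0 x" for x using H0(3) \<epsilon> by simp
    have "(1 / \<epsilon>) * H0 x \<le> (1 / \<epsilon>) * (4 * (3 * (?N * \<epsilon>)) * (norm x)\<^sup>2)" for x
      using \<epsilon> by (intro mult_left_mono H0(4)) auto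
    then show "(1 / \<epsilon>) * H0 x \<le> 12 * ?N * (norm x)\<^sup>2" for x using \<epsilon> by (simp add: mult.assoc)
    show "g x \<le> 4 * ?N * C * (norm x)\<^sup>2" for x using g(4)[of x] by (simp add: mult_ac)
  qed (use g in auto)
qed

section \<open>Mixed densities\<close>

context ma_pol begin

definition density :: "('k \<Rightarrow> real^'n \<Rightarrow> real) \<Rightarrow> real^'n \<Rightarrow> complex" where
  "density fs y = (\<Sum>a\<in>UNIV. \<Sum>b\<in>UNIV. coef a b * (\<Prod>j\<in>UNIV. of_real (hess (fs j) y (a j) (b j))))"

lemma density_continuous:
  assumes "\<And>j. smooth_fun (fs j)" shows "continuous_on S (density fs)"
  unfolding density_def
  by (intro continuous_on_sum continuous_on_mult continuous_on_const continuous_on_prod continuous_on_of_real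
      hess_continuous assms)

text \<open>The functions are replaced by their second-order Taylor polynomials one slot at a time.
  Each replacement costs \<open>\<epsilon>\<close> times values of \<open>P\<close> that stay
  bounded as the mollifier shrinks, because volume factor and height cancel. On quadratic functions
  the value is the density itself.\<close>

lemma P_local_density:
  assumes fs: "\<And>j. smooth_fun (fs j)" "\<And>j. convex_on UNIV (fs j)"
  obtains M where "M \<ge> 0" "\<And>\<epsilon>. \<epsilon> > 0 \<Longrightarrow> \<exists>r>0. \<forall>\<delta> y. 0 < \<delta> \<longrightarrow> \<delta> < r \<longrightarrow> y \<in> cball 0 R \<longrightarrow>
     norm (P fs (\<lambda>x. moll \<delta> (x - y)) - density fs y) \<le> M * \<epsilon>"
proof -
  let ?N = "(real CARD('n))\<^sup>2"
  obtain C0 where C0: "C0 > 0" "\<And>j x a b. x \<in> cball 0 (R + 1) \<Longrightarrow> \<bar>hess (fs j) x a b\<bar> \<le> C0"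
    by (rule hess_bounded[of fs "R + 1", OF fs(1)]) blast
  \<comment> \<open>A common growth constant for the extended remainders, the Taylor polynomials,
    the corrections \<open>H\<close> and the multiple \<open>m\<close> of the squared norm; the
    summand 1 makes it positive.\<close>
  define C where "C = 4 * ?N * C0 + 12 * ?N + 1"
  have C: "C > 0" unfolding C_def using C0(1) by (intro add_nonneg_pos add_nonneg_nonneg) auto
  obtain K where K: "K \<ge> 0" "\<And>d fs \<phi> B. 0 < d \<Longrightarrow> d \<le> 1 \<Longrightarrow> (\<And>j. convex_on UNIV (fs j)) \<Longrightarrow> (\<And>j x. 0 \<le> fs j x) \<Longrightarrow>
     (\<And>j x. fs j x \<le> C * (norm x)\<^sup>2) \<Longrightarrow> Cc \<phi> \<Longrightarrow> {x. \<phi> x \<noteq> 0} \<subseteq> cball 0 d \<Longrightarrow> (\<And>x. \<bar>\<phi> x\<bar> \<le> B) \<Longrightarrow>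
     norm (P fs \<phi>) \<le> K * d ^ CARD('n) * B"
    by (rule P_bound[OF C]) blast
  define c where "c = 1 / (LINT x|lborel. tent (x :: real^'n))"
  have c: "c > 0" unfolding c_def using tent_integral_pos by simp
  have le_C: "t * (norm x)\<^sup>2 \<le> C * (norm x)\<^sup>2" if "t \<le> C" for t and x :: "real^'n"
    using that by (intro mult_right_mono) auto
  have NC0: "0 \<le> ?N * C0" using C0(1) by simp
  have N0: "0 \<le> ?N" by simp
  have les: "?N * C0 \<le> C" "4 * ?N * C0 \<le> C" "12 * ?N \<le> C" "?N \<le> C"
    using NC0 N0 unfolding C_def by linarith+
  show thesis
  \<comment> \<open>Two error terms in each of the \<open>k\<close> slots.\<close>
  proof (rule that[of "2 * real k * (K * c)"])
    show "0 \<le> 2 * real k * (K * c)" using K(1) c by simp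
    fix \<epsilon> :: real assume \<epsilon>: "\<epsilon> > 0"
    obtain r where r: "0 < r" "r \<le> 1"
      "\<And>j x y a b. y \<in> cball 0 R \<Longrightarrow> x \<in> cball y r \<Longrightarrow> \<bar>hess (fs j) x a b - hess (fs j) y a b\<bar> \<le> \<epsilon>"
      by (rule hess_modulus[of fs \<epsilon> R, OF fs(1) \<epsilon>]) blast
    show "\<exists>r>0. \<forall>\<delta> y. 0 < \<delta> \<longrightarrow> \<delta> < r \<longrightarrow> y \<in> cball 0 R \<longrightarrow>
       norm (P fs (\<lambda>x. moll \<delta> (x - y)) - density fs y) \<le> 2 * real k * (K * c) * \<epsilon>"
    proof (intro exI[of _ r] conjI allI impI r(1))
      fix \<delta> :: real and y :: "real^'n" assume \<delta>: "0 < \<delta>" "\<delta> < r" and y: "y \<in> cball 0 R"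
      have yr: "x \<in> cball 0 (R + 1)" if "x \<in> cball y r" for x
        using that y r(2) norm_triangle_ineq[of "x - y" y] by (simp add: dist_norm norm_minus_commute)
      have "\<exists>g H. convex_on UNIV g \<and> convex_on UNIV H \<and> (\<forall>x\<in>cball 0 r. g x = recentre (fs j) y x) \<and>
        (\<forall>x\<in>cball 0 r. g x + \<epsilon> * (?N * (norm x)\<^sup>2) = quad (hess (fs j) y) x + \<epsilon> * H x) \<and>
        (\<forall>x. 0 \<le> g x) \<and> (\<forall>x. g x \<le> 4 * ?N * C0 * (norm x)\<^sup>2) \<and> (\<forall>x. 0 \<le> H x) \<and> (\<forall>x. H x \<le> 12 * ?N * (norm x)\<^sup>2)" for j
      proof (rule taylor_decomposition[OF fs(1) fs(2) r(1) \<epsilon> less_imp_le[OF C0(1)], of y j])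
        show "\<bar>hess (fs j) x a b - hess (fs j) y a b\<bar> \<le> \<epsilon>" if "x \<in> cball y r" for x a b by (rule r(3)[OF y that])
        show "\<bar>hess (fs j) x a b\<bar> \<le> C0" if "x \<in> cball y r" for x a b by (rule C0(2)[OF yr[OF that]])
      qed blast
      then obtain g H where g: "\<And>j. convex_on UNIV (g j)" "\<And>j x. x \<in> cball 0 r \<Longrightarrow> g j x = recentre (fs j) y x"
          "\<And>j x. 0 \<le> g j x" "\<And>j x. g j x \<le> 4 * ?N * C0 * (norm x)\<^sup>2"
        and H: "\<And>j. convex_on UNIV (H j)" "\<And>j x. 0 \<le> H j x" "\<And>j x. H j x \<le> 12 * ?N * (norm x)\<^sup>2"
        and gH: "\<And>j x. x \<in> cball 0 r \<Longrightarrow> g j x + \<epsilon> * (?N * (norm x)\<^sup>2) = quad (hess (fs j) y) x + \<epsilon> * H j x"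
        by metis
      define q where "q = (\<lambda>j. quad (hess (fs j) y))"
      define m where "m = (\<lambda>x::real^'n. ?N * (norm x)\<^sup>2)"
      have q: "convex_on UNIV (q j)" "0 \<le> q j x" "q j x \<le> ?N * C0 * (norm x)\<^sup>2" for j x
      proof -
        show 1: "convex_on UNIV (q j)" unfolding q_def by (rule quad_hess_convex[OF fs])
        show "0 \<le> q j x" using quad_nonneg 1 unfolding q_def by blast
        have "y \<in> cball 0 (R + 1)" using y by simp
        then show "q j x \<le> ?N * C0 * (norm x)\<^sup>2"
          using quad_bound[of "hess (fs j) y" C0 x] C0(2) unfolding q_def by fastforce
      qed
      have m: "convex_on UNIV m" unfolding m_def by (rule convex_on_cmul[OF _ convex_on_norm_square]) simp
      have \<phi>: "Cc (moll \<delta> :: real^'n \<Rightarrow> real)" by (rule moll_Cc[OF \<delta>(1)])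
      have cl: "closure {x :: real^'n. moll \<delta> x \<noteq> 0} \<subseteq> ball 0 r"
      proof -
        have "closure {x :: real^'n. moll \<delta> x \<noteq> 0} \<subseteq> cball 0 \<delta>" by (rule closure_minimal[OF moll_support[OF \<delta>(1)]]) simp
        also have "\<dots> \<subseteq> ball 0 r" using \<delta> by auto
        finally show ?thesis .
      qed
      have bnd: "norm (P ws (moll \<delta>)) \<le> K * c"
        if "\<And>j. convex_on UNIV (ws j)" "\<And>j x. 0 \<le> ws j x" "\<And>j x. ws j x \<le> C * (norm x)\<^sup>2" for ws
      proof -
        have "norm (P ws (moll \<delta>)) \<le> K * \<delta> ^ CARD('n) * (c / \<delta> ^ CARD('n))"
        proof (rule K(2)[OF \<delta>(1) _ that \<phi> moll_support[OF \<delta>(1)]])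
          show "\<delta> \<le> 1" using \<delta> r by simp
          show "\<bar>moll \<delta> x\<bar> \<le> c / \<delta> ^ CARD('n)" for x :: "real^'n"
            using moll_le[OF \<delta>(1), of x] moll_nonneg[OF \<delta>(1), of x] unfolding c_def by simp
        qed
        also have "\<dots> = K * c" using \<delta>(1) by simp
        finally show ?thesis .
      qed
      \<comment> \<open>Hybrid tuples: Taylor polynomials in the slots of \<open>S\<close>, extended
        remainders in the others.\<close>
      define F where "F = (\<lambda>S j. if j \<in> S then q j else g j)"
      have F: "convex_on UNIV (F S j)" "0 \<le> F S j x" "F S j x \<le> C * (norm x)\<^sup>2" for S j x
      proof -
        show "convex_on UNIV (F S j)" "0 \<le> F S j x" unfolding F_def using q g by auto
        have "q j x \<le> C * (norm x)\<^sup>2" using q(3)[of j x] le_C[OF les(1), of x] by linarith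
        moreover have "g j x \<le> C * (norm x)\<^sup>2" using g(4)[of j x] le_C[OF les(2), of x] by linarith
        ultimately show "F S j x \<le> C * (norm x)\<^sup>2" unfolding F_def by simp
      qed
      have H_le: "H j x \<le> C * (norm x)\<^sup>2" for j x
        using H(3)[of j x] le_C[OF les(3), of x] by linarith
      have m_le: "m x \<le> C * (norm x)\<^sup>2" for x
        using le_C[OF les(4), of x] unfolding m_def by linarith
      have step: "norm (P ((F S)(j := q j)) (moll \<delta>) - P ((F S)(j := g j)) (moll \<delta>)) \<le> 2 * \<epsilon> * (K * c)" for S j
      proof -
        have \<epsilon>0: "0 \<le> \<epsilon>" using \<epsilon> by simp
        have cm: "convex_on UNIV (\<lambda>x. \<epsilon> * m x)" "convex_on UNIV (\<lambda>x. \<epsilon> * H j x)"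
          using m H(1) \<epsilon> by (auto intro: convex_on_cmul)
        \<comment> \<open>Both sides have convex entries that agree on the ball, so locality
          applies; additivity then yields the difference of the values at \<open>q j\<close> and
          \<open>g j\<close>, which could not be formed as a convex function.\<close>
        have "P ((F S)(j := (\<lambda>x. g j x + \<epsilon> * m x))) (moll \<delta>) = P ((F S)(j := (\<lambda>x. q j x + \<epsilon> * H j x))) (moll \<delta>)"
        proof (rule P_local[where U = "ball 0 r" and y = "\<lambda>_. 0" and c = "\<lambda>_. 0"])
          show "convex_on UNIV (((F S)(j := (\<lambda>x. g j x + \<epsilon> * m x))) i)" "convex_on UNIV (((F S)(j := (\<lambda>x. q j x + \<epsilon> * H j x))) i)" for i
            using F(1) convex_on_add[OF g(1) cm(1)] convex_on_add[OF q(1) cm(2)] by auto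
          show "((F S)(j := (\<lambda>x. g j x + \<epsilon> * m x))) i x = ((F S)(j := (\<lambda>x. q j x + \<epsilon> * H j x))) i x + (0 \<bullet> x + 0)" if "x \<in> ball 0 r" for i x
            using gH[of x j] that unfolding q_def m_def by simp
        qed (use \<phi> cl in auto)
        moreover have "P ((F S)(j := (\<lambda>x. g j x + \<epsilon> * m x))) (moll \<delta>) = P ((F S)(j := g j)) (moll \<delta>) + of_real \<epsilon> * P ((F S)(j := m)) (moll \<delta>)"
          using P_add[where fs = "F S" and j = j, OF F(1) g(1) cm(1) \<phi>] P_scale[where fs = "F S" and j = j, OF F(1) m \<phi> \<epsilon>0] by simp
        moreover have "P ((F S)(j := (\<lambda>x. q j x + \<epsilon> * H j x))) (moll \<delta>) = P ((F S)(j := q j)) (moll \<delta>) + of_real \<epsilon> * P ((F S)(j := H j)) (moll \<delta>)"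
          using P_add[where fs = "F S" and j = j, OF F(1) q(1) cm(2) \<phi>] P_scale[where fs = "F S" and j = j, OF F(1) H(1) \<phi> \<epsilon>0] by simp
        ultimately have "P ((F S)(j := q j)) (moll \<delta>) - P ((F S)(j := g j)) (moll \<delta>) = of_real \<epsilon> * P ((F S)(j := m)) (moll \<delta>) - of_real \<epsilon> * P ((F S)(j := H j)) (moll \<delta>)"
          by (simp add: algebra_simps)
        also have "norm \<dots> \<le> \<epsilon> * norm (P ((F S)(j := m)) (moll \<delta>)) + \<epsilon> * norm (P ((F S)(j := H j)) (moll \<delta>))"
          by (rule order_trans[OF norm_triangle_ineq4]) (use \<epsilon> in \<open>simp add: norm_mult\<close>)
        also have "\<dots> \<le> \<epsilon> * (K * c) + \<epsilon> * (K * c)"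
        proof (intro add_mono mult_left_mono bnd)
          show "0 \<le> ((F S)(j := m)) i x" for i x using F(2) by (simp add: m_def)
        qed (use F m H m_le H_le \<epsilon> in auto)
        finally show ?thesis by (simp add: mult_ac)
      qed
      have tele: "norm (P (F S) (moll \<delta>) - P (F {}) (moll \<delta>)) \<le> real (card S) * (2 * \<epsilon> * (K * c))" for S
        using finite[of S]
      proof (induction S rule: finite_induct)
        case (insert j S)
        have e1: "(F S)(j := q j) = F (insert j S)" unfolding F_def by auto
        have e2: "(F S)(j := g j) = F S" unfolding F_def using insert.hyps by auto
        have "norm (P (F (insert j S)) (moll \<delta>) - P (F {}) (moll \<delta>))
          \<le> norm (P (F (insert j S)) (moll \<delta>) - P (F S) (moll \<delta>)) + norm (P (F S) (moll \<delta>) - P (F {}) (moll \<delta>))"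
          using norm_triangle_ineq[of "P (F (insert j S)) (moll \<delta>) - P (F S) (moll \<delta>)" "P (F S) (moll \<delta>) - P (F {}) (moll \<delta>)"] by simp
        also have "\<dots> \<le> 2 * \<epsilon> * (K * c) + real (card S) * (2 * \<epsilon> * (K * c))"
          using step[of S j] insert.IH unfolding e1 e2 by (intro add_mono)
        also have "\<dots> = real (card (insert j S)) * (2 * \<epsilon> * (K * c))"
          using insert.hyps by (simp add: algebra_simps)
        finally show ?case .
      qed simp
      have Pq: "P (F UNIV) (moll \<delta>) = density fs y"
      proof -
        have "F UNIV = (\<lambda>j. quad (hess (fs j) y))" by (simp add: F_def q_def)
        moreover have "P (\<lambda>j. quad (hess (fs j) y)) (moll \<delta>) = density fs y"
          using P_quad[of "\<lambda>j. hess (fs j) y", OF _ \<phi>] quad_hess_convex[OF fs] moll_integral[OF \<delta>(1), where 'n='n]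
          unfolding density_def by simp
        ultimately show ?thesis by simp
      qed
      have Pg: "P (F {}) (moll \<delta>) = P fs (\<lambda>x. moll \<delta> (x - y))"
      proof -
        have "F {} = g" by (simp add: F_def)
        moreover have "P g (moll \<delta>) = P (\<lambda>j x. fs j (x - (- y))) (moll \<delta>)"
        proof (rule P_local[where U = "ball 0 r" and y = "\<lambda>j. - grad (fs j) y" and c = "\<lambda>j. - fs j y"])
          show "convex_on UNIV (\<lambda>x. fs j (x - (- y)))" for j by (rule convex_on_translate[OF fs(2)])
          show "g j x = fs j (x - - y) + (- grad (fs j) y \<bullet> x + - fs j y)" if "x \<in> ball 0 r" for j x
            using g(2)[of x j] that by (simp add: recentre_def)
        qed (use g \<phi> cl in auto)
        moreover have "P (\<lambda>j x. fs j (x - (- y))) (moll \<delta>) = P fs (\<lambda>x. moll \<delta> (x - y))"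
          using P_translate[where fs = fs and v = "- y", OF fs(2) \<phi>] by simp
        ultimately show ?thesis by simp
      qed
      show "norm (P fs (\<lambda>x. moll \<delta> (x - y)) - density fs y) \<le> 2 * real k * (K * c) * \<epsilon>"
        using tele[of UNIV] unfolding Pq Pg by (simp add: norm_minus_commute k_card mult_ac)
    qed
  qed
qed

text \<open>Mollification turns \<open>P fs \<phi>\<close> into the integral of
  \<open>\<phi> y\<close> times the values at mollifiers centred at \<open>y\<close>. These values
  are uniformly close to the density on the support of \<open>\<phi>\<close>; each of the two errors
  gets half of \<open>e\<close>.\<close>

theorem P_formula:
  assumes fs: "\<And>j. smooth_fun (fs j)" "\<And>j. convex_on UNIV (fs j)" and \<phi>: "Cc \<phi>"
  shows "P fs \<phi> = (LINT x|lborel. complex_of_real (\<phi> x) * density fs x)"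
proof -
  obtain R where R: "R > 0" "{x. \<phi> x \<noteq> 0} \<subseteq> cball 0 R" by (rule Cc_support[OF \<phi>])
  obtain M where M: "M \<ge> 0" "\<And>\<epsilon>. \<epsilon> > 0 \<Longrightarrow> \<exists>r>0. \<forall>\<delta> y. 0 < \<delta> \<longrightarrow> \<delta> < r \<longrightarrow> y \<in> cball 0 R \<longrightarrow>
     norm (P fs (\<lambda>x. moll \<delta> (x - y)) - density fs y) \<le> M * \<epsilon>"
    by (rule P_local_density[where fs = fs and R = R, OF fs]) blast
  have L: "radon_functional (P fs)" by (rule P_radon[OF fs(2)])
  define a where "a = (LINT x|lborel. \<bar>\<phi> x\<bar>)"
  have a: "a \<ge> 0" unfolding a_def by (rule integral_nonneg_AE) simp
  let ?I = "LINT x|lborel. complex_of_real (\<phi> x) * density fs x"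
  have "norm (P fs \<phi> - ?I) \<le> 0 + e" if e: "e > 0" for e
  proof -
    define \<epsilon> where "\<epsilon> = e / (2 * (M * a + 1))"
    have Ma: "M * a + 1 > 0" using M(1) a by (intro add_nonneg_pos mult_nonneg_nonneg) auto
    have \<epsilon>: "\<epsilon> > 0" unfolding \<epsilon>_def using e Ma by simp
    have \<epsilon>2: "M * \<epsilon> * a \<le> e / 2"
    proof -
      have "M * \<epsilon> * a \<le> (M * a + 1) * \<epsilon>" using \<epsilon> by (simp add: algebra_simps)
      also have "\<dots> = e / 2"
      proof -
        have "X * (e / (2 * X)) = e / 2" if "X > 0" for X :: real using that by simp
        from this[OF Ma] show ?thesis unfolding \<epsilon>_def .
      qed
      finally show ?thesis .
    qed
    obtain r where r: "r > 0" "\<And>\<delta> y. 0 < \<delta> \<Longrightarrow> \<delta> < r \<Longrightarrow> y \<in> cball 0 R \<Longrightarrow> norm (P fs (\<lambda>x. moll \<delta> (x - y)) - density fs y) \<le> M * \<epsilon>"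
      using M(2)[OF \<epsilon>] by blast
    obtain d0 where d0: "d0 > 0" "\<And>d. 0 < d \<Longrightarrow> d < d0 \<Longrightarrow> norm ((LINT y|lborel. complex_of_real (\<phi> y) * P fs (\<lambda>x. moll d (x - y))) - P fs \<phi>) \<le> e / 2"
      by (rule radon_mollify[OF L \<phi>, of "e / 2"]) (use e in auto)
    define d where "d = min r d0 / 2"
    have d: "0 < d" "d < r" "d < d0" using r d0 by (auto simp: d_def)
    let ?J = "LINT y|lborel. complex_of_real (\<phi> y) * P fs (\<lambda>x. moll d (x - y))"
    note int1 = radon_convolution(2)[OF L \<phi> moll_Cc[OF d(1)]]
    note int2 = continuous_Cc_integrable[OF \<phi> density_continuous[OF fs(1)]]
    have "?J - ?I = (LINT y|lborel. complex_of_real (\<phi> y) * P fs (\<lambda>x. moll d (x - y)) - complex_of_real (\<phi> y) * density fs y)"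
      by (rule Bochner_Integration.integral_diff[OF int1 int2, symmetric])
    also have "norm \<dots> \<le> (LINT y|lborel. norm (complex_of_real (\<phi> y) * P fs (\<lambda>x. moll d (x - y)) - complex_of_real (\<phi> y) * density fs y))"
      by (rule integral_norm_bound)
    also have "\<dots> \<le> (LINT y|lborel. (M * \<epsilon>) * \<bar>\<phi> y\<bar>)"
    proof (rule integral_mono)
      show "integrable lborel (\<lambda>y. norm (complex_of_real (\<phi> y) * P fs (\<lambda>x. moll d (x - y)) - complex_of_real (\<phi> y) * density fs y))"
        by (intro integrable_norm Bochner_Integration.integrable_diff int1 int2)
      show "integrable lborel (\<lambda>y. (M * \<epsilon>) * \<bar>\<phi> y\<bar>)"
        by (intro integrable_mult_right integrable_abs Cc_integrable[OF \<phi>])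
      fix y
      show "norm (complex_of_real (\<phi> y) * P fs (\<lambda>x. moll d (x - y)) - complex_of_real (\<phi> y) * density fs y) \<le> (M * \<epsilon>) * \<bar>\<phi> y\<bar>"
      proof (cases "\<phi> y = 0")
        case False
        then have y: "y \<in> cball 0 R" using R(2) by blast
        have "norm (complex_of_real (\<phi> y) * (P fs (\<lambda>x. moll d (x - y)) - density fs y)) \<le> \<bar>\<phi> y\<bar> * (M * \<epsilon>)"
          unfolding norm_mult using r(2)[OF d(1,2) y] by (simp add: mult_left_mono)
        then show ?thesis by (simp add: right_diff_distrib mult.commute)
      qed simp
    qed
    also have "\<dots> = M * \<epsilon> * a" by (simp add: a_def)
    finally have 1: "norm (?J - ?I) \<le> e / 2" using \<epsilon>2 by linarith
    have 2: "norm (?J - P fs \<phi>) \<le> e / 2" by (rule d0(2)[OF d(1,3)])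
    have "norm (P fs \<phi> - ?I) \<le> norm (?J - ?I) + norm (?J - P fs \<phi>)"
      using norm_triangle_ineq4[of "?J - ?I" "?J - P fs \<phi>"] by simp
    then show ?thesis using 1 2 by simp
  qed
  then have "norm (P fs \<phi> - ?I) \<le> 0" by (rule field_le_epsilon)
  then show ?thesis by simp
qed

end

section \<open>Goodey-Weil distribution and its Fourier-Laplace transform\<close>

text \<open>On the line through \<open>X\<close> in direction \<open>axis j v\<close> only the
  \<open>j\<close>-th factor moves; uniqueness of the derivative along that line gives the
  formula.\<close>

lemma iter_dd_tensor_single:
  fixes fs :: "'k::finite \<Rightarrow> real^'n \<Rightarrow> real"
  assumes fs: "\<And>j. smooth_fun (fs j)"
  shows "iter_dd [axis j v] (tensor fs) = tensor (fs(j := iter_dd [v] (fs j)))"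
proof
  fix X :: "real^'n^'k"
  define c where "c = (\<Prod>i\<in>UNIV - {j}. complex_of_real (fs i (X $ i)))"
  have line: "tensor fs (X + t *\<^sub>R axis j v) = complex_of_real (fs j (X $ j + t *\<^sub>R v)) * c" for t
  proof -
    have "tensor fs (X + t *\<^sub>R axis j v) = complex_of_real (fs j (X $ j + t *\<^sub>R v)) * (\<Prod>i\<in>UNIV - {j}. complex_of_real (fs i ((X + t *\<^sub>R axis j v) $ i)))"
      unfolding tensor_def by (subst prod.remove[of UNIV j]) (auto simp: axis_def)
    also have "(\<Prod>i\<in>UNIV - {j}. complex_of_real (fs i ((X + t *\<^sub>R axis j v) $ i))) = c"
      unfolding c_def by (rule prod.cong[OF refl]) (auto simp: axis_def)
    finally show ?thesis .
  qed
  have "((\<lambda>t. X + t *\<^sub>R axis j v) has_derivative (\<lambda>t. t *\<^sub>R axis j v)) (at (0::real))"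
    by (auto intro!: derivative_eq_intros)
  moreover have "(tensor fs has_derivative frechet_derivative (tensor fs) (at X)) (at (X + 0 *\<^sub>R axis j v))"
    using smooth_fun_has_derivative[OF smooth_fun_tensor[OF fs]] by simp
  ultimately have 1: "((\<lambda>t. tensor fs (X + t *\<^sub>R axis j v)) has_derivative (\<lambda>t. frechet_derivative (tensor fs) (at X) (t *\<^sub>R axis j v))) (at (0::real))"
    by (rule has_derivative_compose)
  have "((\<lambda>t. fs j (X $ j + t *\<^sub>R v)) has_derivative (\<lambda>h. iter_dd [v] (fs j) (X $ j) * h)) (at 0)"
    using smooth_fun_line_deriv[OF fs, of j "X $ j" v 0] unfolding has_field_derivative_def by simp
  then have 2: "((\<lambda>t. complex_of_real (fs j (X $ j + t *\<^sub>R v)) * c) has_derivative (\<lambda>h. complex_of_real (iter_dd [v] (fs j) (X $ j) * h) * c)) (at 0)"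
    by (intro has_derivative_mult_left bounded_linear.has_derivative[OF bounded_linear_of_real])
  from has_derivative_unique[OF 1[unfolded line] 2]
  have "frechet_derivative (tensor fs) (at X) (1 *\<^sub>R axis j v) = complex_of_real (iter_dd [v] (fs j) (X $ j) * 1) * c" by metis
  moreover have "tensor (fs(j := iter_dd [v] (fs j))) X = complex_of_real (iter_dd [v] (fs j) (X $ j)) * c"
  proof -
    have "(\<Prod>i\<in>UNIV - {j}. complex_of_real ((fs(j := iter_dd [v] (fs j))) i (X $ i))) = c"
      unfolding c_def by (rule prod.cong[OF refl]) auto
    then show ?thesis unfolding tensor_def by (subst prod.remove[of UNIV j]) auto
  qed
  ultimately show "iter_dd [axis j v] (tensor fs) X = tensor (fs(j := iter_dd [v] (fs j))) X" by simp
qed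

text \<open>Two coordinate directions in every slot of \<open>js\<close>; on a tensor product they
  produce the Hessian entries \<open>(a j, b j)\<close> of the factors.\<close>

definition dirs :: "'k list \<Rightarrow> ('k \<Rightarrow> 'n) \<Rightarrow> ('k \<Rightarrow> 'n) \<Rightarrow> (real^'n^'k) list" where
  "dirs js a b = concat (map (\<lambda>j. [axis j (axis (a j) 1), axis j (axis (b j) 1)]) js)"

lemma iter_dd_tensor:
  fixes fs :: "'k::finite \<Rightarrow> real^'n \<Rightarrow> real"
  assumes fs: "\<And>j. smooth_fun (fs j)"
  shows "distinct js \<Longrightarrow> iter_dd (dirs js a b) (tensor fs) = tensor (\<lambda>j. if j \<in> set js then iter_dd [axis (a j) 1, axis (b j) 1] (fs j) else fs j)"
proof (induction js)
  case (Cons j js)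
  let ?fs = "\<lambda>j. if j \<in> set js then iter_dd [axis (a j) 1, axis (b j) 1] (fs j) else fs j"
  have s: "smooth_fun (?fs i)" for i using smooth_fun_iter_dd[OF fs, of _ i] fs by (simp del: iter_dd.simps)
  have j: "j \<notin> set js" using Cons.prems by simp
  have s2: "smooth_fun ((?fs(j := iter_dd [axis (b j) 1] (?fs j))) i)" for i
    using s smooth_fun_iter_dd[OF s] by (cases "i = j") (simp_all del: iter_dd.simps)
  have "iter_dd (dirs (j # js) a b) (tensor fs) = iter_dd [axis j (axis (a j) 1)] (iter_dd [axis j (axis (b j) 1)] (iter_dd (dirs js a b) (tensor fs)))"
    unfolding iter_dd_append[symmetric] by (simp add: dirs_def)
  also have "iter_dd (dirs js a b) (tensor fs) = tensor ?fs" using Cons by simp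
  also have "iter_dd [axis j (axis (b j) 1)] (tensor ?fs) = tensor (?fs(j := iter_dd [axis (b j) 1] (?fs j)))"
    by (rule iter_dd_tensor_single[OF s])
  also have "iter_dd [axis j (axis (a j) 1)] \<dots> = tensor ((?fs(j := iter_dd [axis (b j) 1] (?fs j)))(j := iter_dd [axis (a j) 1] ((?fs(j := iter_dd [axis (b j) 1] (?fs j))) j)))"
    by (rule iter_dd_tensor_single[OF s2])
  also have "(?fs(j := iter_dd [axis (b j) 1] (?fs j)))(j := iter_dd [axis (a j) 1] ((?fs(j := iter_dd [axis (b j) 1] (?fs j))) j))
     = (\<lambda>i. if i \<in> set (j # js) then iter_dd [axis (a i) 1, axis (b i) 1] (fs i) else fs i)"
    using j by (auto simp: fun_eq_iff)
  finally show ?case .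
qed (simp add: dirs_def)

lemma smooth_diag_continuous:
  assumes "smooth_fun (g :: real^'n^'k \<Rightarrow> complex)" shows "continuous_on UNIV (\<lambda>x. g (\<chi> j. x))"
  by (rule continuous_on_compose2[OF smooth_fun_continuous[OF assms, of UNIV]])
    (auto intro!: continuous_on_vec_lambda continuous_on_id)

lemma polarization_permute:
  fixes fs :: "'k::finite \<Rightarrow> real^'n \<Rightarrow> real"
  assumes \<sigma>: "\<sigma> permutes (UNIV :: 'k set)"
  shows "polarization \<mu> (\<lambda>j. fs (\<sigma> j)) = polarization \<mu> fs"
proof -
  have inj: "inj \<sigma>" using permutes_inj[OF \<sigma>] .
  have "(\<Sum>S\<in>Pow UNIV. (-1) ^ (CARD('k) - card S) * \<mu> (\<lambda>x. \<Sum>j\<in>S. fs (\<sigma> j) x)) = 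
     (\<Sum>S\<in>Pow (UNIV :: 'k set). (-1) ^ (CARD('k) - card S) * \<mu> (\<lambda>x. \<Sum>j\<in>S. fs j x))"
  proof (rule sum.reindex_bij_witness[of _ "\<lambda>S. inv \<sigma> ` S" "\<lambda>S. \<sigma> ` S"])
    fix S
    show "inv \<sigma> ` \<sigma> ` S = S" using inj by (simp add: image_comp)
    show "\<sigma> ` inv \<sigma> ` S = S" using permutes_surj[OF \<sigma>] by (simp add: image_f_inv_f)
    have "inj_on \<sigma> S" using inj inj_on_subset by blast
    then show "(-1) ^ (CARD('k) - card (\<sigma> ` S)) * \<mu> (\<lambda>x. \<Sum>j\<in>\<sigma> ` S. fs j x) = (-1) ^ (CARD('k) - card S) * \<mu> (\<lambda>x. \<Sum>j\<in>S. fs (\<sigma> j) x)"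
      by (simp add: card_image sum.reindex)
  qed auto
  then show ?thesis unfolding polarization_def by simp
qed

lemma permute_bounded_linear: "bounded_linear (\<lambda>X :: real^'n^'k. \<chi> j. X $ \<sigma> j)"
  by (rule linear_conv_bounded_linear[THEN iffD1]) (auto intro!: linearI simp: vec_eq_iff)

lemma permute_norm:
  assumes "\<sigma> permutes (UNIV :: 'k::finite set)" shows "norm (\<chi> j. X $ \<sigma> j) = norm (X :: real^'n^'k)"
proof -
  have nv: "norm Y = sqrt (\<Sum>j\<in>UNIV. (norm (Y $ j))\<^sup>2)" for Y :: "real^'n^'k"
    unfolding norm_vec_def[of Y] L2_set_def ..
  have "(\<Sum>j\<in>UNIV. (norm (X $ \<sigma> j))\<^sup>2) = (\<Sum>j\<in>UNIV. (norm (X $ j))\<^sup>2)"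
    using sum.permute[OF assms, of "\<lambda>j. (norm (X $ j))\<^sup>2"] by (simp only: comp_def)
  then show ?thesis unfolding nv by simp
qed

lemma FL_exponent_bounded_linear:
  "bounded_linear (\<lambda>X :: real^'n^'k. \<i> * (\<Sum>j\<in>UNIV. \<Sum>l\<in>UNIV. z $ j $ l * complex_of_real (X $ j $ l)))"
  by (intro bounded_linear_mult_right[THEN bounded_linear_compose] bounded_linear_sum bounded_linear_of_real[THEN bounded_linear_compose]
      bounded_linear_vec_nth[THEN bounded_linear_compose] bounded_linear_vec_nth)

text \<open>A tent so narrow that the exponential has positive real part on its support.\<close>
lemma FT_nonzero:
  fixes w :: "complex^'n"
  obtains \<phi> where "Cc \<phi>" "FT \<phi> w \<noteq> 0"
proof -
  let ?E = "\<lambda>x::real^'n. exp (\<i> * (\<Sum>l\<in>UNIV. w $ l * complex_of_real (x $ l)))"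
  have cE: "continuous_on UNIV ?E" by (intro continuous_intros)
  then have "continuous (at 0) ?E" by (simp add: continuous_on_eq_continuous_at)
  from this[unfolded continuous_at_eps_delta, rule_format, of "1/2"]
  obtain d where d: "d > 0" "\<And>x. dist x 0 < d \<Longrightarrow> dist (?E x) (?E 0) < 1/2" by auto
  have re: "Re (?E x) > 0" if "norm x < d" for x
  proof -
    have "norm (?E x - 1) < 1/2" using d(2)[of x] that by (simp add: dist_norm)
    then have "\<bar>Re (?E x - 1)\<bar> < 1/2" using abs_Re_le_cmod[of "?E x - 1"] by linarith
    moreover have "Re (?E x - 1) = Re (?E x) - 1" by simp
    ultimately show ?thesis by linarith
  qed
  define \<phi> where "\<phi> = (moll (d/2) :: real^'n \<Rightarrow> real)"
  have \<phi>: "Cc \<phi>" unfolding \<phi>_def by (rule moll_Cc) (use d in simp)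
  have \<phi>0: "\<phi> x \<ge> 0" for x unfolding \<phi>_def by (rule moll_nonneg) (use d in simp)
  have supp: "norm x < d" if "\<phi> x \<noteq> 0" for x
  proof -
    have "x \<in> cball 0 (d/2)" using subsetD[OF moll_support[of "d/2"], of x] that d(1) unfolding \<phi>_def by simp
    then show ?thesis using d(1) by simp
  qed
  have cR: "continuous_on UNIV (\<lambda>x. Re (?E x))" by (intro continuous_intros)
  have "(LINT x|lborel. \<phi> x * Re (?E x)) > 0"
  proof (rule Cc_integral_pos[OF Cc_mult[OF \<phi> cR], of 0])
    fix x show "0 \<le> \<phi> x * Re (?E x)"
      using \<phi>0[of x] re[of x] supp[of x] by (cases "\<phi> x = 0") auto
  next
    show "0 < \<phi> 0 * Re (?E 0)"
      unfolding \<phi>_def moll_def tent_def using d(1) tent_integral_pos[where 'n='n] by (simp add: tent_def)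
  qed
  moreover have "Re (FT \<phi> w) = (LINT x|lborel. \<phi> x * Re (?E x))"
  proof -
    have i: "integrable lborel (\<lambda>x. ?E x * complex_of_real (\<phi> x))"
      using continuous_Cc_integrable[OF \<phi> cE] by (simp add: mult.commute)
    have "Re (FT \<phi> w) = (LINT x|lborel. Re (?E x * complex_of_real (\<phi> x)))"
      unfolding FT_def by (rule integral_Re[OF i, symmetric])
    then show ?thesis by (simp add: mult.commute)
  qed
  ultimately have "FT \<phi> w \<noteq> 0" by auto
  then show thesis using that \<phi> by blast
qed

section \<open>The explicit distribution and its transform\<close>

context ma_pol begin

text \<open>Read off from \<open>P_formula\<close> on tensor products: differentiate twice in every
  slot, restrict to the diagonal \<open>\<chi> j. x\<close> and integrate against
  \<open>\<phi>\<close>. The value 0 at other functions is the convention of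
  \<open>is_GW\<close>.\<close>

definition gw :: "(real^'n \<Rightarrow> real) \<Rightarrow> (real^'n^'k \<Rightarrow> complex) \<Rightarrow> complex" where
  "gw \<phi> g = (if smooth_fun g then \<Sum>a\<in>UNIV. \<Sum>b\<in>UNIV. coef a b *
     (LINT x|lborel. complex_of_real (\<phi> x) * iter_dd (dirs ks a b) g (\<chi> j. x)) else 0)"

lemma gw_integrable:
  assumes "Cc \<phi>" "smooth_fun (g :: real^'n^'k \<Rightarrow> complex)"
  shows "integrable lborel (\<lambda>x. complex_of_real (\<phi> x) * iter_dd vs g (\<chi> j. x))"
  by (rule continuous_Cc_integrable[OF assms(1) smooth_diag_continuous[OF smooth_fun_iter_dd[OF assms(2)]]])

lemma gw_linear:
  assumes \<phi>: "Cc \<phi>" and g: "smooth_fun g" and h: "smooth_fun h"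
  shows "gw \<phi> (\<lambda>x. a * g x + h x) = a * gw \<phi> g + gw \<phi> h"
proof -
  have ag: "smooth_fun (\<lambda>x. a * g x)" by (rule smooth_fun_bounded_linear_left[OF bounded_linear_mult_right g])
  have s: "smooth_fun (\<lambda>x. a * g x + h x)" by (rule smooth_fun_add[OF ag h])
  have "(LINT x|lborel. complex_of_real (\<phi> x) * iter_dd vs (\<lambda>x. a * g x + h x) (\<chi> j. x)) =
    a * (LINT x|lborel. complex_of_real (\<phi> x) * iter_dd vs g (\<chi> j. x)) + (LINT x|lborel. complex_of_real (\<phi> x) * iter_dd vs h (\<chi> j. x))" for vs
  proof -
    have "(\<lambda>x. complex_of_real (\<phi> x) * iter_dd vs (\<lambda>x. a * g x + h x) (\<chi> j. x)) =
      (\<lambda>x. a * (complex_of_real (\<phi> x) * iter_dd vs g (\<chi> j. x)) + complex_of_real (\<phi> x) * iter_dd vs h (\<chi> j. x))"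
      unfolding iter_dd_add[OF ag h] iter_dd_bounded_linear_left[OF bounded_linear_mult_right g] by (simp add: algebra_simps)
    then show ?thesis using gw_integrable[OF \<phi> g] gw_integrable[OF \<phi> h] by simp
  qed
  then show ?thesis unfolding gw_def using s g h
    by (simp add: sum_distrib_left sum.distrib algebra_simps)
qed

lemma dirs_length: "length (dirs js a b) = 2 * length js"
  unfolding dirs_def by (induction js) auto

lemma dirs_norm: "v \<in> set (dirs js a b) \<Longrightarrow> norm v \<le> 1"
  unfolding dirs_def by auto

text \<open>Order \<open>2 * k\<close> and support on the diagonal. The bound is kept explicit
  because the permuted distribution needs it with the same compact set.\<close>

lemma gw_bound:
  assumes \<phi>: "Cc \<phi>"
  obtains R C where "R > 0" "\<And>g B. smooth_fun g \<Longrightarrow> (\<And>vs x. length vs \<le> 2 * k \<Longrightarrow> (\<forall>v\<in>set vs. norm v \<le> 1) \<Longrightarrow> x \<in> (\<lambda>x. \<chi> j. x) ` cball 0 R \<Longrightarrow>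
     norm (iter_dd vs g x) \<le> B) \<Longrightarrow> norm (gw \<phi> g) \<le> C * B"
proof -
  obtain R where R: "R > 0" "{x. \<phi> x \<noteq> 0} \<subseteq> cball 0 R" by (rule Cc_support[OF \<phi>])
  define I where "I = (LINT x|lborel. \<bar>\<phi> x\<bar>)"
  show thesis
  proof (rule that[of R "\<Sum>a\<in>UNIV. \<Sum>b\<in>UNIV. norm (coef a b) * I", OF R(1)])
    fix g :: "real^'n^'k \<Rightarrow> complex" and B
    assume g: "smooth_fun g" and B: "\<And>vs x. length vs \<le> 2 * k \<Longrightarrow> (\<forall>v\<in>set vs. norm v \<le> 1) \<Longrightarrow> x \<in> (\<lambda>x. \<chi> j. x) ` cball 0 R \<Longrightarrow> norm (iter_dd vs g x) \<le> B"
    have one: "norm (LINT x|lborel. complex_of_real (\<phi> x) * iter_dd (dirs ks a b) g (\<chi> j. x)) \<le> I * B" for a b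
    proof -
      have "norm (LINT x|lborel. complex_of_real (\<phi> x) * iter_dd (dirs ks a b) g (\<chi> j. x)) \<le> (LINT x|lborel. norm (complex_of_real (\<phi> x) * iter_dd (dirs ks a b) g (\<chi> j. x)))"
        by (rule integral_norm_bound)
      also have "\<dots> \<le> (LINT x|lborel. \<bar>\<phi> x\<bar> * B)"
      proof (rule integral_mono)
        show "integrable lborel (\<lambda>x. norm (complex_of_real (\<phi> x) * iter_dd (dirs ks a b) g (\<chi> j. x)))"
          by (rule integrable_norm[OF gw_integrable[OF \<phi> g]])
        show "integrable lborel (\<lambda>x. \<bar>\<phi> x\<bar> * B)" by (intro integrable_mult_left integrable_abs Cc_integrable[OF \<phi>])
        fix x
        show "norm (complex_of_real (\<phi> x) * iter_dd (dirs ks a b) g (\<chi> j. x)) \<le> \<bar>\<phi> x\<bar> * B"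
        proof (cases "\<phi> x = 0")
          case False
          then have "x \<in> cball 0 R" using R(2) by blast
          then have "norm (iter_dd (dirs ks a b) g (\<chi> j. x)) \<le> B"
            by (intro B) (auto simp: dirs_length length_ks dirs_norm)
          then show ?thesis by (simp add: norm_mult mult_left_mono)
        qed simp
      qed
      also have "\<dots> = I * B" unfolding I_def using Cc_integrable[OF \<phi>] by simp
      finally show ?thesis .
    qed
    have "norm (gw \<phi> g) \<le> (\<Sum>a\<in>UNIV. \<Sum>b\<in>UNIV. norm (coef a b) * (I * B))"
      unfolding gw_def using g one by (simp add: norm_mult mult_left_mono sum_norm_le)
    then show "norm (gw \<phi> g) \<le> (\<Sum>a\<in>UNIV. \<Sum>b\<in>UNIV. norm (coef a b) * I) * B"
      by (simp add: sum_distrib_right mult.assoc)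
  qed
qed

lemma diag_compact: "compact ((\<lambda>x. \<chi> j. x :: real^'n^'k) ` cball 0 R)"
  by (rule compact_continuous_image[OF _ compact_cball]) (auto intro!: continuous_on_vec_lambda continuous_on_id)

lemma gw_comp_distr: assumes \<phi>: "Cc \<phi>" shows "comp_distr (gw \<phi>)"
proof -
  obtain R C where RC: "R > 0" "\<And>g B. smooth_fun g \<Longrightarrow> (\<And>vs x. length vs \<le> 2 * k \<Longrightarrow> (\<forall>v\<in>set vs. norm v \<le> 1) \<Longrightarrow> x \<in> (\<lambda>x. \<chi> j. x) ` cball 0 R \<Longrightarrow>
     norm (iter_dd vs g x) \<le> B) \<Longrightarrow> norm (gw \<phi> g) \<le> C * B"
    by (rule gw_bound[OF \<phi>]) blast
  show ?thesis unfolding comp_distr_def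
  proof (intro conjI allI impI gw_linear[OF \<phi>] exI[of _ "(\<lambda>x. \<chi> j. x) ` cball 0 R"] exI[of _ C] exI[of _ "2 * k"] diag_compact)
    fix g :: "real^'n^'k \<Rightarrow> complex" and B
    assume "smooth_fun g" "\<forall>vs x. length vs \<le> 2 * k \<longrightarrow> (\<forall>v\<in>set vs. norm v \<le> 1) \<longrightarrow> x \<in> (\<lambda>x. \<chi> j. x) ` cball 0 R \<longrightarrow> norm (iter_dd vs g x) \<le> B"
    then show "norm (gw \<phi> g) \<le> C * B" by (intro RC(2)) auto
  qed
qed

lemma gw_tensor:
  assumes \<phi>: "Cc \<phi>" and fs: "\<And>j. smooth_fun (fs j)" "\<And>j. convex_on UNIV (fs j)"
  shows "gw \<phi> (tensor fs) = P fs \<phi>"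
proof -
  have t: "iter_dd (dirs ks a b) (tensor fs) (\<chi> j. x) = (\<Prod>j\<in>UNIV. of_real (hess (fs j) x (a j) (b j)))" for a b x
    unfolding iter_dd_tensor[OF fs(1) ks(1)] ks(2) by (simp add: tensor_def hess_def)
  have "P fs \<phi> = (LINT x|lborel. (\<Sum>a\<in>UNIV. \<Sum>b\<in>UNIV. coef a b * (complex_of_real (\<phi> x) * iter_dd (dirs ks a b) (tensor fs) (\<chi> j. x))))"
    unfolding P_formula[OF fs \<phi>] density_def t by (simp add: sum_distrib_left mult_ac)
  also have "\<dots> = (\<Sum>a\<in>UNIV. \<Sum>b\<in>UNIV. coef a b * (LINT x|lborel. complex_of_real (\<phi> x) * iter_dd (dirs ks a b) (tensor fs) (\<chi> j. x)))"
    using gw_integrable[OF \<phi> smooth_fun_tensor[OF fs(1)]] by (simp add: Bochner_Integration.integral_sum)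
  moreover have "smooth_fun (tensor fs :: real^'n^'k \<Rightarrow> complex)" by (rule smooth_fun_tensor[OF fs(1)])
  ultimately show ?thesis unfolding gw_def by simp
qed

text \<open>Symmetry is not read off the coefficients: the permuted functional is again a compactly
  supported distribution, and on tensor products of convex functions it has the same values because
  polarization is symmetric.\<close>

lemma gw_symmetric: assumes \<phi>: "Cc \<phi>" shows "sym_distr (gw \<phi>)"
  unfolding sym_distr_def
proof (intro allI impI)
  fix \<sigma> and g :: "real^'n^'k \<Rightarrow> complex" assume \<sigma>: "\<sigma> permutes (UNIV :: 'k set)" and g: "smooth_fun g"
  let ?L = "\<lambda>X :: real^'n^'k. \<chi> j. X $ \<sigma> j"
  note L = permute_bounded_linear[of \<sigma>]
  define T where "T = (\<lambda>g. gw \<phi> (\<lambda>X. g (?L X)))"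
  have T: "comp_distr T"
  proof -
    obtain R C where RC: "R > 0" "\<And>g B. smooth_fun g \<Longrightarrow> (\<And>vs x. length vs \<le> 2 * k \<Longrightarrow> (\<forall>v\<in>set vs. norm v \<le> 1) \<Longrightarrow> x \<in> (\<lambda>x. \<chi> j. x) ` cball 0 R \<Longrightarrow>
       norm (iter_dd vs g x) \<le> B) \<Longrightarrow> norm (gw \<phi> g) \<le> C * B"
      by (rule gw_bound[OF \<phi>]) blast
    show ?thesis unfolding comp_distr_def
    proof (intro conjI allI impI exI[of _ "(\<lambda>x. \<chi> j. x) ` cball 0 R"] exI[of _ C] exI[of _ "2 * k"] diag_compact)
      fix a and g h :: "real^'n^'k \<Rightarrow> complex" assume "smooth_fun g" "smooth_fun h"
      then show "T (\<lambda>x. a * g x + h x) = a * T g + T h"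
        unfolding T_def by (intro gw_linear[OF \<phi>] smooth_fun_bounded_linear_right[OF L])
    next
      fix g :: "real^'n^'k \<Rightarrow> complex" and B
      assume g: "smooth_fun g" and *: "\<forall>vs x. length vs \<le> 2 * k \<longrightarrow> (\<forall>v\<in>set vs. norm v \<le> 1) \<longrightarrow> x \<in> (\<lambda>x. \<chi> j. x) ` cball 0 R \<longrightarrow> norm (iter_dd vs g x) \<le> B"
      show "norm (T g) \<le> C * B" unfolding T_def
      \<comment> \<open>Permuting the slots is an isometry and fixes every point of the diagonal, so
        the bound for \<open>gw \<phi>\<close> carries over with the same constants.\<close>
      proof (rule RC(2)[OF smooth_fun_bounded_linear_right[OF L g]])
        fix vs :: "(real^'n^'k) list" and x :: "real^'n^'k"
        assume vs: "length vs \<le> 2 * k" "\<forall>v\<in>set vs. norm v \<le> 1" and x: "x \<in> (\<lambda>x. \<chi> j. x) ` cball 0 R"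
        have "?L x = x" using x by auto
        moreover have "norm (iter_dd (map ?L vs) g x) \<le> B"
          using vs x * by (simp add: permute_norm[OF \<sigma>])
        ultimately show "norm (iter_dd vs (\<lambda>X. g (?L X)) x) \<le> B"
          unfolding iter_dd_bounded_linear_right[OF L g] by simp
      qed
    qed
  qed
  have "T g = gw \<phi> g"
  proof (rule comp_distr_eqI[OF T gw_comp_distr[OF \<phi>] _ g])
    fix fs :: "'k \<Rightarrow> real^'n \<Rightarrow> real" assume fs: "\<And>j. smooth_fun (fs j) \<and> convex_on UNIV (fs j)"
    have "tensor fs (?L X) = tensor (\<lambda>j. fs (inv \<sigma> j)) X" for X
      unfolding tensor_def using prod.permute[OF \<sigma>, of "\<lambda>j. complex_of_real (fs (inv \<sigma> j) (X $ j))"]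
      by (simp add: comp_def permutes_inverses[OF \<sigma>])
    then have "T (tensor fs) = gw \<phi> (tensor (\<lambda>j. fs (inv \<sigma> j)))" unfolding T_def by presburger
    also have "\<dots> = P (\<lambda>j. fs (inv \<sigma> j)) \<phi>" using fs by (intro gw_tensor \<phi>) auto
    also have "\<dots> = P fs \<phi>" by (rule polarization_permute[OF permutes_inv[OF \<sigma>]])
    also have "\<dots> = gw \<phi> (tensor fs)" using fs by (intro gw_tensor[symmetric] \<phi>) auto
    finally show "T (tensor fs) = gw \<phi> (tensor fs)" .
  qed
  then show "gw \<phi> (\<lambda>X. g (\<chi> j. X $ \<sigma> j)) = gw \<phi> g" by (simp add: T_def)
qed

lemma gw_is_GW: assumes \<phi>: "Cc (\<phi> :: real^'n \<Rightarrow> real)" shows "is_GW (\<lambda>f. \<Psi> f \<phi>) (gw \<phi>)"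
  unfolding is_GW_def using gw_comp_distr[OF \<phi>] gw_symmetric[OF \<phi>] gw_tensor[OF \<phi>]
  by (auto simp: gw_def)

lemma GW_gw: "Cc (\<phi> :: real^'n \<Rightarrow> real) \<Longrightarrow> GW (\<lambda>f. \<Psi> f \<phi>) = gw \<phi>"
  by (rule GW_eq[OF gw_is_GW])

text \<open>The symbol of the differential operator, without the sign that comes from the factors
  \<open>\<i>\<close>.\<close>

definition Qpoly :: "complex^'n^'k \<Rightarrow> complex" where
  "Qpoly z = (\<Sum>a\<in>UNIV. \<Sum>b\<in>UNIV. coef a b * (\<Prod>j\<in>UNIV. z $ j $ a j * z $ j $ b j))"

text \<open>The exponential is an eigenfunction; each slot contributes the product of
  \<open>\<i> * z $ j $ a j\<close> and \<open>\<i> * z $ j $ b j\<close>, hence a sign. On the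
  diagonal the exponent depends on the sum of the \<open>z $ j\<close> only, which leaves the
  transform of \<open>\<phi>\<close>.\<close>

lemma FL_gw:
  assumes \<phi>: "Cc \<phi>"
  shows "FL (gw \<phi>) z = (-1) ^ CARD('k) * Qpoly z * FT \<phi> (\<Sum>j\<in>UNIV. z $ j)"
proof -
  let ?L = "\<lambda>X :: real^'n^'k. \<i> * (\<Sum>j\<in>UNIV. \<Sum>l\<in>UNIV. z $ j $ l * complex_of_real (X $ j $ l))"
  let ?w = "\<Sum>j\<in>UNIV. z $ j"
  note L = FL_exponent_bounded_linear[of z]
  have ax: "?L (axis j (axis l 1)) = \<i> * z $ j $ l" for j l
  proof -
    have "(\<Sum>i\<in>UNIV. \<Sum>m\<in>UNIV. z $ i $ m * complex_of_real (axis j (axis l 1) $ i $ m)) = (\<Sum>i\<in>UNIV. if i = j then z $ j $ l else 0)"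
      by (rule sum.cong[OF refl]) (simp add: axis_def if_distrib[of complex_of_real] if_distrib[of "\<lambda>x. _ * x"] cong: if_cong)
    then show ?thesis by simp
  qed
  have pr: "distinct js \<Longrightarrow> (\<Prod>v\<leftarrow>dirs js a b. ?L v) = (\<Prod>j\<in>set js. - (z $ j $ a j * z $ j $ b j))" for js a b
  proof (induction js)
    case (Cons i js)
    have "(\<Prod>v\<leftarrow>dirs (i # js) a b. ?L v) = ?L (axis i (axis (a i) 1)) * (?L (axis i (axis (b i) 1)) * (\<Prod>v\<leftarrow>dirs js a b. ?L v))"
      by (simp add: dirs_def)
    also have "\<dots> = - (z $ i $ a i * z $ i $ b i) * (\<Prod>j\<in>set js. - (z $ j $ a j * z $ j $ b j))"
      using Cons unfolding ax by (simp add: algebra_simps)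
    finally show ?case using Cons.prems by simp
  qed (simp add: dirs_def)
  have pr': "(\<Prod>v\<leftarrow>dirs ks a b. ?L v) = (-1) ^ CARD('k) * (\<Prod>j\<in>UNIV. z $ j $ a j * z $ j $ b j)" for a b
    unfolding pr[OF ks(1)] ks(2) by (subst mult_minus1[symmetric], subst prod.distrib) simp
  have Ld: "?L (\<chi> j. x) = \<i> * (\<Sum>l\<in>UNIV. ?w $ l * complex_of_real (x $ l))" for x
    by (simp add: sum_distrib_right) (rule sum.swap)
  have "(LINT x|lborel. complex_of_real (\<phi> x) * iter_dd (dirs ks a b) (\<lambda>X. exp (?L X)) (\<chi> j. x))
     = ((-1) ^ CARD('k) * (\<Prod>j\<in>UNIV. z $ j $ a j * z $ j $ b j)) * FT \<phi> ?w" for a b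
  proof -
    have "(LINT x|lborel. complex_of_real (\<phi> x) * iter_dd (dirs ks a b) (\<lambda>X. exp (?L X)) (\<chi> j. x))
      = (LINT x|lborel. ((-1) ^ CARD('k) * (\<Prod>j\<in>UNIV. z $ j $ a j * z $ j $ b j)) * (exp (\<i> * (\<Sum>l\<in>UNIV. ?w $ l * complex_of_real (x $ l))) * complex_of_real (\<phi> x)))"
      unfolding iter_dd_exp_linear[OF L] pr' Ld by (simp only: mult_ac)
    also have "\<dots> = ((-1) ^ CARD('k) * (\<Prod>j\<in>UNIV. z $ j $ a j * z $ j $ b j)) * FT \<phi> ?w"
      unfolding FT_def by (rule integral_mult_right_zero)
    finally show ?thesis .
  qed
  then show ?thesis
    unfolding FL_def gw_def Qpoly_def using smooth_fun_exp_linear[OF L]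
    by (simp add: sum_distrib_left sum_distrib_right mult_ac)
qed

text \<open>Permuting \<open>z\<close> amounts to permuting the slots of the exponential inversely,
  which the symmetric distribution ignores. The common factor is then cancelled by a
  \<open>\<phi>\<close> whose transform does not vanish at the sum of the
  \<open>z $ j\<close>.\<close>

lemma Qpoly_symmetric: "sym_poly Qpoly"
  unfolding sym_poly_def
proof (intro allI impI)
  fix \<sigma> and z :: "complex^'n^'k" assume \<sigma>: "\<sigma> permutes (UNIV :: 'k set)"
  let ?z = "\<chi> j. z $ \<sigma> j"
  have sz: "(\<Sum>j\<in>UNIV. ?z $ j) = (\<Sum>j\<in>UNIV. z $ j)"
    using sum.permute[OF \<sigma>, of "\<lambda>j. z $ j"] by (simp add: comp_def)
  obtain \<phi> where \<phi>: "Cc \<phi>" "FT \<phi> (\<Sum>j\<in>UNIV. z $ j) \<noteq> 0" by (rule FT_nonzero)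
  let ?E = "\<lambda>z. \<lambda>X :: real^'n^'k. exp (\<i> * (\<Sum>j\<in>UNIV. \<Sum>l\<in>UNIV. z $ j $ l * complex_of_real (X $ j $ l)))"
  have "?E ?z = (\<lambda>X. ?E z (\<chi> j. X $ inv \<sigma> j))"
  proof
    fix X :: "real^'n^'k"
    have "(\<Sum>j\<in>UNIV. \<Sum>l\<in>UNIV. ?z $ j $ l * complex_of_real (X $ j $ l)) = (\<Sum>j\<in>UNIV. \<Sum>l\<in>UNIV. z $ j $ l * complex_of_real ((\<chi> j. X $ inv \<sigma> j) $ j $ l))"
      using sum.permute[OF \<sigma>, of "\<lambda>j. \<Sum>l\<in>UNIV. z $ j $ l * complex_of_real (X $ inv \<sigma> j $ l)"]
      by (simp add: comp_def permutes_inverses[OF \<sigma>])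
    then show "?E ?z X = ?E z (\<chi> j. X $ inv \<sigma> j)" by simp
  qed
  then have "FL (gw \<phi>) ?z = gw \<phi> (\<lambda>X. ?E z (\<chi> j. X $ inv \<sigma> j))" unfolding FL_def by (rule arg_cong)
  also have "\<dots> = FL (gw \<phi>) z" unfolding FL_def
    using gw_symmetric[OF \<phi>(1)] permutes_inv[OF \<sigma>] smooth_fun_exp_linear[OF FL_exponent_bounded_linear[of z]]
    unfolding sym_distr_def by blast
  finally show "Qpoly ?z = Qpoly z"
    unfolding FL_gw[OF \<phi>(1)] sz using \<phi>(2) by simp
qed

text \<open>The factorial undoes the normalisation in \<open>Q_of\<close>: the one of polarization
  is already contained in \<open>coef\<close>.\<close>

lemma Q_of_exists: "Q_of \<Psi> (\<lambda>z. fact CARD('k) * Qpoly z)"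
  unfolding Q_of_def
proof (intro conjI allI impI)
  show "poly_deg2_each (\<lambda>z :: complex^'n^'k. fact CARD('k) * Qpoly z)"
    unfolding poly_deg2_each_def Qpoly_def
    by (rule exI[of _ "\<lambda>a b. fact CARD('k) * coef a b"]) (simp add: sum_distrib_left mult_ac)
  show "sym_poly (\<lambda>z :: complex^'n^'k. fact CARD('k) * Qpoly z)"
    using Qpoly_symmetric unfolding sym_poly_def by simp
  fix \<phi> :: "real^'n \<Rightarrow> real" and z :: "complex^'n^'k" assume "Cc \<phi>"
  then show "FL (GW (\<lambda>f. \<Psi> f \<phi>)) z = ((-1) ^ CARD('k) / fact CARD('k)) * (fact CARD('k) * Qpoly z) * FT \<phi> (\<Sum>j\<in>UNIV. z $ j)"
    unfolding GW_gw[OF \<open>Cc \<phi>\<close>] FL_gw[OF \<open>Cc \<phi>\<close>] by simp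
qed

end

section \<open>Smooth approximation and vanishing\<close>

text \<open>The first derivative of \<open>ln s\<close> is a quotient with a power of
  \<open>s\<close> in the denominator, and such quotients are stable under differentiation.\<close>

lemma smooth_fun_ln:
  fixes s :: "'a::real_normed_vector \<Rightarrow> real"
  assumes s: "smooth_fun s" and pos: "\<And>x. s x > 0"
  shows "smooth_fun (\<lambda>x. ln (s x))"
proof (rule smooth_funI[of _ "insert (\<lambda>x. ln (s x)) {h. \<exists>u p. smooth_fun u \<and> h = (\<lambda>x. u x / s x ^ p)}"])
  have dln: "((\<lambda>x. ln (s x)) has_derivative (\<lambda>v. frechet_derivative s (at x) v / s x ^ 1)) (at x)" for x
    using pos[of x] by (auto intro!: derivative_eq_intros smooth_fun_has_derivative[OF s] simp: divide_inverse mult.commute)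
  have ddiv: "((\<lambda>x. u x / s x ^ p) has_derivative
      (\<lambda>v. (frechet_derivative u (at x) v * s x - real p * (u x * frechet_derivative s (at x) v)) / s x ^ Suc p)) (at x)"
    if u: "smooth_fun u" for u p x
  proof -
    have nz: "s x \<noteq> 0" using pos[of x] by simp
    have "((\<lambda>x. u x / s x ^ p) has_derivative
      (\<lambda>v. - u x * (inverse (s x ^ p) * (real p * frechet_derivative s (at x) v * s x ^ (p - 1)) * inverse (s x ^ p)) + frechet_derivative u (at x) v / s x ^ p)) (at x)"
      using nz by (intro has_derivative_divide smooth_fun_has_derivative[OF u] has_derivative_power smooth_fun_has_derivative[OF s]) auto
    moreover have "- u x * (inverse (s x ^ p) * (real p * d * s x ^ (p - 1)) * inverse (s x ^ p)) + e / s x ^ p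
       = (e * s x - real p * (u x * d)) / s x ^ Suc p" for d e
      using nz by (cases p) (simp_all add: field_simps power_add)
    ultimately show ?thesis by (simp only:)
  qed
  fix h assume h: "h \<in> insert (\<lambda>x. ln (s x)) {h. \<exists>u p. smooth_fun u \<and> h = (\<lambda>x. u x / s x ^ p)}"
  show "h differentiable (at x)" for x
    using h dln ddiv unfolding differentiable_def by blast
  fix v
  from h consider "h = (\<lambda>x. ln (s x))" | u p where "smooth_fun u" "h = (\<lambda>x. u x / s x ^ p)" by blast
  then have "\<exists>u p. smooth_fun u \<and> (\<lambda>x. frechet_derivative h (at x) v) = (\<lambda>x. u x / s x ^ p)"
  proof cases
    case 1
    have "(\<lambda>x. frechet_derivative h (at x) v) = (\<lambda>x. frechet_derivative s (at x) v / s x ^ 1)"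
      unfolding 1 frechet_derivativeI[OF dln] ..
    then show ?thesis using smooth_fun_deriv[OF s] by blast
  next
    case (2 u p)
    have "(\<lambda>x. frechet_derivative h (at x) v) = (\<lambda>x. (frechet_derivative u (at x) v * s x - real p * (u x * frechet_derivative s (at x) v)) / s x ^ Suc p)"
      unfolding 2 frechet_derivativeI[OF ddiv[OF 2(1)]] ..
    moreover have "smooth_fun (\<lambda>x. frechet_derivative u (at x) v * s x - real p * (u x * frechet_derivative s (at x) v))"
      by (intro smooth_fun_diff smooth_fun_mult smooth_fun_const smooth_fun_deriv s 2)
    ultimately show ?thesis by blast
  qed
  then show "(\<lambda>x. frechet_derivative h (at x) v) \<in> insert (\<lambda>x. ln (s x)) {h. \<exists>u p. smooth_fun u \<and> h = (\<lambda>x. u x / s x ^ p)}" by blast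
qed simp

text \<open>The log-sum-exp function, a smooth convex substitute for \<open>maxaff A\<close> that
  approaches it as \<open>t\<close> grows.\<close>

definition softmax :: "real \<Rightarrow> ('a::euclidean_space \<times> real) set \<Rightarrow> 'a \<Rightarrow> real" where
  "softmax t A x = (1 / t) * ln (\<Sum>p\<in>A. exp (t * (fst p \<bullet> x + snd p)))"

lemma softmax_sum_pos: "finite A \<Longrightarrow> A \<noteq> {} \<Longrightarrow> (\<Sum>p\<in>A. exp (t * (fst p \<bullet> x + snd p)) :: real) > 0"
  by (rule sum_pos) auto

lemma softmax_smooth:
  assumes "finite A" "A \<noteq> {}" shows "smooth_fun (softmax t A)"
proof -
  have "smooth_fun (\<lambda>x. exp (t * (fst p \<bullet> x + snd p)) :: real)" for p :: "'a \<times> real"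
  proof -
    have "smooth_fun (\<lambda>x. exp (t * snd p) * exp ((t *\<^sub>R fst p) \<bullet> x))"
      by (intro smooth_fun_mult smooth_fun_const smooth_fun_exp_linear bounded_linear_inner_right)
    then show ?thesis by (simp add: exp_add[symmetric] algebra_simps)
  qed
  then show ?thesis unfolding softmax_def
    by (intro smooth_fun_mult smooth_fun_const smooth_fun_ln smooth_fun_sum softmax_sum_pos assms)
qed

text \<open>Hoelder's inequality in disguise: after division by \<open>S x\<close> and
  \<open>S y\<close>, convexity of the exponential bounds each summand, and the normalised sums are
  1.\<close>

lemma softmax_convex:
  assumes A: "finite A" "A \<noteq> {}" and t: "t > 0" shows "convex_on UNIV (softmax t A)"
proof (rule convex_onI)
  fix u :: real and x y :: 'a assume u: "0 < u" "u < 1"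
  define S where "S = (\<lambda>x. \<Sum>p\<in>A. exp (t * (fst p \<bullet> x + snd p)))"
  have S: "S x > 0" for x unfolding S_def by (rule softmax_sum_pos[OF A])
  let ?z = "(1 - u) *\<^sub>R x + u *\<^sub>R y" and ?l = "(1 - u) * ln (S x) + u * ln (S y)"
  have "S ?z * exp (- ?l) = (\<Sum>p\<in>A. exp ((1 - u) * (t * (fst p \<bullet> x + snd p) - ln (S x)) + u * (t * (fst p \<bullet> y + snd p) - ln (S y))))"
    unfolding S_def sum_distrib_right exp_add[symmetric]
    by (intro sum.cong refl arg_cong[of _ _ exp]) (simp add: inner_add_right algebra_simps)
  also have "\<dots> \<le> (\<Sum>p\<in>A. (1 - u) * exp (t * (fst p \<bullet> x + snd p) - ln (S x)) + u * exp (t * (fst p \<bullet> y + snd p) - ln (S y)))"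
    by (rule sum_mono) (use convex_onD[OF exp_convex, of u] u in auto)
  also have "\<dots> = (1 - u) * (S x / S x) + u * (S y / S y)"
  proof -
    have "(\<Sum>p\<in>A. exp (t * (fst p \<bullet> w + snd p) - ln (S w))) = S w / S w" for w
    proof -
      have "(\<Sum>p\<in>A. exp (t * (fst p \<bullet> w + snd p) - ln (S w))) = (\<Sum>p\<in>A. exp (t * (fst p \<bullet> w + snd p)) / S w)"
        using S[of w] by (simp add: exp_diff)
      also have "\<dots> = S w / S w" unfolding S_def by (rule sum_divide_distrib[symmetric])
      finally show ?thesis .
    qed
    then show ?thesis by (simp add: sum.distrib sum_distrib_left[symmetric])
  qed
  also have "\<dots> = 1" using S[of x] S[of y] by simp
  finally have le: "S ?z * exp (- ?l) \<le> 1" .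
  have "ln r \<le> l" if "0 < r" "r * exp (- l) \<le> 1" for r l :: real
  proof -
    have "r \<le> exp l" using that(2) by (simp add: exp_minus field_simps)
    then have "ln r \<le> ln (exp l)" using that(1) by (subst ln_le_cancel_iff) auto
    then show ?thesis by simp
  qed
  from this[OF S le] have "ln (S ?z) \<le> ?l" .
  then have "(1 / t) * ln (S ?z) \<le> (1 / t) * ?l" using t by (intro mult_left_mono) auto
  also have "(1 / t) * ?l = (1 - u) * ((1 / t) * ln (S x)) + u * ((1 / t) * ln (S y))"
    by (simp only: distrib_left mult.left_commute)
  finally show "softmax t A ?z \<le> (1 - u) * softmax t A x + u * softmax t A y"
    by (simp only: softmax_def S_def)
qed simp

lemma softmax_close:
  assumes A: "finite A" "A \<noteq> {}" and t: "t > 0"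
  shows "\<bar>softmax t A x - maxaff A x\<bar> \<le> ln (card A) / t"
proof -
  define S where "S = (\<Sum>p\<in>A. exp (t * (fst p \<bullet> x + snd p)))"
  have S: "S > 0" unfolding S_def by (rule softmax_sum_pos[OF A])
  obtain p where p: "p \<in> A" "maxaff A x = fst p \<bullet> x + snd p" by (rule maxaff_attained[OF A])
  have card: "card A > 0" using A by (simp add: card_gt_0_iff)
  have "exp (t * maxaff A x) \<le> S" unfolding S_def p(2)
    using member_le_sum[OF p(1), of "\<lambda>p. exp (t * (fst p \<bullet> x + snd p))"] A(1) by simp
  then have "t * maxaff A x \<le> ln S" using S by (simp add: ln_ge_iff)
  moreover have "S \<le> real (card A) * exp (t * maxaff A x)"
    unfolding S_def using t maxaff_ge[OF A(1)] by (intro sum_bounded_above) auto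
  then have "ln S \<le> ln (card A) + t * maxaff A x"
    using S card ln_le_cancel_iff[of S "real (card A) * exp (t * maxaff A x)"] by (simp add: ln_mult)
  moreover have "softmax t A x = ln S / t" by (simp add: softmax_def S_def)
  ultimately show ?thesis using t by (simp add: abs_le_iff field_simps)
qed

text \<open>Serves to pass from smooth convex functions, for which the integral formula holds, to
  all convex functions: approximate by maxima of affine functions and smooth these by
  log-sum-exp.\<close>

lemma convex_smooth_approx:
  fixes f :: "'a::euclidean_space \<Rightarrow> real"
  assumes f: "convex_on UNIV f"
  obtains F where "\<And>i. smooth_fun (F i)" "\<And>i. convex_on UNIV (F i)"
    "\<And>K. compact K \<Longrightarrow> uniform_limit K F f sequentially"
proof -
  have "\<exists>G. smooth_fun G \<and> convex_on UNIV G \<and> (\<forall>x\<in>cball 0 (real (Suc i)). \<bar>G x - f x\<bar> \<le> 2 / real (Suc i))" for i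
  proof -
    obtain A where A: "finite A" "A \<noteq> {}" "\<And>x. maxaff A x \<le> f x"
      "\<And>x. x \<in> cball 0 (real (Suc i)) \<Longrightarrow> f x - 1 / real (Suc i) \<le> maxaff A x"
      by (rule maxaff_approx[OF f, of "1 / real (Suc i)" "real (Suc i)"]) auto
    \<comment> \<open>Makes the smoothing error at most \<open>1 / real (Suc i)\<close>; the
      \<open>+ 1\<close> keeps \<open>t\<close> positive when \<open>A\<close> is a single
      plane.\<close>
    define t where "t = (ln (card A) + 1) * real (Suc i)"
    have c: "real (card A) \<ge> 1" using A(1,2) by (simp add: Suc_le_eq card_gt_0_iff)
    then have l: "ln (card A) \<ge> 0" by simp
    have t: "t > 0" unfolding t_def using l by (intro mult_pos_pos) auto
    have "ln (card A) / t \<le> 1 / real (Suc i)"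
      unfolding t_def using l by (simp add: divide_simps)
    then have s: "\<bar>softmax t A x - maxaff A x\<bar> \<le> 1 / real (Suc i)" for x
      using softmax_close[OF A(1,2) t, of x] by linarith
    have "\<bar>softmax t A x - f x\<bar> \<le> 2 / real (Suc i)" if "x \<in> cball 0 (real (Suc i))" for x
    proof -
      have "2 / real (Suc i) = 1 / real (Suc i) + 1 / real (Suc i)" by simp
      then show ?thesis using s[of x] A(3)[of x] A(4)[OF that] by linarith
    qed
    then show ?thesis using softmax_smooth[OF A(1,2)] softmax_convex[OF A(1,2) t] by blast
  qed
  then obtain F where F: "\<And>i. smooth_fun (F i)" "\<And>i. convex_on UNIV (F i)"
    "\<And>i x. x \<in> cball 0 (real (Suc i)) \<Longrightarrow> \<bar>F i x - f x\<bar> \<le> 2 / real (Suc i)" by metis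
  show thesis
  proof (rule that[OF F(1,2)])
    fix K :: "'a set" assume K: "compact K"
    show "uniform_limit K F f sequentially"
      unfolding uniform_limit_iff
    proof (intro allI impI)
      fix e :: real assume e: "e > 0"
      obtain R where R: "\<And>x. x \<in> K \<Longrightarrow> norm x \<le> R" using compact_imp_bounded[OF K] unfolding bounded_iff by blast
      obtain N :: nat where N: "real N > max R (2 / e)" using reals_Archimedean2 by blast
      show "\<forall>\<^sub>F i in sequentially. \<forall>x\<in>K. dist (F i x) (f x) < e"
        unfolding eventually_sequentially
      proof (intro exI[of _ N] allI impI ballI)
        fix i x assume i: "N \<le> i" and x: "x \<in> K"
        have "x \<in> cball 0 (real (Suc i))" using R[OF x] N i by simp
        from F(3)[OF this] have "\<bar>F i x - f x\<bar> \<le> 2 / real (Suc i)" .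
        also have "2 / e < real (Suc i)" using N i by simp
        then have "2 / real (Suc i) < e" using e by (simp add: field_simps)
        finally show "dist (F i x) (f x) < e" by (simp add: dist_real_def)
      qed
    qed
  qed
qed

section \<open>Uniqueness and vanishing of the polynomial\<close>

context ma_pol begin

lemma Q_of_unique:
  fixes Q Q' :: "complex^'n^'k \<Rightarrow> complex"
  assumes "Q_of \<Psi> Q" "Q_of \<Psi> Q'" shows "Q = Q'"
proof
  fix z :: "complex^'n^'k"
  obtain \<phi> where \<phi>: "Cc \<phi>" "FT \<phi> (\<Sum>j\<in>UNIV. z $ j) \<noteq> 0" by (rule FT_nonzero)
  have "((-1) ^ CARD('k) / fact CARD('k)) * Q z * FT \<phi> (\<Sum>j\<in>UNIV. z $ j) = ((-1) ^ CARD('k) / fact CARD('k)) * Q' z * FT \<phi> (\<Sum>j\<in>UNIV. z $ j)"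
    using assms \<phi>(1) unfolding Q_of_def by metis
  then show "Q z = Q' z" using \<phi>(2) by simp
qed

text \<open>A ridge is a quarter of the square of the linear form \<open>v\<close>, so the entries
  of its matrix factor; the factor \<open>1/2\<close> here combines with the one in
  \<open>quad\<close>.\<close>

lemma ridge_quad:
  fixes a b :: 'n
  obtains v where "ridge (a, b, s) = quad (\<lambda>c d. 1/2 * (v $ c * v $ d))"
proof
  let ?v = "(\<chi> c. (if c = a then 1 else 0) + (if s then 1 else -1) * (if c = b then 1 else 0)) :: real^'n"
  show "ridge (a, b, s) = quad (\<lambda>c d. 1/2 * (?v $ c * ?v $ d))"
  proof
    fix x :: "real^'n"
    have "quad (\<lambda>c d. 1/2 * (?v $ c * ?v $ d)) x = (\<Sum>c\<in>UNIV. ?v $ c * x $ c) * (\<Sum>d\<in>UNIV. ?v $ d * x $ d) / 4"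
      unfolding quad_def sum_product sum_divide_distrib by (intro sum.cong refl) simp
    also have "(\<Sum>c\<in>UNIV. ?v $ c * x $ c) = (if s then x $ a + x $ b else x $ a - x $ b)"
      by (simp add: distrib_right sum.distrib if_distrib[of "\<lambda>y. y * _"] sum_negf cong: if_cong)
    finally show "ridge (a, b, s) x = quad (\<lambda>c d. 1/2 * (?v $ c * ?v $ d)) x"
      by (simp add: ridge_def power2_eq_square)
  qed
qed

text \<open>Because the Hessian of a ridge is a multiple of \<open>v $ c * v $ d\<close>, the
  polarization of ridges is a multiple of \<open>Qpoly\<close> at a real point. Vanishing there
  kills all \<open>coef\<close>, since these are combinations of such polarizations, then the
  densities, by approximation all differences of order \<open>k\<close> at base point 0, and finally
  \<open>\<Psi>\<close>.\<close>

lemma Qpoly_zero_imp_zero: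
  assumes Q: "\<And>z. Qpoly z = 0" and f: "convex_on UNIV f" and \<phi>: "Cc \<phi>"
  shows "\<Psi> f \<phi> = 0"
proof -
  have m: "Cc (moll 1 :: real^'n \<Rightarrow> real)" by (rule moll_Cc) simp
  have ridge0: "P (\<lambda>j. ridge (a j, b j, s j)) (moll 1) = 0" for a b s
  proof -
    have "\<exists>v. ridge (a j, b j, s j) = quad (\<lambda>c d. 1/2 * (v $ c * v $ d))" for j
      by (rule ridge_quad[of "a j" "b j" "s j"]) blast
    then obtain v where v: "\<And>j. ridge (a j, b j, s j) = quad (\<lambda>c d. 1/2 * (v j $ c * v j $ d))" by metis
    have cv: "convex_on UNIV (quad (\<lambda>c d. 1/2 * (v j $ c * v j $ d)))" for j
      unfolding v[symmetric] by (rule ridge_convex)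
    define z :: "complex^'n^'k" where "z = (\<chi> j. \<chi> c. complex_of_real (v j $ c))"
    have "(\<Prod>j\<in>UNIV. complex_of_real (1/2 * (v j $ a' j * v j $ b' j))) = (1/2) ^ CARD('k) * (\<Prod>j\<in>UNIV. z $ j $ a' j * z $ j $ b' j)" for a' b'
    proof -
      have "(\<Prod>j\<in>UNIV. complex_of_real (1/2 * (v j $ a' j * v j $ b' j))) = (\<Prod>j\<in>UNIV. (1/2) * (z $ j $ a' j * z $ j $ b' j))"
        by (rule prod.cong[OF refl]) (simp add: z_def)
      also have "\<dots> = (1/2) ^ CARD('k) * (\<Prod>j\<in>UNIV. z $ j $ a' j * z $ j $ b' j)"
        by (simp only: prod.distrib prod_constant)
      finally show ?thesis .
    qed
    then have "(\<Sum>a'\<in>UNIV. \<Sum>b'\<in>UNIV. coef a' b' * (\<Prod>j\<in>UNIV. complex_of_real (1/2 * (v j $ a' j * v j $ b' j)))) = (1/2) ^ CARD('k) * Qpoly z"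
      unfolding Qpoly_def sum_distrib_left by (intro sum.cong refl) (simp only: mult_ac)
    moreover have "P (\<lambda>j. ridge (a j, b j, s j)) (moll 1) = P (\<lambda>j. quad (\<lambda>c d. 1/2 * (v j $ c * v j $ d))) (moll 1)"
      unfolding v ..
    ultimately show ?thesis using P_quad[of "\<lambda>j c d. 1/2 * (v j $ c * v j $ d)", OF cv m] Q by simp
  qed
  have coef0: "coef a b = 0" for a b unfolding coef_def ridge0 by simp
  have smooth0: "D (map fs ks) (\<lambda>x. 0) \<phi> = 0" if "\<And>j. smooth_fun (fs j)" "\<And>j. convex_on UNIV (fs j)" for fs
  proof -
    have "P fs \<phi> = 0" unfolding P_formula[OF that \<phi>] density_def coef0 by simp
    then show ?thesis unfolding P_D by simp
  qed
  have all0: "D (map fs ks) (\<lambda>x. 0) \<phi> = 0" if fs: "\<And>j. convex_on UNIV (fs j)" for fs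
  proof -
    have "\<exists>F. (\<forall>i. smooth_fun (F i)) \<and> (\<forall>i. convex_on UNIV (F i)) \<and> (\<forall>K. compact K \<longrightarrow> uniform_limit K F (fs j) sequentially)" for j
      by (rule convex_smooth_approx[OF fs[of j]]) blast
    then obtain F where F: "\<And>j i. smooth_fun (F j i)" "\<And>j i. convex_on UNIV (F j i)"
      "\<And>j K. compact K \<Longrightarrow> uniform_limit K (F j) (fs j) sequentially" by metis
    have "(\<lambda>i. D (map (\<lambda>j. F j i) ks) (\<lambda>x. 0) \<phi>) \<longlonglongrightarrow> D (map fs ks) (\<lambda>x. 0) \<phi>"
      by (rule D_continuous[OF \<phi>]) (use F fs convex_on_zero in \<open>auto intro: uniform_limit_const\<close>)
    moreover have "D (map (\<lambda>j. F j i) ks) (\<lambda>x. 0) \<phi> = 0" for i by (rule smooth0) (use F in auto)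
    ultimately show ?thesis by (simp add: LIMSEQ_const_iff)
  qed
  have "vanishing k \<phi>"
    unfolding vanishing_def
  proof (intro allI impI)
    fix gs :: "(real^'n \<Rightarrow> real) list" and f :: "real^'n \<Rightarrow> real"
    assume gs: "length gs = k" "\<forall>g\<in>set gs. convex_on UNIV g" and f: "convex_on UNIV f"
    \<comment> \<open>Reindexes the list by the index type: \<open>j\<close> receives the entry at
      the position of \<open>j\<close> in \<open>ks\<close>.\<close>
    define fs where "fs = (\<lambda>j. gs ! (THE i. i < k \<and> ks ! i = j))"
    have the: "(THE i'. i' < k \<and> ks ! i' = ks ! i) = i" if "i < k" for i
      using that ks(1) length_ks by (intro the_equality) (auto simp: nth_eq_iff_index_eq)
    have mp: "map fs ks = gs"
      by (rule nth_equalityI) (auto simp: gs length_ks fs_def the)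
    have "convex_on UNIV (fs j)" for j
    proof -
      obtain i where "i < k" "ks ! i = j" using ks(2) length_ks by (metis UNIV_I in_set_conv_nth)
      then have "fs j = gs ! i" using the[of i] by (simp add: fs_def)
      then show ?thesis using gs \<open>i < k\<close> by simp
    qed
    then have "D gs (\<lambda>x. 0) \<phi> = 0" using all0[of fs] mp by simp
    then show "D gs f \<phi> = 0" using D_base[of gs \<phi> f] vanishing_Suc_k[OF \<phi>] gs f by simp
  qed
  then show ?thesis by (rule vanishing_k_imp_zero[OF _ \<phi> f])
qed

lemma Q_of_zero_iff:
  fixes Q :: "complex^'n^'k \<Rightarrow> complex"
  assumes Q: "Q_of \<Psi> Q"
  shows "Q = (\<lambda>_. 0) \<longleftrightarrow> (\<forall>f \<phi>. convex_on UNIV f \<longrightarrow> Cc \<phi> \<longrightarrow> \<Psi> f \<phi> = 0)"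
proof
  have eq: "Q = (\<lambda>z. fact CARD('k) * Qpoly z)" by (rule Q_of_unique[OF Q Q_of_exists])
  assume "Q = (\<lambda>_. 0)"
  then have "fact CARD('k) * Qpoly z = 0" for z using eq by metis
  then have "Qpoly z = 0" for z by simp
  then show "\<forall>f \<phi>. convex_on UNIV f \<longrightarrow> Cc \<phi> \<longrightarrow> \<Psi> f \<phi> = 0" using Qpoly_zero_imp_zero by blast
next
  assume z: "\<forall>f \<phi>. convex_on UNIV f \<longrightarrow> Cc \<phi> \<longrightarrow> \<Psi> f \<phi> = 0"
  have m: "Cc (moll 1 :: real^'n \<Rightarrow> real)" by (rule moll_Cc) simp
  have "\<Psi> (\<lambda>x. \<Sum>j\<in>S. ridge (a j, b j, s j) x) (moll 1) = 0" for a b s and S :: "'k set"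
    by (rule z[rule_format, OF convex_on_sum_UNIV[OF ridge_convex] m])
  then have "P (\<lambda>j. ridge (a j, b j, s j)) (moll 1) = 0" for a b s
    unfolding polarization_def by simp
  then have "coef a b = 0" for a b unfolding coef_def by simp
  then have "(\<lambda>z. fact CARD('k) * Qpoly z) = (\<lambda>_. 0)" unfolding Qpoly_def by simp
  then show "Q = (\<lambda>_. 0)" using Q_of_unique[OF Q Q_of_exists] by simp
qed

end

theorem theorem6p18:
  fixes \<Psi> :: "(real^'n \<Rightarrow> real) \<Rightarrow> (real^'n \<Rightarrow> real) \<Rightarrow> complex"
  assumes "MAVal CARD('k::finite) \<Psi>"
  shows "(\<exists>!Q :: complex^'n^'k \<Rightarrow> complex. Q_of \<Psi> Q) \<and>
         (\<forall>Q :: complex^'n^'k \<Rightarrow> complex. Q_of \<Psi> Q \<longrightarrow>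
            (Q = (\<lambda>_. 0) \<longleftrightarrow> (\<forall>f \<phi>. convex_on UNIV f \<longrightarrow> Cc \<phi> \<longrightarrow> \<Psi> f \<phi> = 0)))"
proof -
  obtain ks :: "'k list" where ks: "set ks = UNIV" "distinct ks"
    using finite_distinct_list[OF finite[of "UNIV :: 'k set"]] by blast
  interpret ma_pol "CARD('k)" \<Psi> ks
    by unfold_locales (use assms ks in auto)
  show ?thesis
    using Q_of_exists Q_of_unique Q_of_zero_iff by blast
qed

end
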